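(* Let $G=(V,E)$ be a connected, locally finite, nonamenable, quasi-transitive graph, and suppose that $p_c(G)<p_{2\to 2}(G)$. Then $$\|T_{p_c}\|_{q\to q}\asymp\begin{cases} q & \text{as } q\uparrow\infty\\ (q-1)^{-1} & \text{as } q\downarrow 1\end{cases}\qquad\text{and}\qquad p_{q\to q}-p_c\asymp\begin{cases} q^{-1} & \text{as } q\uparrow\infty\\ q-1 & \text{as } q\downarrow 1.\end{cases}$$
   Context: $G$ is quasi-transitive if the action of $\operatorname{Aut}(G)$ on $V$ has finitely many orbits. $G$ is nonamenable if there is $c>0$ such that $|\partial_E K|\ge c\sum_{v\in K}\deg(v)$ for every finite $K\subseteq V$, where $\partial_E K$ is the set of edges with exactly one endpoint in $K$. Bernoulli-$p$ bond percolation on $G$: each edge is independently open with probability $p$ and closed otherwise; $G[p]$ is the subgraph of open edges, its connected components are called clusters, and its law is $\mathbf P_p$. $p_c=p_c(G)=\inf\{p\in[0,1]: G[p]\text{ has an infinite cluster a.s.}\}$. $T_p(u,v)=\mathbf P_p(u\leftrightarrow v)$, where $u\leftrightarrow v$ means $u,v$ are in the same cluster. For $M\in[0,\infty]^{V^2}$ and $q\in[1,\infty]$, $\|M\|_{q\to q}=\sup\{\|Mf\|_q/\|f\|_q: f\in L^q(V), f\ge0, f\ne0\}$ (counting measure). $p_{q\to q}=p_{q\to q}(G)=\sup\{p\in[0,1]:\|T_p\|_{q\to q}<\infty\}$. $f(q)\asymp g(q)$ as $q\uparrow\infty$ (resp. $q\downarrow1$) means there are constants $0<c\le C<\infty$ (depending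 on $G$) with $c\,g(q)\le f(q)\le C\,g(q)$ for all sufficiently large $q<\infty$ (resp. all $q>1$ sufficiently close to $1$). *)

theory Defs
  imports "HOL-Probability.Probability"
begin

section \<open>Graphs\<close>

text \<open>
  A graph is a vertex set \<open>V\<close> together with a set \<open>E\<close> of edges, each edge being a two-element
  subset of \<open>V\<close> (so graphs are undirected and simple).
\<close>

definition is_graph :: "'v set \<Rightarrow> 'v set set \<Rightarrow> bool" where
  "is_graph V E \<longleftrightarrow> V \<noteq> {} \<and> (\<forall>e\<in>E. e \<subseteq> V \<and> card e = 2)"

definition adj_rel :: "'v set set \<Rightarrow> ('v \<times> 'v) set" where
  "adj_rel E = {(u, v). {u, v} \<in> E}"

definition connected_graph :: "'v set \<Rightarrow> 'v set set \<Rightarrow> bool" where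
  "connected_graph V E \<longleftrightarrow> (\<forall>u\<in>V. \<forall>v\<in>V. (u, v) \<in> (adj_rel E)\<^sup>*)"

definition locally_finite_graph :: "'v set \<Rightarrow> 'v set set \<Rightarrow> bool" where
  "locally_finite_graph V E \<longleftrightarrow> (\<forall>v\<in>V. finite {e \<in> E. v \<in> e})"

definition degree :: "'v set set \<Rightarrow> 'v \<Rightarrow> nat" where
  "degree E v = card {e \<in> E. v \<in> e}"

definition edge_boundary :: "'v set set \<Rightarrow> 'v set \<Rightarrow> 'v set set" where
  "edge_boundary E K = {e \<in> E. card (e \<inter> K) = 1}"

definition nonamenable :: "'v set \<Rightarrow> 'v set set \<Rightarrow> bool" where
  "nonamenable V E \<longleftrightarrow>
     (\<exists>c>0. \<forall>K. finite K \<and> K \<subseteq> V \<longrightarrow>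
        real (card (edge_boundary E K)) \<ge> c * (\<Sum>v\<in>K. real (degree E v)))"

definition graph_auts :: "'v set \<Rightarrow> 'v set set \<Rightarrow> ('v \<Rightarrow> 'v) set" where
  "graph_auts V E =
     {\<phi>. bij_betw \<phi> V V \<and> (\<forall>u\<in>V. \<forall>v\<in>V. {\<phi> u, \<phi> v} \<in> E \<longleftrightarrow> {u, v} \<in> E)}"

definition quasi_transitive :: "'v set \<Rightarrow> 'v set set \<Rightarrow> bool" where
  "quasi_transitive V E \<longleftrightarrow> finite {{\<phi> v | \<phi>. \<phi> \<in> graph_auts V E} | v. v \<in> V}"


section \<open>Bernoulli bond percolation\<close>

text \<open>
  A configuration is a function \<open>\<omega>\<close> on the edge set, with \<open>\<omega> e\<close> meaning that \<open>e\<close> is open.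
\<close>

definition percolation :: "'v set set \<Rightarrow> real \<Rightarrow> ('v set \<Rightarrow> bool) measure" where
  "percolation E p = (\<Pi>\<^sub>M e\<in>E. measure_pmf (bernoulli_pmf p))"

definition open_edges :: "'v set set \<Rightarrow> ('v set \<Rightarrow> bool) \<Rightarrow> 'v set set" where
  "open_edges E \<omega> = {e \<in> E. \<omega> e}"

definition open_connected :: "'v set set \<Rightarrow> ('v set \<Rightarrow> bool) \<Rightarrow> 'v \<Rightarrow> 'v \<Rightarrow> bool" where
  "open_connected E \<omega> u v \<longleftrightarrow> (u, v) \<in> (adj_rel (open_edges E \<omega>))\<^sup>*"

definition cluster :: "'v set \<Rightarrow> 'v set set \<Rightarrow> ('v set \<Rightarrow> bool) \<Rightarrow> 'v \<Rightarrow> 'v set" where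
  "cluster V E \<omega> v = {u \<in> V. open_connected E \<omega> v u}"

text \<open>
  The infimum is taken in the lattice \<open>[0,1]\<close>: inserting \<open>1\<close> only affects finite graphs, where
  the set is empty. On an infinite, connected, locally finite graph the set contains \<open>1\<close> anyway.
\<close>

definition p_crit :: "'v set \<Rightarrow> 'v set set \<Rightarrow> real" where
  "p_crit V E = Inf (insert 1
     {p \<in> {0..1}. AE \<omega> in percolation E p. \<exists>v\<in>V. infinite (cluster V E \<omega> v)})"

definition two_point :: "'v set set \<Rightarrow> real \<Rightarrow> 'v \<Rightarrow> 'v \<Rightarrow> ennreal" where
  "two_point E p u v =
     emeasure (percolation E p) {\<omega> \<in> space (percolation E p). open_connected E \<omega> u v}"


section \<open>Operator norms\<close>

text \<open>Powers on \<open>[0,\<infinity>]\<close>; only used with positive exponents, whence \<open>\<infinity>\<close> to the \<open>a\<close> is \<open>\<infinity>\<close>.\<close>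

definition ennpowr :: "ennreal \<Rightarrow> real \<Rightarrow> ennreal" where
  "ennpowr x a = (if x = \<infinity> then \<infinity> else ennreal (enn2real x powr a))"

text \<open>
  Sums over \<open>V\<close> with values in \<open>[0,\<infinity>]\<close> are integrals against counting measure. Exponents \<open>q\<close> are
  finite reals \<open>q \<ge> 1\<close>; the exponent \<open>\<infinity>\<close> is not needed.
\<close>

definition lq_norm :: "'v set \<Rightarrow> real \<Rightarrow> ('v \<Rightarrow> ennreal) \<Rightarrow> ennreal" where
  "lq_norm V q f = ennpowr (\<integral>\<^sup>+ v. ennpowr (f v) q \<partial>count_space V) (1 / q)"

definition mat_apply :: "'v set \<Rightarrow> ('v \<Rightarrow> 'v \<Rightarrow> ennreal) \<Rightarrow> ('v \<Rightarrow> ennreal) \<Rightarrow> 'v \<Rightarrow> ennreal" where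
  "mat_apply V M f u = (\<integral>\<^sup>+ v. M u v * f v \<partial>count_space V)"

definition op_norm :: "'v set \<Rightarrow> real \<Rightarrow> ('v \<Rightarrow> 'v \<Rightarrow> ennreal) \<Rightarrow> ennreal" where
  "op_norm V q M =
     (SUP f \<in> {f :: 'v \<Rightarrow> real. (\<forall>v\<in>V. 0 \<le> f v) \<and> (\<exists>v\<in>V. f v \<noteq> 0)
                 \<and> lq_norm V q (\<lambda>v. ennreal (f v)) < \<infinity>}.
        lq_norm V q (mat_apply V M (\<lambda>v. ennreal (f v))) / lq_norm V q (\<lambda>v. ennreal (f v)))"

definition p_op :: "'v set \<Rightarrow> 'v set set \<Rightarrow> real \<Rightarrow> real" where
  "p_op V E q = Sup {p \<in> {0..1}. op_norm V q (two_point E p) < \<infinity>}"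


section \<open>Asymptotic comparison\<close>

text \<open>
  Values are extended reals so that the upper bound includes the finiteness of \<open>f\<close>; this is why
  the real-valued \<open>\<Theta>\<close> of the library is not used.
\<close>

definition asymp_comparable :: "real filter \<Rightarrow> (real \<Rightarrow> ereal) \<Rightarrow> (real \<Rightarrow> real) \<Rightarrow> bool" where
  "asymp_comparable F f g \<longleftrightarrow>
     (\<exists>c C. 0 < c \<and> c \<le> C \<and>
        (\<forall>\<^sub>F q in F. ereal (c * g q) \<le> f q \<and> f q \<le> ereal (C * g q)))"

end

theory Submission
  imports Defs
begin

text \<open>
  Let \<open>D(u,v) \<le> \<infinity>\<close> be the distance in the open subgraph and let \<open>W(u,v)\<close> be the expectation of
  \<open>x\<^sup>D\<close> at density \<open>p\<close>, with \<open>x\<^sup>\<infinity> = 0\<close>. Cutting a geodesic into two disjoint pieces, the BK inequality gives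
  \<open>W' \<le> W + (1 - x/x') W W'\<close> for \<open>x < x'\<close>; cutting it repeatedly, boundedness of the two-point matrix \<open>T\<close> on
  \<open>L\<^sup>2\<close> improves to that of the expectation of \<open>(1+s)\<^sup>D\<close> on \<open>D < \<infinity>\<close> for some \<open>s > 0\<close>. Russo's formula, an
  exploration of the cluster and the smallness of an \<open>L\<^sup>2\<close> diagram show that \<open>p' - p\<close> times the row sums
  of \<open>W\<close> at \<open>p\<close> stays bounded when these sums are finite at \<open>p' > p\<close>. Together with the sharpness of the
  phase transition (in the form of Duminil-Copin and Tassion) it follows that the row sums of \<open>W\<close> at
  \<open>p\<^sub>c\<close> are comparable to \<open>1/(1-x)\<close>.

  As \<open>1 = (x\<^sup>D)\<^sup>a ((1+s)\<^sup>D)\<^sup>b\<close> for suitable \<open>a + b = 1\<close>, interpolation between row sums and \<open>L\<^sup>2\<close>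
  bounds the norm of \<open>T\<close> at \<open>p\<^sub>c\<close> on \<open>L\<^sup>q\<close> by a multiple of \<open>1/(q-1)\<close>. A Neumann series then bounds
  \<open>p\<^sub>q - p\<^sub>c\<close> from below by a multiple of the inverse of this norm. Conversely, at density \<open>p\<close> the two-point function is at least
  \<open>p\<close> to the power of the graph distance, so the summability of \<open>T\<^sup>q\<close> for \<open>p < p\<^sub>q\<close> makes the row sums of \<open>W\<close> finite at
  \<open>x\<close> with \<open>1 - x\<close> of order \<open>q - 1\<close>, and this bounds \<open>p\<^sub>q - p\<^sub>c\<close> from above by a multiple of \<open>q - 1\<close>. Duality between
  \<open>q\<close> and \<open>q/(q-1)\<close> covers \<open>q \<rightarrow> \<infinity>\<close>.
\<close>

section \<open>Finite Bernoulli fields\<close>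

text \<open>Every percolation estimate is made for a finite set \<open>L\<close> of edges, where an
  expectation is a polynomial in \<open>p\<close>. This gives Russo's formula and BK by induction on
  \<open>L\<close>, and it makes all sums finite beforehand, so that self-referential inequalities
  can be solved. Infinite volume enters as a supremum, the weights with \<open>x \<le> 1\<close>
  being increasing in the configuration.

  The weight \<open>x\<close> regularises: at \<open>p_crit\<close> the row sums of the two-point
  matrix itself are infinite. Independent thinning trades weight for density, which carries the
  finiteness of subcritical row sums to weighted ones at and slightly above \<open>p_crit\<close>.

  The obstacle is to bound the growth of the row sums below by their square. Joining the clusters of
  two vertices by a single edge would need a small triangle diagram, but boundedness on L2 only
  makes it finite. So all pairs at distance at most \<open>r\<close> are joined: the main term gains
  the volume of a ball, while for suitable \<open>r\<close> the error diagram is an arbitrarily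
  small multiple of that volume.\<close>

definition bern_wt :: "'e set \<Rightarrow> real \<Rightarrow> 'e set \<Rightarrow> real" where
  "bern_wt L p w = p ^ card w * (1 - p) ^ card (L - w)"

definition bern_exp :: "'e set \<Rightarrow> real \<Rightarrow> ('e set \<Rightarrow> real) \<Rightarrow> real" where
  "bern_exp L p f = (\<Sum>w\<in>Pow L. bern_wt L p w * f w)"

lemma bern_wt_nonneg: "0 \<le> p \<Longrightarrow> p \<le> 1 \<Longrightarrow> 0 \<le> bern_wt L p w"
  by (simp add: bern_wt_def)

lemma bern_exp_empty [simp]: "bern_exp {} p f = f {}"
  by (simp add: bern_exp_def bern_wt_def)

lemma bern_exp_insert:
  assumes "finite L" "e \<notin> L"
  shows "bern_exp (insert e L) p f = (1 - p) * bern_exp L p f + p * bern_exp L p (\<lambda>w. f (insert e w))"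
proof -
  have disj: "Pow L \<inter> insert e ` Pow L = {}" using assms by auto
  have inj: "inj_on (insert e) (Pow L)"
    by (intro inj_onI) (use assms in \<open>metis Pow_iff insert_ident subsetD\<close>)
  have "bern_exp (insert e L) p f
      = (\<Sum>w\<in>Pow L. bern_wt (insert e L) p w * f w)
        + (\<Sum>w\<in>insert e ` Pow L. bern_wt (insert e L) p w * f w)"
    unfolding bern_exp_def Pow_insert using assms disj by (intro sum.union_disjoint) auto
  also have "(\<Sum>w\<in>insert e ` Pow L. bern_wt (insert e L) p w * f w)
      = (\<Sum>w\<in>Pow L. bern_wt (insert e L) p (insert e w) * f (insert e w))"
    by (subst sum.reindex[OF inj]) simp
  also have "\<dots> = p * bern_exp L p (\<lambda>w. f (insert e w))"
    unfolding bern_exp_def sum_distrib_left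
  proof (rule sum.cong)
    fix w assume w: "w \<in> Pow L"
    then have "finite w" "e \<notin> w" using assms finite_subset by auto
    moreover have "insert e L - insert e w = L - w" using assms w by auto
    ultimately show "bern_wt (insert e L) p (insert e w) * f (insert e w)
        = p * (bern_wt L p w * f (insert e w))"
      by (simp add: bern_wt_def)
  qed simp
  also have "(\<Sum>w\<in>Pow L. bern_wt (insert e L) p w * f w) = (1 - p) * bern_exp L p f"
    unfolding bern_exp_def sum_distrib_left
  proof (rule sum.cong)
    fix w assume w: "w \<in> Pow L"
    then have "insert e L - w = insert e (L - w)" "e \<notin> L - w" using assms by auto
    then show "bern_wt (insert e L) p w * f w = (1 - p) * (bern_wt L p w * f w)"
      using assms by (simp add: bern_wt_def)
  qed simp
  finally show ?thesis .
qed

lemma bern_exp_add: "bern_exp L p (\<lambda>w. f w + g w) = bern_exp L p f + bern_exp L p g"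
  by (simp add: bern_exp_def algebra_simps sum.distrib)

lemma bern_exp_diff: "bern_exp L p (\<lambda>w. f w - g w) = bern_exp L p f - bern_exp L p g"
  by (simp add: bern_exp_def algebra_simps sum_subtractf)

lemma bern_exp_cmult: "bern_exp L p (\<lambda>w. c * f w) = c * bern_exp L p f"
  by (simp add: bern_exp_def sum_distrib_left mult.left_commute)

lemma bern_exp_cmult_right: "bern_exp L p (\<lambda>w. f w * c) = bern_exp L p f * c"
  by (simp add: bern_exp_def sum_distrib_right mult.assoc)

lemma bern_exp_sum: "bern_exp L p (\<lambda>w. \<Sum>i\<in>I. f i w) = (\<Sum>i\<in>I. bern_exp L p (f i))"
  unfolding bern_exp_def by (subst sum.swap) (simp add: sum_distrib_left)

lemma bern_exp_const: "finite L \<Longrightarrow> bern_exp L p (\<lambda>w. c) = c"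
proof (induction L rule: finite_induct)
  case (insert e L) then show ?case by (simp add: bern_exp_insert algebra_simps)
qed simp

lemma bern_exp_cong: "(\<And>w. w \<subseteq> L \<Longrightarrow> f w = g w) \<Longrightarrow> bern_exp L p f = bern_exp L p g"
  unfolding bern_exp_def by (intro sum.cong) auto

lemma bern_exp_mono:
  "0 \<le> p \<Longrightarrow> p \<le> 1 \<Longrightarrow> (\<And>w. w \<subseteq> L \<Longrightarrow> f w \<le> g w) \<Longrightarrow> bern_exp L p f \<le> bern_exp L p g"
  unfolding bern_exp_def by (intro sum_mono mult_left_mono bern_wt_nonneg) auto

lemma bern_exp_nonneg:
  "0 \<le> p \<Longrightarrow> p \<le> 1 \<Longrightarrow> (\<And>w. w \<subseteq> L \<Longrightarrow> 0 \<le> f w) \<Longrightarrow> 0 \<le> bern_exp L p f"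
  unfolding bern_exp_def by (intro sum_nonneg mult_nonneg_nonneg bern_wt_nonneg) auto

lemma bern_exp_mono_set:
  assumes "finite L'" "L \<subseteq> L'" "0 \<le> p" "p \<le> 1"
    and mono: "\<And>w w'. w \<subseteq> w' \<Longrightarrow> w' \<subseteq> L' \<Longrightarrow> f w \<le> f w'"
  shows "bern_exp L p f \<le> bern_exp L' p f"
proof -
  have finL: "finite L" using assms finite_subset by blast
  have "bern_exp L p f \<le> bern_exp (L \<union> D) p f" if "finite D" "D \<subseteq> L' - L" for D
    using that
  proof (induction D rule: finite_induct)
    case (insert e D)
    have eq: "e \<notin> L \<union> D" and fin: "finite (L \<union> D)" using insert finL by auto
    have "bern_exp (L \<union> D) p f \<le> bern_exp (L \<union> D) p (\<lambda>w. f (insert e w))"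
      by (rule bern_exp_mono[OF assms(3,4)]) (use insert.prems assms(2) in \<open>auto intro!: mono\<close>)
    then have "p * bern_exp (L \<union> D) p f \<le> p * bern_exp (L \<union> D) p (\<lambda>w. f (insert e w))"
      using assms by (intro mult_left_mono)
    moreover have "L \<union> insert e D = insert e (L \<union> D)" by auto
    moreover have "bern_exp L p f \<le> bern_exp (L \<union> D) p f" using insert by auto
    ultimately show ?case using bern_exp_insert[OF fin eq, of p f] by (simp add: algebra_simps)
  qed simp
  from this[of "L' - L"] show ?thesis using assms(1,2) by (simp add: Un_absorb1)
qed

lemma bern_exp_mono_p:
  assumes "finite L" "0 \<le> p" "p \<le> p'" "p' \<le> 1"
    and "\<And>w w'. w \<subseteq> w' \<Longrightarrow> w' \<subseteq> L \<Longrightarrow> f w \<le> f w'"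
  shows "bern_exp L p f \<le> bern_exp L p' f"
  using assms(1,5)
proof (induction L arbitrary: f rule: finite_induct)
  case (insert e L)
  let ?f = "\<lambda>w. f (insert e w)"
  have 1: "bern_exp L p f \<le> bern_exp L p' f"
    by (rule insert.IH) (use insert.prems in blast)
  have 2: "bern_exp L p ?f \<le> bern_exp L p' ?f"
    by (rule insert.IH) (intro insert.prems; blast)
  have 3: "bern_exp L p f \<le> bern_exp L p ?f"
    by (rule bern_exp_mono) (use assms in \<open>auto intro!: insert.prems\<close>)
  have "(1 - p) * bern_exp L p f + p * bern_exp L p ?f
      \<le> (1 - p') * bern_exp L p f + p' * bern_exp L p ?f"
    using mult_right_mono[of 0 "bern_exp L p ?f - bern_exp L p f" "p' - p"] 3 assms(3)
      mult_nonneg_nonneg[of "p' - p" "bern_exp L p ?f - bern_exp L p f"]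
    by (simp add: algebra_simps)
  also have "\<dots> \<le> (1 - p') * bern_exp L p' f + p' * bern_exp L p' ?f"
    using 1 2 assms by (intro add_mono mult_left_mono) auto
  finally show ?case using insert.hyps by (simp add: bern_exp_insert)
qed simp

lemma bern_exp_insert_idem:
  assumes "finite L" "e \<in> L"
  shows "bern_exp L p (\<lambda>w. f (insert e w)) = bern_exp (L - {e}) p (\<lambda>w. f (insert e w))"
    and "bern_exp L p (\<lambda>w. f (w - {e})) = bern_exp (L - {e}) p f"
proof -
  have L: "L = insert e (L - {e})" "finite (L - {e})" "e \<notin> L - {e}" using assms by auto
  show "bern_exp L p (\<lambda>w. f (insert e w)) = bern_exp (L - {e}) p (\<lambda>w. f (insert e w))"
    by (subst L(1), subst bern_exp_insert[OF L(2,3)]) (simp add: algebra_simps)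
  have "bern_exp (L - {e}) p (\<lambda>w. f (w - {e})) = bern_exp (L - {e}) p f"
    by (intro bern_exp_cong arg_cong[where f = f]) auto
  moreover have "bern_exp (L - {e}) p (\<lambda>w. f (insert e w - {e})) = bern_exp (L - {e}) p f"
    by (intro bern_exp_cong arg_cong[where f = f]) auto
  ultimately show "bern_exp L p (\<lambda>w. f (w - {e})) = bern_exp (L - {e}) p f"
    by (subst L(1), subst bern_exp_insert[OF L(2,3)]) (simp add: algebra_simps)
qed

lemma bern_exp_open_edge:
  assumes "finite L" "e \<in> L" "0 \<le> p" "p \<le> 1" and "\<And>w. w \<subseteq> L \<Longrightarrow> 0 \<le> f w"
  shows "p * bern_exp L p (\<lambda>w. f (insert e w)) \<le> bern_exp L p f"
proof -
  have L: "L = insert e (L - {e})" "finite (L - {e})" "e \<notin> L - {e}" using assms by auto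
  have "bern_exp L p f = (1 - p) * bern_exp (L - {e}) p f + p * bern_exp (L - {e}) p (\<lambda>w. f (insert e w))"
    by (subst L(1), subst bern_exp_insert[OF L(2,3)]) simp
  moreover have "0 \<le> (1 - p) * bern_exp (L - {e}) p f"
    using assms by (intro mult_nonneg_nonneg bern_exp_nonneg) auto
  ultimately show ?thesis using assms by (simp add: bern_exp_insert_idem)
qed

lemma bern_exp_open_edges:
  assumes "finite L" "finite A" "A \<subseteq> L" "0 \<le> p" "p \<le> 1" and "\<And>w. w \<subseteq> L \<Longrightarrow> 0 \<le> f w"
  shows "p ^ card A * bern_exp L p (\<lambda>w. f (w \<union> A)) \<le> bern_exp L p f"
  using assms(2,3,6)
proof (induction A arbitrary: f rule: finite_induct)
  case (insert e A)
  have "p ^ card (insert e A) * bern_exp L p (\<lambda>w. f (w \<union> insert e A))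
      = p * (p ^ card A * bern_exp L p (\<lambda>w. f (insert e (w \<union> A))))"
    using insert.hyps by simp
  also have "\<dots> \<le> p * bern_exp L p (\<lambda>w. f (insert e w))"
    using insert.IH[of "\<lambda>w. f (insert e w)"] insert.prems assms by (intro mult_left_mono) auto
  also have "\<dots> \<le> bern_exp L p f"
    using insert.prems assms by (intro bern_exp_open_edge) auto
  finally show ?case .
qed simp

lemma bern_exp_restrict:
  assumes "finite L'" "L \<subseteq> L'"
  shows "bern_exp L' p (\<lambda>w. f (w \<inter> L)) = bern_exp L p f"
proof -
  have finL: "finite L" using assms finite_subset by blast
  have "bern_exp (L \<union> D) p (\<lambda>w. f (w \<inter> L)) = bern_exp L p f" if "finite D" "D \<subseteq> L' - L" for D
    using that
  proof (induction D rule: finite_induct)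
    case empty
    have "bern_exp L p (\<lambda>w. f (w \<inter> L)) = bern_exp L p f"
      by (intro bern_exp_cong arg_cong[where f = f]) auto
    then show ?case by simp
  next
    case (insert e D)
    have eq: "e \<notin> L \<union> D" and fin: "finite (L \<union> D)" using insert finL by auto
    have "bern_exp (L \<union> D) p (\<lambda>w. f (insert e w \<inter> L)) = bern_exp (L \<union> D) p (\<lambda>w. f (w \<inter> L))"
      by (intro bern_exp_cong arg_cong[where f = f]) (use eq in auto)
    moreover have "L \<union> insert e D = insert e (L \<union> D)" by auto
    moreover have "bern_exp (L \<union> D) p (\<lambda>w. f (w \<inter> L)) = bern_exp L p f" using insert by auto
    ultimately show ?case using bern_exp_insert[OF fin eq, of p "\<lambda>w. f (w \<inter> L)"]
      by (simp add: algebra_simps)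
  qed
  from this[of "L' - L"] show ?thesis using assms(1,2) by (simp add: Un_absorb1)
qed

lemma bern_exp_reindex:
  assumes "inj_on h L" "finite L"
  shows "bern_exp (h ` L) p f = bern_exp L p (\<lambda>w. f (h ` w))"
proof -
  have inj: "inj_on ((`) h) (Pow L)"
    using assms(1) by (rule inj_on_image_Pow)
  have "bern_exp (h ` L) p f = (\<Sum>w\<in>Pow L. bern_wt (h ` L) p (h ` w) * f (h ` w))"
    unfolding bern_exp_def image_Pow_surj[OF refl, symmetric] by (subst sum.reindex[OF inj]) simp
  also have "\<dots> = bern_exp L p (\<lambda>w. f (h ` w))"
    unfolding bern_exp_def
  proof (rule sum.cong)
    fix w assume "w \<in> Pow L"
    then have w: "w \<subseteq> L" by simp
    have "card (h ` w) = card w" using inj_on_subset[OF assms(1) w] by (rule card_image)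
    moreover have "h ` L - h ` w = h ` (L - w)" using assms(1) w by (auto simp: inj_on_def)
    moreover have "card (h ` (L - w)) = card (L - w)"
      by (rule card_image) (rule inj_on_subset[OF assms(1)], auto)
    ultimately show "bern_wt (h ` L) p (h ` w) * f (h ` w) = bern_wt L p w * f (h ` w)"
      by (simp add: bern_wt_def)
  qed simp
  finally show ?thesis .
qed

text \<open>The inner expectation runs over subsets of the random set \<open>w\<close>: an edge is
  first opened with probability \<open>p\<close> and then kept with probability
  \<open>t\<close>.\<close>

lemma bern_exp_thin:
  assumes "finite L"
  shows "bern_exp L p (\<lambda>w. bern_exp w t f) = bern_exp L (p * t) f"
  using assms
proof (induction L arbitrary: f rule: finite_induct)
  case (insert e L)
  have "bern_exp L p (\<lambda>w. bern_exp (insert e w) t f)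
      = bern_exp L p (\<lambda>w. (1 - t) * bern_exp w t f + t * bern_exp w t (\<lambda>w. f (insert e w)))"
    by (intro bern_exp_cong bern_exp_insert) (use insert.hyps finite_subset in auto)
  also have "\<dots> = (1 - t) * bern_exp L (p * t) f + t * bern_exp L (p * t) (\<lambda>w. f (insert e w))"
    by (simp add: bern_exp_add bern_exp_cmult insert.IH)
  finally have eq: "bern_exp L p (\<lambda>w. bern_exp (insert e w) t f)
      = (1 - t) * bern_exp L (p * t) f + t * bern_exp L (p * t) (\<lambda>w. f (insert e w))" .
  show ?case
    unfolding bern_exp_insert[OF insert.hyps(1,2)] insert.IH eq by (simp add: algebra_simps)
qed simp

text \<open>Russo's formula for arbitrary functionals. With \<open>e\<close> forced open or closed
  the functional does not depend on the state of \<open>e\<close>, so splitting off one edge and the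
  product rule suffice.\<close>

lemma bern_exp_russo:
  assumes "finite L"
  shows "((\<lambda>p. bern_exp L p f) has_real_derivative
     (\<Sum>e\<in>L. bern_exp L p (\<lambda>w. f (insert e w)) - bern_exp L p (\<lambda>w. f (w - {e})))) (at p)"
  using assms
proof (induction L arbitrary: f rule: finite_induct)
  case (insert a L)
  let ?g = "\<lambda>w. f (insert a w)"
  let ?D = "\<lambda>f e. bern_exp L p (\<lambda>w. f (insert e w)) - bern_exp L p (\<lambda>w. f (w - {e}))"
  have der: "((\<lambda>p. (1 - p) * bern_exp L p f + p * bern_exp L p ?g) has_real_derivative
      (bern_exp L p ?g - bern_exp L p f + (1 - p) * (\<Sum>e\<in>L. ?D f e) + p * (\<Sum>e\<in>L. ?D ?g e))) (at p)"
    by (rule derivative_eq_intros insert.IH refl | simp add: algebra_simps)+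
  have a: "bern_exp (insert a L) p ?g - bern_exp (insert a L) p (\<lambda>w. f (w - {a}))
      = bern_exp L p ?g - bern_exp L p f"
    using bern_exp_insert_idem[of "insert a L" a p f] insert.hyps by simp
  have "(\<Sum>e\<in>L. bern_exp (insert a L) p (\<lambda>w. f (insert e w)) - bern_exp (insert a L) p (\<lambda>w. f (w - {e})))
      = (\<Sum>e\<in>L. (1 - p) * ?D f e + p * ?D ?g e)"
  proof (rule sum.cong)
    fix e assume "e \<in> L"
    then have "insert a w - {e} = insert a (w - {e})" for w using insert.hyps by auto
    then show "bern_exp (insert a L) p (\<lambda>w. f (insert e w)) - bern_exp (insert a L) p (\<lambda>w. f (w - {e}))
        = (1 - p) * ?D f e + p * ?D ?g e"
      using insert.hyps by (simp add: bern_exp_insert insert_commute algebra_simps)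
  qed simp
  also have "\<dots> = (1 - p) * (\<Sum>e\<in>L. ?D f e) + p * (\<Sum>e\<in>L. ?D ?g e)"
    by (simp add: sum.distrib sum_distrib_left)
  finally have "(\<Sum>e\<in>insert a L. bern_exp (insert a L) p (\<lambda>w. f (insert e w))
        - bern_exp (insert a L) p (\<lambda>w. f (w - {e})))
     = bern_exp L p ?g - bern_exp L p f + (1 - p) * (\<Sum>e\<in>L. ?D f e) + p * (\<Sum>e\<in>L. ?D ?g e)"
    using insert.hyps a by simp
  with der show ?case
    using insert.hyps by (simp add: bern_exp_insert)
qed simp

text \<open>
  The van den Berg--Kesten inequality for functionals: \<open>G\<close> is bounded by \<open>g\<close> evaluated on some pair
  of disjoint sets of open edges. In the induction step the functional
  \<open>max (g (I + e) J) (g I (J + e))\<close> is bounded both by \<open>g (I + e) (J + e)\<close> and by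
  \<open>g (I + e) J + g I (J + e) - g I J\<close>, and the two bounds are averaged with weights \<open>p\<close>, \<open>1 - p\<close>.
\<close>

lemma bern_exp_BK:
  fixes g :: "'e set \<Rightarrow> 'e set \<Rightarrow> real"
  assumes "finite L" "0 \<le> p" "p \<le> 1"
    and "\<And>I J I' J'. I \<subseteq> I' \<Longrightarrow> J \<subseteq> J' \<Longrightarrow> I' \<subseteq> L \<Longrightarrow> J' \<subseteq> L \<Longrightarrow> g I J \<le> g I' J'"
    and "\<And>w. w \<subseteq> L \<Longrightarrow> \<exists>I\<subseteq>w. G w \<le> g I (w - I)"
  shows "bern_exp L p G \<le> bern_exp L p (\<lambda>w1. bern_exp L p (\<lambda>w2. g w1 w2))"
  using assms(1,4,5)
proof (induction L arbitrary: G g rule: finite_induct)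
  case (insert e L)
  note g = insert.prems(1)
  let ?E = "\<lambda>h. bern_exp L p (\<lambda>w1. bern_exp L p (\<lambda>w2. h w1 w2 :: real))"
  define h where "h = (\<lambda>I J. max (g (insert e I) J) (g I (insert e J)))"
  have h_mono: "h I J \<le> h I' J'" if "I \<subseteq> I'" "J \<subseteq> J'" "I' \<subseteq> L" "J' \<subseteq> L" for I J I' J'
    unfolding h_def using that by (intro max.mono g) auto
  have 1: "bern_exp L p G \<le> ?E g"
    by (rule insert.IH) (use insert.prems in \<open>simp_all add: subset_insertI2\<close>)
  have 2: "bern_exp L p (\<lambda>w. G (insert e w)) \<le> ?E h"
  proof (rule insert.IH)
    fix w assume w: "w \<subseteq> L"
    then have ew: "e \<notin> w" using insert.hyps by auto
    obtain I where I: "I \<subseteq> insert e w" "G (insert e w) \<le> g I (insert e w - I)"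
      using insert.prems(2)[of "insert e w"] w by auto
    show "\<exists>I\<subseteq>w. G (insert e w) \<le> h I (w - I)"
    proof (cases "e \<in> I")
      case True
      then have "g I (insert e w - I) \<le> g (insert e (I - {e})) (w - (I - {e}))"
        using I w by (intro g) auto
      then have "G (insert e w) \<le> h (I - {e}) (w - (I - {e}))" unfolding h_def using I by simp
      moreover have "I - {e} \<subseteq> w" using I by auto
      ultimately show ?thesis by blast
    next
      case False
      then have "g I (insert e w - I) \<le> g I (insert e (w - I))" using I w by (intro g) auto
      then have "G (insert e w) \<le> h I (w - I)" unfolding h_def using I by simp
      moreover have "I \<subseteq> w" using I False by auto
      ultimately show ?thesis by blast
    qed
  qed (use h_mono in auto)
  have E_mono: "?E a \<le> ?E b" if "\<And>I J. I \<subseteq> L \<Longrightarrow> J \<subseteq> L \<Longrightarrow> a I J \<le> b I J" for a b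
    using that assms by (intro bern_exp_mono) auto
  have 3: "?E h \<le> ?E (\<lambda>I J. g (insert e I) J + g I (insert e J) - g I J)"
  proof (rule E_mono)
    fix I J assume "I \<subseteq> L" "J \<subseteq> L"
    then have "g I J \<le> g (insert e I) J" "g I J \<le> g I (insert e J)" by (intro g; auto)+
    then show "h I J \<le> g (insert e I) J + g I (insert e J) - g I J" by (auto simp: h_def)
  qed
  have 4: "?E h \<le> ?E (\<lambda>I J. g (insert e I) (insert e J))"
    unfolding h_def by (intro E_mono max.boundedI g) auto
  let ?A = "?E g" and ?B = "?E (\<lambda>I J. g (insert e I) J)" and ?C = "?E (\<lambda>I J. g I (insert e J))"
    and ?D = "?E (\<lambda>I J. g (insert e I) (insert e J))"
  have 3: "?E h \<le> ?B + ?C - ?A"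
    using 3 by (simp add: bern_exp_add bern_exp_diff)
  have "bern_exp (insert e L) p G = (1 - p) * bern_exp L p G + p * bern_exp L p (\<lambda>w. G (insert e w))"
    using insert.hyps by (simp add: bern_exp_insert)
  also have "\<dots> \<le> (1 - p) * ?A + p * ?E h"
    using 1 2 assms by (intro add_mono mult_left_mono) auto
  also have "\<dots> = (1 - p) * ?A + p * ((1 - p) * ?E h + p * ?E h)" by (simp add: algebra_simps)
  also have "\<dots> \<le> (1 - p) * ?A + p * ((1 - p) * (?B + ?C - ?A) + p * ?D)"
    using 3 4 assms by (intro add_mono mult_left_mono) auto
  also have "\<dots> = (1 - p) * ((1 - p) * ?A + p * ?C) + p * ((1 - p) * ?B + p * ?D)"
    by (simp add: algebra_simps)
  also have "\<dots> = bern_exp (insert e L) p (\<lambda>w1. bern_exp (insert e L) p (\<lambda>w2. g w1 w2))"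
    using insert.hyps by (simp add: bern_exp_insert bern_exp_add bern_exp_cmult) (simp add: algebra_simps)
  finally show ?case .
qed auto

text \<open>For indicators of increasing events this is the indicator of disjoint occurrence. The
  maximum over splittings extends it to weights, so that BK applies to powers of distances.\<close>

definition disj_prod :: "('e set \<Rightarrow> real) \<Rightarrow> ('e set \<Rightarrow> real) \<Rightarrow> 'e set \<Rightarrow> real" where
  "disj_prod a b w = Max ((\<lambda>I. a I * b (w - I)) ` Pow w)"

lemma disj_prod_ge:
  assumes "finite w" "I \<subseteq> w" "J \<subseteq> w" "I \<inter> J = {}" "0 \<le> a I"
    and "\<And>w w'. w \<subseteq> w' \<Longrightarrow> finite w' \<Longrightarrow> b w \<le> b w'"
  shows "a I * b J \<le> disj_prod a b w"
proof -
  have "a I * b J \<le> a I * b (w - I)"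
    using assms by (intro mult_left_mono assms(6)) auto
  also have "\<dots> \<le> disj_prod a b w"
    unfolding disj_prod_def using assms by (intro Max_ge) auto
  finally show ?thesis .
qed

lemma disj_prod_attained:
  assumes "finite w"
  shows "\<exists>I\<subseteq>w. disj_prod a b w = a I * b (w - I)"
proof -
  have "disj_prod a b w \<in> (\<lambda>I. a I * b (w - I)) ` Pow w"
    unfolding disj_prod_def using assms by (intro Max_in) auto
  then show ?thesis by auto
qed

lemma disj_prod_nonneg:
  assumes "finite w" "\<And>w. finite w \<Longrightarrow> 0 \<le> a w" "\<And>w. finite w \<Longrightarrow> 0 \<le> b w"
  shows "0 \<le> disj_prod a b w"
  using disj_prod_attained[OF assms(1), of a b] assms finite_subset
  by (metis finite_Diff mult_nonneg_nonneg)

lemma disj_prod_mono: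
  assumes "w \<subseteq> w'" "finite w'" "\<And>w. finite w \<Longrightarrow> 0 \<le> a w"
    and "\<And>w w'. w \<subseteq> w' \<Longrightarrow> finite w' \<Longrightarrow> b w \<le> b w'"
  shows "disj_prod a b w \<le> disj_prod a b w'"
proof -
  have fin: "finite w" using assms finite_subset by blast
  obtain I where I: "I \<subseteq> w" "disj_prod a b w = a I * b (w - I)"
    using disj_prod_attained[OF fin, of a b] by blast
  show ?thesis unfolding I(2)
    by (rule disj_prod_ge) (use I assms finite_subset[OF I(1) fin] in \<open>auto\<close>)
qed

lemma bern_exp_disj_prod:
  assumes "finite L" "0 \<le> p" "p \<le> 1"
    and a: "\<And>w w'. w \<subseteq> w' \<Longrightarrow> finite w' \<Longrightarrow> a w \<le> a w'" "\<And>w. finite w \<Longrightarrow> 0 \<le> a w"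
    and b: "\<And>w w'. w \<subseteq> w' \<Longrightarrow> finite w' \<Longrightarrow> b w \<le> b w'" "\<And>w. finite w \<Longrightarrow> 0 \<le> b w"
  shows "bern_exp L p (disj_prod a b) \<le> bern_exp L p a * bern_exp L p b"
proof -
  have fin: "finite w" if "w \<subseteq> L" for w using that assms(1) finite_subset by blast
  have "bern_exp L p (disj_prod a b) \<le> bern_exp L p (\<lambda>w1. bern_exp L p (\<lambda>w2. a w1 * b w2))"
  proof (rule bern_exp_BK[OF assms(1-3)])
    show "a I * b J \<le> a I' * b J'" if "I \<subseteq> I'" "J \<subseteq> J'" "I' \<subseteq> L" "J' \<subseteq> L" for I J I' J'
      using that fin by (intro mult_mono a b) (auto intro: finite_subset)
    show "\<exists>I\<subseteq>w. disj_prod a b w \<le> a I * b (w - I)" if "w \<subseteq> L" for w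
      using disj_prod_attained[OF fin[OF that], of a b] by auto
  qed
  then show ?thesis by (simp add: bern_exp_cmult bern_exp_cmult_right)
qed

text \<open>
  Exchanging the states outside \<open>\<tau>\<close> between two independent copies preserves their joint law.
\<close>

lemma bern_exp_explore:
  assumes "finite L"
    and sub: "\<And>w. w \<subseteq> L \<Longrightarrow> \<tau> w \<subseteq> L"
    and stop: "\<And>w w'. w \<subseteq> L \<Longrightarrow> w' \<subseteq> L \<Longrightarrow> w \<inter> \<tau> w = w' \<inter> \<tau> w \<Longrightarrow> \<tau> w' = \<tau> w"
  shows "bern_exp L p (\<lambda>w. f (w \<inter> \<tau> w) (w - \<tau> w))
      = bern_exp L p (\<lambda>w1. bern_exp L p (\<lambda>w2. f (w1 \<inter> \<tau> w1) (w2 - \<tau> w1)))"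
proof -
  define m where "m = (\<lambda>w. bern_wt L p w)"
  define s where "s = (\<lambda>(w1, w2). ((w1 \<inter> \<tau> w1) \<union> (w2 - \<tau> w1), (w2 \<inter> \<tau> w1) \<union> (w1 - \<tau> w1)))"
  \<comment> \<open>By \<open>stop\<close> the set \<open>\<tau> w\<close> can be read off from the
    states inside it, as for a stopping time. The exchange keeps these states, hence keeps
    \<open>\<tau>\<close>, and is an involution.\<close>
  have s\<tau>: "\<tau> (fst (s (w1, w2))) = \<tau> w1" if "w1 \<subseteq> L" "w2 \<subseteq> L" for w1 w2
    unfolding s_def using that by (intro stop) auto
  have s_in: "s z \<in> Pow L \<times> Pow L" if "z \<in> Pow L \<times> Pow L" for z
    using that by (auto simp: s_def)
  have ss: "s (s z) = z" if "z \<in> Pow L \<times> Pow L" for z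
  proof -
    obtain w1 w2 where z: "z = (w1, w2)" by (cases z)
    have "\<tau> ((w1 \<inter> \<tau> w1) \<union> (w2 - \<tau> w1)) = \<tau> w1"
      using s\<tau>[of w1 w2] that z by (simp add: s_def)
    then show ?thesis unfolding z s_def by auto
  qed
  \<comment> \<open>The weight sees only the numbers of open and closed edges, and their totals over
    both copies are unchanged.\<close>
  have wt: "m w1 * m w2 = m (fst (s (w1, w2))) * m (snd (s (w1, w2)))" if "w1 \<subseteq> L" "w2 \<subseteq> L" for w1 w2
  proof -
    let ?T = "\<tau> w1"
    have fin: "finite w1" "finite w2" using that assms(1) finite_subset by auto
    have c: "card w = card (w \<inter> ?T) + card (w - ?T)" if "finite w" for w
      using card_Int_Diff[OF that] by simp
    have cl: "card (L - w) = card ((L \<inter> ?T) - w) + card ((L - ?T) - w)" for w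
    proof -
      have "(L - w) \<inter> ?T = (L \<inter> ?T) - w" "(L - w) - ?T = (L - ?T) - w" by auto
      then show ?thesis using c[of "L - w"] assms(1) by simp
    qed
    define v1 where "v1 = (w1 \<inter> ?T) \<union> (w2 - ?T)"
    define v2 where "v2 = (w2 \<inter> ?T) \<union> (w1 - ?T)"
    have v: "v1 \<inter> ?T = w1 \<inter> ?T" "v1 - ?T = w2 - ?T" "v2 \<inter> ?T = w2 \<inter> ?T" "v2 - ?T = w1 - ?T"
      "(L \<inter> ?T) - v1 = (L \<inter> ?T) - w1" "(L \<inter> ?T) - v2 = (L \<inter> ?T) - w2"
      "(L - ?T) - v1 = (L - ?T) - w2" "(L - ?T) - v2 = (L - ?T) - w1"
      by (auto simp: v1_def v2_def)
    have fv: "finite v1" "finite v2" using fin by (auto simp: v1_def v2_def)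
    have "card v1 + card v2 = card w1 + card w2"
      using c[OF fv(1)] c[OF fv(2)] c[OF fin(1)] c[OF fin(2)] by (simp add: v)
    moreover have "card (L - v1) + card (L - v2) = card (L - w1) + card (L - w2)"
      using cl[of v1] cl[of v2] cl[of w1] cl[of w2] by (simp add: v)
    moreover have "m a * m b = p ^ (card a + card b) * (1 - p) ^ (card (L - a) + card (L - b))" for a b
      by (simp add: m_def bern_wt_def power_add)
    ultimately show ?thesis by (simp add: s_def v1_def v2_def)
  qed
  have "bern_exp L p (\<lambda>w1. bern_exp L p (\<lambda>w2. f (w1 \<inter> \<tau> w1) (w2 - \<tau> w1)))
      = (\<Sum>(w1, w2)\<in>Pow L \<times> Pow L. m w1 * m w2 * f (w1 \<inter> \<tau> w1) (w2 - \<tau> w1))"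
    unfolding bern_exp_def m_def
    by (subst sum.cartesian_product[symmetric]) (simp add: sum_distrib_left mult.assoc)
  also have "\<dots> = (\<Sum>(w1, w2)\<in>Pow L \<times> Pow L. m w1 * m w2 * f (w1 \<inter> \<tau> w1) (w1 - \<tau> w1))"
  proof (rule sum.reindex_bij_witness[where i = s and j = s])
    fix z assume z: "z \<in> Pow L \<times> Pow L"
    then show "s (s z) = z" "s (s z) = z" "s z \<in> Pow L \<times> Pow L" "s z \<in> Pow L \<times> Pow L"
      using ss s_in by auto
    obtain w1 w2 where zz: "z = (w1, w2)" by (cases z)
    obtain v1 v2 where v: "s z = (v1, v2)" by (cases "s z")
    have "\<tau> v1 = \<tau> w1" using s\<tau>[of w1 w2] z zz v by simp
    moreover have "v1 \<inter> \<tau> w1 = w1 \<inter> \<tau> w1" "v1 - \<tau> w1 = w2 - \<tau> w1"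
      using v by (auto simp: zz s_def)
    moreover have "m v1 * m v2 = m w1 * m w2" using wt[of w1 w2] z zz v by simp
    ultimately show "(case s z of (w1, w2) \<Rightarrow> m w1 * m w2 * f (w1 \<inter> \<tau> w1) (w1 - \<tau> w1))
        = (case z of (w1, w2) \<Rightarrow> m w1 * m w2 * f (w1 \<inter> \<tau> w1) (w2 - \<tau> w1))"
      using v zz by simp
  qed
  also have "\<dots> = (\<Sum>w1\<in>Pow L. m w1 * f (w1 \<inter> \<tau> w1) (w1 - \<tau> w1)) * (\<Sum>w2\<in>Pow L. m w2)"
    by (subst sum.cartesian_product[symmetric]) (simp add: sum_distrib_left sum_distrib_right mult_ac)
  also have "(\<Sum>w2\<in>Pow L. m w2) = 1"
    using bern_exp_const[OF assms(1), of p 1] by (simp add: bern_exp_def m_def)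
  finally show ?thesis by (simp add: bern_exp_def m_def)
qed

section \<open>Weighted connection functionals\<close>

definition gdist :: "'v set set \<Rightarrow> 'v \<Rightarrow> 'v \<Rightarrow> nat" where
  "gdist w u v = (LEAST n. (u, v) \<in> adj_rel w ^^ n)"

text \<open>The guard gives weight zero at infinite distance, where \<open>gdist\<close> is
  unspecified. Bases above 1 occur as well; for them the weight is no longer increasing in
  \<open>w\<close>.\<close>

definition conn_wt :: "real \<Rightarrow> 'v set set \<Rightarrow> 'v \<Rightarrow> 'v \<Rightarrow> real" where
  "conn_wt x w u v = (if (u, v) \<in> (adj_rel w)\<^sup>* then x ^ gdist w u v else 0)"

lemma adj_rel_mono: "w \<subseteq> w' \<Longrightarrow> adj_rel w \<subseteq> adj_rel w'"
  by (auto simp: adj_rel_def)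

lemma adj_rel_sym: "(u, v) \<in> adj_rel w \<Longrightarrow> (v, u) \<in> adj_rel w"
  by (simp add: adj_rel_def insert_commute)

lemma adj_rtrancl_mono: "w \<subseteq> w' \<Longrightarrow> (u, v) \<in> (adj_rel w)\<^sup>* \<Longrightarrow> (u, v) \<in> (adj_rel w')\<^sup>*"
  using rtrancl_mono[OF adj_rel_mono] by blast

lemma adj_relpow_mono: "w \<subseteq> w' \<Longrightarrow> (u, v) \<in> adj_rel w ^^ n \<Longrightarrow> (u, v) \<in> adj_rel w' ^^ n"
proof (induction n arbitrary: v)
  case (Suc n)
  then show ?case using adj_rel_mono[OF Suc.prems(1)] by auto
qed simp

lemma adj_relpow_sym: "(u, v) \<in> adj_rel w ^^ n \<Longrightarrow> (v, u) \<in> adj_rel w ^^ n"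
proof (induction n arbitrary: v)
  case (Suc n)
  then obtain y where "(u, y) \<in> adj_rel w ^^ n" "(y, v) \<in> adj_rel w" by auto
  then show ?case using Suc.IH adj_rel_sym relpow_Suc_I2 by metis
qed simp

lemma adj_rtrancl_sym: "(u, v) \<in> (adj_rel w)\<^sup>* \<Longrightarrow> (v, u) \<in> (adj_rel w)\<^sup>*"
  by (metis adj_relpow_sym rtrancl_power)

lemma gdist_relpow: "(u, v) \<in> (adj_rel w)\<^sup>* \<Longrightarrow> (u, v) \<in> adj_rel w ^^ gdist w u v"
  unfolding gdist_def by (metis LeastI rtrancl_imp_relpow)

lemma gdist_le: "(u, v) \<in> adj_rel w ^^ n \<Longrightarrow> gdist w u v \<le> n"
  unfolding gdist_def by (rule Least_le)

lemma gdist_commute: "gdist w u v = gdist w v u"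
  unfolding gdist_def by (metis adj_relpow_sym)

lemma gdist_triangle:
  assumes "(u, a) \<in> (adj_rel w)\<^sup>*" "(a, v) \<in> (adj_rel w)\<^sup>*"
  shows "gdist w u v \<le> gdist w u a + gdist w a v"
proof (rule gdist_le)
  show "(u, v) \<in> adj_rel w ^^ (gdist w u a + gdist w a v)"
    using gdist_relpow[OF assms(1)] gdist_relpow[OF assms(2)] by (auto simp: relpow_add)
qed

lemma gdist_mono: "w \<subseteq> w' \<Longrightarrow> (u, v) \<in> (adj_rel w)\<^sup>* \<Longrightarrow> gdist w' u v \<le> gdist w u v"
  by (intro gdist_le adj_relpow_mono[OF _ gdist_relpow])

lemma conn_wt_commute: "conn_wt x w u v = conn_wt x w v u"
  unfolding conn_wt_def using adj_rtrancl_sym gdist_commute by metis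

lemma conn_wt_nonneg: "0 \<le> x \<Longrightarrow> 0 \<le> conn_wt x w u v"
  by (simp add: conn_wt_def)

lemma conn_wt_le_1: "0 \<le> x \<Longrightarrow> x \<le> 1 \<Longrightarrow> conn_wt x w u v \<le> 1"
  by (simp add: conn_wt_def power_le_one)

lemma conn_wt_ge: "(u, v) \<in> adj_rel w ^^ n \<Longrightarrow> 0 \<le> x \<Longrightarrow> x \<le> 1 \<Longrightarrow> x ^ n \<le> conn_wt x w u v"
  by (auto simp: conn_wt_def intro!: power_decreasing gdist_le dest: relpow_imp_rtrancl)

lemma conn_wt_mono: "w \<subseteq> w' \<Longrightarrow> 0 \<le> x \<Longrightarrow> x \<le> 1 \<Longrightarrow> conn_wt x w u v \<le> conn_wt x w' u v"
  unfolding conn_wt_def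
  using adj_rtrancl_mono[of w w' u v] gdist_mono[of w w' u v] by (auto intro: power_decreasing)

lemma conn_wt_mono_x: "0 \<le> x \<Longrightarrow> x \<le> y \<Longrightarrow> conn_wt x w u v \<le> conn_wt y w u v"
  by (auto simp: conn_wt_def intro: power_mono)

lemma conn_wt_refl [simp]: "conn_wt x w u u = 1"
proof -
  have "gdist w u u \<le> 0" by (rule gdist_le) simp
  then show ?thesis by (simp add: conn_wt_def)
qed

lemma conn_wt_1: "conn_wt 1 w u v = of_bool ((u, v) \<in> (adj_rel w)\<^sup>*)"
  by (simp add: conn_wt_def)

lemma conn_wt_triangle:
  assumes "0 \<le> x" "x \<le> 1"
  shows "conn_wt x w u a * conn_wt x w a v \<le> conn_wt x w u v"
proof (cases "(u, a) \<in> (adj_rel w)\<^sup>* \<and> (a, v) \<in> (adj_rel w)\<^sup>*")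
  case True
  then have "(u, v) \<in> (adj_rel w)\<^sup>*" by auto
  then show ?thesis using True assms gdist_triangle[of u a w v]
    by (simp add: conn_wt_def power_add[symmetric] power_decreasing)
next
  case False
  then show ?thesis using assms by (auto simp: conn_wt_def)
qed

lemma adj_rtrancl_in_Union: "(u, v) \<in> (adj_rel w)\<^sup>* \<Longrightarrow> u \<noteq> v \<Longrightarrow> u \<in> \<Union>w \<and> v \<in> \<Union>w"
proof -
  have *: "a \<in> \<Union>w" if "(a, b) \<in> (adj_rel w)\<^sup>*" "a \<noteq> b" for a b
    using that by (cases rule: converse_rtranclE) (auto simp: adj_rel_def)
  assume "(u, v) \<in> (adj_rel w)\<^sup>*" "u \<noteq> v"
  then show ?thesis using * adj_rtrancl_sym by metis
qed

lemma conn_wt_eq_0: "u \<noteq> v \<Longrightarrow> u \<notin> \<Union>w \<or> v \<notin> \<Union>w \<Longrightarrow> conn_wt x w u v = 0"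
  using adj_rtrancl_in_Union[of u v w] by (auto simp: conn_wt_def)

section \<open>Geodesics and their edge-disjoint pieces\<close>

definition path_edges :: "(nat \<Rightarrow> 'v) \<Rightarrow> nat \<Rightarrow> nat \<Rightarrow> 'v set set" where
  "path_edges c i j = (\<lambda>l. {c l, c (Suc l)}) ` {i..<j}"

lemma path_edges_relpow: "i \<le> j \<Longrightarrow> path_edges c i j \<subseteq> w \<Longrightarrow> (c i, c j) \<in> adj_rel w ^^ (j - i)"
proof (induction j)
  case (Suc j)
  show ?case
  proof (cases "i = Suc j")
    case False
    then have "i \<le> j" using Suc by simp
    moreover have "path_edges c i j \<subseteq> w" "{c j, c (Suc j)} \<in> w"
      using Suc.prems \<open>i \<le> j\<close> by (auto simp: path_edges_def)
    ultimately show ?thesis using Suc.IH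
      by (auto simp: Suc_diff_le adj_rel_def)
  qed simp
qed simp

lemma path_edges_disjoint:
  assumes "inj_on c {..n}" "j \<le> k" "l \<le> n"
  shows "path_edges c i j \<inter> path_edges c k l = {}"
proof (rule ccontr)
  assume "\<not> ?thesis"
  then obtain a b where ab: "a < j" "k \<le> b" "b < l" "{c a, c (Suc a)} = {c b, c (Suc b)}"
    by (auto simp: path_edges_def)
  then have "c a = c b \<or> c a = c (Suc b)" by (metis doubleton_eq_iff)
  then have "a = b \<or> a = Suc b" using assms ab by (auto dest!: inj_onD[OF assms(1)])
  then show False using ab assms by auto
qed

text \<open>A minimal walk visits no vertex twice, since the loop could be cut out; injectivity is
  what makes its pieces edge-disjoint.\<close>

lemma geodesic:
  assumes "(u, v) \<in> (adj_rel w)\<^sup>*"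
  obtains c where "c 0 = u" "c (gdist w u v) = v" "inj_on c {..gdist w u v}"
    "path_edges c 0 (gdist w u v) \<subseteq> w"
proof -
  define n where "n = gdist w u v"
  obtain c where c: "c 0 = u" "c n = v" "\<And>i. i < n \<Longrightarrow> (c i, c (Suc i)) \<in> adj_rel w"
    using gdist_relpow[OF assms] unfolding n_def relpow_fun_conv by auto
  have w: "path_edges c 0 n \<subseteq> w" using c by (auto simp: path_edges_def adj_rel_def)
  then have sub: "path_edges c i j \<subseteq> w" if "j \<le> n" for i j using that by (auto simp: path_edges_def)
  have "inj_on c {..n}"
  proof (rule linorder_inj_onI')
    fix i j assume ij: "i \<in> {..n}" "j \<in> {..n}" "i < j"
    show "c i \<noteq> c j"
    proof
      assume eq: "c i = c j"
      have "(u, c i) \<in> adj_rel w ^^ i" using path_edges_relpow[of 0 i c w] sub ij c by simp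
      moreover have "(c i, v) \<in> adj_rel w ^^ (n - j)"
        using path_edges_relpow[of j n c w] sub ij c eq by simp
      ultimately have "(u, v) \<in> adj_rel w ^^ (i + (n - j))" by (auto simp: relpow_add)
      then show False using gdist_le ij n_def by fastforce
    qed
  qed
  then show ?thesis using c w that unfolding n_def by blast
qed

lemma path_vertices:
  assumes "path_edges c 0 n \<subseteq> w" "k \<le> n" "0 < n"
  shows "c k \<in> \<Union>w"
proof (cases "k < n")
  case True
  then have "{c k, c (Suc k)} \<in> w" using assms by (auto simp: path_edges_def)
  then show ?thesis by blast
next
  case False
  have "{c (n - 1), c (Suc (n - 1))} \<in> path_edges c 0 n"
    unfolding path_edges_def by (rule imageI) (use assms in auto)
  then have "{c (n - 1), c (Suc (n - 1))} \<in> w" "k = n"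
    using assms False by auto
  then show ?thesis using assms by auto
qed

lemma sum_over_path:
  fixes f :: "'v \<Rightarrow> real"
  assumes "finite F" "inj_on c N" "c ` N \<subseteq> F" "\<And>a. a \<in> F \<Longrightarrow> 0 \<le> f a" "\<And>k. k \<in> N \<Longrightarrow> g k \<le> f (c k)"
  shows "sum g N \<le> sum f F"
proof -
  have "sum g N \<le> sum (f \<circ> c) N" using assms by (intro sum_mono) auto
  also have "\<dots> = sum f (c ` N)" using assms by (simp add: sum.reindex)
  also have "\<dots> \<le> sum f F" using assms by (intro sum_mono2) auto
  finally show ?thesis .
qed

text \<open>The telescoping sum for \<open>y^n - x^n\<close>, arranged so that the exponents
  \<open>k\<close> and \<open>n - k\<close> are the lengths of the two pieces of a path of length
  \<open>n\<close>.\<close>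

lemma power_diff_splitting:
  fixes x y :: real
  assumes "0 < y"
  shows "y ^ n = x ^ n + (1 - x / y) * (\<Sum>k<n. x ^ k * y ^ (n - k))"
proof (induction n)
  case (Suc n)
  have "(\<Sum>k<Suc n. x ^ k * y ^ (Suc n - k)) = x ^ n * y + (\<Sum>k<n. y * (x ^ k * y ^ (n - k)))"
    by (simp add: Suc_diff_le mult_ac)
  also have "\<dots> = x ^ n * y + y * (\<Sum>k<n. x ^ k * y ^ (n - k))" by (simp add: sum_distrib_left)
  finally have "x ^ Suc n + (1 - x / y) * (\<Sum>k<Suc n. x ^ k * y ^ (Suc n - k))
      = x ^ Suc n + (1 - x / y) * y * x ^ n + y * ((1 - x / y) * (\<Sum>k<n. x ^ k * y ^ (n - k)))"
    by (simp add: algebra_simps)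
  also have "(1 - x / y) * (\<Sum>k<n. x ^ k * y ^ (n - k)) = y ^ n - x ^ n" using Suc by simp
  finally show ?case using assms by (simp add: field_simps)
qed simp

text \<open>The \<open>k\<close>-th vertex of a geodesic accounts for the \<open>k\<close>-th term
  of \<open>power_diff_splitting\<close>; the pieces before and after it are edge-disjoint, so their
  weights multiply inside \<open>disj_prod\<close>.\<close>

lemma conn_wt_resolvent:
  assumes "0 < x" "x \<le> y" "y \<le> 1" "finite F" "finite w" "\<Union>w \<subseteq> F"
  shows "conn_wt y w u v \<le> conn_wt x w u v
    + (1 - x / y) * (\<Sum>a\<in>F. disj_prod (\<lambda>w. conn_wt x w u a) (\<lambda>w. conn_wt y w a v) w)"
    (is "_ \<le> _ + _ * (\<Sum>a\<in>F. ?f a)")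
proof (cases "(u, v) \<in> (adj_rel w)\<^sup>*")
  case True
  define n where "n = gdist w u v"
  obtain c where c: "c 0 = u" "c n = v" "inj_on c {..n}" "path_edges c 0 n \<subseteq> w"
    using geodesic[OF True] unfolding n_def by blast
  have sub: "path_edges c i j \<subseteq> w" if "j \<le> n" for i j using that c(4) by (auto simp: path_edges_def)
  have nn: "0 \<le> ?f a" for a
    by (intro disj_prod_nonneg conn_wt_nonneg) (use assms in auto)
  have "(\<Sum>k<n. x ^ k * y ^ (n - k)) \<le> (\<Sum>a\<in>F. ?f a)"
  proof (rule sum_over_path[where c = c, OF assms(4) _ _ nn])
    show "inj_on c {..<n}" by (rule inj_on_subset[OF c(3)]) auto
    show "c ` {..<n} \<subseteq> F"
    proof (rule image_subsetI)
      fix k assume "k \<in> {..<n}"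
      then have "c k \<in> \<Union>w" using path_vertices[OF c(4), of k] by auto
      then show "c k \<in> F" using assms(6) by blast
    qed
    fix k assume k: "k \<in> {..<n}"
    have "(u, c k) \<in> adj_rel (path_edges c 0 k) ^^ k" "(c k, v) \<in> adj_rel (path_edges c k n) ^^ (n - k)"
      using path_edges_relpow[of 0 k c] path_edges_relpow[of k n c] k c by auto
    then have "x ^ k * y ^ (n - k) \<le> conn_wt x (path_edges c 0 k) u (c k) * conn_wt y (path_edges c k n) (c k) v"
      using assms by (intro mult_mono conn_wt_ge conn_wt_nonneg) auto
    also have "\<dots> \<le> ?f (c k)"
      using sub[of k 0] sub[of n k] path_edges_disjoint[OF c(3), of k k n 0] k assms
      by (intro disj_prod_ge conn_wt_nonneg conn_wt_mono) simp_all
    finally show "x ^ k * y ^ (n - k) \<le> ?f (c k)" .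
  qed
  moreover have "0 \<le> 1 - x / y" using assms by simp
  ultimately have "(1 - x / y) * (\<Sum>k<n. x ^ k * y ^ (n - k)) \<le> (1 - x / y) * (\<Sum>a\<in>F. ?f a)"
    by (intro mult_left_mono)
  then show ?thesis using power_diff_splitting[of y n x] assms True by (simp add: conn_wt_def n_def)
next
  case False
  have "0 \<le> ?f a" for a by (intro disj_prod_nonneg conn_wt_nonneg) (use assms in auto)
  then show ?thesis using False assms by (auto simp: conn_wt_def intro!: mult_nonneg_nonneg sum_nonneg)
qed

text \<open>The walk is stopped at its first vertex in \<open>A\<close>; every edge before that
  starts outside \<open>A\<close>.\<close>

lemma adj_rtrancl_hit:
  assumes "(z, u) \<in> (adj_rel w)\<^sup>*" "u \<in> A"
  shows "\<exists>a\<in>A. (z, a) \<in> (adj_rel {e \<in> w. \<not> e \<subseteq> A})\<^sup>*"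
  using assms
proof (induction rule: converse_rtrancl_induct)
  case (step z z')
  show ?case
  proof (cases "z \<in> A")
    case False
    then have "(z, z') \<in> adj_rel {e \<in> w. \<not> e \<subseteq> A}" using step by (auto simp: adj_rel_def)
    then show ?thesis using step by (meson converse_rtrancl_into_rtrancl)
  qed blast
qed blast

text \<open>The tree-graph inequality. The walk from \<open>z\<close> is followed until it first
  meets the geodesic from \<open>u\<close> to \<open>a\<close>, at \<open>t\<close>. It uses no edge
  with both ends on the geodesic, so it is disjoint from both pieces of the latter.\<close>

lemma conn_wt_tree:
  assumes "0 \<le> x" "x \<le> 1" "finite F" "finite w" "\<Union>w \<subseteq> F" "u \<in> F"
  shows "conn_wt x w u a * conn_wt 1 w u z \<le> (\<Sum>t\<in>F. disj_prod (\<lambda>w. conn_wt x w u t)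
      (disj_prod (\<lambda>w. conn_wt x w t a) (\<lambda>w. conn_wt 1 w t z)) w)"
    (is "_ \<le> (\<Sum>t\<in>F. ?f t)")
proof -
  have nn: "0 \<le> ?f t" for t by (intro disj_prod_nonneg conn_wt_nonneg) (use assms in auto)
  show ?thesis
  proof (cases "(u, a) \<in> (adj_rel w)\<^sup>* \<and> (u, z) \<in> (adj_rel w)\<^sup>*")
    case True
    define n where "n = gdist w u a"
    obtain c where c: "c 0 = u" "c n = a" "inj_on c {..n}" "path_edges c 0 n \<subseteq> w"
      using geodesic True unfolding n_def by metis
    have sub: "path_edges c i j \<subseteq> w" if "j \<le> n" for i j using that c(4) by (auto simp: path_edges_def)
    have "u \<in> c ` {..n}" using c(1) by auto
    then obtain k where k: "k \<le> n" "(z, c k) \<in> (adj_rel {e \<in> w. \<not> e \<subseteq> c ` {..n}})\<^sup>*"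
      using adj_rtrancl_hit[OF adj_rtrancl_sym, of u z w "c ` {..n}"] True by auto
    define K where "K = {e \<in> w. \<not> e \<subseteq> c ` {..n}}"
    have Kdis: "path_edges c i j \<inter> K = {}" if "j \<le> n" for i j
      using that by (auto simp: K_def path_edges_def)
    have tF: "c k \<in> F"
    proof (cases "n = 0")
      case True then show ?thesis using k c assms by simp
    next
      case False then show ?thesis using path_vertices[OF c(4) k(1)] assms(5) by auto
    qed
    have 1: "(u, c k) \<in> adj_rel (path_edges c 0 k) ^^ k" "(c k, a) \<in> adj_rel (path_edges c k n) ^^ (n - k)"
      using path_edges_relpow[of 0 k c] path_edges_relpow[of k n c] k c by auto
    have "conn_wt x w u a * conn_wt 1 w u z = x ^ k * (x ^ (n - k) * 1)"
      using True k by (simp add: conn_wt_def n_def power_add[symmetric])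
    also have "\<dots> \<le> conn_wt x (path_edges c 0 k) u (c k)
        * (conn_wt x (path_edges c k n) (c k) a * conn_wt 1 K (c k) z)"
      using 1 k assms adj_rtrancl_sym
      by (intro mult_mono conn_wt_ge conn_wt_nonneg mult_nonneg_nonneg)
        (auto simp: conn_wt_1 K_def)
    also have "\<dots> \<le> conn_wt x (path_edges c 0 k) u (c k)
        * disj_prod (\<lambda>w. conn_wt x w (c k) a) (\<lambda>w. conn_wt 1 w (c k) z) (w - path_edges c 0 k)"
    proof (intro mult_left_mono disj_prod_ge)
      show "path_edges c k n \<subseteq> w - path_edges c 0 k" "K \<subseteq> w - path_edges c 0 k" "path_edges c k n \<inter> K = {}"
        using sub[of n k] path_edges_disjoint[OF c(3), of k k n 0] Kdis[of k 0] Kdis[of n k] k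
        by (auto simp: K_def)
    qed (use assms in \<open>auto intro: conn_wt_nonneg conn_wt_mono\<close>)
    also have "\<dots> \<le> ?f (c k)"
      by (rule disj_prod_ge; (rule disj_prod_mono)?)
        (use assms sub k in \<open>auto intro: conn_wt_nonneg conn_wt_mono\<close>)
    also have "\<dots> \<le> (\<Sum>t\<in>F. ?f t)" using nn tF assms by (intro member_le_sum) auto
    finally show ?thesis .
  next
    case False
    then show ?thesis using nn by (auto simp: conn_wt_def intro!: sum_nonneg)
  qed
qed

text \<open>
  Iterating \<open>chain_count\<close> counts the chains of \<open>k\<close> vertices of \<open>F\<close> that are visited in order by edge-disjoint
  connections; the vertices of a geodesic provide at least \<open>gdist choose k\<close> of them.
\<close>

fun chain_count :: "'v set \<Rightarrow> nat \<Rightarrow> 'v set set \<Rightarrow> 'v \<Rightarrow> 'v \<Rightarrow> real" where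
  "chain_count F 0 w u v = conn_wt 1 w u v"
| "chain_count F (Suc k) w u v = (\<Sum>a\<in>F. disj_prod (\<lambda>w. conn_wt 1 w u a) (\<lambda>w. chain_count F k w a v) w)"

lemma chain_count_nonneg: "finite w \<Longrightarrow> 0 \<le> chain_count F k w u v"
  by (induction k arbitrary: u w) (auto intro!: sum_nonneg disj_prod_nonneg conn_wt_nonneg)

lemma chain_count_mono: "w \<subseteq> w' \<Longrightarrow> finite w' \<Longrightarrow> chain_count F k w u v \<le> chain_count F k w' u v"
  by (induction k arbitrary: u w w')
    (auto intro!: sum_mono disj_prod_mono conn_wt_nonneg conn_wt_mono)

lemma chain_count_path:
  assumes "finite F" "inj_on c {..n}" "i \<le> n" "c ` {..<n} \<subseteq> F"
  shows "real ((n - i) choose k) \<le> chain_count F k (path_edges c i n) (c i) (c n)"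
  using assms(3)
proof (induction k arbitrary: i)
  case 0
  have "(c i, c n) \<in> (adj_rel (path_edges c i n))\<^sup>*"
    using path_edges_relpow[OF 0, of c] relpow_imp_rtrancl by blast
  then show ?case by (simp add: conn_wt_1)
next
  case (Suc k)
  have fin: "finite (path_edges c i j)" for i j by (simp add: path_edges_def)
  let ?f = "\<lambda>a. disj_prod (\<lambda>w. conn_wt 1 w (c i) a) (\<lambda>w. chain_count F k w a (c n)) (path_edges c i n)"
  \<comment> \<open>The hockey-stick identity, summing over the position \<open>j\<close> of the
    first chain vertex. It needs only \<open>n - Suc j\<close>; the weaker \<open>n - j\<close> is
    what the induction hypothesis at \<open>j\<close> provides.\<close>
  have "real ((n - i) choose Suc k) \<le> (\<Sum>j\<in>{i..<n}. real ((n - j) choose k))"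
  proof -
    have "(m choose Suc k) = (\<Sum>j<m. j choose k)" for m
      by (induction m) auto
    then have "(n - i) choose Suc k = (\<Sum>j<n - i. j choose k)" by blast
    also have "\<dots> = (\<Sum>j\<in>{i..<n}. (n - Suc j) choose k)"
      by (rule sum.reindex_bij_witness[where i = "\<lambda>j. n - Suc j" and j = "\<lambda>j. n - Suc j"]) auto
    also have "\<dots> \<le> (\<Sum>j\<in>{i..<n}. (n - j) choose k)"
      by (intro sum_mono binomial_right_mono) auto
    finally show ?thesis by (metis of_nat_le_iff of_nat_sum)
  qed
  also have "\<dots> \<le> (\<Sum>a\<in>F. ?f a)"
  proof (rule sum_over_path[where c = c, OF assms(1)])
    show "inj_on c {i..<n}" using assms(2) by (rule inj_on_subset) auto
    show "c ` {i..<n} \<subseteq> F" using assms(4) by auto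
    show "0 \<le> ?f a" for a by (intro disj_prod_nonneg conn_wt_nonneg chain_count_nonneg fin) auto
    fix j assume j: "j \<in> {i..<n}"
    have "(c i, c j) \<in> (adj_rel (path_edges c i j))\<^sup>*"
      using relpow_imp_rtrancl[OF path_edges_relpow[of i j c, OF _ order_refl]] j by auto
    then have "real ((n - j) choose k)
        \<le> conn_wt 1 (path_edges c i j) (c i) (c j) * chain_count F k (path_edges c j n) (c j) (c n)"
      using Suc.IH[of j] j by (simp add: conn_wt_1)
    also have "\<dots> \<le> ?f (c j)"
      using fin j path_edges_disjoint[OF assms(2), of j j n i]
      by (intro disj_prod_ge conn_wt_nonneg chain_count_mono) (auto simp: path_edges_def)
    finally show "real ((n - j) choose k) \<le> ?f (c j)" .
  qed
  finally show ?case by simp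
qed

lemma chain_count_gdist:
  assumes "finite F" "finite w" "\<Union>w \<subseteq> F" "(u, v) \<in> (adj_rel w)\<^sup>*"
  shows "real (gdist w u v choose k) \<le> chain_count F k w u v"
proof -
  define n where "n = gdist w u v"
  obtain c where c: "c 0 = u" "c n = v" "inj_on c {..n}" "path_edges c 0 n \<subseteq> w"
    using geodesic assms(4) unfolding n_def by metis
  have "c ` {..<n} \<subseteq> F" using path_vertices[OF c(4)] assms(3) by fastforce
  from chain_count_path[OF assms(1) c(3) _ this, of 0 k]
  have "real (n choose k) \<le> chain_count F k (path_edges c 0 n) u v" using c by simp
  also have "\<dots> \<le> chain_count F k w u v" using c assms by (intro chain_count_mono) auto
  finally show ?thesis unfolding n_def .
qed

section \<open>Correlation inequalities in finite volume\<close>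

definition conn_exp :: "'v set set \<Rightarrow> real \<Rightarrow> real \<Rightarrow> 'v \<Rightarrow> 'v \<Rightarrow> real" where
  "conn_exp L p x u v = bern_exp L p (\<lambda>w. conn_wt x w u v)"

lemma conn_exp_commute: "conn_exp L p x u v = conn_exp L p x v u"
  by (simp add: conn_exp_def conn_wt_commute)

lemma conn_exp_nonneg: "0 \<le> p \<Longrightarrow> p \<le> 1 \<Longrightarrow> 0 \<le> x \<Longrightarrow> 0 \<le> conn_exp L p x u v"
  unfolding conn_exp_def by (intro bern_exp_nonneg conn_wt_nonneg)

lemma conn_exp_le_1:
  assumes "finite L" "0 \<le> p" "p \<le> 1" "0 \<le> x" "x \<le> 1"
  shows "conn_exp L p x u v \<le> 1"
proof -
  have "conn_exp L p x u v \<le> bern_exp L p (\<lambda>w. 1)"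
    unfolding conn_exp_def using assms by (intro bern_exp_mono conn_wt_le_1)
  then show ?thesis using assms by (simp add: bern_exp_const)
qed

lemma conn_exp_refl [simp]: "finite L \<Longrightarrow> conn_exp L p x u u = 1"
  by (simp add: conn_exp_def bern_exp_const)

lemma conn_exp_mono:
  assumes "finite L'" "L \<subseteq> L'" "0 \<le> p" "p \<le> p'" "p' \<le> 1" "0 \<le> x" "x \<le> y" "y \<le> 1"
  shows "conn_exp L p x u v \<le> conn_exp L' p' y u v"
proof -
  have "conn_exp L p x u v \<le> conn_exp L p y u v"
    unfolding conn_exp_def using assms by (intro bern_exp_mono conn_wt_mono_x) auto
  also have "\<dots> \<le> conn_exp L p' y u v"
    unfolding conn_exp_def using assms
    by (intro bern_exp_mono_p conn_wt_mono finite_subset[OF assms(2)]) auto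
  also have "\<dots> \<le> conn_exp L' p' y u v"
    unfolding conn_exp_def using assms by (intro bern_exp_mono_set conn_wt_mono) auto
  finally show ?thesis .
qed

lemma conn_exp_eq_0: "u \<noteq> v \<Longrightarrow> u \<notin> \<Union>L \<or> v \<notin> \<Union>L \<Longrightarrow> conn_exp L p x u v = 0"
  unfolding conn_exp_def bern_exp_def
  by (intro sum.neutral ballI, subst conn_wt_eq_0) auto

lemma conn_exp_resolvent:
  assumes "finite L" "0 \<le> p" "p \<le> 1" "0 < x" "x \<le> y" "y \<le> 1" "finite F" "\<Union>L \<subseteq> F"
  shows "conn_exp L p y u v \<le> conn_exp L p x u v
    + (1 - x / y) * (\<Sum>a\<in>F. conn_exp L p x u a * conn_exp L p y a v)"
proof -
  have fin: "finite w" "\<Union>w \<subseteq> F" if "w \<subseteq> L" for w using that assms finite_subset by auto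
  have "conn_exp L p y u v \<le> bern_exp L p (\<lambda>w. conn_wt x w u v
    + (1 - x / y) * (\<Sum>a\<in>F. disj_prod (\<lambda>w. conn_wt x w u a) (\<lambda>w. conn_wt y w a v) w))"
    unfolding conn_exp_def using assms fin by (intro bern_exp_mono conn_wt_resolvent) auto
  also have "\<dots> = conn_exp L p x u v + (1 - x / y) *
      (\<Sum>a\<in>F. bern_exp L p (disj_prod (\<lambda>w. conn_wt x w u a) (\<lambda>w. conn_wt y w a v)))"
    by (simp add: bern_exp_add bern_exp_cmult bern_exp_sum conn_exp_def)
  also have "\<dots> \<le> conn_exp L p x u v
    + (1 - x / y) * (\<Sum>a\<in>F. conn_exp L p x u a * conn_exp L p y a v)"
    unfolding conn_exp_def using assms
    by (intro add_mono mult_left_mono sum_mono bern_exp_disj_prod conn_wt_mono conn_wt_nonneg) auto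
  finally show ?thesis .
qed

text \<open>Given \<open>w\<close>, one fixed geodesic survives the thinning with probability at
  least \<open>t\<close> to the power of its length, and the distance has then not
  increased.\<close>

lemma conn_exp_thin:
  assumes "finite L" "0 \<le> p" "p \<le> 1" "0 < t" "t \<le> 1" "0 < y" "y \<le> 1"
  shows "conn_exp L p (t * y) u v \<le> conn_exp L (p * t) y u v"
proof -
  have "conn_wt (t * y) w u v \<le> bern_exp w t (\<lambda>w. conn_wt y w u v)" if w: "w \<subseteq> L" for w
  proof (cases "(u, v) \<in> (adj_rel w)\<^sup>*")
    case True
    have fin: "finite w" using w assms finite_subset by blast
    define n where "n = gdist w u v"
    obtain c where c: "c 0 = u" "c n = v" "inj_on c {..n}" "path_edges c 0 n \<subseteq> w"
      using geodesic True unfolding n_def by metis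
    let ?A = "path_edges c 0 n"
    have card: "card ?A \<le> n" unfolding path_edges_def using card_image_le[of "{0..<n}"] by simp
    have finA: "finite ?A" by (simp add: path_edges_def)
    have "(u, v) \<in> adj_rel ?A ^^ n" using path_edges_relpow[of 0 n c ?A] c by simp
    then have ge: "y ^ n \<le> conn_wt y ?A u v" using assms by (intro conn_wt_ge) auto
    have "conn_wt (t * y) w u v = t ^ n * y ^ n" using True by (simp add: conn_wt_def n_def power_mult_distrib)
    also have "\<dots> \<le> t ^ card ?A * bern_exp w t (\<lambda>w. conn_wt y ?A u v)"
      using assms ge card fin by (intro mult_mono power_decreasing) (auto simp: bern_exp_const)
    also have "\<dots> \<le> t ^ card ?A * bern_exp w t (\<lambda>w. conn_wt y (w \<union> ?A) u v)"
      using assms by (intro mult_left_mono bern_exp_mono conn_wt_mono) auto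
    also have "\<dots> \<le> bern_exp w t (\<lambda>w. conn_wt y w u v)"
      using assms c fin finA by (intro bern_exp_open_edges conn_wt_nonneg) auto
    finally show ?thesis .
  next
    case False
    then show ?thesis using assms by (auto simp: conn_wt_def intro!: bern_exp_nonneg)
  qed
  then have "conn_exp L p (t * y) u v \<le> bern_exp L p (\<lambda>w. bern_exp w t (\<lambda>w. conn_wt y w u v))"
    unfolding conn_exp_def using assms by (intro bern_exp_mono) auto
  then show ?thesis using assms by (simp add: bern_exp_thin conn_exp_def)
qed

lemma conn_exp_tree:
  assumes "finite L" "0 \<le> p" "p \<le> 1" "0 \<le> x" "x \<le> 1" "finite F" "\<Union>L \<subseteq> F" "u \<in> F"
  shows "bern_exp L p (\<lambda>w. conn_wt x w u a * conn_wt 1 w u z)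
    \<le> (\<Sum>t\<in>F. conn_exp L p x u t * (conn_exp L p x t a * conn_exp L p 1 t z))"
proof -
  have fin: "finite w" "\<Union>w \<subseteq> F" if "w \<subseteq> L" for w using that assms finite_subset by auto
  have "bern_exp L p (\<lambda>w. conn_wt x w u a * conn_wt 1 w u z)
      \<le> bern_exp L p (\<lambda>w. \<Sum>t\<in>F. disj_prod (\<lambda>w. conn_wt x w u t)
          (disj_prod (\<lambda>w. conn_wt x w t a) (\<lambda>w. conn_wt 1 w t z)) w)"
    using assms fin by (intro bern_exp_mono conn_wt_tree) auto
  also have "\<dots> = (\<Sum>t\<in>F. bern_exp L p (disj_prod (\<lambda>w. conn_wt x w u t)
          (disj_prod (\<lambda>w. conn_wt x w t a) (\<lambda>w. conn_wt 1 w t z))))"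
    by (simp add: bern_exp_sum)
  also have "\<dots> \<le> (\<Sum>t\<in>F. bern_exp L p (\<lambda>w. conn_wt x w u t)
          * bern_exp L p (disj_prod (\<lambda>w. conn_wt x w t a) (\<lambda>w. conn_wt 1 w t z)))"
    using assms
    by (intro sum_mono bern_exp_disj_prod conn_wt_mono conn_wt_nonneg disj_prod_mono disj_prod_nonneg) auto
  also have "\<dots> \<le> (\<Sum>t\<in>F. bern_exp L p (\<lambda>w. conn_wt x w u t)
          * (bern_exp L p (\<lambda>w. conn_wt x w t a) * bern_exp L p (\<lambda>w. conn_wt 1 w t z)))"
    using assms
    by (intro sum_mono mult_left_mono bern_exp_disj_prod conn_wt_mono conn_wt_nonneg bern_exp_nonneg) auto
  finally show ?thesis by (simp add: conn_exp_def)
qed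

lemma chain_count_exp:
  assumes "finite L" "0 \<le> p" "p \<le> 1"
  shows "bern_exp L p (\<lambda>w. chain_count F (Suc k) w u v)
    \<le> (\<Sum>a\<in>F. conn_exp L p 1 u a * bern_exp L p (\<lambda>w. chain_count F k w a v))"
  unfolding chain_count.simps bern_exp_sum conn_exp_def using assms
  by (intro sum_mono bern_exp_disj_prod conn_wt_mono conn_wt_nonneg chain_count_mono chain_count_nonneg) auto

section \<open>Exploration of the cluster of a vertex\<close>

lemma reach_touching:
  assumes "\<And>e. e \<in> w \<Longrightarrow> e \<inter> {z. (u, z) \<in> (adj_rel w)\<^sup>*} \<noteq> {} \<Longrightarrow> e \<in> w'"
    and "(u, z) \<in> adj_rel w ^^ n"
  shows "(u, z) \<in> adj_rel w' ^^ n"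
  using assms(2)
proof (induction n arbitrary: z)
  case (Suc n)
  then obtain y where y: "(u, y) \<in> adj_rel w ^^ n" "(y, z) \<in> adj_rel w" by auto
  then have "{y, z} \<in> w'" using relpow_imp_rtrancl[OF y(1)]
    by (intro assms(1)) (auto simp: adj_rel_def)
  then show ?case using Suc.IH[OF y(1)] by (auto simp: adj_rel_def)
qed simp

text \<open>Here \<open>w1\<close> determines the cluster of \<open>u\<close> and \<open>T\<close>
  consists of edges touching it. A geodesic of \<open>w2\<close> from \<open>b\<close> to
  \<open>v\<close> either misses this cluster, and then it avoids \<open>T\<close> and
  \<open>v\<close> lies outside, or it meets the cluster at some \<open>z\<close> and is cut there,
  dropping the weight of its first piece.\<close>

lemma conn_wt_explore:
  assumes "0 < x" "x \<le> 1" "finite F" "finite w2" "\<Union>w2 \<subseteq> F" "v \<in> F"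
    and T: "\<And>e. e \<in> w2 \<Longrightarrow> e \<in> T \<Longrightarrow> e \<inter> {z. (u, z) \<in> (adj_rel w1)\<^sup>*} \<noteq> {}"
  shows "conn_wt x w2 b v \<le> (1 - conn_wt 1 w1 u v) * conn_wt x (w2 - T) b v
    + (\<Sum>z\<in>F. conn_wt 1 w1 u z * disj_prod (\<lambda>w. conn_wt 1 w b z) (\<lambda>w. conn_wt x w z v) w2)"
    (is "_ \<le> ?A + (\<Sum>z\<in>F. ?f z)")
proof -
  have nn: "0 \<le> ?f z" for z
    by (intro disj_prod_nonneg conn_wt_nonneg mult_nonneg_nonneg) (use assms in auto)
  have A: "0 \<le> ?A" using assms by (intro mult_nonneg_nonneg conn_wt_nonneg) (auto simp: conn_wt_1)
  show ?thesis
  proof (cases "(b, v) \<in> (adj_rel w2)\<^sup>*")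
    case True
    define n where "n = gdist w2 b v"
    obtain c where c: "c 0 = b" "c n = v" "inj_on c {..n}" "path_edges c 0 n \<subseteq> w2"
      using geodesic True unfolding n_def by metis
    have sub: "path_edges c i j \<subseteq> w2" if "j \<le> n" for i j using that c(4) by (auto simp: path_edges_def)
    have eq: "conn_wt x w2 b v = x ^ n" using True by (simp add: conn_wt_def n_def)
    show ?thesis
    proof (cases "\<exists>k\<le>n. (u, c k) \<in> (adj_rel w1)\<^sup>*")
      case True
      then obtain k where k: "k \<le> n" "(u, c k) \<in> (adj_rel w1)\<^sup>*" by blast
      have zF: "c k \<in> F"
      proof (cases "n = 0")
        case True then show ?thesis using k c assms by simp
      next
        case False then show ?thesis using path_vertices[OF c(4) k(1)] assms(5) by auto
      qed
      have 1: "(b, c k) \<in> adj_rel (path_edges c 0 k) ^^ k" "(c k, v) \<in> adj_rel (path_edges c k n) ^^ (n - k)"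
        using path_edges_relpow[of 0 k c] path_edges_relpow[of k n c] k c by auto
      have "x ^ n \<le> 1 ^ k * x ^ (n - k)" using assms by (simp add: power_decreasing)
      also have "\<dots> \<le> conn_wt 1 (path_edges c 0 k) b (c k) * conn_wt x (path_edges c k n) (c k) v"
        using assms 1 by (intro mult_mono conn_wt_ge conn_wt_nonneg) auto
      also have "\<dots> \<le> disj_prod (\<lambda>w. conn_wt 1 w b (c k)) (\<lambda>w. conn_wt x w (c k) v) w2"
        using sub[of k 0] sub[of n k] path_edges_disjoint[OF c(3), of k k n 0] k assms
        by (intro disj_prod_ge conn_wt_nonneg conn_wt_mono) simp_all
      also have "\<dots> = ?f (c k)" using k by (simp add: conn_wt_1)
      also have "\<dots> \<le> (\<Sum>z\<in>F. ?f z)" using nn zF assms by (intro member_le_sum) auto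
      finally show ?thesis using A eq by simp
    next
      case False
      have "path_edges c 0 n \<subseteq> w2 - T"
      proof
        fix e assume e: "e \<in> path_edges c 0 n"
        then obtain l where l: "l < n" "e = {c l, c (Suc l)}" by (auto simp: path_edges_def)
        have "(u, c l) \<notin> (adj_rel w1)\<^sup>*" "(u, c (Suc l)) \<notin> (adj_rel w1)\<^sup>*"
          using False l by auto
        then have "e \<inter> {z. (u, z) \<in> (adj_rel w1)\<^sup>*} = {}" using l by simp
        then show "e \<in> w2 - T" using T[of e] c(4) e by blast
      qed
      then have "(b, v) \<in> adj_rel (w2 - T) ^^ n" using path_edges_relpow[of 0 n c] c by simp
      then have "x ^ n \<le> conn_wt x (w2 - T) b v" using assms by (intro conn_wt_ge) auto
      moreover have "conn_wt 1 w1 u v = 0" using False c by (auto simp: conn_wt_1)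
      ultimately show ?thesis using eq nn by (simp add: sum_nonneg add_increasing2)
    qed
  next
    case False
    then show ?thesis using A nn by (auto simp: conn_wt_def intro!: add_nonneg_nonneg sum_nonneg)
  qed
qed

text \<open>The left side is an expectation over two independent copies; the purpose is to realise
  both connections in one configuration with \<open>u\<close> and \<open>v\<close> still in
  different clusters, ready to be joined by a path from \<open>a\<close> to \<open>b\<close>. The
  cluster of \<open>u\<close> is taken from the first copy and the rest from the second. The error
  is that the connection from \<open>b\<close> to \<open>v\<close> hits this cluster, at
  \<open>z\<close>.\<close>

lemma conn_exp_explore:
  assumes "finite L" "0 \<le> p" "p \<le> 1" "0 < x" "x \<le> 1" "finite F" "\<Union>L \<subseteq> F" "v \<in> F"
  shows "conn_exp L p x u a * conn_exp L p x b v
     \<le> bern_exp L p (\<lambda>w. (1 - conn_wt 1 w u v) * conn_wt x w u a * conn_wt x w b v)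
      + (\<Sum>z\<in>F. bern_exp L p (\<lambda>w. conn_wt x w u a * conn_wt 1 w u z)
                  * (conn_exp L p 1 b z * conn_exp L p x z v))"
proof -
  define K where "K = (\<lambda>w. {z. (u, z) \<in> (adj_rel w)\<^sup>*})"
  \<comment> \<open>All edges touching the cluster of \<open>u\<close>, open or closed: precisely
    what an exploration of the cluster reveals.\<close>
  define \<tau> where "\<tau> = (\<lambda>w. {e \<in> L. e \<inter> K w \<noteq> {}})"
  have K_\<tau>: "(u, z) \<in> adj_rel (w \<inter> \<tau> w) ^^ n" if "(u, z) \<in> adj_rel w ^^ n" "w \<subseteq> L" for w z n
    by (rule reach_touching[OF _ that(1)]) (use that in \<open>auto simp: \<tau>_def K_def\<close>)
  have cw: "conn_wt y w u z = conn_wt y (w \<inter> \<tau> w) u z" if "w \<subseteq> L" for w z y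
  proof -
    have eq: "(u, z) \<in> adj_rel w ^^ n \<longleftrightarrow> (u, z) \<in> adj_rel (w \<inter> \<tau> w) ^^ n" for n
      using K_\<tau>[OF _ that] adj_relpow_mono[of "w \<inter> \<tau> w" w] by blast
    then have "gdist w u z = gdist (w \<inter> \<tau> w) u z" by (simp add: gdist_def)
    moreover have "(u, z) \<in> (adj_rel w)\<^sup>* \<longleftrightarrow> (u, z) \<in> (adj_rel (w \<inter> \<tau> w))\<^sup>*"
      using eq by (simp add: rtrancl_power)
    ultimately show ?thesis by (simp add: conn_wt_def)
  qed
  have stop: "\<tau> w' = \<tau> w" if w: "w \<subseteq> L" "w' \<subseteq> L" "w \<inter> \<tau> w = w' \<inter> \<tau> w" for w w'
  proof -
    have "K w \<subseteq> K w'"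
      using K_\<tau>[OF _ w(1)] w(3) unfolding K_def
      by (smt (verit, ccfv_SIG) Collect_mono_iff adj_rtrancl_mono inf_le1 rtrancl_power)
    moreover have "z \<in> K w" if "(u, z) \<in> (adj_rel w')\<^sup>*" for z
      using that
    proof (induction rule: rtrancl_induct)
      case (step y z)
      then have "{y, z} \<in> w' \<inter> \<tau> w" using w(2) by (auto simp: \<tau>_def adj_rel_def)
      then have "(y, z) \<in> adj_rel w" using w(3) by (auto simp: adj_rel_def)
      then show ?case using step by (auto simp: K_def)
    qed (simp add: K_def)
    ultimately have "K w' = K w" by (auto simp: K_def)
    then show ?thesis by (simp add: \<tau>_def)
  qed
  define f where "f = (\<lambda>A B. (1 - conn_wt 1 A u v) * conn_wt x A u a * conn_wt x B b v)"
  let ?D = "\<lambda>z. disj_prod (\<lambda>w. conn_wt 1 w b z) (\<lambda>w. conn_wt x w z v)"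
  have fin: "finite w" "\<Union>w \<subseteq> F" if "w \<subseteq> L" for w using that assms finite_subset by auto
  have "conn_exp L p x u a * conn_exp L p x b v
      = bern_exp L p (\<lambda>w1. bern_exp L p (\<lambda>w2. conn_wt x w1 u a * conn_wt x w2 b v))"
    by (simp add: conn_exp_def bern_exp_cmult bern_exp_cmult_right)
  also have "\<dots> \<le> bern_exp L p (\<lambda>w1. bern_exp L p (\<lambda>w2. f (w1 \<inter> \<tau> w1) (w2 - \<tau> w1)
      + (\<Sum>z\<in>F. (conn_wt x w1 u a * conn_wt 1 w1 u z) * ?D z w2)))"
  proof (intro bern_exp_mono assms)
    fix w1 w2 assume w: "w1 \<subseteq> L" "w2 \<subseteq> L"
    have "conn_wt x w1 u a * conn_wt x w2 b v
      \<le> conn_wt x w1 u a * ((1 - conn_wt 1 w1 u v) * conn_wt x (w2 - \<tau> w1) b v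
        + (\<Sum>z\<in>F. conn_wt 1 w1 u z * ?D z w2))"
      using assms w fin
      by (intro mult_left_mono conn_wt_explore conn_wt_nonneg) (auto simp: \<tau>_def K_def)
    then show "conn_wt x w1 u a * conn_wt x w2 b v \<le> f (w1 \<inter> \<tau> w1) (w2 - \<tau> w1)
      + (\<Sum>z\<in>F. (conn_wt x w1 u a * conn_wt 1 w1 u z) * ?D z w2)"
      using cw[OF w(1)] by (simp add: f_def algebra_simps sum_distrib_left)
  qed
  \<comment> \<open>The main term reads the first copy on the revealed edges and the second copy off
    them, so \<open>bern_exp_explore\<close> merges the copies into one.\<close>
  also have "\<dots> = bern_exp L p (\<lambda>w. f (w \<inter> \<tau> w) (w - \<tau> w))
      + (\<Sum>z\<in>F. bern_exp L p (\<lambda>w. conn_wt x w u a * conn_wt 1 w u z) * bern_exp L p (?D z))"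
    by (subst bern_exp_explore[OF assms(1) _ stop])
      (simp_all add: \<tau>_def bern_exp_add bern_exp_sum bern_exp_cmult bern_exp_cmult_right)
  also have "\<dots> \<le> bern_exp L p (\<lambda>w. (1 - conn_wt 1 w u v) * conn_wt x w u a * conn_wt x w b v)
      + (\<Sum>z\<in>F. bern_exp L p (\<lambda>w. conn_wt x w u a * conn_wt 1 w u z)
                  * (conn_exp L p 1 b z * conn_exp L p x z v))"
  proof (intro add_mono sum_mono mult_left_mono bern_exp_mono assms)
    fix w assume "w \<subseteq> L"
    then show "f (w \<inter> \<tau> w) (w - \<tau> w) \<le> (1 - conn_wt 1 w u v) * conn_wt x w u a * conn_wt x w b v"
      unfolding f_def using assms cw[of w, symmetric]
      by (intro mult_mono conn_wt_mono mult_nonneg_nonneg conn_wt_nonneg) (auto simp: conn_wt_1)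
  next
    fix z
    show "bern_exp L p (?D z) \<le> conn_exp L p 1 b z * conn_exp L p x z v"
      unfolding conn_exp_def using assms
      by (intro bern_exp_disj_prod conn_wt_mono conn_wt_nonneg) auto
    show "0 \<le> bern_exp L p (\<lambda>w. conn_wt x w u a * conn_wt 1 w u z)"
      using assms by (intro bern_exp_nonneg mult_nonneg_nonneg conn_wt_nonneg) auto
  qed
  finally show ?thesis .
qed

text \<open>The edges of \<open>A\<close> are opened one after another. The increment due to
  \<open>e\<close> when some of them are already open is compared with the influence of
  \<open>e\<close>, at the price of the probability that those edges are open.\<close>

lemma bern_exp_open_set_increment:
  fixes g :: "'e set \<Rightarrow> real"
  assumes "finite L" "finite A" "A \<subseteq> L" "0 \<le> p" "p \<le> 1"
    and mono: "\<And>w w'. w \<subseteq> w' \<Longrightarrow> g w \<le> g w'"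
  shows "p ^ card A * (bern_exp L p (\<lambda>w. g (w \<union> A)) - bern_exp L p g)
    \<le> (\<Sum>e\<in>A. bern_exp L p (\<lambda>w. g (insert e w)) - bern_exp L p (\<lambda>w. g (w - {e})))"
  using assms(2,3)
proof (induction A rule: finite_induct)
  case (insert e A)
  let ?\<Delta> = "\<lambda>e. bern_exp L p (\<lambda>w. g (insert e w)) - bern_exp L p (\<lambda>w. g (w - {e}))"
  let ?E = "\<lambda>A. bern_exp L p (\<lambda>w. g (w \<union> A))"
  have nn: "0 \<le> ?\<Delta> e" for e
    using assms by (simp add: bern_exp_mono mono subset_insertI2)
  have "?E (insert e A) - ?E A = bern_exp L p (\<lambda>w. g (insert e (w \<union> A)) - g (w \<union> A))"
    by (simp add: bern_exp_diff)
  also have "\<dots> \<le> bern_exp L p (\<lambda>w. g (insert e (w \<union> A)) - g ((w \<union> A) - {e}))"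
    using assms by (intro bern_exp_mono diff_left_mono mono) auto
  finally have "p ^ card A * (?E (insert e A) - ?E A)
      \<le> p ^ card A * bern_exp L p (\<lambda>w. g (insert e (w \<union> A)) - g ((w \<union> A) - {e}))"
    using assms by (intro mult_left_mono) auto
  also have "\<dots> \<le> bern_exp L p (\<lambda>w. g (insert e w) - g (w - {e}))"
    using assms insert mono
    by (intro bern_exp_open_edges[where f = "\<lambda>w. g (insert e w) - g (w - {e})"])
      (auto simp: subset_insertI2)
  finally have 1: "p ^ card A * (?E (insert e A) - ?E A) \<le> ?\<Delta> e" by (simp add: bern_exp_diff)
  have 2: "p ^ card A * (?E A - bern_exp L p g) \<le> (\<Sum>e\<in>A. ?\<Delta> e)" using insert by auto
  have "p ^ card (insert e A) * (?E (insert e A) - bern_exp L p g)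
      = p * (p ^ card A * (?E (insert e A) - ?E A) + p ^ card A * (?E A - bern_exp L p g))"
    using insert by (simp add: algebra_simps)
  also have "\<dots> \<le> p * (?\<Delta> e + (\<Sum>e\<in>A. ?\<Delta> e))"
    using 1 2 assms by (intro mult_left_mono add_mono) auto
  also have "\<dots> \<le> 1 * (?\<Delta> e + (\<Sum>e\<in>A. ?\<Delta> e))"
    using nn assms by (intro mult_right_mono add_nonneg_nonneg sum_nonneg) auto
  finally show ?case using insert by simp
qed simp

lemma conn_wt_join_increment:
  assumes "0 \<le> x" "x \<le> 1" "(a, b) \<in> adj_rel A ^^ m" "m \<le> r"
  shows "x ^ r * ((1 - conn_wt 1 w u v) * conn_wt x w u a * conn_wt x w b v)
    \<le> conn_wt x (w \<union> A) u v - conn_wt x w u v"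
proof (cases "(u, v) \<in> (adj_rel w)\<^sup>*")
  case True
  then show ?thesis using assms conn_wt_mono[of w "w \<union> A" x u v] by (simp add: conn_wt_1)
next
  case False
  have "x ^ r \<le> x ^ m" using assms by (intro power_decreasing) auto
  also have "\<dots> \<le> conn_wt x A a b" using assms by (intro conn_wt_ge)
  also have "\<dots> \<le> conn_wt x (w \<union> A) a b" using assms by (intro conn_wt_mono) auto
  finally have r: "x ^ r \<le> conn_wt x (w \<union> A) a b" .
  have "x ^ r * (conn_wt x w u a * conn_wt x w b v)
      \<le> conn_wt x (w \<union> A) a b * (conn_wt x (w \<union> A) u a * conn_wt x (w \<union> A) b v)"
    using assms r by (intro mult_mono conn_wt_mono mult_nonneg_nonneg conn_wt_nonneg) auto
  also have "\<dots> = (conn_wt x (w \<union> A) u a * conn_wt x (w \<union> A) a b) * conn_wt x (w \<union> A) b v"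
    by (simp add: mult_ac)
  also have "\<dots> \<le> conn_wt x (w \<union> A) u b * conn_wt x (w \<union> A) b v"
    using assms by (intro mult_right_mono conn_wt_triangle conn_wt_nonneg) auto
  also have "\<dots> \<le> conn_wt x (w \<union> A) u v" using assms by (intro conn_wt_triangle)
  finally show ?thesis using False by (simp add: conn_wt_def)
qed

text \<open>By Russo's formula the derivative is the sum of the influences of the edges. Opening the
  path \<open>A (a, b)\<close> when \<open>u\<close> is connected to \<open>a\<close> and
  \<open>b\<close> to \<open>v\<close>, but not \<open>u\<close> to \<open>v\<close>, raises the
  weight, and the influences of its edges pay for this. An edge lies on at most \<open>M\<close>
  paths and is charged at most \<open>M\<close> times. The subtracted double sum is the error of
  \<open>conn_exp_explore\<close>, with the tree-graph bound inserted.\<close>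

lemma conn_exp_derivative_lower:
  fixes Q :: "('v \<times> 'v) set" and A :: "'v \<times> 'v \<Rightarrow> 'v set set" and M :: nat
  assumes "finite L" "0 \<le> p" "p \<le> 1" "0 < x" "x \<le> 1" "finite F" "\<Union>L \<subseteq> F" "u \<in> F" "v \<in> F"
    and Q: "finite Q"
    and A: "\<And>a b. (a, b) \<in> Q \<Longrightarrow> A (a, b) \<subseteq> L \<and> card (A (a, b)) \<le> r \<and> (\<exists>m\<le>r. (a, b) \<in> adj_rel (A (a, b)) ^^ m)"
    and M: "\<And>e. e \<in> L \<Longrightarrow> card {q \<in> Q. e \<in> A q} \<le> M"
  shows "\<exists>D::real. ((\<lambda>p. conn_exp L p x u v) has_real_derivative D) (at p) \<and>
    (p * x) ^ r * (\<Sum>(a, b)\<in>Q. conn_exp L p x u a * conn_exp L p x b v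
        - (\<Sum>z\<in>F. \<Sum>t\<in>F. conn_exp L p x u t * (conn_exp L p x t a * conn_exp L p 1 t z)
            * (conn_exp L p 1 b z * conn_exp L p x z v))) \<le> real M * D"
proof -
  let ?g = "\<lambda>w. conn_wt x w u v"
  let ?\<Delta> = "\<lambda>e. bern_exp L p (\<lambda>w. ?g (insert e w)) - bern_exp L p (\<lambda>w. ?g (w - {e}))"
  have nn: "0 \<le> ?\<Delta> e" for e
    using assms by (simp, intro bern_exp_mono conn_wt_mono) auto
  have der: "((\<lambda>p. conn_exp L p x u v) has_real_derivative (\<Sum>e\<in>L. ?\<Delta> e)) (at p)"
    unfolding conn_exp_def by (rule bern_exp_russo[OF assms(1)])
  have "(p * x) ^ r * (\<Sum>(a, b)\<in>Q. conn_exp L p x u a * conn_exp L p x b v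
        - (\<Sum>z\<in>F. \<Sum>t\<in>F. conn_exp L p x u t * (conn_exp L p x t a * conn_exp L p 1 t z)
            * (conn_exp L p 1 b z * conn_exp L p x z v))) \<le> (\<Sum>q\<in>Q. \<Sum>e\<in>A q. ?\<Delta> e)"
    unfolding sum_distrib_left
  proof (rule sum_mono, clarify)
    fix a b assume ab: "(a, b) \<in> Q"
    then obtain m where m: "m \<le> r" "(a, b) \<in> adj_rel (A (a, b)) ^^ m" using A by blast
    have AL: "A (a, b) \<subseteq> L" "card (A (a, b)) \<le> r" "finite (A (a, b))"
      using A[OF ab] assms(1) finite_subset by blast+
    let ?J = "bern_exp L p (\<lambda>w. (1 - conn_wt 1 w u v) * conn_wt x w u a * conn_wt x w b v)"
    have J0: "0 \<le> ?J" using assms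
      by (intro bern_exp_nonneg mult_nonneg_nonneg conn_wt_nonneg) (auto simp: conn_wt_1)
    have "conn_exp L p x u a * conn_exp L p x b v
      \<le> ?J + (\<Sum>z\<in>F. bern_exp L p (\<lambda>w. conn_wt x w u a * conn_wt 1 w u z)
                  * (conn_exp L p 1 b z * conn_exp L p x z v))"
      using assms by (intro conn_exp_explore) auto
    also have "\<dots> \<le> ?J + (\<Sum>z\<in>F. (\<Sum>t\<in>F. conn_exp L p x u t * (conn_exp L p x t a * conn_exp L p 1 t z))
                  * (conn_exp L p 1 b z * conn_exp L p x z v))"
      using assms by (intro add_mono sum_mono mult_right_mono conn_exp_tree mult_nonneg_nonneg conn_exp_nonneg) auto
    finally have 1: "conn_exp L p x u a * conn_exp L p x b v
        - (\<Sum>z\<in>F. \<Sum>t\<in>F. conn_exp L p x u t * (conn_exp L p x t a * conn_exp L p 1 t z)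
            * (conn_exp L p 1 b z * conn_exp L p x z v)) \<le> ?J"
      by (simp add: sum_distrib_right)
    have "x ^ r * ?J \<le> bern_exp L p (\<lambda>w. ?g (w \<union> A (a, b)) - ?g w)"
      unfolding bern_exp_cmult[symmetric] using assms m
      by (intro bern_exp_mono conn_wt_join_increment) auto
    then have "p ^ r * (x ^ r * ?J) \<le> p ^ card (A (a, b)) * (bern_exp L p (\<lambda>w. ?g (w \<union> A (a, b))) - bern_exp L p ?g)"
      using assms AL J0 by (intro mult_mono power_decreasing) (auto simp: bern_exp_diff)
    also have "\<dots> \<le> (\<Sum>e\<in>A (a, b). ?\<Delta> e)"
      using assms AL by (intro bern_exp_open_set_increment conn_wt_mono) auto
    finally have 2: "(p * x) ^ r * ?J \<le> (\<Sum>e\<in>A (a, b). ?\<Delta> e)" by (simp add: power_mult_distrib mult_ac)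
    show "(p * x) ^ r * (conn_exp L p x u a * conn_exp L p x b v
        - (\<Sum>z\<in>F. \<Sum>t\<in>F. conn_exp L p x u t * (conn_exp L p x t a * conn_exp L p 1 t z)
            * (conn_exp L p 1 b z * conn_exp L p x z v))) \<le> (\<Sum>e\<in>A (a, b). ?\<Delta> e)"
      using mult_left_mono[OF 1, of "(p * x) ^ r"] 2 assms by simp
  qed
  also have "(\<Sum>q\<in>Q. \<Sum>e\<in>A q. ?\<Delta> e) = (\<Sum>q\<in>Q. \<Sum>e\<in>L. if e \<in> A q then ?\<Delta> e else 0)"
  proof (rule sum.cong[OF refl])
    fix q assume "q \<in> Q"
    then have "A q \<subseteq> L" using A by (cases q) auto
    then have "L \<inter> {e. e \<in> A q} = A q" by auto
    then show "(\<Sum>e\<in>A q. ?\<Delta> e) = (\<Sum>e\<in>L. if e \<in> A q then ?\<Delta> e else 0)"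
      using sum.inter_restrict[OF assms(1), of ?\<Delta> "A q"] \<open>A q \<subseteq> L\<close> by (simp add: Int_absorb1)
  qed
  also have "\<dots> = (\<Sum>e\<in>L. \<Sum>q\<in>Q. if e \<in> A q then ?\<Delta> e else 0)" by (rule sum.swap)
  also have "\<dots> = (\<Sum>e\<in>L. card {q \<in> Q. e \<in> A q} * ?\<Delta> e)"
    using Q by (intro sum.cong) (auto simp: sum.inter_filter[symmetric])
  also have "\<dots> \<le> (\<Sum>e\<in>L. M * ?\<Delta> e)"
    using M nn by (intro sum_mono mult_right_mono) auto
  also have "\<dots> = M * (\<Sum>e\<in>L. ?\<Delta> e)" by (simp add: sum_distrib_left)
  finally show ?thesis using der by blast
qed

section \<open>Quasi-transitive graphs\<close>

text \<open>The last clause keeps the edges close to \<open>a\<close>. In \<open>path_family\<close>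
  it bounds the number of pairs whose path runs through a given edge.\<close>

lemma relpow_path_set:
  assumes "(a, b) \<in> adj_rel w ^^ n"
  shows "\<exists>A\<subseteq>w. finite A \<and> card A \<le> n \<and> (a, b) \<in> adj_rel A ^^ n \<and> (\<forall>e\<in>A. \<exists>y\<in>e. \<exists>m\<le>n. (a, y) \<in> adj_rel w ^^ m)"
proof -
  obtain c where c: "c 0 = a" "c n = b" "\<And>i. i < n \<Longrightarrow> (c i, c (Suc i)) \<in> adj_rel w"
    using assms unfolding relpow_fun_conv by auto
  have w: "path_edges c 0 n \<subseteq> w" using c by (auto simp: path_edges_def adj_rel_def)
  have "\<exists>y\<in>e. \<exists>m\<le>n. (a, y) \<in> adj_rel w ^^ m" if e: "e \<in> path_edges c 0 n" for e
  proof -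
    obtain l where l: "l < n" "e = {c l, c (Suc l)}" using e by (auto simp: path_edges_def)
    have "path_edges c 0 l \<subseteq> w" using w l by (auto simp: path_edges_def)
    then have "(a, c l) \<in> adj_rel w ^^ l" using path_edges_relpow[of 0 l c w] c by simp
    then show ?thesis using l by (intro bexI[of _ "c l"] exI[of _ l]) auto
  qed
  moreover have "(a, b) \<in> adj_rel (path_edges c 0 n) ^^ n"
    using path_edges_relpow[of 0 n c "path_edges c 0 n"] c by simp
  moreover have "card (path_edges c 0 n) \<le> n"
    unfolding path_edges_def using card_image_le[of "{0..<n}"] by simp
  moreover have "finite (path_edges c 0 n)" by (simp add: path_edges_def)
  ultimately show ?thesis using w by (intro exI[of _ "path_edges c 0 n"] conjI ballI) simp_all
qed

definition gball :: "'v set set \<Rightarrow> 'v \<Rightarrow> nat \<Rightarrow> 'v set" where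
  "gball E v r = {u. \<exists>n\<le>r. (v, u) \<in> adj_rel E ^^ n}"

lemma gball_self: "v \<in> gball E v r"
  unfolding gball_def mem_Collect_eq by (rule exI[of _ 0]) simp

lemma gball_0: "gball E v 0 = {v}"
  by (auto simp: gball_def)

lemma gball_sym: "u \<in> gball E v r \<Longrightarrow> v \<in> gball E u r"
  using adj_relpow_sym[where w = E] by (auto simp: gball_def)

lemma gball_trans: "u \<in> gball E v r \<Longrightarrow> z \<in> gball E u s \<Longrightarrow> z \<in> gball E v (r + s)"
proof -
  assume "u \<in> gball E v r" "z \<in> gball E u s"
  then obtain n m where nm: "n \<le> r" "(v, u) \<in> adj_rel E ^^ n" "m \<le> s" "(u, z) \<in> adj_rel E ^^ m"
    by (auto simp: gball_def)
  have "(v, z) \<in> adj_rel E ^^ (n + m)" by (rule relpow_trans[OF nm(2,4)])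
  moreover have "n + m \<le> r + s" using nm by simp
  ultimately show "z \<in> gball E v (r + s)" unfolding gball_def by blast
qed

lemma gball_mono: "r \<le> s \<Longrightarrow> gball E v r \<subseteq> gball E v s"
  by (auto simp: gball_def) (meson order_trans)

lemma gball_Suc: "gball E v (Suc r) = gball E v r \<union> (\<Union>u\<in>gball E v r. {z. {u, z} \<in> E})"
proof
  show "gball E v (Suc r) \<subseteq> gball E v r \<union> (\<Union>u\<in>gball E v r. {z. {u, z} \<in> E})"
  proof
    fix z assume "z \<in> gball E v (Suc r)"
    then obtain n where n: "n \<le> Suc r" "(v, z) \<in> adj_rel E ^^ n" by (auto simp: gball_def)
    show "z \<in> gball E v r \<union> (\<Union>u\<in>gball E v r. {z. {u, z} \<in> E})"
    proof (cases "n \<le> r")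
      case True then show ?thesis using n by (auto simp: gball_def)
    next
      case False
      then have "n = Suc r" using n by simp
      then obtain y where "(v, y) \<in> adj_rel E ^^ r" "(y, z) \<in> adj_rel E" using n by auto
      then show ?thesis by (auto simp: gball_def adj_rel_def)
    qed
  qed
  have "z \<in> gball E v (Suc r)" if "u \<in> gball E v r" "{u, z} \<in> E" for u z
  proof -
    have "(u, z) \<in> adj_rel E ^^ 1" using that(2) by (simp add: adj_rel_def)
    then have "z \<in> gball E u 1" unfolding gball_def by blast
    then show ?thesis using gball_trans[OF that(1)] by fastforce
  qed
  then show "gball E v r \<union> (\<Union>u\<in>gball E v r. {z. {u, z} \<in> E}) \<subseteq> gball E v (Suc r)"
    using gball_mono[of r "Suc r" E v] by auto
qed

locale qt_graph =
  fixes V :: "'v set" and E :: "'v set set"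
  assumes graph: "is_graph V E" and connected: "connected_graph V E"
    and loc_fin: "locally_finite_graph V E" and quasi: "quasi_transitive V E"
begin

lemma V_nonempty: "V \<noteq> {}" using graph by (simp add: is_graph_def)

lemma edge_in_V: "e \<in> E \<Longrightarrow> e \<subseteq> V" using graph by (simp add: is_graph_def)

lemma edge_card: "e \<in> E \<Longrightarrow> card e = 2" using graph by (simp add: is_graph_def)

lemma reach: "u \<in> V \<Longrightarrow> v \<in> V \<Longrightarrow> (u, v) \<in> (adj_rel E)\<^sup>*"
  using connected by (simp add: connected_graph_def)

lemma Union_edges: "L \<subseteq> E \<Longrightarrow> \<Union>L \<subseteq> V" using edge_in_V by blast

lemma finite_Union_edges: "finite L \<Longrightarrow> L \<subseteq> E \<Longrightarrow> finite (\<Union>L)"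
  by (intro finite_Union) (auto intro!: card_ge_0_finite dest!: subsetD dest: edge_card)

lemma finite_edges_at: "v \<in> V \<Longrightarrow> finite {e \<in> E. v \<in> e}"
  using loc_fin by (simp add: locally_finite_graph_def)

lemma gball_subset: "v \<in> V \<Longrightarrow> gball E v r \<subseteq> V"
  by (induction r) (auto simp: gball_0 gball_Suc dest: edge_in_V)

lemma finite_nbrs: "u \<in> V \<Longrightarrow> finite {z. {u, z} \<in> E}"
proof -
  assume u: "u \<in> V"
  have "{z. {u, z} \<in> E} \<subseteq> \<Union>{e \<in> E. u \<in> e}" by auto
  moreover have "finite (\<Union>{e \<in> E. u \<in> e})"
    using finite_edges_at[OF u] by (intro finite_Union_edges) auto
  ultimately show ?thesis by (rule finite_subset)
qed

lemma finite_gball: "v \<in> V \<Longrightarrow> finite (gball E v r)"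
  by (induction r) (use gball_subset finite_nbrs in \<open>auto simp: gball_0 gball_Suc\<close>)

lemma in_gball: "u \<in> V \<Longrightarrow> v \<in> V \<Longrightarrow> v \<in> gball E u (gdist E u v)"
  using gdist_relpow[OF reach] by (auto simp: gball_def)

lemma aut_inj: "\<sigma> \<in> graph_auts V E \<Longrightarrow> inj_on \<sigma> V"
  and aut_in: "\<sigma> \<in> graph_auts V E \<Longrightarrow> v \<in> V \<Longrightarrow> \<sigma> v \<in> V"
  and aut_image: "\<sigma> \<in> graph_auts V E \<Longrightarrow> \<sigma> ` V = V"
  by (auto simp: graph_auts_def bij_betw_def)

lemma aut_edge: "\<sigma> \<in> graph_auts V E \<Longrightarrow> e \<in> E \<Longrightarrow> \<sigma> ` e \<in> E"
proof -
  assume \<sigma>: "\<sigma> \<in> graph_auts V E" and e: "e \<in> E"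
  obtain a b where ab: "e = {a, b}" using edge_card[OF e] by (auto simp: card_2_iff)
  then have "a \<in> V" "b \<in> V" using edge_in_V[OF e] by auto
  then show ?thesis using \<sigma> e ab by (simp add: graph_auts_def)
qed

lemma aut_inv:
  assumes "\<sigma> \<in> graph_auts V E"
  shows "inv_into V \<sigma> \<in> graph_auts V E"
proof -
  have b: "bij_betw \<sigma> V V" using assms by (simp add: graph_auts_def)
  have "{inv_into V \<sigma> u, inv_into V \<sigma> v} \<in> E \<longleftrightarrow> {u, v} \<in> E" if "u \<in> V" "v \<in> V" for u v
  proof -
    have "inv_into V \<sigma> u \<in> V" "inv_into V \<sigma> v \<in> V" "\<sigma> (inv_into V \<sigma> u) = u" "\<sigma> (inv_into V \<sigma> v) = v"
      using that aut_image[OF assms] by (auto intro: inv_into_into f_inv_into_f)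
    moreover have "{\<sigma> (inv_into V \<sigma> u), \<sigma> (inv_into V \<sigma> v)} \<in> E \<longleftrightarrow> {inv_into V \<sigma> u, inv_into V \<sigma> v} \<in> E"
      using assms calculation(1,2) unfolding graph_auts_def by blast
    ultimately show ?thesis by simp
  qed
  then show ?thesis using bij_betw_inv_into[OF b] by (simp add: graph_auts_def)
qed

lemma aut_inv_eq:
  assumes "\<sigma> \<in> graph_auts V E" "v \<in> V"
  shows "inv_into V \<sigma> (\<sigma> v) = v"
  using assms aut_inj by (simp add: inv_into_f_f)

lemma aut_comp:
  assumes "\<sigma> \<in> graph_auts V E" "\<tau> \<in> graph_auts V E"
  shows "\<sigma> \<circ> \<tau> \<in> graph_auts V E"
  using assms aut_in[OF assms(2)] by (auto simp: graph_auts_def intro: bij_betw_trans)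

lemma aut_id: "id \<in> graph_auts V E" by (simp add: graph_auts_def)

section \<open>Uniformity from finitely many orbits\<close>

lemma orbit_representatives:
  obtains R where "finite R" "R \<subseteq> V" "\<And>v. v \<in> V \<Longrightarrow> \<exists>r\<in>R. \<exists>\<sigma>\<in>graph_auts V E. v = \<sigma> r"
proof -
  define orb where "orb v = {\<sigma> v | \<sigma>. \<sigma> \<in> graph_auts V E}" for v
  have "{orb v | v. v \<in> V} = orb ` V" by auto
  then have "finite (orb ` V)" using quasi by (simp add: quasi_transitive_def orb_def)
  then obtain R where R: "finite R" "R \<subseteq> V" "orb ` R = orb ` V"
    using finite_subset_image[OF _ order_refl] by metis
  have "\<exists>r\<in>R. \<exists>\<sigma>\<in>graph_auts V E. v = \<sigma> r" if "v \<in> V" for v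
  proof -
    have "orb v \<in> orb ` R" using R(3) that by simp
    then obtain r where r: "r \<in> R" "orb r = orb v" by force
    have "id v \<in> orb v" unfolding orb_def using aut_id by blast
    then have "v \<in> orb r" using r by simp
    then show ?thesis using r by (auto simp: orb_def)
  qed
  then show ?thesis using R that by blast
qed

lemma aut_relpow:
  assumes "\<sigma> \<in> graph_auts V E" "(a, y) \<in> adj_rel E ^^ m"
  shows "(\<sigma> a, \<sigma> y) \<in> adj_rel E ^^ m"
  using assms(2)
proof (induction m arbitrary: y)
  case (Suc m)
  then obtain x where x: "(a, x) \<in> adj_rel E ^^ m" "{x, y} \<in> E" by (auto simp: adj_rel_def)
  have "\<sigma> ` {x, y} \<in> E" by (rule aut_edge[OF assms(1) x(2)])
  then show ?case using Suc.IH[OF x(1)] by (auto simp: adj_rel_def)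
qed simp

lemma near_translate:
  obtains D where "\<And>u v. u \<in> V \<Longrightarrow> v \<in> V \<Longrightarrow> \<exists>\<sigma>\<in>graph_auts V E. \<sigma> v \<in> gball E u D"
proof -
  obtain R where R: "finite R" "R \<subseteq> V" "\<And>v. v \<in> V \<Longrightarrow> \<exists>r\<in>R. \<exists>\<sigma>\<in>graph_auts V E. v = \<sigma> r"
    using orbit_representatives by blast
  define D where "D = Max ((\<lambda>(a, b). gdist E a b) ` (R \<times> R))"
  have D: "gdist E a b \<le> D" if "a \<in> R" "b \<in> R" for a b
    unfolding D_def using R that by (intro Max_ge) auto
  have "\<exists>\<sigma>\<in>graph_auts V E. \<sigma> v \<in> gball E u D" if uv: "u \<in> V" "v \<in> V" for u v
  proof -
    obtain a \<sigma> b \<tau> where a: "a \<in> R" "\<sigma> \<in> graph_auts V E" "u = \<sigma> a"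
      and b: "b \<in> R" "\<tau> \<in> graph_auts V E" "v = \<tau> b" using R uv by metis
    \<comment> \<open>This maps \<open>v = \<tau> b\<close> to \<open>\<sigma> b\<close>, whose
      distance from \<open>u = \<sigma> a\<close> is at most that of the representatives
      \<open>a\<close> and \<open>b\<close>, hence at most \<open>D\<close>.\<close>
    define \<rho> where "\<rho> = \<sigma> \<circ> inv_into V \<tau>"
    have \<rho>: "\<rho> \<in> graph_auts V E" unfolding \<rho>_def using a b by (intro aut_comp aut_inv)
    have \<rho>v: "\<rho> v = \<sigma> b" using aut_inv_eq[OF b(2), of b] b R by (auto simp: \<rho>_def)
    have ab: "a \<in> V" "b \<in> V" using a b R by auto
    have "(\<sigma> a, \<sigma> b) \<in> adj_rel E ^^ gdist E a b"
      by (rule aut_relpow[OF a(2) gdist_relpow[OF reach[OF ab]]])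
    then have "\<rho> v \<in> gball E u D" using \<rho>v a(3) D[OF a(1) b(1)] by (auto simp: gball_def)
    then show ?thesis using \<rho> by blast
  qed
  then show ?thesis using that by blast
qed

lemma card_gball_aut_le:
  assumes "\<sigma> \<in> graph_auts V E" "v \<in> V"
  shows "card (gball E v r) \<le> card (gball E (\<sigma> v) r)"
proof (rule card_inj_on_le)
  show "inj_on \<sigma> (gball E v r)"
    using aut_inj[OF assms(1)] gball_subset[OF assms(2)] inj_on_subset by blast
  show "\<sigma> ` gball E v r \<subseteq> gball E (\<sigma> v) r"
    using aut_relpow[OF assms(1)] by (auto simp: gball_def)
  show "finite (gball E (\<sigma> v) r)" using assms aut_in finite_gball by blast
qed

lemma card_gball_bounded: obtains B where "\<And>v. v \<in> V \<Longrightarrow> card (gball E v r) \<le> B" "0 < B"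
proof -
  obtain R where R: "finite R" "R \<subseteq> V" "\<And>v. v \<in> V \<Longrightarrow> \<exists>r\<in>R. \<exists>\<sigma>\<in>graph_auts V E. v = \<sigma> r"
    using orbit_representatives by blast
  define B where "B = Suc (Max ((\<lambda>v. card (gball E v r)) ` R))"
  have "card (gball E v r) \<le> B" if v: "v \<in> V" for v
  proof -
    obtain a \<sigma> where a: "a \<in> R" "\<sigma> \<in> graph_auts V E" "v = \<sigma> a" using R(3)[OF v] by blast
    then have "inv_into V \<sigma> v = a" using aut_inv_eq[OF a(2), of a] R by auto
    then have "card (gball E v r) \<le> card (gball E a r)"
      using card_gball_aut_le[OF aut_inv[OF a(2)] v, of r] by simp
    also have "\<dots> \<le> Max ((\<lambda>v. card (gball E v r)) ` R)" using R a by (intro Max_ge) auto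
    finally show ?thesis by (simp add: B_def)
  qed
  then show ?thesis using that by (auto simp: B_def)
qed

text \<open>The constant has to be independent of the radius. After moving \<open>v\<close> to
  within \<open>D\<close> of \<open>u\<close>, its ball lies in the \<open>D\<close>-neighbourhood
  of the ball around \<open>u\<close>, so balls of the fixed radius \<open>D\<close> cover
  it.\<close>

lemma card_gball_comparable:
  obtains C where "0 < C" "\<And>u v r. u \<in> V \<Longrightarrow> v \<in> V \<Longrightarrow> card (gball E v r) \<le> C * card (gball E u r)"
proof -
  obtain D where D: "\<And>u v. u \<in> V \<Longrightarrow> v \<in> V \<Longrightarrow> \<exists>\<sigma>\<in>graph_auts V E. \<sigma> v \<in> gball E u D"
    using near_translate by blast
  obtain C where C: "\<And>v. v \<in> V \<Longrightarrow> card (gball E v D) \<le> C" "0 < C"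
    using card_gball_bounded by blast
  have "card (gball E v r) \<le> C * card (gball E u r)" if uv: "u \<in> V" "v \<in> V" for u v r
  proof -
    obtain \<sigma> where \<sigma>: "\<sigma> \<in> graph_auts V E" "\<sigma> v \<in> gball E u D" using D[OF uv] by blast
    have "card (gball E v r) \<le> card (gball E (\<sigma> v) r)" by (rule card_gball_aut_le[OF \<sigma>(1) uv(2)])
    also have "\<dots> \<le> card (\<Union>z\<in>gball E u r. gball E z D)"
    proof (intro card_mono subsetI)
      show "finite (\<Union>z\<in>gball E u r. gball E z D)"
        using uv gball_subset finite_gball by blast
      fix y assume "y \<in> gball E (\<sigma> v) r"
      then have "y \<in> gball E u (D + r)" using gball_trans \<sigma>(2) by fast
      then obtain n where n: "n \<le> r + D" "(u, y) \<in> adj_rel E ^^ n" by (auto simp: gball_def add.commute)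
      \<comment> \<open>A walk of length at most \<open>r + D\<close> is cut after at most
        \<open>r\<close> steps.\<close>
      define k where "k = min n r"
      have "n = k + (n - k)" "k \<le> r" "n - k \<le> D" using n by (auto simp: k_def)
      then have "(u, y) \<in> adj_rel E ^^ k O adj_rel E ^^ (n - k)"
        using n(2) relpow_add[of k "n - k" "adj_rel E"] by simp
      then obtain z where "(u, z) \<in> adj_rel E ^^ k" "(z, y) \<in> adj_rel E ^^ (n - k)" by auto
      then show "y \<in> (\<Union>z\<in>gball E u r. gball E z D)"
        using \<open>k \<le> r\<close> \<open>n - k \<le> D\<close> by (auto simp: gball_def)
    qed
    also have "\<dots> \<le> (\<Sum>z\<in>gball E u r. card (gball E z D))"
      using uv by (intro card_UN_le finite_gball)
    also have "\<dots> \<le> (\<Sum>z\<in>gball E u r. C)"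
      using uv gball_subset C by (intro sum_mono) blast
    finally show ?thesis by (simp add: mult.commute)
  qed
  then show ?thesis using that C by blast
qed

lemma card_gball_ge:
  assumes "infinite V" "v \<in> V"
  shows "r < card (gball E v r)"
proof (induction r)
  case 0 show ?case by (simp add: gball_0)
next
  case (Suc r)
  have "gball E v r \<noteq> gball E v (Suc r)"
  proof
    assume eq: "gball E v r = gball E v (Suc r)"
    have "z \<in> gball E v r" if "(v, z) \<in> (adj_rel E)\<^sup>*" for z
      using that
    proof (induction rule: rtrancl_induct)
      case (step y z)
      then have "z \<in> gball E v (Suc r)" by (auto simp: gball_Suc adj_rel_def)
      then show ?case using eq by simp
    qed (rule gball_self)
    then have "V \<subseteq> gball E v r" using reach[OF assms(2)] by blast
    then show False using assms finite_gball finite_subset by blast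
  qed
  then have "gball E v r \<subset> gball E v (Suc r)" using gball_mono[of r "Suc r" E v] by auto
  then have "card (gball E v r) < card (gball E v (Suc r))"
    using finite_gball[OF assms(2)] by (intro psubset_card_mono)
  then show ?case using Suc by simp
qed

lemma countable_V: "countable V"
proof -
  obtain v where v: "v \<in> V" using V_nonempty by blast
  have "V \<subseteq> (\<Union>r. gball E v r)" using in_gball[OF v] by blast
  moreover have "countable (\<Union>r. gball E v r)"
    using finite_gball[OF v] by (auto intro: countable_finite)
  ultimately show ?thesis by (rule countable_subset)
qed

lemma countable_E: "countable E"
proof -
  have "E \<subseteq> {e. finite e \<and> e \<subseteq> V}" using edge_in_V edge_card by (auto intro: card_ge_0_finite)
  then show ?thesis using countable_Collect_finite_subset[OF countable_V] countable_subset by blast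
qed

end

section \<open>The infinite-volume limit\<close>

lemma conn_exp_map_le:
  assumes "finite L" "inj_on ((`) \<sigma>) L" "0 \<le> p" "p \<le> 1" "0 \<le> x" "x \<le> 1"
  shows "conn_exp L p x u v \<le> conn_exp ((`) \<sigma> ` L) p x (\<sigma> u) (\<sigma> v)"
  unfolding conn_exp_def bern_exp_reindex[OF assms(2,1)]
proof (intro bern_exp_mono assms)
  fix w assume "w \<subseteq> L"
  have step: "(\<sigma> u, \<sigma> y) \<in> adj_rel ((`) \<sigma> ` w) ^^ n" if "(u, y) \<in> adj_rel w ^^ n" for y n
    using that
  proof (induction n arbitrary: y)
    case (Suc n)
    then obtain z where z: "(u, z) \<in> adj_rel w ^^ n" "{z, y} \<in> w" by (auto simp: adj_rel_def)
    have "{\<sigma> z, \<sigma> y} \<in> (`) \<sigma> ` w" using z(2) by (intro image_eqI[of _ _ "{z, y}"]) auto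
    then show ?case using Suc.IH[OF z(1)] by (auto simp: adj_rel_def)
  qed simp
  show "conn_wt x w u v \<le> conn_wt x ((`) \<sigma> ` w) (\<sigma> u) (\<sigma> v)"
  proof (cases "(u, v) \<in> (adj_rel w)\<^sup>*")
    case True
    then show ?thesis
      using conn_wt_ge[OF step[OF gdist_relpow[OF True]] assms(5,6)] by (simp add: conn_wt_def)
  next
    case False
    then show ?thesis using assms conn_wt_nonneg by (simp add: conn_wt_def)
  qed
qed

lemma conn_exp_path:
  assumes "finite L" "A \<subseteq> L" "card A \<le> n" "(u, a) \<in> adj_rel A ^^ n" "0 \<le> p" "p \<le> 1" "0 \<le> x" "x \<le> 1"
  shows "(p * x) ^ n * conn_exp L p x a v \<le> conn_exp L p x u v"
proof -
  have finA: "finite A" using assms finite_subset by blast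
  have "x ^ n * conn_wt x w a v \<le> conn_wt x (w \<union> A) u v" for w
  proof -
    have "x ^ n * conn_wt x w a v \<le> conn_wt x (w \<union> A) u a * conn_wt x (w \<union> A) a v"
      using assms by (intro mult_mono conn_wt_ge conn_wt_mono conn_wt_nonneg adj_relpow_mono[of A "w \<union> A"]) auto
    also have "\<dots> \<le> conn_wt x (w \<union> A) u v" using assms by (intro conn_wt_triangle)
    finally show ?thesis .
  qed
  then have 1: "x ^ n * conn_exp L p x a v \<le> bern_exp L p (\<lambda>w. conn_wt x (w \<union> A) u v)"
    unfolding conn_exp_def bern_exp_cmult[symmetric] using assms by (intro bern_exp_mono) auto
  have "0 \<le> x ^ n * conn_exp L p x a v" using assms by (intro mult_nonneg_nonneg conn_exp_nonneg) auto
  then have "p ^ n * (x ^ n * conn_exp L p x a v) \<le> p ^ card A * bern_exp L p (\<lambda>w. conn_wt x (w \<union> A) u v)"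
    using 1 assms by (intro mult_mono power_decreasing) auto
  also have "\<dots> \<le> conn_exp L p x u v"
    unfolding conn_exp_def using assms finA by (intro bern_exp_open_edges conn_wt_nonneg) auto
  finally show ?thesis by (simp add: power_mult_distrib mult_ac)
qed

context qt_graph
begin

text \<open>For \<open>x \<le> 1\<close> the supremum runs over an increasing net and is also its
  limit; it is the expectation of the weight in the infinite graph. Both descriptions are used: the
  supremum for upper bounds, the limit for inequalities between sums.\<close>

definition conn_lim :: "real \<Rightarrow> real \<Rightarrow> 'v \<Rightarrow> 'v \<Rightarrow> real" where
  "conn_lim p x u v = (SUP L\<in>{L. finite L \<and> L \<subseteq> E}. conn_exp L p x u v)"

lemma conn_lim_upper:
  assumes "finite L" "L \<subseteq> E" "0 \<le> p" "p \<le> 1" "0 \<le> x" "x \<le> 1"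
  shows "conn_exp L p x u v \<le> conn_lim p x u v"
  unfolding conn_lim_def
proof (rule cSUP_upper)
  show "bdd_above ((\<lambda>L. conn_exp L p x u v) ` {L. finite L \<and> L \<subseteq> E})"
    using conn_exp_le_1 assms by (intro bdd_aboveI[of _ 1]) auto
qed (use assms in auto)

lemma conn_lim_least:
  assumes "\<And>L. finite L \<Longrightarrow> L \<subseteq> E \<Longrightarrow> conn_exp L p x u v \<le> c"
  shows "conn_lim p x u v \<le> c"
  unfolding conn_lim_def by (rule cSUP_least) (use assms in auto)

lemma conn_lim_tendsto:
  assumes "0 \<le> p" "p \<le> 1" "0 \<le> x" "x \<le> 1"
  shows "((\<lambda>L. conn_exp L p x u v) \<longlongrightarrow> conn_lim p x u v) (finite_subsets_at_top E)"
proof (rule order_tendstoI)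
  fix a assume "a < conn_lim p x u v"
  then obtain L0 where L0: "finite L0" "L0 \<subseteq> E" "a < conn_exp L0 p x u v"
    by (meson conn_lim_least not_le)
  have "a < conn_exp L p x u v" if "finite L" "L0 \<subseteq> L" "L \<subseteq> E" for L
    using L0(3) conn_exp_mono[OF that(1,2), of p p x x u v] assms by simp
  then show "\<forall>\<^sub>F L in finite_subsets_at_top E. a < conn_exp L p x u v"
    unfolding eventually_finite_subsets_at_top using L0 by (intro exI[of _ L0]) auto
next
  fix a assume "conn_lim p x u v < a"
  then have "conn_exp L p x u v < a" if "finite L" "L \<subseteq> E" for L
    using conn_lim_upper[OF that assms, of u v] by linarith
  then show "\<forall>\<^sub>F L in finite_subsets_at_top E. conn_exp L p x u v < a"
    unfolding eventually_finite_subsets_at_top by (intro exI[of _ "{}"]) auto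
qed

lemma lim_upper_bound:
  fixes l :: real
  assumes "(f \<longlongrightarrow> l) (finite_subsets_at_top E)" "\<And>L. finite L \<Longrightarrow> L \<subseteq> E \<Longrightarrow> f L \<le> K"
  shows "l \<le> K"
proof (rule tendsto_upperbound[OF assms(1)])
  show "\<forall>\<^sub>F L in finite_subsets_at_top E. f L \<le> K"
    unfolding eventually_finite_subsets_at_top using assms(2) by (intro exI[of _ "{}"]) auto
qed simp

lemma conn_lim_nonneg:
  assumes "0 \<le> p" "p \<le> 1" "0 \<le> x" "x \<le> 1" shows "0 \<le> conn_lim p x u v"
  using conn_lim_upper[of "{}" p x u v] conn_exp_nonneg[of p x "{}" u v] assms by simp

lemma conn_lim_le_1:
  assumes "0 \<le> p" "p \<le> 1" "0 \<le> x" "x \<le> 1" shows "conn_lim p x u v \<le> 1"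
  using assms by (intro conn_lim_least conn_exp_le_1)

lemma conn_lim_refl:
  assumes "0 \<le> p" "p \<le> 1" "0 \<le> x" "x \<le> 1" shows "conn_lim p x u u = 1"
  using conn_lim_le_1[of p x u u] conn_lim_upper[of "{}" p x u u] assms by simp

lemma conn_lim_commute: "conn_lim p x u v = conn_lim p x v u"
  unfolding conn_lim_def by (subst conn_exp_commute) (rule refl)

lemma conn_lim_mono:
  assumes "0 \<le> p" "p \<le> p'" "p' \<le> 1" "0 \<le> x" "x \<le> y" "y \<le> 1"
  shows "conn_lim p x u v \<le> conn_lim p' y u v"
proof (rule conn_lim_least)
  fix L assume L: "finite L" "L \<subseteq> E"
  have "conn_exp L p x u v \<le> conn_exp L p' y u v" using assms L by (intro conn_exp_mono) auto
  also have "\<dots> \<le> conn_lim p' y u v" using assms L by (intro conn_lim_upper) auto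
  finally show "conn_exp L p x u v \<le> conn_lim p' y u v" .
qed

lemma conn_lim_thin:
  assumes "0 \<le> p" "p \<le> 1" "0 < t" "t \<le> 1" "0 < y" "y \<le> 1"
  shows "conn_lim p (t * y) u v \<le> conn_lim (p * t) y u v"
proof (rule conn_lim_least)
  fix L assume L: "finite L" "L \<subseteq> E"
  have "conn_exp L p (t * y) u v \<le> conn_exp L (p * t) y u v" using assms L by (intro conn_exp_thin)
  also have "\<dots> \<le> conn_lim (p * t) y u v" using assms L by (intro conn_lim_upper) (auto simp: mult_le_one)
  finally show "conn_exp L p (t * y) u v \<le> conn_lim (p * t) y u v" .
qed

lemma conn_lim_path:
  assumes "(u, a) \<in> adj_rel E ^^ n" "0 \<le> p" "p \<le> 1" "0 \<le> x" "x \<le> 1"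
  shows "(p * x) ^ n * conn_lim p x a v \<le> conn_lim p x u v"
proof -
  obtain A where A: "A \<subseteq> E" "finite A" "card A \<le> n" "(u, a) \<in> adj_rel A ^^ n"
    using relpow_path_set[OF assms(1)] by blast
  have "((\<lambda>L. (p * x) ^ n * conn_exp L p x a v) \<longlongrightarrow> (p * x) ^ n * conn_lim p x a v) (finite_subsets_at_top E)"
    by (intro tendsto_intros conn_lim_tendsto assms)
  then show ?thesis
  proof (rule lim_upper_bound)
    fix L assume L: "finite L" "L \<subseteq> E"
    have "(p * x) ^ n * conn_exp L p x a v \<le> (p * x) ^ n * conn_exp (L \<union> A) p x a v"
      using assms L A by (intro mult_left_mono conn_exp_mono) auto
    also have "\<dots> \<le> conn_exp (L \<union> A) p x u v" using assms L A by (intro conn_exp_path[OF _ _ A(3,4)]) auto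
    also have "\<dots> \<le> conn_lim p x u v" using assms L A by (intro conn_lim_upper) auto
    finally show "(p * x) ^ n * conn_exp L p x a v \<le> conn_lim p x u v" .
  qed
qed

lemma conn_lim_power_gdist:
  assumes "u \<in> V" "v \<in> V" "0 \<le> p" "p \<le> 1"
  shows "p ^ gdist E u v \<le> conn_lim p 1 u v"
  using conn_lim_path[OF gdist_relpow[OF reach[OF assms(1,2)]], of p 1 v] assms
  by (simp add: conn_lim_refl)

lemma conn_lim_decay:
  assumes "0 \<le> p" "p \<le> 1" "0 \<le> x" "x \<le> 1"
  shows "conn_lim p x u v \<le> x ^ gdist E u v * conn_lim p 1 u v"
proof (rule conn_lim_least)
  fix L assume L: "finite L" "L \<subseteq> E"
  have "conn_wt x w u v \<le> x ^ gdist E u v * conn_wt 1 w u v" if "w \<subseteq> L" for w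
    using gdist_mono[of w E u v] that L assms by (auto simp: conn_wt_def power_decreasing)
  then have "conn_exp L p x u v \<le> x ^ gdist E u v * conn_exp L p 1 u v"
    unfolding conn_exp_def bern_exp_cmult[symmetric] using assms by (intro bern_exp_mono) auto
  also have "\<dots> \<le> x ^ gdist E u v * conn_lim p 1 u v"
    using assms L by (intro mult_left_mono conn_lim_upper) auto
  finally show "conn_exp L p x u v \<le> x ^ gdist E u v * conn_lim p 1 u v" .
qed

lemma aut_inj_edges: "\<sigma> \<in> graph_auts V E \<Longrightarrow> L \<subseteq> E \<Longrightarrow> inj_on ((`) \<sigma>) L"
  using inj_on_image_Pow[OF aut_inj] edge_in_V by (meson PowI inj_on_subset subset_iff)

lemma conn_lim_aut_le:
  assumes "\<sigma> \<in> graph_auts V E" "0 \<le> p" "p \<le> 1" "0 \<le> x" "x \<le> 1"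
  shows "conn_lim p x u v \<le> conn_lim p x (\<sigma> u) (\<sigma> v)"
proof (rule conn_lim_least)
  fix L assume L: "finite L" "L \<subseteq> E"
  have "conn_exp L p x u v \<le> conn_exp ((`) \<sigma> ` L) p x (\<sigma> u) (\<sigma> v)"
    using assms L by (intro conn_exp_map_le aut_inj_edges)
  also have "\<dots> \<le> conn_lim p x (\<sigma> u) (\<sigma> v)"
    using assms L aut_edge[OF assms(1)] by (intro conn_lim_upper) auto
  finally show "conn_exp L p x u v \<le> conn_lim p x (\<sigma> u) (\<sigma> v)" .
qed

lemma conn_lim_aut:
  assumes "\<sigma> \<in> graph_auts V E" "0 \<le> p" "p \<le> 1" "0 \<le> x" "x \<le> 1" "u \<in> V" "v \<in> V"
  shows "conn_lim p x (\<sigma> u) (\<sigma> v) = conn_lim p x u v"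
  using conn_lim_aut_le[OF assms(1-5), of u v]
    conn_lim_aut_le[OF aut_inv[OF assms(1)] assms(2-5), of "\<sigma> u" "\<sigma> v"]
    aut_inv_eq[OF assms(1)] assms(6,7) by simp

section \<open>Row sums of the weighted two-point matrix\<close>

definition row_bdd :: "real \<Rightarrow> real \<Rightarrow> real \<Rightarrow> bool" where
  "row_bdd p x K \<longleftrightarrow> (\<forall>u\<in>V. \<forall>F. finite F \<and> F \<subseteq> V \<longrightarrow> (\<Sum>v\<in>F. conn_lim p x u v) \<le> K)"

text \<open>Informative only together with some \<open>row_bdd p x K\<close>, as the supremum of an
  unbounded set of reals is unspecified.\<close>

definition row_sup :: "real \<Rightarrow> real \<Rightarrow> real" where
  "row_sup p x = Sup {(\<Sum>v\<in>F. conn_lim p x u v) | u F. u \<in> V \<and> finite F \<and> F \<subseteq> V}"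

lemma row_bddD: "row_bdd p x K \<Longrightarrow> u \<in> V \<Longrightarrow> finite F \<Longrightarrow> F \<subseteq> V \<Longrightarrow> (\<Sum>v\<in>F. conn_lim p x u v) \<le> K"
  by (simp add: row_bdd_def)

lemma row_bdd_mono:
  assumes "row_bdd p' y K" "0 \<le> p" "p \<le> p'" "p' \<le> 1" "0 \<le> x" "x \<le> y" "y \<le> 1" "K \<le> K'"
  shows "row_bdd p x K'"
  unfolding row_bdd_def
proof (intro ballI allI impI)
  fix u F assume "u \<in> V" "finite F \<and> F \<subseteq> V"
  then have "(\<Sum>v\<in>F. conn_lim p' y u v) \<le> K" using assms(1) by (simp add: row_bdd_def)
  moreover have "(\<Sum>v\<in>F. conn_lim p x u v) \<le> (\<Sum>v\<in>F. conn_lim p' y u v)"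
    using assms by (intro sum_mono conn_lim_mono) auto
  ultimately show "(\<Sum>v\<in>F. conn_lim p x u v) \<le> K'" using assms by linarith
qed

lemma row_bdd_thin:
  assumes "row_bdd (p * t) y K" "0 \<le> p" "p \<le> 1" "0 < t" "t \<le> 1" "0 < y" "y \<le> 1"
  shows "row_bdd p (t * y) K"
  unfolding row_bdd_def
proof (intro ballI allI impI)
  fix u F assume "u \<in> V" "finite F \<and> F \<subseteq> V"
  then have "(\<Sum>v\<in>F. conn_lim (p * t) y u v) \<le> K" using assms(1) by (simp add: row_bdd_def)
  moreover have "(\<Sum>v\<in>F. conn_lim p (t * y) u v) \<le> (\<Sum>v\<in>F. conn_lim (p * t) y u v)"
    using assms by (intro sum_mono conn_lim_thin) auto
  ultimately show "(\<Sum>v\<in>F. conn_lim p (t * y) u v) \<le> K" by linarith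
qed

lemma row_sup_upper:
  assumes "row_bdd p x K" "u \<in> V" "finite F" "F \<subseteq> V"
  shows "(\<Sum>v\<in>F. conn_lim p x u v) \<le> row_sup p x"
  unfolding row_sup_def
proof (rule cSup_upper)
  show "bdd_above {(\<Sum>v\<in>F. conn_lim p x u v) | u F. u \<in> V \<and> finite F \<and> F \<subseteq> V}"
    using assms(1) by (intro bdd_aboveI[of _ K]) (auto simp: row_bdd_def)
qed (use assms in auto)

lemma row_bdd_row_sup: "row_bdd p x K \<Longrightarrow> row_bdd p x (row_sup p x)"
  using row_sup_upper[of p x K] unfolding row_bdd_def by blast

lemma row_sup_le: "row_bdd p x K \<Longrightarrow> row_sup p x \<le> K"
  unfolding row_sup_def using V_nonempty by (intro cSup_least) (auto simp: row_bdd_def)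

lemma row_sup_witness:
  assumes "c < row_sup p x"
  obtains u F where "u \<in> V" "finite F" "F \<subseteq> V" "c < (\<Sum>v\<in>F. conn_lim p x u v)"
proof -
  have "\<not> row_bdd p x c" using assms row_sup_le by fastforce
  then show ?thesis using that by (auto simp: row_bdd_def not_le)
qed

lemma row_sup_ge_1:
  assumes "row_bdd p x K" "0 \<le> p" "p \<le> 1" "0 \<le> x" "x \<le> 1"
  shows "1 \<le> row_sup p x"
proof -
  obtain v where v: "v \<in> V" using V_nonempty by blast
  show ?thesis using row_sup_upper[OF assms(1) v, of "{v}"] v assms by (simp add: conn_lim_refl)
qed

text \<open>The resolvent inequality bounds a row sum at \<open>y\<close> by \<open>K\<close> plus
  \<open>(1 - x / y) * K\<close> times the largest such row sum. In finite volume that largest row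
  sum \<open>m\<close> is a finite number, so the inequality can be solved for it; the bound does
  not involve the volume.\<close>

lemma row_bdd_neumann:
  assumes "row_bdd p x K" "0 \<le> p" "p \<le> 1" "0 < x" "x \<le> y" "y \<le> 1" "(1 - x / y) * K < 1"
  shows "row_bdd p y (K / (1 - (1 - x / y) * K))"
  unfolding row_bdd_def
proof (intro ballI allI impI)
  fix u G assume uG: "u \<in> V" "finite G \<and> G \<subseteq> V"
  let ?c = "1 - x / y"
  have c: "0 \<le> ?c" using assms by simp
  have "((\<lambda>L. \<Sum>v\<in>G. conn_exp L p y u v) \<longlongrightarrow> (\<Sum>v\<in>G. conn_lim p y u v)) (finite_subsets_at_top E)"
    using assms by (intro tendsto_sum conn_lim_tendsto) auto
  then show "(\<Sum>v\<in>G. conn_lim p y u v) \<le> K / (1 - ?c * K)"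
  proof (rule lim_upper_bound)
    fix L assume L: "finite L" "L \<subseteq> E"
    define F where "F = insert u (G \<union> \<Union>L)"
    have F: "finite F" "F \<subseteq> V" "\<Union>L \<subseteq> F" "u \<in> F" "G \<subseteq> F"
      using uG L finite_Union_edges Union_edges by (auto simp: F_def)
    define S where "S = (\<lambda>a. \<Sum>v\<in>F. conn_exp L p y a v)"
    define m where "m = Max (S ` F)"
    have m: "S a \<le> m" if "a \<in> F" for a unfolding m_def using F that by (intro Max_ge) auto
    have lim: "conn_exp L p x a b \<le> conn_lim p x a b" for a b using assms L by (intro conn_lim_upper) auto
    have m0: "0 \<le> S a" for a unfolding S_def using assms by (intro sum_nonneg conn_exp_nonneg) auto
    have "S a \<le> K + ?c * (K * m)" if a: "a \<in> F" for a
    proof -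
      have Ka: "(\<Sum>b\<in>F. conn_exp L p x a b) \<le> K"
      proof (rule order_trans[OF sum_mono[OF lim]])
        show "(\<Sum>b\<in>F. conn_lim p x a b) \<le> K" using row_bddD[OF assms(1), of a F] F a by auto
      qed
      have "S a \<le> (\<Sum>v\<in>F. conn_exp L p x a v + ?c * (\<Sum>b\<in>F. conn_exp L p x a b * conn_exp L p y b v))"
        unfolding S_def using assms L F by (intro sum_mono conn_exp_resolvent) auto
      also have "\<dots> = (\<Sum>v\<in>F. conn_exp L p x a v) + ?c * (\<Sum>b\<in>F. conn_exp L p x a b * S b)"
        unfolding S_def sum.distrib sum_distrib_left[symmetric] by (subst sum.swap) (simp add: sum_distrib_left)
      also have "\<dots> \<le> K + ?c * (\<Sum>b\<in>F. conn_exp L p x a b * m)"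
        using Ka c assms m by (intro add_mono mult_left_mono sum_mono conn_exp_nonneg) auto
      also have "\<dots> \<le> K + ?c * (K * m)"
        unfolding sum_distrib_right[symmetric] using Ka c m[OF a] m0[of a]
        by (intro add_left_mono mult_left_mono mult_right_mono) auto
      finally show ?thesis .
    qed
    then have "m \<le> K + ?c * (K * m)" unfolding m_def using F by (subst Max_le_iff) auto
    then have "m * (1 - ?c * K) \<le> K" by (simp add: algebra_simps)
    then have "m \<le> K / (1 - ?c * K)" using assms(7) by (simp add: pos_le_divide_eq)
    moreover have "(\<Sum>v\<in>G. conn_exp L p y u v) \<le> S u"
      unfolding S_def using F assms by (intro sum_mono2 conn_exp_nonneg) auto
    ultimately show "(\<Sum>v\<in>G. conn_exp L p y u v) \<le> K / (1 - ?c * K)" using m[OF F(4)] by linarith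
  qed
qed

text \<open>The substitute for transitivity: an automorphism moves the row at \<open>u'\<close> to a
  vertex within \<open>D\<close> of \<open>u\<close>, and a path to this vertex costs at most
  \<open>D\<close> factors \<open>p * x\<close>.\<close>

lemma row_transfer:
  obtains D where "\<And>p x u u' F'. 0 \<le> p \<Longrightarrow> p \<le> 1 \<Longrightarrow> 0 \<le> x \<Longrightarrow> x \<le> 1 \<Longrightarrow> u \<in> V \<Longrightarrow> u' \<in> V \<Longrightarrow>
    finite F' \<Longrightarrow> F' \<subseteq> V \<Longrightarrow> \<exists>F. finite F \<and> F \<subseteq> V \<and>
      (p * x) ^ D * (\<Sum>v\<in>F'. conn_lim p x u' v) \<le> (\<Sum>v\<in>F. conn_lim p x u v)"
proof -
  obtain D where D: "\<And>u v. u \<in> V \<Longrightarrow> v \<in> V \<Longrightarrow> \<exists>\<sigma>\<in>graph_auts V E. \<sigma> v \<in> gball E u D"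
    using near_translate by blast
  have "\<exists>F. finite F \<and> F \<subseteq> V \<and> (p * x) ^ D * (\<Sum>v\<in>F'. conn_lim p x u' v) \<le> (\<Sum>v\<in>F. conn_lim p x u v)"
    if px: "0 \<le> p" "p \<le> 1" "0 \<le> x" "x \<le> 1" and u: "u \<in> V" "u' \<in> V" and F': "finite F'" "F' \<subseteq> V"
    for p x :: real and u u' F'
  proof -
    obtain \<sigma> where \<sigma>: "\<sigma> \<in> graph_auts V E" "\<sigma> u' \<in> gball E u D" using D[OF u] by blast
    then obtain n where n: "n \<le> D" "(u, \<sigma> u') \<in> adj_rel E ^^ n" by (auto simp: gball_def)
    have inj: "inj_on \<sigma> F'" using aut_inj[OF \<sigma>(1)] F'(2) inj_on_subset by blast
    have nonneg: "0 \<le> (\<Sum>v\<in>F'. conn_lim p x u' v)" using px by (intro sum_nonneg conn_lim_nonneg)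
    have px1: "0 \<le> p * x" "p * x \<le> 1" using px by (auto simp: mult_le_one)
    have "(p * x) ^ D * (\<Sum>v\<in>F'. conn_lim p x u' v) \<le> (p * x) ^ n * (\<Sum>v\<in>F'. conn_lim p x u' v)"
      using px1 nonneg n by (intro mult_right_mono power_decreasing)
    also have "\<dots> = (\<Sum>v\<in>F'. (p * x) ^ n * conn_lim p x (\<sigma> u') (\<sigma> v))"
      unfolding sum_distrib_left using conn_lim_aut[OF \<sigma>(1) px u(2)] F' by (intro sum.cong) auto
    also have "\<dots> \<le> (\<Sum>v\<in>F'. conn_lim p x u (\<sigma> v))"
      using px n by (intro sum_mono conn_lim_path) auto
    also have "\<dots> = (\<Sum>v\<in>\<sigma> ` F'. conn_lim p x u v)" by (simp add: sum.reindex[OF inj])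
    finally show ?thesis using F' aut_in[OF \<sigma>(1)] by (intro exI[of _ "\<sigma> ` F'"]) auto
  qed
  then show ?thesis using that by blast
qed

end

section \<open>Growth of the susceptibility\<close>

context qt_graph
begin

section \<open>Boundedness on L2 and smallness of the error diagram\<close>

definition l2_bdd :: "real \<Rightarrow> real \<Rightarrow> bool" where
  "l2_bdd p N \<longleftrightarrow> 0 \<le> N \<and> (\<forall>F f. finite F \<and> F \<subseteq> V \<and> (\<forall>v. 0 \<le> f v) \<longrightarrow>
     (\<Sum>u\<in>F. (\<Sum>v\<in>F. conn_lim p 1 u v * f v)\<^sup>2) \<le> N\<^sup>2 * (\<Sum>v\<in>F. (f v)\<^sup>2))"

lemma l2_bddD:
  assumes "l2_bdd p N" "finite F" "F \<subseteq> V" "\<And>v. 0 \<le> f v"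
  shows "(\<Sum>u\<in>F. (\<Sum>v\<in>F. conn_lim p 1 u v * f v)\<^sup>2) \<le> N\<^sup>2 * (\<Sum>v\<in>F. (f v)\<^sup>2)"
  using assms unfolding l2_bdd_def by blast

lemma l2_bdd_column:
  assumes "l2_bdd p N" "w \<in> V" "finite F" "F \<subseteq> V"
  shows "(\<Sum>v\<in>F. (conn_lim p 1 v w)\<^sup>2) \<le> N\<^sup>2"
proof -
  let ?f = "\<lambda>v. if v = w then 1 else 0 :: real"
  let ?F = "insert w F"
  have "(\<Sum>v\<in>F. (conn_lim p 1 v w)\<^sup>2) \<le> (\<Sum>v\<in>?F. (conn_lim p 1 v w)\<^sup>2)"
    using assms by (intro sum_mono2) auto
  also have "\<dots> = (\<Sum>u\<in>?F. (\<Sum>v\<in>?F. conn_lim p 1 u v * ?f v)\<^sup>2)"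
  proof (rule sum.cong[OF refl])
    fix u
    have "(\<Sum>v\<in>?F. conn_lim p 1 u v * ?f v) = (\<Sum>v\<in>?F. if w = v then conn_lim p 1 u v else 0)"
      by (intro sum.cong) auto
    also have "\<dots> = conn_lim p 1 u w" using assms(3) by (subst sum.delta') auto
    finally show "(conn_lim p 1 u w)\<^sup>2 = (\<Sum>v\<in>?F. conn_lim p 1 u v * ?f v)\<^sup>2" by simp
  qed
  also have "\<dots> \<le> N\<^sup>2 * (\<Sum>v\<in>?F. (?f v)\<^sup>2)"
    using assms by (intro l2_bddD) auto
  also have "(\<Sum>v\<in>?F. (?f v)\<^sup>2) = (\<Sum>v\<in>?F. if w = v then 1 else 0)" by (intro sum.cong) auto
  also have "\<dots> = 1" using assms(3) by (subst sum.delta') auto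
  finally show ?thesis by simp
qed

lemma l2_bdd_tail_at:
  assumes "l2_bdd p N" "t \<in> V" "0 < \<epsilon>"
  shows "\<exists>s. \<forall>F. finite F \<and> F \<subseteq> V \<longrightarrow> (\<Sum>v\<in>F - gball E t s. (conn_lim p 1 v t)\<^sup>2) \<le> \<epsilon>"
proof -
  let ?h = "\<lambda>F. \<Sum>v\<in>F. (conn_lim p 1 v t)\<^sup>2"
  let ?A = "{F. finite F \<and> F \<subseteq> V}"
  have bdd: "bdd_above (?h ` ?A)"
    using l2_bdd_column[OF assms(1,2)] by (intro bdd_aboveI[of _ "N\<^sup>2"]) auto
  have "(SUP F\<in>?A. ?h F) - \<epsilon> < (SUP F\<in>?A. ?h F)" using assms by simp
  moreover have "?A \<noteq> {}" by auto
  ultimately obtain F0 where F0: "finite F0" "F0 \<subseteq> V" "(SUP F\<in>?A. ?h F) - \<epsilon> < ?h F0"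
    using less_cSUP_iff[OF _ bdd, of "(SUP F\<in>?A. ?h F) - \<epsilon>"] by auto
  define s where "s = Max (insert 0 (gdist E t ` F0))"
  have sub: "F0 \<subseteq> gball E t s"
  proof
    fix v assume v: "v \<in> F0"
    then have "gdist E t v \<le> s" unfolding s_def using F0 by (intro Max_ge) auto
    then show "v \<in> gball E t s"
      using in_gball[OF assms(2), of v] v F0 gball_mono[of "gdist E t v" s E t] by auto
  qed
  have "?h (F - gball E t s) \<le> \<epsilon>" if F: "finite F" "F \<subseteq> V" for F
  proof -
    have "?h F0 + ?h (F - gball E t s) = ?h (F0 \<union> (F - gball E t s))"
      using F0 F sub by (intro sum.union_disjoint[symmetric]) auto
    also have "\<dots> \<le> (SUP F\<in>?A. ?h F)" using F0 F bdd by (intro cSUP_upper) auto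
    finally show ?thesis using F0 by linarith
  qed
  then show ?thesis by blast
qed

text \<open>The radius must serve all \<open>t\<close> at once. A column at \<open>t\<close> is an
  automorphic image of one at a representative, and there are finitely many of those.\<close>

lemma l2_bdd_tail:
  assumes "l2_bdd p N" "0 < \<epsilon>" "0 \<le> p" "p \<le> 1"
  obtains s where "\<And>t F. t \<in> V \<Longrightarrow> finite F \<Longrightarrow> F \<subseteq> V \<Longrightarrow> (\<Sum>v\<in>F - gball E t s. (conn_lim p 1 v t)\<^sup>2) \<le> \<epsilon>"
proof -
  obtain R where R: "finite R" "R \<subseteq> V" "\<And>v. v \<in> V \<Longrightarrow> \<exists>r\<in>R. \<exists>\<sigma>\<in>graph_auts V E. v = \<sigma> r"
    using orbit_representatives by blast
  have "\<exists>S. \<forall>t\<in>V. \<forall>F. finite F \<and> F \<subseteq> V \<longrightarrow> (\<Sum>v\<in>F - gball E t (S t). (conn_lim p 1 v t)\<^sup>2) \<le> \<epsilon>"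
    using l2_bdd_tail_at[OF assms(1) _ assms(2)] by (intro bchoice) blast
  then obtain S where S: "\<And>t F. t \<in> V \<Longrightarrow> finite F \<Longrightarrow> F \<subseteq> V \<Longrightarrow>
      (\<Sum>v\<in>F - gball E t (S t). (conn_lim p 1 v t)\<^sup>2) \<le> \<epsilon>" by blast
  define s where "s = Max (S ` R)"
  have "(\<Sum>v\<in>F - gball E t s. (conn_lim p 1 v t)\<^sup>2) \<le> \<epsilon>" if t: "t \<in> V" and F: "finite F" "F \<subseteq> V" for t F
  proof -
    obtain a \<sigma> where a: "a \<in> R" "\<sigma> \<in> graph_auts V E" "t = \<sigma> a" using R(3)[OF t] by blast
    have aV: "a \<in> V" using a R by auto
    have Ss: "S a \<le> s" unfolding s_def using R a by (intro Max_ge) auto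
    let ?\<tau> = "inv_into V \<sigma>"
    have \<tau>: "?\<tau> \<in> graph_auts V E" "?\<tau> t = a" using aut_inv[OF a(2)] aut_inv_eq[OF a(2) aV] a by auto
    have inj: "inj_on ?\<tau> (F - gball E t s)" by (rule inj_on_subset[OF aut_inj[OF \<tau>(1)]]) (use F in auto)
    have sub: "?\<tau> ` (F - gball E t s) \<subseteq> ?\<tau> ` F - gball E a (S a)"
    proof (rule image_subsetI)
      fix v assume "v \<in> F - gball E t s"
      then have v: "v \<in> F" "v \<notin> gball E t s" by auto
      have "?\<tau> v \<notin> gball E a (S a)"
      proof
        assume "?\<tau> v \<in> gball E a (S a)"
        then have "\<sigma> (?\<tau> v) \<in> gball E (\<sigma> a) (S a)"
          using aut_relpow[OF a(2)] by (auto simp: gball_def)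
        moreover have "\<sigma> (?\<tau> v) = v"
          using v F aut_image[OF a(2)] f_inv_into_f[of v \<sigma> V] by auto
        ultimately show False using v a gball_mono[OF Ss, of E t] by auto
      qed
      then show "?\<tau> v \<in> ?\<tau> ` F - gball E a (S a)" using v by simp
    qed
    have "(\<Sum>v\<in>F - gball E t s. (conn_lim p 1 v t)\<^sup>2) = (\<Sum>v\<in>F - gball E t s. (conn_lim p 1 (?\<tau> v) (?\<tau> t))\<^sup>2)"
      using conn_lim_aut[OF \<tau>(1) assms(3,4)] t F by (intro sum.cong) auto
    also have "\<dots> = (\<Sum>v\<in>?\<tau> ` (F - gball E t s). (conn_lim p 1 v a)\<^sup>2)"
      by (simp add: sum.reindex[OF inj] \<tau>(2))
    also have "\<dots> \<le> (\<Sum>v\<in>?\<tau> ` F - gball E a (S a). (conn_lim p 1 v a)\<^sup>2)"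
      using sub F by (intro sum_mono2) auto
    also have "\<dots> \<le> \<epsilon>" using aV F aut_in[OF \<tau>(1)] by (intro S) auto
    finally show ?thesis .
  qed
  then show ?thesis using that by blast
qed

lemma sum_square_le_card:
  fixes g :: "'b \<Rightarrow> real"
  assumes "finite B"
  shows "(\<Sum>b\<in>B. g b)\<^sup>2 \<le> card B * (\<Sum>b\<in>B. (g b)\<^sup>2)"
  using Cauchy_Schwarz_ineq_sum[of "\<lambda>_. 1" g B] by simp

text \<open>
  The diagram is the pairing of a column of \<open>T\<close> with the average of \<open>T\<^sup>2\<close> over balls of radius \<open>r\<close>.
  Far from \<open>t\<close> the column is small in \<open>L\<^sup>2\<close>; near \<open>t\<close> the average is at most the \<open>L\<^sup>2\<close> norm divided
  by the square root of the volume of the ball.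
\<close>

lemma diagram_small:
  fixes \<eta> :: real
  assumes "infinite V" "o' \<in> V" "l2_bdd p N" "0 \<le> p" "p \<le> 1" "0 < \<eta>"
  obtains r where "\<And>t F. t \<in> V \<Longrightarrow> finite F \<Longrightarrow> F \<subseteq> V \<Longrightarrow>
    (\<Sum>a\<in>F. \<Sum>b\<in>F \<inter> gball E a r. \<Sum>z\<in>F. conn_lim p 1 t a * (conn_lim p 1 b z * conn_lim p 1 z t))
      \<le> \<eta> * card (gball E o' r)"
proof -
  let ?T = "conn_lim p 1"
  have T0: "0 \<le> ?T u v" and T1: "?T u v \<le> 1" for u v
    using assms conn_lim_nonneg conn_lim_le_1 by auto
  have N0: "0 \<le> N" using assms(3) by (simp add: l2_bdd_def)
  obtain C :: nat where C: "0 < C" "\<And>u v r. u \<in> V \<Longrightarrow> v \<in> V \<Longrightarrow> card (gball E v r) \<le> C * card (gball E u r)"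
    using card_gball_comparable by metis
  \<comment> \<open>Summation over balls has norm at most \<open>C * b0\<close> on L2, and the
    vector \<open>g\<close> below has norm at most \<open>N^2 + 1\<close>; so \<open>c * b0\<close>
    bounds the norm of \<open>h\<close>.\<close>
  define c where "c = real C * (N\<^sup>2 + 1)"
  have c0: "0 < c" using C by (simp add: c_def add_nonneg_pos)
  \<comment> \<open>The square root of \<open>\<epsilon>\<close> times \<open>c * b0\<close> is
    \<open>\<eta> / 2 * b0\<close>, the share of the vertices far from \<open>t\<close>.\<close>
  define \<epsilon> where "\<epsilon> = (\<eta> / (2 * c))\<^sup>2"
  have \<epsilon>0: "0 < \<epsilon>" using assms c0 by (simp add: \<epsilon>_def)
  obtain s where s: "\<And>t F. t \<in> V \<Longrightarrow> finite F \<Longrightarrow> F \<subseteq> V \<Longrightarrow> (\<Sum>v\<in>F - gball E t s. (?T v t)\<^sup>2) \<le> \<epsilon>"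
    using l2_bdd_tail[OF assms(3) \<epsilon>0 assms(4,5)] by blast
  obtain B where B: "\<And>v. v \<in> V \<Longrightarrow> card (gball E v s) \<le> B" "0 < B"
    using card_gball_bounded by blast
  \<comment> \<open>Since \<open>b0\<close> exceeds \<open>r\<close>, the contribution
    \<open>B * c * sqrt b0\<close> of the at most \<open>B\<close> vertices near \<open>t\<close> is
    at most \<open>\<eta> / 2 * b0\<close>.\<close>
  obtain r :: nat where r: "(2 * B * c / \<eta>)\<^sup>2 < r" using reals_Archimedean2 by blast
  define b0 where "b0 = real (card (gball E o' r))"
  have b0: "real r < b0" using card_gball_ge[OF assms(1,2)] by (simp add: b0_def)
  have b0pos: "0 < b0" using b0 by linarith
  have cardle: "card (gball E a r) \<le> C * b0" if "a \<in> V" for a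
    using C(2)[OF assms(2) that, of r] unfolding b0_def by (metis of_nat_le_iff of_nat_mult)
  have "(\<Sum>a\<in>F. \<Sum>b\<in>F \<inter> gball E a r. \<Sum>z\<in>F. ?T t a * (?T b z * ?T z t)) \<le> \<eta> * b0"
    if t: "t \<in> V" and F: "finite F" "F \<subseteq> V" for t F
  proof -
    define g where "g = (\<lambda>b. \<Sum>z\<in>F. ?T b z * ?T z t)"
    define h where "h = (\<lambda>a. \<Sum>b\<in>F \<inter> gball E a r. g b)"
    have g0: "0 \<le> g b" for b unfolding g_def using T0 by (intro sum_nonneg mult_nonneg_nonneg)
    have h0: "0 \<le> h a" for a unfolding h_def using g0 by (intro sum_nonneg)
    have eq: "(\<Sum>a\<in>F. \<Sum>b\<in>F \<inter> gball E a r. \<Sum>z\<in>F. ?T t a * (?T b z * ?T z t)) = (\<Sum>a\<in>F. ?T a t * h a)"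
      by (simp add: h_def g_def sum_distrib_left conn_lim_commute[of p 1 t])
    have "(\<Sum>b\<in>F. (g b)\<^sup>2) \<le> N\<^sup>2 * (\<Sum>z\<in>F. (?T z t)\<^sup>2)"
      unfolding g_def using assms F T0 by (intro l2_bddD)
    also have "\<dots> \<le> N\<^sup>2 * N\<^sup>2"
      using l2_bdd_column[OF assms(3) t F] by (intro mult_left_mono) auto
    also have "\<dots> \<le> (N\<^sup>2 + 1)\<^sup>2" by (simp add: power2_eq_square algebra_simps)
    finally have g2: "(\<Sum>b\<in>F. (g b)\<^sup>2) \<le> (N\<^sup>2 + 1)\<^sup>2" .
    have hsq: "(h a)\<^sup>2 \<le> C * b0 * (\<Sum>b\<in>F \<inter> gball E a r. (g b)\<^sup>2)" if a: "a \<in> F" for a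
    proof -
      have "(h a)\<^sup>2 \<le> card (F \<inter> gball E a r) * (\<Sum>b\<in>F \<inter> gball E a r. (g b)\<^sup>2)"
        unfolding h_def using F by (intro sum_square_le_card) auto
      also have "\<dots> \<le> (C * b0) * (\<Sum>b\<in>F \<inter> gball E a r. (g b)\<^sup>2)"
      proof (intro mult_right_mono sum_nonneg)
        have "card (F \<inter> gball E a r) \<le> card (gball E a r)"
          using a F by (intro card_mono finite_gball) auto
        then show "card (F \<inter> gball E a r) \<le> C * b0" using cardle[of a] a F by fastforce
      qed auto
      finally show ?thesis .
    qed
    have h_near: "h a \<le> c * sqrt b0" if a: "a \<in> F" for a
    proof -
      have "(h a)\<^sup>2 \<le> C * b0 * (\<Sum>b\<in>F \<inter> gball E a r. (g b)\<^sup>2)" by (rule hsq[OF a])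
      also have "\<dots> \<le> C * b0 * (N\<^sup>2 + 1)\<^sup>2"
        using b0pos F by (intro mult_left_mono order_trans[OF sum_mono2 g2]) auto
      also have "\<dots> \<le> (C * C) * b0 * (N\<^sup>2 + 1)\<^sup>2"
        using C b0pos by (intro mult_right_mono) auto
      also have "\<dots> = (c * sqrt b0)\<^sup>2" using b0pos by (simp add: c_def power_mult_distrib power2_eq_square)
      finally show ?thesis using c0 b0pos by (simp add: power2_le_iff_abs_le abs_le_iff)
    qed
    \<comment> \<open>Cauchy-Schwarz inside each ball, then an exchange of \<open>a\<close> and
      \<open>b\<close>: by symmetry of the ball relation each \<open>b\<close> is counted once for
      every \<open>a\<close> in its own ball.\<close>
    have h2: "(\<Sum>a\<in>F. (h a)\<^sup>2) \<le> (c * b0)\<^sup>2"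
    proof -
      let ?S = "\<Sum>a\<in>F. \<Sum>b\<in>F \<inter> gball E a r. (g b)\<^sup>2"
      have "?S = (\<Sum>a\<in>F. \<Sum>b\<in>F. if b \<in> gball E a r then (g b)\<^sup>2 else 0)"
        using F by (simp add: sum.inter_restrict)
      also have "\<dots> = (\<Sum>b\<in>F. \<Sum>a\<in>F. if b \<in> gball E a r then (g b)\<^sup>2 else 0)" by (rule sum.swap)
      also have "\<dots> = (\<Sum>b\<in>F. card {a \<in> F. b \<in> gball E a r} * (g b)\<^sup>2)"
        using F by (simp add: sum.inter_filter[symmetric])
      also have "\<dots> \<le> (\<Sum>b\<in>F. (C * b0) * (g b)\<^sup>2)"
      proof (intro sum_mono mult_right_mono)
        fix b assume b: "b \<in> F"
        have "card {a \<in> F. b \<in> gball E a r} \<le> card (gball E b r)"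
          using b F by (intro card_mono finite_gball) (auto intro: gball_sym)
        then show "card {a \<in> F. b \<in> gball E a r} \<le> C * b0" using cardle[of b] b F by fastforce
      qed auto
      also have "\<dots> = C * b0 * (\<Sum>b\<in>F. (g b)\<^sup>2)" by (simp add: sum_distrib_left)
      also have "\<dots> \<le> C * b0 * (N\<^sup>2 + 1)\<^sup>2" using g2 b0pos by (intro mult_left_mono) auto
      finally have S: "?S \<le> C * b0 * (N\<^sup>2 + 1)\<^sup>2" .
      have "(\<Sum>a\<in>F. (h a)\<^sup>2) \<le> C * b0 * ?S"
        unfolding sum_distrib_left[of "C * b0"] using hsq by (intro sum_mono) (simp add: sum_distrib_left)
      also have "\<dots> \<le> C * b0 * (C * b0 * (N\<^sup>2 + 1)\<^sup>2)"
        using S b0pos by (intro mult_left_mono) auto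
      also have "\<dots> = (c * b0)\<^sup>2" by (simp add: c_def power2_eq_square)
      finally show ?thesis .
    qed
    let ?G = "gball E t s"
    have "(\<Sum>a\<in>F \<inter> ?G. ?T a t * h a) \<le> (\<Sum>a\<in>F \<inter> ?G. 1 * (c * sqrt b0))"
      using T0 T1 h0 h_near by (intro sum_mono mult_mono) auto
    also have "\<dots> = card (F \<inter> ?G) * (c * sqrt b0)" by simp
    also have "\<dots> \<le> B * (c * sqrt b0)"
    proof (intro mult_right_mono)
      have "card (F \<inter> ?G) \<le> card ?G" using t by (intro card_mono finite_gball) auto
      then show "real (card (F \<inter> ?G)) \<le> real B" using B(1)[OF t] by simp
    qed (use c0 b0pos in auto)
    also have "\<dots> \<le> (\<eta> / 2) * b0"
    proof -
      have "2 * B * c / \<eta> \<le> sqrt b0"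
        using r b0 by (intro real_le_rsqrt) linarith
      then have "B * c \<le> \<eta> / 2 * sqrt b0" using assms by (simp add: field_simps)
      then have "B * c * sqrt b0 \<le> \<eta> / 2 * sqrt b0 * sqrt b0" using b0pos by (intro mult_right_mono) auto
      then show ?thesis using b0pos by (simp add: mult.assoc)
    qed
    finally have near: "(\<Sum>a\<in>F \<inter> ?G. ?T a t * h a) \<le> \<eta> / 2 * b0" .
    have "(\<Sum>a\<in>F - ?G. ?T a t * h a)\<^sup>2 \<le> (\<Sum>a\<in>F - ?G. (?T a t)\<^sup>2) * (\<Sum>a\<in>F - ?G. (h a)\<^sup>2)"
      by (rule Cauchy_Schwarz_ineq_sum)
    also have "\<dots> \<le> \<epsilon> * (c * b0)\<^sup>2"
    proof (intro mult_mono s t F)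
      have "(\<Sum>a\<in>F - ?G. (h a)\<^sup>2) \<le> (\<Sum>a\<in>F. (h a)\<^sup>2)" using F by (intro sum_mono2) auto
      then show "(\<Sum>a\<in>F - ?G. (h a)\<^sup>2) \<le> (c * b0)\<^sup>2" using h2 by linarith
    qed (use \<epsilon>0 in \<open>auto intro: sum_nonneg\<close>)
    also have "\<dots> = (\<eta> / 2 * b0)\<^sup>2" using c0 by (simp add: \<epsilon>_def power2_eq_square)
    finally have far: "(\<Sum>a\<in>F - ?G. ?T a t * h a) \<le> \<eta> / 2 * b0"
      using assms b0pos by (simp add: power2_le_iff_abs_le abs_le_iff)
    have "(\<Sum>a\<in>F. ?T a t * h a) = (\<Sum>a\<in>F \<inter> ?G. ?T a t * h a) + (\<Sum>a\<in>F - ?G. ?T a t * h a)"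
      using F(1) by (rule sum.Int_Diff)
    then show ?thesis using near far eq by simp
  qed
  then show ?thesis unfolding b0_def by (rule that)
qed

text \<open>One path is fixed for each pair, independently of \<open>F\<close>. If it uses
  \<open>e\<close>, its starting point is within \<open>r\<close> of an end of \<open>e\<close>,
  which leaves at most \<open>2 * B * B\<close> pairs.\<close>

lemma path_family:
  obtains A :: "'v \<times> 'v \<Rightarrow> 'v set set" and M :: nat where "0 < M"
    "\<And>a b. b \<in> gball E a r \<Longrightarrow> A (a, b) \<subseteq> E \<and> finite (A (a, b)) \<and> card (A (a, b)) \<le> r \<and> (\<exists>m\<le>r. (a, b) \<in> adj_rel (A (a, b)) ^^ m)"
    "\<And>e F. e \<in> E \<Longrightarrow> finite F \<Longrightarrow> F \<subseteq> V \<Longrightarrow> card {q \<in> Sigma F (\<lambda>a. F \<inter> gball E a r). e \<in> A q} \<le> M"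
proof -
  have ex: "\<exists>A. A \<subseteq> E \<and> finite A \<and> card A \<le> r \<and> (\<exists>m\<le>r. (a, b) \<in> adj_rel A ^^ m) \<and>
      (\<forall>e\<in>A. \<exists>y\<in>e. y \<in> gball E a r)" if "b \<in> gball E a r" for a b
  proof -
    obtain n where n: "n \<le> r" "(a, b) \<in> adj_rel E ^^ n" using \<open>b \<in> gball E a r\<close> by (auto simp: gball_def)
    obtain A where A: "A \<subseteq> E" "finite A" "card A \<le> n" "(a, b) \<in> adj_rel A ^^ n"
      "\<forall>e\<in>A. \<exists>y\<in>e. \<exists>m\<le>n. (a, y) \<in> adj_rel E ^^ m" using relpow_path_set[OF n(2)] by blast
    have "\<exists>y\<in>e. y \<in> gball E a r" if e: "e \<in> A" for e
    proof -
      obtain y m where "y \<in> e" "m \<le> n" "(a, y) \<in> adj_rel E ^^ m" using A(5) e by auto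
      then have "y \<in> gball E a r" unfolding gball_def using n(1) by (auto intro!: exI[of _ m])
      then show ?thesis using \<open>y \<in> e\<close> by blast
    qed
    moreover have "card A \<le> r" using A n by simp
    ultimately show ?thesis using A n by blast
  qed
  have "\<forall>q. \<exists>A. snd q \<in> gball E (fst q) r \<longrightarrow> A \<subseteq> E \<and> finite A \<and> card A \<le> r \<and>
      (\<exists>m\<le>r. q \<in> adj_rel A ^^ m) \<and> (\<forall>e\<in>A. \<exists>y\<in>e. y \<in> gball E (fst q) r)"
  proof
    fix q :: "'v \<times> 'v"
    show "\<exists>A. snd q \<in> gball E (fst q) r \<longrightarrow> A \<subseteq> E \<and> finite A \<and> card A \<le> r \<and>
      (\<exists>m\<le>r. q \<in> adj_rel A ^^ m) \<and> (\<forall>e\<in>A. \<exists>y\<in>e. y \<in> gball E (fst q) r)"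
      using ex[of "snd q" "fst q"] by (cases "snd q \<in> gball E (fst q) r") simp_all
  qed
  from choice[OF this] obtain A where A0: "\<And>q. snd q \<in> gball E (fst q) r \<Longrightarrow> A q \<subseteq> E \<and> finite (A q) \<and>
      card (A q) \<le> r \<and> (\<exists>m\<le>r. q \<in> adj_rel (A q) ^^ m) \<and> (\<forall>e\<in>A q. \<exists>y\<in>e. y \<in> gball E (fst q) r)"
    by blast
  have A': "A (a, b) \<subseteq> E \<and> finite (A (a, b)) \<and> card (A (a, b)) \<le> r \<and>
      (\<exists>m\<le>r. (a, b) \<in> adj_rel (A (a, b)) ^^ m) \<and> (\<forall>e\<in>A (a, b). \<exists>y\<in>e. y \<in> gball E a r)"
    if "b \<in> gball E a r" for a b using A0[of "(a, b)"] that by simp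
  obtain B where B: "\<And>v. v \<in> V \<Longrightarrow> card (gball E v r) \<le> B" "0 < B"
    using card_gball_bounded by blast
  have "card {q \<in> Sigma F (\<lambda>a. F \<inter> gball E a r). e \<in> A q} \<le> 2 * B * B"
    if e: "e \<in> E" and F: "finite F" "F \<subseteq> V" for e F
  proof -
    have eV: "e \<subseteq> V" "finite e" "card e = 2" using edge_in_V[OF e] edge_card[OF e] card_ge_0_finite[of e] by auto
    let ?Y = "\<Union>y\<in>e. gball E y r"
    have Y: "?Y \<subseteq> V" "finite ?Y" using eV gball_subset finite_gball by auto
    have "card {q \<in> Sigma F (\<lambda>a. F \<inter> gball E a r). e \<in> A q} \<le> card (Sigma ?Y (\<lambda>a. gball E a r))"
    proof (rule card_mono)
      show "finite (Sigma ?Y (\<lambda>a. gball E a r))" using Y finite_gball by (intro finite_SigmaI) auto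
      show "{q \<in> Sigma F (\<lambda>a. F \<inter> gball E a r). e \<in> A q} \<subseteq> Sigma ?Y (\<lambda>a. gball E a r)"
      proof
        fix q assume "q \<in> {q \<in> Sigma F (\<lambda>a. F \<inter> gball E a r). e \<in> A q}"
        then obtain a b where ab: "q = (a, b)" "b \<in> gball E a r" "e \<in> A (a, b)" by auto
        then obtain y where "y \<in> e" "y \<in> gball E a r" using A'[OF ab(2)] by auto
        then have "a \<in> ?Y" using gball_sym[of y E a r] by blast
        then show "q \<in> Sigma ?Y (\<lambda>a. gball E a r)" using ab by simp
      qed
    qed
    also have "\<dots> = (\<Sum>a\<in>?Y. card (gball E a r))" using Y finite_gball by (intro card_SigmaI) auto
    also have "\<dots> \<le> (\<Sum>a\<in>?Y. B)" using Y B by (intro sum_mono) auto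
    also have "\<dots> = card ?Y * B" by simp
    also have "\<dots> \<le> (\<Sum>y\<in>e. card (gball E y r)) * B" using eV by (intro mult_right_mono card_UN_le) auto
    also have "\<dots> \<le> (\<Sum>y\<in>e. B) * B" using eV B by (intro mult_right_mono sum_mono) auto
    finally show ?thesis using eV by simp
  qed
  moreover have "A (a, b) \<subseteq> E \<and> finite (A (a, b)) \<and> card (A (a, b)) \<le> r \<and> (\<exists>m\<le>r. (a, b) \<in> adj_rel (A (a, b)) ^^ m)"
    if "b \<in> gball E a r" for a b using A'[OF that] by simp
  moreover have "0 < 2 * B * B" using B by simp
  ultimately show ?thesis by (intro that[of "2 * B * B" A])
qed


text \<open>The derivative bound of \<open>conn_exp_derivative_lower\<close>, integrated from
  \<open>p1\<close> to \<open>p2\<close> and summed over \<open>v\<close>. By monotonicity in the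
  density the main term is estimated at \<open>p1\<close> and the error at \<open>p2\<close>. In the
  error the two outer legs contribute a row sum \<open>X\<close> each, and \<open>\<eta>\<close>
  bounds the diagram between them.\<close>

lemma susceptibility_increment:
  obtains M :: nat where "0 < M"
    "\<And>p1 p2 x X \<eta> u F0. 0 \<le> p1 \<Longrightarrow> p1 < p2 \<Longrightarrow> p2 \<le> 1 \<Longrightarrow> 0 < x \<Longrightarrow> x \<le> 1 \<Longrightarrow> row_bdd p2 x X \<Longrightarrow>
      (\<And>t F. t \<in> V \<Longrightarrow> finite F \<Longrightarrow> F \<subseteq> V \<Longrightarrow>
        (\<Sum>a\<in>F. \<Sum>b\<in>F \<inter> gball E a r. \<Sum>z\<in>F. conn_lim p2 1 t a * (conn_lim p2 1 b z * conn_lim p2 1 z t)) \<le> \<eta>) \<Longrightarrow>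
      u \<in> V \<Longrightarrow> finite F0 \<Longrightarrow> F0 \<subseteq> V \<Longrightarrow>
      (p1 * x) ^ r * (p2 - p1) * ((\<Sum>v\<in>F0. \<Sum>a\<in>F0. \<Sum>b\<in>F0 \<inter> gball E a r. conn_lim p1 x u a * conn_lim p1 x b v)
          - X * X * \<eta>)
        \<le> M * ((\<Sum>v\<in>F0. conn_lim p2 x u v) - (\<Sum>v\<in>F0. conn_lim p1 x u v))"
proof -
  obtain A :: "'v \<times> 'v \<Rightarrow> 'v set set" and M :: nat where M: "0 < M"
    and A: "\<And>a b. b \<in> gball E a r \<Longrightarrow> A (a, b) \<subseteq> E \<and> finite (A (a, b)) \<and> card (A (a, b)) \<le> r \<and> (\<exists>m\<le>r. (a, b) \<in> adj_rel (A (a, b)) ^^ m)"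
    and MA: "\<And>e F. e \<in> E \<Longrightarrow> finite F \<Longrightarrow> F \<subseteq> V \<Longrightarrow> card {q \<in> Sigma F (\<lambda>a. F \<inter> gball E a r). e \<in> A q} \<le> M"
    by (rule path_family[of r]) blast
  have main: "(p1 * x) ^ r * (p2 - p1) * ((\<Sum>v\<in>F0. \<Sum>a\<in>F0. \<Sum>b\<in>F0 \<inter> gball E a r. conn_lim p1 x u a * conn_lim p1 x b v)
          - X * X * \<eta>)
        \<le> M * ((\<Sum>v\<in>F0. conn_lim p2 x u v) - (\<Sum>v\<in>F0. conn_lim p1 x u v))"
    if p: "0 \<le> p1" "p1 < p2" "p2 \<le> 1" and x: "0 < x" "x \<le> 1" and X: "row_bdd p2 x X"
      and \<eta>: "\<And>t F. t \<in> V \<Longrightarrow> finite F \<Longrightarrow> F \<subseteq> V \<Longrightarrow>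
        (\<Sum>a\<in>F. \<Sum>b\<in>F \<inter> gball E a r. \<Sum>z\<in>F. conn_lim p2 1 t a * (conn_lim p2 1 b z * conn_lim p2 1 z t)) \<le> \<eta>"
      and u: "u \<in> V" and F0: "finite F0" "F0 \<subseteq> V" for p1 p2 x X \<eta> u F0
  proof -
    let ?W2 = "conn_lim p2 x" and ?T2 = "conn_lim p2 1"
    define Q where "Q = Sigma F0 (\<lambda>a. F0 \<inter> gball E a r)"
    have finQ: "finite Q" unfolding Q_def using F0 by (intro finite_SigmaI) auto
    have QA: "A q \<subseteq> E" "finite (A q)" if "q \<in> Q" for q
      using A that by (auto simp: Q_def)
    \<comment> \<open>Volumes containing \<open>L0\<close> contain all chosen paths, whose edges can
      therefore be opened there.\<close>
    define L0 where "L0 = \<Union>(A ` Q)"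
    have L0: "finite L0" "L0 \<subseteq> E" unfolding L0_def using finQ QA by blast+
    have W0: "0 \<le> ?W2 a b" for a b using p x by (intro conn_lim_nonneg) auto
    have T0: "0 \<le> ?T2 a b" for a b using p x by (intro conn_lim_nonneg) auto
    have WT: "?W2 a b \<le> ?T2 a b" for a b using p x by (intro conn_lim_mono) auto
    have X0: "0 \<le> X" using row_bddD[OF X u, of "{}"] by simp
    have \<eta>0: "0 \<le> \<eta>" using \<eta>[OF u, of "{}"] by simp
    have fin_vol: "(p1 * x) ^ r * (p2 - p1) *
         ((\<Sum>v\<in>F0. \<Sum>(a, b)\<in>Q. conn_exp L p1 x u a * conn_exp L p1 x b v) - X * X * \<eta>)
        \<le> M * ((\<Sum>v\<in>F0. conn_exp L p2 x u v) - (\<Sum>v\<in>F0. conn_exp L p1 x u v))"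
      if L: "finite L" "L0 \<subseteq> L" "L \<subseteq> E" for L
    proof -
      define F where "F = insert u (F0 \<union> \<Union>L)"
      have F: "finite F" "F \<subseteq> V" "\<Union>L \<subseteq> F" "u \<in> F" "F0 \<subseteq> F"
        using u F0 L finite_Union_edges Union_edges by (auto simp: F_def)
      \<comment> \<open>The error at infinite volume and density \<open>p2\<close>: a leg from
        \<open>u\<close> to \<open>t\<close>, the diagram through \<open>t\<close>,
        \<open>a\<close>, \<open>b\<close> and \<open>z\<close>, in which \<open>a\<close> and
        \<open>b\<close> are merely close to each other, and a leg from \<open>z\<close> to
        \<open>v\<close>.\<close>
      define K where "K = (\<lambda>v. \<Sum>(a, b)\<in>Q. \<Sum>z\<in>F. \<Sum>t\<in>F. ?W2 u t * (?T2 t a * (?T2 b z * ?T2 z t)) * ?W2 z v)"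
      have pt: "(p1 * x) ^ r * (p2 - p1) * ((\<Sum>(a, b)\<in>Q. conn_exp L p1 x u a * conn_exp L p1 x b v) - K v)
          \<le> M * (conn_exp L p2 x u v - conn_exp L p1 x u v)" if v: "v \<in> F0" for v
      proof -
        let ?B = "(\<Sum>(a, b)\<in>Q. conn_exp L p1 x u a * conn_exp L p1 x b v) - K v"
        have inc: "0 \<le> conn_exp L p2 x u v - conn_exp L p1 x u v"
          using conn_exp_mono[OF L(1) order_refl, of p1 p2 x x u v] p x by simp
        define R where "R = (\<lambda>\<xi> D::real. ((\<lambda>p. conn_exp L p x u v) has_real_derivative D) (at \<xi>) \<and>
            (\<xi> * x) ^ r * (\<Sum>(a, b)\<in>Q. conn_exp L \<xi> x u a * conn_exp L \<xi> x b v
              - (\<Sum>z\<in>F. \<Sum>t\<in>F. conn_exp L \<xi> x u t * (conn_exp L \<xi> x t a * conn_exp L \<xi> 1 t z)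
                  * (conn_exp L \<xi> 1 b z * conn_exp L \<xi> x z v))) \<le> M * D)"
        have ex: "\<exists>D. R \<xi> D" if "0 \<le> \<xi>" "\<xi> \<le> 1" for \<xi>
          unfolding R_def
        proof (rule conn_exp_derivative_lower)
          show "A (a, b) \<subseteq> L \<and> card (A (a, b)) \<le> r \<and> (\<exists>m\<le>r. (a, b) \<in> adj_rel (A (a, b)) ^^ m)"
            if "(a, b) \<in> Q" for a b
            using A[of b a] that L(2) by (auto simp: Q_def L0_def)
          show "card {q \<in> Q. e \<in> A q} \<le> M" if "e \<in> L" for e
            unfolding Q_def using L F0 that by (intro MA) auto
        qed (use that x L F v finQ in auto)
        define D where "D = (\<lambda>\<xi>. SOME d. R \<xi> d)"
        have D: "R \<xi> (D \<xi>)" if "0 \<le> \<xi>" "\<xi> \<le> 1" for \<xi>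
          unfolding D_def using ex[OF that] by (rule someI_ex)
        have der: "((\<lambda>p. conn_exp L p x u v) has_real_derivative D \<xi>) (at \<xi>)" if "p1 \<le> \<xi>" "\<xi> \<le> p2" for \<xi>
          using D[of \<xi>] that p by (auto simp: R_def)
        obtain \<xi> where \<xi>: "p1 < \<xi>" "\<xi> < p2" "conn_exp L p2 x u v - conn_exp L p1 x u v = (p2 - p1) * D \<xi>"
          using MVT2[OF p(2) der] by blast
        have \<xi>01: "0 \<le> \<xi>" "\<xi> \<le> 1" using \<xi> p by auto
        \<comment> \<open>If the bracket is negative the claim follows from monotonicity in the
          density. Otherwise the prefactor \<open>(p1 * x) ^ r\<close> may be enlarged to its value
          at \<open>\<xi>\<close>.\<close>
        show ?thesis
        proof (cases "0 \<le> ?B")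
          case True
          have up: "conn_exp L \<xi> y a b \<le> conn_lim p2 y a b" if "0 \<le> y" "y \<le> 1" for y a b
          proof -
            have "conn_exp L \<xi> y a b \<le> conn_exp L p2 y a b"
              using L p \<xi> that by (intro conn_exp_mono) auto
            also have "\<dots> \<le> conn_lim p2 y a b" using L p that by (intro conn_lim_upper) auto
            finally show ?thesis .
          qed
          have nn: "0 \<le> conn_exp L \<xi> y a b" if "0 \<le> y" for y a b using \<xi>01 that by (intro conn_exp_nonneg)
          have "?B = (\<Sum>(a, b)\<in>Q. conn_exp L p1 x u a * conn_exp L p1 x b v
              - (\<Sum>z\<in>F. \<Sum>t\<in>F. ?W2 u t * (?T2 t a * (?T2 b z * ?T2 z t)) * ?W2 z v))"
            by (simp add: K_def sum_subtractf case_prod_unfold)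
          also have "\<dots> \<le> (\<Sum>(a, b)\<in>Q. conn_exp L \<xi> x u a * conn_exp L \<xi> x b v
              - (\<Sum>z\<in>F. \<Sum>t\<in>F. conn_exp L \<xi> x u t * (conn_exp L \<xi> x t a * conn_exp L \<xi> 1 t z)
                  * (conn_exp L \<xi> 1 b z * conn_exp L \<xi> x z v)))"
          proof (rule sum_mono, clarify, rule diff_mono)
            fix a b
            show "conn_exp L p1 x u a * conn_exp L p1 x b v \<le> conn_exp L \<xi> x u a * conn_exp L \<xi> x b v"
              using L p \<xi> x by (intro mult_mono conn_exp_mono conn_exp_nonneg) auto
            show "(\<Sum>z\<in>F. \<Sum>t\<in>F. conn_exp L \<xi> x u t * (conn_exp L \<xi> x t a * conn_exp L \<xi> 1 t z)
                  * (conn_exp L \<xi> 1 b z * conn_exp L \<xi> x z v))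
                \<le> (\<Sum>z\<in>F. \<Sum>t\<in>F. ?W2 u t * (?T2 t a * (?T2 b z * ?T2 z t)) * ?W2 z v)"
            proof (intro sum_mono)
              fix z t
              \<comment> \<open>Only the outer legs keep the weight \<open>x\<close>; inside the
                diagram it is raised to 1, where the L2 bound is available.\<close>
              have "conn_exp L \<xi> x u t * (conn_exp L \<xi> x t a * conn_exp L \<xi> 1 t z)
                  * (conn_exp L \<xi> 1 b z * conn_exp L \<xi> x z v)
                \<le> ?W2 u t * (?T2 t a * ?T2 t z) * (?T2 b z * ?W2 z v)"
                using x by (intro mult_mono up nn mult_nonneg_nonneg W0 T0 order_trans[OF up WT]) auto
              then show "conn_exp L \<xi> x u t * (conn_exp L \<xi> x t a * conn_exp L \<xi> 1 t z)
                  * (conn_exp L \<xi> 1 b z * conn_exp L \<xi> x z v)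
                \<le> ?W2 u t * (?T2 t a * (?T2 b z * ?T2 z t)) * ?W2 z v"
                by (simp add: conn_lim_commute[of p2 1 t z] mult_ac)
            qed
          qed
          finally have "(p1 * x) ^ r * ?B \<le> (\<xi> * x) ^ r * (\<Sum>(a, b)\<in>Q. conn_exp L \<xi> x u a * conn_exp L \<xi> x b v
              - (\<Sum>z\<in>F. \<Sum>t\<in>F. conn_exp L \<xi> x u t * (conn_exp L \<xi> x t a * conn_exp L \<xi> 1 t z)
                  * (conn_exp L \<xi> 1 b z * conn_exp L \<xi> x z v)))"
            using True p x \<xi> by (intro mult_mono power_mono) auto
          also have "\<dots> \<le> M * D \<xi>" using D[OF \<xi>01] unfolding R_def by blast
          finally have "(p2 - p1) * ((p1 * x) ^ r * ?B) \<le> (p2 - p1) * (M * D \<xi>)"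
            using p by (intro mult_left_mono) auto
          then show ?thesis using \<xi>(3) by (simp add: mult_ac)
        next
          case False
          then have "(p1 * x) ^ r * (p2 - p1) * ?B \<le> 0"
            using p x by (intro mult_nonneg_nonpos mult_nonneg_nonneg) auto
          also have "0 \<le> M * (conn_exp L p2 x u v - conn_exp L p1 x u v)" using inc by simp
          finally show ?thesis .
        qed
      qed
      have K: "(\<Sum>v\<in>F0. K v) \<le> X * X * \<eta>"
      proof -
        have "(\<Sum>v\<in>F0. K v) = (\<Sum>(a, b)\<in>Q. \<Sum>z\<in>F. \<Sum>t\<in>F. ?W2 u t * (?T2 t a * (?T2 b z * ?T2 z t)) * (\<Sum>v\<in>F0. ?W2 z v))"
          unfolding K_def sum_distrib_left
          by (subst sum.swap, simp add: case_prod_unfold, rule sum.cong[OF refl],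
              subst sum.swap, rule sum.cong[OF refl], subst sum.swap, rule refl)
        also have "\<dots> \<le> (\<Sum>(a, b)\<in>Q. \<Sum>z\<in>F. \<Sum>t\<in>F. ?W2 u t * (?T2 t a * (?T2 b z * ?T2 z t)) * X)"
        proof (rule sum_mono, clarify, intro sum_mono mult_left_mono)
          fix a b z t assume "z \<in> F" "t \<in> F"
          then show "(\<Sum>v\<in>F0. ?W2 z v) \<le> X" using F F0 by (intro row_bddD[OF X]) auto
        qed (intro mult_nonneg_nonneg W0 T0)
        also have "\<dots> = (\<Sum>a\<in>F0. \<Sum>b\<in>F0 \<inter> gball E a r. \<Sum>z\<in>F. \<Sum>t\<in>F. ?W2 u t * (?T2 t a * (?T2 b z * ?T2 z t)) * X)"
          unfolding Q_def using F0 by (subst sum.Sigma) auto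
        also have "\<dots> \<le> (\<Sum>a\<in>F. \<Sum>b\<in>F \<inter> gball E a r. \<Sum>z\<in>F. \<Sum>t\<in>F. ?W2 u t * (?T2 t a * (?T2 b z * ?T2 z t)) * X)"
        proof -
          have nn: "0 \<le> ?W2 u t * (?T2 t a * (?T2 b z * ?T2 z t)) * X" for a b z t
            using W0 T0 X0 by (intro mult_nonneg_nonneg)
          show ?thesis
          proof (rule order_trans[OF sum_mono sum_mono2])
            show "(\<Sum>b\<in>F0 \<inter> gball E a r. \<Sum>z\<in>F. \<Sum>t\<in>F. ?W2 u t * (?T2 t a * (?T2 b z * ?T2 z t)) * X)
              \<le> (\<Sum>b\<in>F \<inter> gball E a r. \<Sum>z\<in>F. \<Sum>t\<in>F. ?W2 u t * (?T2 t a * (?T2 b z * ?T2 z t)) * X)" for a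
              using F nn by (intro sum_mono2) (auto intro!: sum_nonneg)
          qed (use F nn in \<open>auto intro!: sum_nonneg\<close>)
        qed
        also have "\<dots> = (\<Sum>t\<in>F. ?W2 u t * X * (\<Sum>a\<in>F. \<Sum>b\<in>F \<inter> gball E a r. \<Sum>z\<in>F. ?T2 t a * (?T2 b z * ?T2 z t)))"
        proof -
          have "(\<Sum>a\<in>F. \<Sum>b\<in>F \<inter> gball E a r. \<Sum>z\<in>F. \<Sum>t\<in>F. ?W2 u t * (?T2 t a * (?T2 b z * ?T2 z t)) * X)
            = (\<Sum>a\<in>F. \<Sum>b\<in>F \<inter> gball E a r. \<Sum>t\<in>F. \<Sum>z\<in>F. ?W2 u t * (?T2 t a * (?T2 b z * ?T2 z t)) * X)"
            by (intro sum.cong refl sum.swap)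
          also have "\<dots> = (\<Sum>a\<in>F. \<Sum>t\<in>F. \<Sum>b\<in>F \<inter> gball E a r. \<Sum>z\<in>F. ?W2 u t * (?T2 t a * (?T2 b z * ?T2 z t)) * X)"
            by (intro sum.cong refl sum.swap)
          also have "\<dots> = (\<Sum>t\<in>F. \<Sum>a\<in>F. \<Sum>b\<in>F \<inter> gball E a r. \<Sum>z\<in>F. ?W2 u t * (?T2 t a * (?T2 b z * ?T2 z t)) * X)"
            by (rule sum.swap)
          finally show ?thesis by (simp add: sum_distrib_left mult_ac)
        qed
        also have "\<dots> \<le> (\<Sum>t\<in>F. ?W2 u t * X * \<eta>)"
          using F X0 W0 by (intro sum_mono mult_left_mono \<eta> mult_nonneg_nonneg) auto
        also have "\<dots> = (\<Sum>t\<in>F. ?W2 u t) * (X * \<eta>)" by (simp add: sum_distrib_right mult.assoc)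
        also have "\<dots> \<le> X * (X * \<eta>)"
          using row_bddD[OF X u F(1,2)] X0 \<eta>0 by (intro mult_right_mono) auto
        finally show ?thesis by (simp add: mult.assoc)
      qed
      have "(p1 * x) ^ r * (p2 - p1) * ((\<Sum>v\<in>F0. \<Sum>(a, b)\<in>Q. conn_exp L p1 x u a * conn_exp L p1 x b v) - X * X * \<eta>)
          \<le> (p1 * x) ^ r * (p2 - p1) * (\<Sum>v\<in>F0. (\<Sum>(a, b)\<in>Q. conn_exp L p1 x u a * conn_exp L p1 x b v) - K v)"
        using K p x by (intro mult_left_mono mult_nonneg_nonneg) (auto simp: sum_subtractf)
      also have "\<dots> \<le> (\<Sum>v\<in>F0. M * (conn_exp L p2 x u v - conn_exp L p1 x u v))"
        unfolding sum_distrib_left by (intro sum_mono pt)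
      also have "\<dots> = M * ((\<Sum>v\<in>F0. conn_exp L p2 x u v) - (\<Sum>v\<in>F0. conn_exp L p1 x u v))"
        by (simp add: sum_distrib_left[symmetric] sum_subtractf)
      finally show ?thesis .
    qed
    have Qsum: "(\<Sum>v\<in>F0. \<Sum>(a, b)\<in>Q. conn_lim p1 x u a * conn_lim p1 x b v)
        = (\<Sum>v\<in>F0. \<Sum>a\<in>F0. \<Sum>b\<in>F0 \<inter> gball E a r. conn_lim p1 x u a * conn_lim p1 x b v)"
      unfolding Q_def using F0 by (intro sum.cong refl sum.Sigma[symmetric]) auto
    have "(p1 * x) ^ r * (p2 - p1) *
         ((\<Sum>v\<in>F0. \<Sum>(a, b)\<in>Q. conn_lim p1 x u a * conn_lim p1 x b v) - X * X * \<eta>)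
        \<le> M * ((\<Sum>v\<in>F0. conn_lim p2 x u v) - (\<Sum>v\<in>F0. conn_lim p1 x u v))"
    proof (rule tendsto_le[of "finite_subsets_at_top E"])
      show "((\<lambda>L. M * ((\<Sum>v\<in>F0. conn_exp L p2 x u v) - (\<Sum>v\<in>F0. conn_exp L p1 x u v)))
        \<longlongrightarrow> M * ((\<Sum>v\<in>F0. conn_lim p2 x u v) - (\<Sum>v\<in>F0. conn_lim p1 x u v))) (finite_subsets_at_top E)"
        using p x by (intro tendsto_intros conn_lim_tendsto) auto
      show "((\<lambda>L. (p1 * x) ^ r * (p2 - p1) *
         ((\<Sum>v\<in>F0. \<Sum>(a, b)\<in>Q. conn_exp L p1 x u a * conn_exp L p1 x b v) - X * X * \<eta>))
        \<longlongrightarrow> (p1 * x) ^ r * (p2 - p1) *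
         ((\<Sum>v\<in>F0. \<Sum>(a, b)\<in>Q. conn_lim p1 x u a * conn_lim p1 x b v) - X * X * \<eta>)) (finite_subsets_at_top E)"
        unfolding case_prod_unfold using p x by (intro tendsto_intros conn_lim_tendsto) auto
      show "\<forall>\<^sub>F L in finite_subsets_at_top E. (p1 * x) ^ r * (p2 - p1) *
         ((\<Sum>v\<in>F0. \<Sum>(a, b)\<in>Q. conn_exp L p1 x u a * conn_exp L p1 x b v) - X * X * \<eta>)
        \<le> M * ((\<Sum>v\<in>F0. conn_exp L p2 x u v) - (\<Sum>v\<in>F0. conn_exp L p1 x u v))"
        unfolding eventually_finite_subsets_at_top using L0 fin_vol by (intro exI[of _ L0]) auto
    qed simp
    then show ?thesis unfolding Qsum .
  qed
  show ?thesis by (rule that[OF M main])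
qed

lemma row_bdd_weaken: "row_bdd p x K \<Longrightarrow> K \<le> K' \<Longrightarrow> row_bdd p x K'"
  unfolding row_bdd_def by (meson order_trans)

text \<open>Thinning by \<open>t = p1 / p2\<close> bounds the row sums at density \<open>p2\<close>
  and weight \<open>t * x\<close> by those at \<open>p1\<close> and \<open>x\<close>. The Neumann
  bound then raises the weight back to \<open>x\<close>; the hypothesis makes its factor
  \<open>(1 - t) * X\<close> at most 1/2.\<close>

lemma row_sup_double:
  assumes "row_bdd p1 x K" "0 < p0" "p0 \<le> p1" "p1 < p2" "p2 \<le> 1" "0 < x" "x \<le> 1"
    and "(p2 - p1) * row_sup p1 x \<le> p0 / 2"
  shows "row_bdd p2 x (2 * row_sup p1 x)"
proof -
  let ?X = "row_sup p1 x"
  define t where "t = p1 / p2"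
  have t: "0 < t" "t \<le> 1" "p2 * t = p1" using assms by (auto simp: t_def)
  have X: "row_bdd p1 x ?X" "1 \<le> ?X" using row_bdd_row_sup row_sup_ge_1 assms by auto
  have b: "row_bdd p2 (t * x) ?X" using X t assms by (intro row_bdd_thin) auto
  have e: "1 - (t * x) / x = (p2 - p1) / p2" using assms by (simp add: t_def field_simps)
  have "(p2 - p1) / p2 * ?X = (p2 - p1) * ?X / p2" by simp
  also have "\<dots> \<le> (p0 / 2) / p2" using assms by (intro divide_right_mono) auto
  also have "\<dots> \<le> 1 / 2" using assms by (simp add: field_simps)
  finally have h: "(1 - (t * x) / x) * ?X \<le> 1 / 2" using e by simp
  have "row_bdd p2 x (?X / (1 - (1 - (t * x) / x) * ?X))"
  proof (rule row_bdd_neumann[OF b])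
    show "0 < t * x" using t assms by simp
    show "t * x \<le> x" using t assms by (simp add: mult_left_le_one_le)
    show "(1 - (t * x) / x) * ?X < 1" using h by linarith
  qed (use assms in auto)
  moreover have "?X / (1 - (1 - (t * x) / x) * ?X) \<le> ?X / (1 / 2)"
    by (rule frac_le) (use h X(2) in linarith)+
  then have "?X / (1 - (1 - (t * x) / x) * ?X) \<le> 2 * ?X" by simp
  ultimately show ?thesis by (rule row_bdd_weaken)
qed

text \<open>The integrated form of the inequality that the derivative of the susceptibility is at
  least a multiple of its square. The assumption that the supremum at most doubles lets the error,
  which involves row sums at \<open>p2\<close>, be compared with the main term at
  \<open>p1\<close>.\<close>

lemma row_sup_quadratic:
  assumes "infinite V" "0 < p0" "ps \<le> 1" "p0 \<le> ps" "l2_bdd ps N"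
  obtains c where "0 < c" "\<And>p1 p2 x K. p0 \<le> p1 \<Longrightarrow> p1 < p2 \<Longrightarrow> p2 \<le> ps \<Longrightarrow> 1 / 2 \<le> x \<Longrightarrow> x \<le> 1 \<Longrightarrow>
     row_bdd p2 x K \<Longrightarrow> row_sup p2 x \<le> 2 * row_sup p1 x \<Longrightarrow>
     row_sup p1 x + c * (p2 - p1) * (row_sup p1 x)\<^sup>2 \<le> row_sup p2 x"
proof -
  obtain D where D: "\<And>p x u u' F'. 0 \<le> p \<Longrightarrow> p \<le> 1 \<Longrightarrow> 0 \<le> x \<Longrightarrow> x \<le> 1 \<Longrightarrow> u \<in> V \<Longrightarrow> u' \<in> V \<Longrightarrow>
    finite F' \<Longrightarrow> F' \<subseteq> V \<Longrightarrow> \<exists>F. finite F \<and> F \<subseteq> V \<and>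
      (p * x) ^ D * (\<Sum>v\<in>F'. conn_lim p x u' v) \<le> (\<Sum>v\<in>F. conn_lim p x u v)"
    using row_transfer by blast
  obtain C :: nat where C: "0 < C" "\<And>u v r. u \<in> V \<Longrightarrow> v \<in> V \<Longrightarrow> card (gball E v r) \<le> C * card (gball E u r)"
    using card_gball_comparable by metis
  obtain o' where o': "o' \<in> V" using V_nonempty by blast
  \<comment> \<open>The loss in \<open>row_transfer\<close>, uniform over densities at least
    \<open>p0\<close> and weights at least 1/2.\<close>
  define \<kappa> where "\<kappa> = (p0 / 2) ^ D"
  have \<kappa>: "0 < \<kappa>" using assms by (simp add: \<kappa>_def)
  \<comment> \<open>The lower bound of the main term uses two row sums of at least half the
    supremum, which costs 1/4, the transfer factor \<open>\<kappa>\<close>, and the comparison of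
    ball volumes, which costs \<open>C\<close>.\<close>
  define \<kappa>' where "\<kappa>' = \<kappa> / (4 * C)"
  have \<kappa>': "0 < \<kappa>'" using \<kappa> C by (simp add: \<kappa>'_def)
  \<comment> \<open>With row sums at most \<open>2 * X\<close> at \<open>p2\<close>, the factor 1/8
    makes the error half of the main term.\<close>
  obtain r where r: "\<And>t F. t \<in> V \<Longrightarrow> finite F \<Longrightarrow> F \<subseteq> V \<Longrightarrow>
    (\<Sum>a\<in>F. \<Sum>b\<in>F \<inter> gball E a r. \<Sum>z\<in>F. conn_lim ps 1 t a * (conn_lim ps 1 b z * conn_lim ps 1 z t))
      \<le> (\<kappa>' / 8) * card (gball E o' r)"
    using diagram_small[OF assms(1) o' assms(5), of "\<kappa>' / 8"] assms \<kappa>' by auto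
  define b0 where "b0 = real (card (gball E o' r))"
  have b0: "0 < b0" using card_gball_ge[OF assms(1) o', of r] by (simp add: b0_def)
  obtain M :: nat where M: "0 < M" and key:
    "\<And>p1 p2 x X \<eta> u F0. 0 \<le> p1 \<Longrightarrow> p1 < p2 \<Longrightarrow> p2 \<le> 1 \<Longrightarrow> 0 < x \<Longrightarrow> x \<le> 1 \<Longrightarrow> row_bdd p2 x X \<Longrightarrow>
      (\<And>t F. t \<in> V \<Longrightarrow> finite F \<Longrightarrow> F \<subseteq> V \<Longrightarrow>
        (\<Sum>a\<in>F. \<Sum>b\<in>F \<inter> gball E a r. \<Sum>z\<in>F. conn_lim p2 1 t a * (conn_lim p2 1 b z * conn_lim p2 1 z t)) \<le> \<eta>) \<Longrightarrow>
      u \<in> V \<Longrightarrow> finite F0 \<Longrightarrow> F0 \<subseteq> V \<Longrightarrow>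
      (p1 * x) ^ r * (p2 - p1) * ((\<Sum>v\<in>F0. \<Sum>a\<in>F0. \<Sum>b\<in>F0 \<inter> gball E a r. conn_lim p1 x u a * conn_lim p1 x b v)
          - X * X * \<eta>)
        \<le> M * ((\<Sum>v\<in>F0. conn_lim p2 x u v) - (\<Sum>v\<in>F0. conn_lim p1 x u v))"
    using susceptibility_increment[of r] by blast
  define c where "c = (p0 / 2) ^ r * (\<kappa>' * b0 / 2) / M"
  have c0: "0 < c" using assms \<kappa>' b0 M by (simp add: c_def)
  have "row_sup p1 x + c * (p2 - p1) * (row_sup p1 x)\<^sup>2 \<le> row_sup p2 x"
    if p: "p0 \<le> p1" "p1 < p2" "p2 \<le> ps" and x: "1 / 2 \<le> x" "x \<le> 1"
      and K: "row_bdd p2 x K" and dbl: "row_sup p2 x \<le> 2 * row_sup p1 x" for p1 p2 x K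
  proof -
    let ?X = "row_sup p1 x" and ?W = "conn_lim p1 x"
    have p01: "0 \<le> p1" "p1 \<le> 1" "p2 \<le> 1" "0 \<le> p2" using p assms by auto
    have K1: "row_bdd p1 x K" using p x p01 by (intro row_bdd_mono[OF K]) auto
    have X1: "1 \<le> ?X" using row_sup_ge_1[OF K1] p01 x by auto
    have W0: "0 \<le> ?W a b" for a b using p01 x by (intro conn_lim_nonneg) auto
    have \<kappa>_le: "\<kappa> \<le> (p1 * x) ^ D"
    proof -
      have "p0 * (1 / 2) \<le> p1 * x" using p x assms by (intro mult_mono) auto
      then show ?thesis unfolding \<kappa>_def using assms by (intro power_mono) auto
    qed
    have rowlow: "\<exists>F. finite F \<and> F \<subseteq> V \<and> \<kappa> * (?X / 2) \<le> (\<Sum>v\<in>F. ?W b v)" if b: "b \<in> V" for b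
    proof -
      have "?X / 2 < ?X" using X1 by simp
      then obtain u' F' where F': "u' \<in> V" "finite F'" "F' \<subseteq> V" "?X / 2 < (\<Sum>v\<in>F'. ?W u' v)"
        by (rule row_sup_witness)
      obtain F where F: "finite F" "F \<subseteq> V" "(p1 * x) ^ D * (\<Sum>v\<in>F'. ?W u' v) \<le> (\<Sum>v\<in>F. ?W b v)"
        using D[of p1 x b u' F'] p01 x b F' by auto
      have "\<kappa> * (?X / 2) \<le> (p1 * x) ^ D * (\<Sum>v\<in>F'. ?W u' v)"
        using \<kappa>_le F' X1 \<kappa> by (intro mult_mono) auto
      then show ?thesis using F by (intro exI[of _ F]) auto
    qed
    have diag: "(\<Sum>a\<in>F. \<Sum>b\<in>F \<inter> gball E a r. \<Sum>z\<in>F. conn_lim p2 1 t a * (conn_lim p2 1 b z * conn_lim p2 1 z t))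
        \<le> (\<kappa>' / 8) * b0" if "t \<in> V" "finite F" "F \<subseteq> V" for t F
    proof -
      have "(\<Sum>a\<in>F. \<Sum>b\<in>F \<inter> gball E a r. \<Sum>z\<in>F. conn_lim p2 1 t a * (conn_lim p2 1 b z * conn_lim p2 1 z t))
        \<le> (\<Sum>a\<in>F. \<Sum>b\<in>F \<inter> gball E a r. \<Sum>z\<in>F. conn_lim ps 1 t a * (conn_lim ps 1 b z * conn_lim ps 1 z t))"
        using p p01 assms by (intro sum_mono mult_mono conn_lim_mono mult_nonneg_nonneg conn_lim_nonneg) auto
      also have "\<dots> \<le> (\<kappa>' / 8) * b0" unfolding b0_def by (rule r[OF that])
      finally show ?thesis .
    qed
    \<comment> \<open>The supremum need not be attained, so every \<open>w\<close> below it is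
      treated; the lower bound on \<open>w\<close> keeps the row at \<open>u\<close> above half the
      supremum.\<close>
    have "?X \<le> row_sup p2 x - c * (p2 - p1) * ?X\<^sup>2"
    proof (rule dense_le_bounded[of "?X / 2"])
      show "?X / 2 < ?X" using X1 by simp
      fix w assume w: "?X / 2 < w" "w < ?X"
      then obtain u A0 where A0: "u \<in> V" "finite A0" "A0 \<subseteq> V" "w < (\<Sum>v\<in>A0. ?W u v)"
        using row_sup_witness by metis
      have "\<forall>b. \<exists>F. b \<in> V \<longrightarrow> finite F \<and> F \<subseteq> V \<and> \<kappa> * (?X / 2) \<le> (\<Sum>v\<in>F. ?W b v)"
        using rowlow by auto
      from choice[OF this] obtain G where
        G: "\<And>b. b \<in> V \<Longrightarrow> finite (G b) \<and> G b \<subseteq> V \<and> \<kappa> * (?X / 2) \<le> (\<Sum>v\<in>G b. ?W b v)" by blast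
      define B where "B = (\<Union>a\<in>A0. gball E a r)"
      have B: "finite B" "B \<subseteq> V" unfolding B_def using A0 finite_gball gball_subset by blast+
      define F0 where "F0 = A0 \<union> B \<union> (\<Union>b\<in>B. G b)"
      have F0: "finite F0" "F0 \<subseteq> V" unfolding F0_def using A0 B G by auto
      have low: "\<kappa>' * b0 * ?X\<^sup>2 \<le> (\<Sum>v\<in>F0. \<Sum>a\<in>F0. \<Sum>b\<in>F0 \<inter> gball E a r. ?W u a * ?W b v)"
      proof -
        have "\<kappa>' * b0 * ?X\<^sup>2 = (?X / 2) * ((b0 / C) * (\<kappa> * (?X / 2)))"
          by (simp add: \<kappa>'_def power2_eq_square)
        also have "\<dots> \<le> (\<Sum>a\<in>A0. ?W u a) * ((b0 / C) * (\<kappa> * (?X / 2)))"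
          using w A0 b0 \<kappa> X1 by (intro mult_right_mono mult_nonneg_nonneg) auto
        also have "\<dots> = (\<Sum>a\<in>A0. ?W u a * ((b0 / C) * (\<kappa> * (?X / 2))))" by (rule sum_distrib_right)
        also have "\<dots> \<le> (\<Sum>a\<in>A0. ?W u a * (\<Sum>b\<in>F0 \<inter> gball E a r. \<Sum>v\<in>F0. ?W b v))"
        proof (intro sum_mono mult_left_mono W0)
          fix a assume a: "a \<in> A0"
          have sub: "gball E a r \<subseteq> F0" using a by (auto simp: F0_def B_def)
          have "b0 \<le> C * card (gball E a r)"
            unfolding b0_def using C(2)[of a o' r] a A0 o' by (metis of_nat_le_iff of_nat_mult subsetD)
          then have "b0 / C \<le> card (gball E a r)" using C by (simp add: pos_divide_le_eq mult.commute)
          then have "(b0 / C) * (\<kappa> * (?X / 2)) \<le> card (gball E a r) * (\<kappa> * (?X / 2))"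
            using \<kappa> X1 by (intro mult_right_mono) auto
          also have "\<dots> = (\<Sum>b\<in>gball E a r. \<kappa> * (?X / 2))" by simp
          also have "\<dots> \<le> (\<Sum>b\<in>gball E a r. \<Sum>v\<in>F0. ?W b v)"
          proof (rule sum_mono)
            fix b assume b: "b \<in> gball E a r"
            then have bB: "b \<in> B" using a by (auto simp: B_def)
            then have "\<kappa> * (?X / 2) \<le> (\<Sum>v\<in>G b. ?W b v)" using G B by blast
            also have "\<dots> \<le> (\<Sum>v\<in>F0. ?W b v)" using F0 bB W0 by (intro sum_mono2) (auto simp: F0_def)
            finally show "\<kappa> * (?X / 2) \<le> (\<Sum>v\<in>F0. ?W b v)" .
          qed
          also have "gball E a r = F0 \<inter> gball E a r" using sub by blast
          finally show "(b0 / C) * (\<kappa> * (?X / 2)) \<le> (\<Sum>b\<in>F0 \<inter> gball E a r. \<Sum>v\<in>F0. ?W b v)" .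
        qed
        also have "\<dots> \<le> (\<Sum>a\<in>F0. ?W u a * (\<Sum>b\<in>F0 \<inter> gball E a r. \<Sum>v\<in>F0. ?W b v))"
          using F0 W0 by (intro sum_mono2) (auto simp: F0_def intro!: mult_nonneg_nonneg sum_nonneg)
        also have "\<dots> = (\<Sum>a\<in>F0. \<Sum>b\<in>F0 \<inter> gball E a r. \<Sum>v\<in>F0. ?W u a * ?W b v)"
          by (simp add: sum_distrib_left)
        also have "\<dots> = (\<Sum>a\<in>F0. \<Sum>v\<in>F0. \<Sum>b\<in>F0 \<inter> gball E a r. ?W u a * ?W b v)"
          by (intro sum.cong refl sum.swap)
        also have "\<dots> = (\<Sum>v\<in>F0. \<Sum>a\<in>F0. \<Sum>b\<in>F0 \<inter> gball E a r. ?W u a * ?W b v)" by (rule sum.swap)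
        finally show ?thesis .
      qed
      have X2: "row_bdd p2 x (2 * ?X)"
        by (rule row_bdd_weaken[OF row_bdd_row_sup[OF K] dbl])
      have px: "(p0 / 2) ^ r \<le> (p1 * x) ^ r"
      proof -
        have "p0 * (1 / 2) \<le> p1 * x" using p x assms by (intro mult_mono) auto
        then show ?thesis using assms by (intro power_mono) auto
      qed
      have "c * (p2 - p1) * ?X\<^sup>2 * M = (p0 / 2) ^ r * (p2 - p1) * (\<kappa>' * b0 * ?X\<^sup>2 - (2 * ?X) * (2 * ?X) * (\<kappa>' / 8 * b0))"
        using M by (simp add: c_def power2_eq_square field_simps)
      also have "\<dots> \<le> (p1 * x) ^ r * (p2 - p1) * ((\<Sum>v\<in>F0. \<Sum>a\<in>F0. \<Sum>b\<in>F0 \<inter> gball E a r. ?W u a * ?W b v)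
          - (2 * ?X) * (2 * ?X) * (\<kappa>' / 8 * b0))"
      proof (intro mult_mono px diff_right_mono low)
        have "0 \<le> \<kappa>' * b0 * ?X\<^sup>2 / 2" using \<kappa>' b0 by (intro divide_nonneg_nonneg mult_nonneg_nonneg) auto
        then show "0 \<le> \<kappa>' * b0 * ?X\<^sup>2 - (2 * ?X) * (2 * ?X) * (\<kappa>' / 8 * b0)"
          by (simp add: power2_eq_square)
      qed (use p x p01 in auto)
      also have "\<dots> \<le> M * ((\<Sum>v\<in>F0. conn_lim p2 x u v) - (\<Sum>v\<in>F0. ?W u v))"
        using p x p01 A0 F0 X2 diag by (intro key) auto
      finally have "c * (p2 - p1) * ?X\<^sup>2 \<le> (\<Sum>v\<in>F0. conn_lim p2 x u v) - (\<Sum>v\<in>F0. ?W u v)"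
        using M by (simp add: mult.commute)
      moreover have "(\<Sum>v\<in>A0. ?W u v) \<le> (\<Sum>v\<in>F0. ?W u v)"
        using F0 W0 by (intro sum_mono2) (auto simp: F0_def)
      moreover have "(\<Sum>v\<in>F0. conn_lim p2 x u v) \<le> row_sup p2 x"
        using A0 F0 by (intro row_sup_upper[OF K]) auto
      ultimately show "w \<le> row_sup p2 x - c * (p2 - p1) * ?X\<^sup>2" using A0 by linarith
    qed
    then show ?thesis by simp
  qed
  then show ?thesis by (rule that[OF c0])
qed

text \<open>
  With \<open>X = row_sup p x\<close> and a step \<open>s\<close> of order \<open>1 / X\<close>, the supremum at most doubles and grows by at
  least a fixed factor; hence \<open>(p2 - p) * row_sup p x\<close> could be increased if it were large.
\<close>

lemma row_sup_window:
  assumes "infinite V" "0 < p0" "ps \<le> 1" "p0 \<le> ps" "l2_bdd ps N"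
  obtains C where "0 < C" "\<And>p1 p2 x K. p0 \<le> p1 \<Longrightarrow> p1 < p2 \<Longrightarrow> p2 \<le> ps \<Longrightarrow> 1 / 2 \<le> x \<Longrightarrow> x \<le> 1 \<Longrightarrow>
     row_bdd p2 x K \<Longrightarrow> (p2 - p1) * row_sup p1 x \<le> C"
proof -
  obtain c where c: "0 < c" and quad: "\<And>p1 p2 x K. p0 \<le> p1 \<Longrightarrow> p1 < p2 \<Longrightarrow> p2 \<le> ps \<Longrightarrow> 1 / 2 \<le> x \<Longrightarrow> x \<le> 1 \<Longrightarrow>
     row_bdd p2 x K \<Longrightarrow> row_sup p2 x \<le> 2 * row_sup p1 x \<Longrightarrow>
     row_sup p1 x + c * (p2 - p1) * (row_sup p1 x)\<^sup>2 \<le> row_sup p2 x"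
    using row_sup_quadratic[OF assms] by blast
  define a where "a = p0 / 2"
  define b where "b = c * a"
  have ab: "0 < a" "0 < b" using assms c by (auto simp: a_def b_def)
  \<comment> \<open>The first entry leaves room for a step before \<open>p2\<close>. The second
    gives \<open>(1 + b / 2) * Y \<le> (1 + b) * (Y - a)\<close> once \<open>Y\<close> exceeds it:
    the growth of the supremum outweighs the shrinking of the window.\<close>
  define C where "C = max (2 * a) (2 * a * (1 + b) / b)"
  have C0: "0 < C" using ab by (simp add: C_def)
  have "(p2 - p1) * row_sup p1 x \<le> C"
    if p: "p0 \<le> p1" "p1 < p2" "p2 \<le> ps" and x: "1 / 2 \<le> x" "x \<le> 1" and K: "row_bdd p2 x K" for p1 p2 x K
  proof (rule ccontr)
    define Y where "Y = (\<lambda>p. (p2 - p) * row_sup p x)"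
    assume "\<not> ?thesis"
    then have big: "C < Y p1" by (simp add: Y_def)
    have Kp: "row_bdd p x K" if "p1 \<le> p" "p \<le> p2" for p
      using that p x assms by (intro row_bdd_mono[OF K]) auto
    have X1: "1 \<le> row_sup p x" if "p1 \<le> p" "p \<le> p2" for p
      using row_sup_ge_1[OF Kp[OF that]] that p x assms by auto
    have bdd: "bdd_above (Y ` {p1..p2})"
    proof (rule bdd_aboveI[of _ "(p2 - p1) * K"])
      fix y assume "y \<in> Y ` {p1..p2}"
      then obtain p' where p': "p1 \<le> p'" "p' \<le> p2" "y = (p2 - p') * row_sup p' x" by (auto simp: Y_def)
      then show "y \<le> (p2 - p1) * K"
        using row_sup_le[OF Kp[of p']] X1[of p'] by (auto intro!: mult_mono)
    qed
    \<comment> \<open>Finite because of the bound \<open>K\<close> at \<open>p2\<close>. A density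
      at which \<open>Y\<close> is within the factor \<open>1 + b / 2\<close> of \<open>Z\<close>
      yields a value above \<open>Z\<close> one step later.\<close>
    define Z where "Z = (SUP p\<in>{p1..p2}. Y p)"
    have ZY: "Y q \<le> Z" if "p1 \<le> q" "q \<le> p2" for q
      unfolding Z_def using that bdd by (intro cSUP_upper) auto
    have Z0: "C < Z" using big ZY[of p1] p by auto
    then have "max C (Z / (1 + b / 2)) < Z" using ab C0 by (simp add: field_simps)
    then have "\<exists>q\<in>{p1..p2}. max C (Z / (1 + b / 2)) < Y q"
      using less_cSUP_iff[OF _ bdd, of "max C (Z / (1 + b / 2))"] p unfolding Z_def[symmetric] by auto
    then obtain q where q: "p1 \<le> q" "q \<le> p2" "max C (Z / (1 + b / 2)) < Y q" by auto
    let ?X = "row_sup q x"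
    have X: "1 \<le> ?X" using X1 q by auto
    have YC: "C < Y q" and YZ: "Z < Y q * (1 + b / 2)" using q ab by (auto simp: field_simps)
    define s where "s = a / ?X"
    have s0: "0 < s" using ab X by (simp add: s_def)
    have sX: "s * ?X = a" using X by (simp add: s_def)
    have "2 * a < (p2 - q) * ?X" using YC by (simp add: C_def Y_def)
    then have "2 * (s * ?X) < (p2 - q) * ?X" using sX by simp
    then have sq: "2 * s < p2 - q" using X by (simp add: mult.assoc[symmetric])
    have fin: "row_bdd (q + s) x K" using Kp q s0 sq by auto
    have "row_bdd (q + s) x (2 * ?X)"
      using Kp[of q] assms p q x s0 sq sX by (intro row_sup_double[of q x K p0 "q + s"]) (auto simp: a_def)
    then have "row_sup (q + s) x \<le> 2 * ?X" by (rule row_sup_le)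
    then have "?X + c * (q + s - q) * ?X\<^sup>2 \<le> row_sup (q + s) x"
      using p q s0 sq x fin by (intro quad) auto
    moreover have "c * (q + s - q) * ?X\<^sup>2 = b * ?X" using sX by (simp add: b_def power2_eq_square mult_ac)
    ultimately have grow: "(1 + b) * ?X \<le> row_sup (q + s) x" by (simp add: algebra_simps)
    have "(1 + b / 2) * Y q \<le> (1 + b) * (Y q - a)"
    proof -
      have "2 * a * (1 + b) / b < Y q" using YC by (simp add: C_def)
      then have "2 * a * (1 + b) < b * Y q" using ab by (simp add: field_simps)
      then show ?thesis by (simp add: algebra_simps)
    qed
    also have "\<dots> = (p2 - (q + s)) * ((1 + b) * ?X)" using sX by (simp add: Y_def algebra_simps)
    also have "\<dots> \<le> Y (q + s)" unfolding Y_def using grow sq s0 by (intro mult_left_mono) auto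
    also have "\<dots> \<le> Z" using q s0 sq by (intro ZY) auto
    finally show False using YZ by (simp add: mult.commute)
  qed
  then show ?thesis by (rule that[OF C0])
qed

end

section \<open>Sharpness of the phase transition\<close>

lemma bern_exp_single: "finite L \<Longrightarrow> 0 \<le> p \<Longrightarrow> p \<le> 1 \<Longrightarrow> bern_exp L p (\<lambda>w. of_bool (e \<in> w)) \<le> p"
proof (cases "e \<in> L")
  case True
  assume L: "finite L" "0 \<le> p" "p \<le> 1"
  have "bern_exp L p (\<lambda>w. of_bool (e \<in> w)) = bern_exp L p (\<lambda>w. of_bool (e \<in> w \<inter> {e}))"
    by (intro bern_exp_cong) auto
  also have "\<dots> = bern_exp {e} p (\<lambda>w. of_bool (e \<in> w))"
    using True L by (intro bern_exp_restrict) auto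
  also have "\<dots> = p" by (simp add: bern_exp_insert)
  finally show ?thesis by simp
next
  case False
  assume L: "finite L" "0 \<le> p" "p \<le> 1"
  have "bern_exp L p (\<lambda>w. of_bool (e \<in> w)) = bern_exp L p (\<lambda>w. 0)"
    using False by (intro bern_exp_cong) auto
  then show ?thesis using L by (simp add: bern_exp_const)
qed

context qt_graph
begin

section \<open>The functional of Duminil-Copin and Tassion\<close>

definition out_pairs :: "'v set \<Rightarrow> ('v \<times> 'v) set" where
  "out_pairs S = {(x, y). x \<in> S \<and> y \<notin> S \<and> {x, y} \<in> E}"

definition inner_edges :: "'v set \<Rightarrow> 'v set set" where
  "inner_edges S = {e \<in> E. e \<subseteq> S}"

text \<open>Multiplied by \<open>p\<close> this is the functional of Duminil-Copin and Tassion: the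
  expected number of open edges leaving \<open>S\<close> from the cluster of \<open>u\<close> inside
  \<open>S\<close>.\<close>

definition exit_sum :: "real \<Rightarrow> 'v \<Rightarrow> 'v set \<Rightarrow> real" where
  "exit_sum p u S = (\<Sum>(x, y)\<in>out_pairs S. conn_exp (inner_edges S) p 1 u x)"

definition touching :: "'v set \<Rightarrow> 'v set set" where
  "touching S = {e \<in> E. e \<inter> S \<noteq> {}}"

lemma finite_touching: "finite S \<Longrightarrow> S \<subseteq> V \<Longrightarrow> finite (touching S)"
proof -
  assume S: "finite S" "S \<subseteq> V"
  have "touching S = (\<Union>v\<in>S. {e \<in> E. v \<in> e})" by (auto simp: touching_def)
  then show ?thesis using S finite_edges_at by auto
qed

lemma inner_subset_touching: "inner_edges S \<subseteq> touching S"
proof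
  fix e assume e: "e \<in> inner_edges S"
  then have "e \<noteq> {}" using edge_card[of e] by (auto simp: inner_edges_def)
  then show "e \<in> touching S" using e by (auto simp: inner_edges_def touching_def)
qed

lemma finite_inner: "finite S \<Longrightarrow> S \<subseteq> V \<Longrightarrow> finite (inner_edges S)"
  by (rule finite_subset[OF inner_subset_touching finite_touching])

lemma finite_out_pairs: "finite S \<Longrightarrow> S \<subseteq> V \<Longrightarrow> finite (out_pairs S)"
proof -
  assume S: "finite S" "S \<subseteq> V"
  have "out_pairs S \<subseteq> Sigma S (\<lambda>x. {y. {x, y} \<in> E})" by (auto simp: out_pairs_def)
  moreover have "finite (Sigma S (\<lambda>x. {y. {x, y} \<in> E}))"
    using S finite_nbrs by (intro finite_SigmaI) auto
  ultimately show ?thesis by (rule finite_subset)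
qed

lemma exit_sum_mono:
  assumes "finite S" "S \<subseteq> V" "0 \<le> p" "p \<le> p'" "p' \<le> 1"
  shows "exit_sum p u S \<le> exit_sum p' u S"
  unfolding exit_sum_def using assms finite_inner
  by (intro sum_mono) (auto intro!: conn_exp_mono)

lemma exit_sum_aut:
  assumes "\<sigma> \<in> graph_auts V E" "finite S" "S \<subseteq> V" "u \<in> V" "0 \<le> p" "p \<le> 1"
  shows "exit_sum p (\<sigma> u) (\<sigma> ` S) \<le> exit_sum p u S"
proof -
  let ?\<tau> = "inv_into V \<sigma>"
  have \<tau>: "?\<tau> \<in> graph_auts V E" "\<And>v. v \<in> V \<Longrightarrow> ?\<tau> (\<sigma> v) = v" "\<And>v. v \<in> V \<Longrightarrow> \<sigma> (?\<tau> v) = v"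
    using aut_inv[OF assms(1)] aut_inv_eq[OF assms(1)] aut_image[OF assms(1)] f_inv_into_f[of _ \<sigma> V] by auto
  have \<tau>S: "?\<tau> ` \<sigma> ` S = S"
    unfolding image_image using \<tau>(2) assms(3) by force
  have inner: "(`) ?\<tau> ` inner_edges (\<sigma> ` S) \<subseteq> inner_edges S"
  proof (rule image_subsetI)
    fix e assume e: "e \<in> inner_edges (\<sigma> ` S)"
    then have "?\<tau> ` e \<subseteq> ?\<tau> ` \<sigma> ` S" by (intro image_mono) (auto simp: inner_edges_def)
    moreover have "?\<tau> ` e \<in> E" using e aut_edge[OF \<tau>(1)] by (auto simp: inner_edges_def)
    ultimately show "?\<tau> ` e \<in> inner_edges S" using \<tau>S by (simp add: inner_edges_def)
  qed
  have out: "out_pairs (\<sigma> ` S) \<subseteq> (\<lambda>(x, y). (\<sigma> x, \<sigma> y)) ` out_pairs S"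
  proof
    fix q assume "q \<in> out_pairs (\<sigma> ` S)"
    then obtain x y where q: "q = (x, y)" "x \<in> \<sigma> ` S" "y \<notin> \<sigma> ` S" "{x, y} \<in> E"
      by (auto simp: out_pairs_def)
    have xy: "x \<in> V" "y \<in> V" using edge_in_V[OF q(4)] by auto
    have "?\<tau> ` {x, y} \<in> E" by (rule aut_edge[OF \<tau>(1) q(4)])
    moreover have "?\<tau> x \<in> S" using q(2) \<tau>S by blast
    moreover have "?\<tau> y \<notin> S" using q(3) \<tau>(3)[OF xy(2)] by force
    ultimately have "(?\<tau> x, ?\<tau> y) \<in> out_pairs S" by (simp add: out_pairs_def)
    then have "(\<lambda>(x, y). (\<sigma> x, \<sigma> y)) (?\<tau> x, ?\<tau> y) \<in> (\<lambda>(x, y). (\<sigma> x, \<sigma> y)) ` out_pairs S" by (rule imageI)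
    then show "q \<in> (\<lambda>(x, y). (\<sigma> x, \<sigma> y)) ` out_pairs S" using q(1) \<tau>(3) xy by simp
  qed
  have \<sigma>S: "finite (\<sigma> ` S)" "\<sigma> ` S \<subseteq> V" using assms aut_in by auto
  have fin: "finite (inner_edges (\<sigma> ` S))" "finite (inner_edges S)" using \<sigma>S assms finite_inner by auto
  have le: "conn_exp (inner_edges (\<sigma> ` S)) p 1 (\<sigma> u) (\<sigma> x) \<le> conn_exp (inner_edges S) p 1 u x"
    if x: "x \<in> S" for x
  proof -
    have "conn_exp (inner_edges (\<sigma> ` S)) p 1 (\<sigma> u) (\<sigma> x)
        \<le> conn_exp ((`) ?\<tau> ` inner_edges (\<sigma> ` S)) p 1 (?\<tau> (\<sigma> u)) (?\<tau> (\<sigma> x))"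
      using fin assms \<tau> by (intro conn_exp_map_le aut_inj_edges) (auto simp: inner_edges_def)
    also have "\<dots> = conn_exp ((`) ?\<tau> ` inner_edges (\<sigma> ` S)) p 1 u x"
      using \<tau>(2) assms x by auto
    also have "\<dots> \<le> conn_exp (inner_edges S) p 1 u x"
      using fin inner assms by (intro conn_exp_mono) auto
    finally show ?thesis .
  qed
  let ?g = "\<lambda>(x, y :: 'v). conn_exp (inner_edges (\<sigma> ` S)) p 1 (\<sigma> u) x" and ?h = "\<lambda>(x, y). (\<sigma> x, \<sigma> y)"
  have "exit_sum p (\<sigma> u) (\<sigma> ` S) \<le> sum ?g (?h ` out_pairs S)"
    unfolding exit_sum_def using out assms finite_out_pairs
    by (intro sum_mono2) (auto intro!: conn_exp_nonneg)
  also have "\<dots> \<le> sum (?g \<circ> ?h) (out_pairs S)"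
    using finite_out_pairs[OF assms(2,3)] assms(5,6)
    by (intro sum_image_le) (auto intro!: conn_exp_nonneg)
  also have "\<dots> \<le> exit_sum p u S"
    unfolding exit_sum_def by (intro sum_mono) (use le in \<open>auto simp: out_pairs_def\<close>)
  finally show ?thesis .
qed

text \<open>A geodesic is cut at its first exit from \<open>S\<close> into three edge-disjoint
  pieces: a part using inner edges only, the crossing edge, and the remainder.\<close>

lemma conn_wt_exit:
  assumes "u \<in> S" "v \<notin> S" "finite S" "S \<subseteq> V" "finite w" "w \<subseteq> E"
  shows "conn_wt 1 w u v \<le> (\<Sum>(x, y)\<in>out_pairs S. disj_prod (\<lambda>w. conn_wt 1 (w \<inter> inner_edges S) u x)
     (disj_prod (\<lambda>w. of_bool ({x, y} \<in> w)) (\<lambda>w. conn_wt 1 w y v)) w)"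
    (is "_ \<le> (\<Sum>(x, y)\<in>_. ?f x y)")
proof -
  have nn: "0 \<le> ?f x y" for x y
    by (intro disj_prod_nonneg conn_wt_nonneg) (use assms in auto)
  show ?thesis
  proof (cases "(u, v) \<in> (adj_rel w)\<^sup>*")
    case True
    define n where "n = gdist w u v"
    obtain c where c: "c 0 = u" "c n = v" "inj_on c {..n}" "path_edges c 0 n \<subseteq> w"
      using geodesic True unfolding n_def by metis
    define i where "i = (LEAST i. c i \<notin> S)"
    have i: "c i \<notin> S" unfolding i_def using c(2) assms(2) by (metis (mono_tags) LeastI)
    have il: "c j \<in> S" if "j < i" for j using that not_less_Least unfolding i_def by blast
    have "i \<noteq> 0" using i c(1) assms(1) by metis
    then obtain k where k: "i = Suc k" by (cases i) auto
    have "i \<le> n" unfolding i_def using c(2) assms(2) by (intro Least_le) simp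
    then have kn: "Suc k \<le> n" using k by simp
    let ?x = "c k" and ?y = "c (Suc k)"
    let ?I = "path_edges c 0 k" and ?J = "path_edges c k (Suc k)" and ?K = "path_edges c (Suc k) n"
    have J: "?J = {{?x, ?y}}" by (auto simp: path_edges_def)
    have sub: "path_edges c i j \<subseteq> w" if "j \<le> n" for i j using that c(4) by (auto simp: path_edges_def)
    have xyE: "{?x, ?y} \<in> E" using sub[of "Suc k" k] J kn assms(6) by auto
    have xy: "(?x, ?y) \<in> out_pairs S" using xyE il[of k] i k by (simp add: out_pairs_def)
    have Iin: "?I \<subseteq> inner_edges S"
      using sub[of k 0] kn assms(6) il k by (auto simp: inner_edges_def path_edges_def)
    have dis: "?I \<inter> ?J = {}" "?I \<inter> ?K = {}" "?J \<inter> ?K = {}"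
      using kn by (auto intro!: path_edges_disjoint[OF c(3)])
    have "(u, ?x) \<in> (adj_rel ?I)\<^sup>*" using relpow_imp_rtrancl[OF path_edges_relpow[of 0 k c ?I]] c by simp
    moreover have "?I \<inter> inner_edges S = ?I" using Iin by blast
    ultimately have 1: "conn_wt 1 (?I \<inter> inner_edges S) u ?x = 1" by (simp add: conn_wt_1)
    have "(?y, v) \<in> (adj_rel ?K)\<^sup>*" using relpow_imp_rtrancl[OF path_edges_relpow[of "Suc k" n c ?K]] c kn by simp
    then have 2: "conn_wt 1 ?K ?y v = 1" by (simp add: conn_wt_1)
    have "conn_wt 1 w u v = conn_wt 1 (?I \<inter> inner_edges S) u ?x * (of_bool ({?x, ?y} \<in> ?J) * conn_wt 1 ?K ?y v)"
      using True 1 2 J by (simp add: conn_wt_1)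
    also have "\<dots> \<le> conn_wt 1 (?I \<inter> inner_edges S) u ?x
        * disj_prod (\<lambda>w. of_bool ({?x, ?y} \<in> w)) (\<lambda>w. conn_wt 1 w ?y v) (w - ?I)"
    proof (intro mult_left_mono disj_prod_ge)
      show "?J \<subseteq> w - ?I" "?K \<subseteq> w - ?I" "?J \<inter> ?K = {}" using sub[of "Suc k" k] sub[of n "Suc k"] dis kn by auto
    qed (use assms in \<open>auto intro: conn_wt_nonneg conn_wt_mono\<close>)
    also have "\<dots> \<le> ?f ?x ?y"
    proof (rule disj_prod_ge)
      show "?I \<subseteq> w" using sub[of k 0] kn by simp
      fix w w' :: "'v set set" assume "w \<subseteq> w'" "finite w'"
      then show "disj_prod (\<lambda>w. of_bool ({?x, ?y} \<in> w)) (\<lambda>w. conn_wt 1 w ?y v) w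
        \<le> (disj_prod (\<lambda>w. of_bool ({?x, ?y} \<in> w)) (\<lambda>w. conn_wt 1 w ?y v) w' :: real)"
        by (intro disj_prod_mono conn_wt_mono) auto
    qed (use assms in \<open>auto intro: conn_wt_nonneg\<close>)
    also have "\<dots> = (\<lambda>(x, y). ?f x y) (?x, ?y)" by simp
    also have "\<dots> \<le> (\<Sum>(x, y)\<in>out_pairs S. ?f x y)"
      using xy nn finite_out_pairs[OF assms(3,4)] by (intro member_le_sum) auto
    finally show ?thesis .
  next
    case False
    then show ?thesis using nn by (auto simp: conn_wt_1 intro!: sum_nonneg)
  qed
qed

lemma conn_exp_exit:
  assumes "u \<in> S" "finite S" "S \<subseteq> V" "finite L" "L \<subseteq> E" "0 \<le> p" "p \<le> 1"
  shows "conn_exp L p 1 u v \<le> of_bool (v \<in> S)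
    + (\<Sum>(x, y)\<in>out_pairs S. conn_exp (inner_edges S) p 1 u x * (p * conn_exp L p 1 y v))"
proof (cases "v \<in> S")
  case True
  have "0 \<le> (\<Sum>(x, y)\<in>out_pairs S. conn_exp (inner_edges S) p 1 u x * (p * conn_exp L p 1 y v))"
    using assms by (intro sum_nonneg) (auto intro!: mult_nonneg_nonneg conn_exp_nonneg)
  moreover have "conn_exp L p 1 u v \<le> 1" using assms by (intro conn_exp_le_1) auto
  ultimately show ?thesis using True by simp
next
  case False
  let ?a = "\<lambda>x w. conn_wt 1 (w \<inter> inner_edges S) u x" and ?b = "\<lambda>x y w. of_bool ({x, y} \<in> w) :: real"
  let ?c = "\<lambda>y w. conn_wt 1 w y v"
  have fin: "finite w" if "w \<subseteq> L" for w using that assms finite_subset by blast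
  have "conn_exp L p 1 u v \<le> bern_exp L p (\<lambda>w. \<Sum>(x, y)\<in>out_pairs S. disj_prod (?a x) (disj_prod (?b x y) (?c y)) w)"
    unfolding conn_exp_def using assms False fin by (intro bern_exp_mono conn_wt_exit) auto
  also have "\<dots> = (\<Sum>(x, y)\<in>out_pairs S. bern_exp L p (disj_prod (?a x) (disj_prod (?b x y) (?c y))))"
    by (simp add: bern_exp_sum case_prod_unfold)
  also have "\<dots> \<le> (\<Sum>(x, y)\<in>out_pairs S. conn_exp (inner_edges S) p 1 u x * (p * conn_exp L p 1 y v))"
  proof (rule sum_mono, clarify)
    fix x y
    have "bern_exp L p (disj_prod (?a x) (disj_prod (?b x y) (?c y)))
        \<le> bern_exp L p (?a x) * bern_exp L p (disj_prod (?b x y) (?c y))"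
      using assms by (intro bern_exp_disj_prod disj_prod_mono disj_prod_nonneg conn_wt_nonneg conn_wt_mono) auto
    also have "\<dots> \<le> bern_exp L p (?a x) * (bern_exp L p (?b x y) * bern_exp L p (?c y))"
      using assms by (intro mult_left_mono bern_exp_disj_prod bern_exp_nonneg conn_wt_nonneg conn_wt_mono) auto
    also have "\<dots> \<le> conn_exp (inner_edges S) p 1 u x * (p * conn_exp L p 1 y v)"
    proof -
      have "bern_exp L p (?a x) = bern_exp L p (\<lambda>w. conn_wt 1 (w \<inter> (L \<inter> inner_edges S)) u x)"
        by (intro bern_exp_cong arg_cong[where f = "\<lambda>w. conn_wt 1 w u x"]) auto
      also have "\<dots> = conn_exp (L \<inter> inner_edges S) p 1 u x"
        unfolding conn_exp_def using assms by (intro bern_exp_restrict[where f = "\<lambda>w. conn_wt 1 w u x"]) auto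
      also have "\<dots> \<le> conn_exp (inner_edges S) p 1 u x"
        using assms finite_inner by (intro conn_exp_mono) auto
      finally have "bern_exp L p (?a x) \<le> conn_exp (inner_edges S) p 1 u x" .
      moreover have "bern_exp L p (?b x y) \<le> p" using assms by (intro bern_exp_single)
      ultimately show ?thesis using assms unfolding conn_exp_def[of L]
        by (intro mult_mono bern_exp_nonneg conn_wt_nonneg mult_nonneg_nonneg) (auto intro: conn_exp_nonneg)
    qed
    finally show "bern_exp L p (disj_prod (?a x) (disj_prod (?b x y) (?c y)))
      \<le> conn_exp (inner_edges S) p 1 u x * (p * conn_exp L p 1 y v)" .
  qed
  finally show ?thesis using False by simp
qed

text \<open>A row sum is at most the size of \<open>S\<close> plus \<open>p * exit_sum\<close> times
  the largest row sum. Automorphisms carry the sets chosen for finitely many representatives to all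
  vertices, so the factor is at most some \<open>\<alpha> < 1\<close> everywhere, and in finite
  volume the inequality can be solved.\<close>

lemma row_bdd_if_exit_sum:
  assumes "0 \<le> p" "p \<le> 1" "\<And>u. u \<in> V \<Longrightarrow> \<exists>S. finite S \<and> S \<subseteq> V \<and> u \<in> S \<and> p * exit_sum p u S < 1"
  obtains K where "row_bdd p 1 K"
proof -
  obtain R where R: "finite R" "R \<subseteq> V" "\<And>v. v \<in> V \<Longrightarrow> \<exists>r\<in>R. \<exists>\<sigma>\<in>graph_auts V E. v = \<sigma> r"
    using orbit_representatives by blast
  have Rne: "R \<noteq> {}" using V_nonempty R by blast
  have "\<forall>u. \<exists>S. u \<in> V \<longrightarrow> finite S \<and> S \<subseteq> V \<and> u \<in> S \<and> p * exit_sum p u S < 1" using assms(3) by auto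
  from choice[OF this] obtain S where
    S: "\<And>u. u \<in> V \<Longrightarrow> finite (S u) \<and> S u \<subseteq> V \<and> u \<in> S u \<and> p * exit_sum p u (S u) < 1" by blast
  define K0 where "K0 = Max ((\<lambda>u. card (S u)) ` R)"
  define \<alpha> where "\<alpha> = Max (insert 0 ((\<lambda>u. p * exit_sum p u (S u)) ` R))"
  have \<alpha>: "0 \<le> \<alpha>" "\<alpha> < 1" unfolding \<alpha>_def using R S by (auto simp: Max_ge_iff Max_less_iff)
  have unif: "\<exists>S. finite S \<and> S \<subseteq> V \<and> u \<in> S \<and> card S \<le> K0 \<and> p * exit_sum p u S \<le> \<alpha>" if u: "u \<in> V" for u
  proof -
    obtain a \<sigma> where a: "a \<in> R" "\<sigma> \<in> graph_auts V E" "u = \<sigma> a" using R(3)[OF u] by blast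
    have aV: "a \<in> V" using a R by auto
    have "card (\<sigma> ` S a) \<le> card (S a)" using S[OF aV] by (intro card_image_le) auto
    also have "\<dots> \<le> K0" unfolding K0_def using R a by (intro Max_ge) auto
    finally have 1: "card (\<sigma> ` S a) \<le> K0" .
    have "p * exit_sum p u (\<sigma> ` S a) \<le> p * exit_sum p a (S a)"
      unfolding a(3) using S[OF aV] assms aV a by (intro mult_left_mono exit_sum_aut) auto
    also have "\<dots> \<le> \<alpha>" unfolding \<alpha>_def using R a by (intro Max_ge) auto
    finally have 2: "p * exit_sum p u (\<sigma> ` S a) \<le> \<alpha>" .
    show ?thesis using 1 2 S[OF aV] a aut_in[OF a(2)] by (intro exI[of _ "\<sigma> ` S a"]) auto
  qed
  have "row_bdd p 1 (K0 / (1 - \<alpha>))"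
    unfolding row_bdd_def
  proof (intro ballI allI impI)
    fix u G assume uG: "u \<in> V" "finite G \<and> G \<subseteq> V"
    have "((\<lambda>L. \<Sum>v\<in>G. conn_exp L p 1 u v) \<longlongrightarrow> (\<Sum>v\<in>G. conn_lim p 1 u v)) (finite_subsets_at_top E)"
      using assms by (intro tendsto_sum conn_lim_tendsto) auto
    then show "(\<Sum>v\<in>G. conn_lim p 1 u v) \<le> K0 / (1 - \<alpha>)"
    proof (rule lim_upper_bound)
      fix L assume L: "finite L" "L \<subseteq> E"
      define F where "F = insert u (G \<union> \<Union>L)"
      have F: "finite F" "F \<subseteq> V" "\<Union>L \<subseteq> F" "u \<in> F" "G \<subseteq> F"
        using uG L finite_Union_edges Union_edges by (auto simp: F_def)
      define Z where "Z = (\<lambda>a. \<Sum>v\<in>F. conn_exp L p 1 a v)"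
      define m where "m = Max (Z ` F)"
      have m: "Z a \<le> m" if "a \<in> F" for a unfolding m_def using F that by (intro Max_ge) auto
      have Z0: "0 \<le> Z a" for a unfolding Z_def using assms by (intro sum_nonneg conn_exp_nonneg) auto
      have m0: "0 \<le> m" using m[OF F(4)] Z0[of u] by simp
      \<comment> \<open>The crossing edge may end outside \<open>F\<close>; such a vertex meets no
        edge of \<open>L\<close>, and its row restricted to \<open>F\<close> vanishes.\<close>
      have Zm: "Z y \<le> m" for y
      proof (cases "y \<in> F")
        case False
        then have "Z y = 0" unfolding Z_def using F by (intro sum.neutral ballI conn_exp_eq_0) auto
        then show ?thesis using m0 by simp
      qed (rule m)
      have "Z a \<le> K0 + \<alpha> * m" if a: "a \<in> F" for a
      proof -
        obtain S where S: "finite S" "S \<subseteq> V" "a \<in> S" "card S \<le> K0" "p * exit_sum p a S \<le> \<alpha>"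
          using unif[of a] a F by blast
        have "Z a \<le> (\<Sum>v\<in>F. of_bool (v \<in> S)
            + (\<Sum>(x, y)\<in>out_pairs S. conn_exp (inner_edges S) p 1 a x * (p * conn_exp L p 1 y v)))"
          unfolding Z_def using S L assms by (intro sum_mono conn_exp_exit) auto
        also have "\<dots> = card (F \<inter> S) + (\<Sum>(x, y)\<in>out_pairs S. conn_exp (inner_edges S) p 1 a x * (p * Z y))"
          unfolding sum.distrib
        proof (intro arg_cong2[where f = "(+)"])
          show "(\<Sum>v\<in>F. of_bool (v \<in> S)) = real (card (F \<inter> S))" using F by simp
          show "(\<Sum>v\<in>F. \<Sum>(x, y)\<in>out_pairs S. conn_exp (inner_edges S) p 1 a x * (p * conn_exp L p 1 y v))
            = (\<Sum>(x, y)\<in>out_pairs S. conn_exp (inner_edges S) p 1 a x * (p * Z y))"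
            unfolding Z_def by (subst sum.swap) (simp add: sum_distrib_left case_prod_unfold)
        qed
        also have "\<dots> \<le> K0 + (\<Sum>(x, y)\<in>out_pairs S. conn_exp (inner_edges S) p 1 a x * (p * m))"
        proof (intro add_mono sum_mono)
          have "card (F \<inter> S) \<le> card S" using S by (intro card_mono) auto
          then show "real (card (F \<inter> S)) \<le> K0" using S by simp
        qed (use assms Zm in \<open>auto intro!: mult_left_mono conn_exp_nonneg\<close>)
        also have "(\<Sum>(x, y)\<in>out_pairs S. conn_exp (inner_edges S) p 1 a x * (p * m)) = (p * exit_sum p a S) * m"
          unfolding exit_sum_def by (simp add: sum_distrib_left sum_distrib_right case_prod_unfold mult_ac)
        also have "K0 + (p * exit_sum p a S) * m \<le> K0 + \<alpha> * m"
          using S m0 by (intro add_left_mono mult_right_mono) auto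
        finally show ?thesis .
      qed
      then have "m \<le> K0 + \<alpha> * m" unfolding m_def using F by (subst Max_le_iff) auto
      then have "m \<le> K0 / (1 - \<alpha>)" using \<alpha> by (simp add: pos_le_divide_eq algebra_simps)
      moreover have "(\<Sum>v\<in>G. conn_exp L p 1 u v) \<le> Z u"
        unfolding Z_def using F assms by (intro sum_mono2 conn_exp_nonneg) auto
      ultimately show "(\<Sum>v\<in>G. conn_exp L p 1 u v) \<le> K0 / (1 - \<alpha>)" using m[OF F(4)] by linarith
    qed
  qed
  then show ?thesis by (rule that)
qed

section \<open>Escape from a finite set\<close>

definition escapes :: "'v set \<Rightarrow> 'v set set \<Rightarrow> 'v \<Rightarrow> bool" where
  "escapes B w x \<longleftrightarrow> (\<exists>y. y \<notin> B \<and> (x, y) \<in> (adj_rel w)\<^sup>*)"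

definition escape_prob :: "'v \<Rightarrow> 'v set \<Rightarrow> real \<Rightarrow> real" where
  "escape_prob u B p = bern_exp (touching B) p (\<lambda>w. of_bool (escapes B w u))"

lemma escapes_mono: "w \<subseteq> w' \<Longrightarrow> escapes B w x \<Longrightarrow> escapes B w' x"
  unfolding escapes_def using adj_rtrancl_mono[of w w' x] by auto

lemma escapes_step: "{x, y} \<in> w \<Longrightarrow> escapes B w y \<Longrightarrow> escapes B w x"
  unfolding escapes_def using converse_rtrancl_into_rtrancl[of x y "adj_rel w"]
  by (auto simp: adj_rel_def)

text \<open>
  Exploring the clusters of the complement of \<open>B\<close> reveals the set \<open>S\<close> of vertices that do not escape,
  but none of the edges inside \<open>S\<close>.
\<close>

lemma escape_prob_derivative:
  assumes "u \<in> B" "finite B" "B \<subseteq> V" "0 \<le> p" "p \<le> 1"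
    and m: "0 \<le> m" "\<And>S. finite S \<Longrightarrow> S \<subseteq> V \<Longrightarrow> u \<in> S \<Longrightarrow> m \<le> exit_sum p u S"
  shows "\<exists>D. (escape_prob u B has_real_derivative D) (at p) \<and> m * (1 - escape_prob u B p) \<le> D"
proof -
  define L where "L = touching B"
  have L: "finite L" "L \<subseteq> E" unfolding L_def using finite_touching assms by (auto simp: touching_def)
  define f where "f = (\<lambda>w. of_bool (escapes B w u) :: real)"
  define S where "S = (\<lambda>w. {x \<in> B. \<not> escapes B w x})"
  define \<tau> where "\<tau> = (\<lambda>w. {e \<in> L. \<not> e \<subseteq> S w})"
  let ?D = "\<Sum>e\<in>L. bern_exp L p (\<lambda>w. f (insert e w)) - bern_exp L p (\<lambda>w. f (w - {e}))"
  have fm: "f w \<le> f w'" if "w \<subseteq> w'" for w w' using escapes_mono[OF that] by (auto simp: f_def)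
  have S_fin: "finite (S w)" "S w \<subseteq> B" "S w \<subseteq> V" for w using assms by (auto simp: S_def)
  have der: "(escape_prob u B has_real_derivative ?D) (at p)"
    unfolding escape_prob_def[abs_def] f_def L_def using bern_exp_russo finite_touching assms by blast
  have stopS: "S w' = S w" if w: "w \<subseteq> L" "w' \<subseteq> L" "w \<inter> \<tau> w = w' \<inter> \<tau> w" for w w'
  proof -
    have "x \<in> S w" if "x \<in> S w'" for x
    proof (rule ccontr)
      assume "x \<notin> S w"
      then have "escapes B w x" using that by (simp add: S_def)
      then obtain y where y: "y \<notin> B" "(x, y) \<in> (adj_rel w)\<^sup>*" by (auto simp: escapes_def)
      from y(2) have "escapes B w' x"
      proof (induction rule: converse_rtrancl_induct)
        case base show ?case using y by (auto simp: escapes_def)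
      next
        case (step a b)
        have ab: "{a, b} \<in> w" using step by (simp add: adj_rel_def)
        have "escapes B w b" using step y by (auto simp: escapes_def)
        then have "b \<notin> S w" by (simp add: S_def)
        then have "{a, b} \<in> w \<inter> \<tau> w" using ab w by (auto simp: \<tau>_def)
        then have "{a, b} \<in> w'" using w(3) by blast
        then show ?case using step.IH by (rule escapes_step)
      qed
      then show False using that by (simp add: S_def)
    qed
    moreover have "x \<in> S w'" if x: "x \<in> S w" for x
    proof -
      have "z \<in> S w" if "(x, z) \<in> (adj_rel w')\<^sup>*" for z
        using that
      proof (induction rule: rtrancl_induct)
        case (step a b)
        show ?case
        proof (rule ccontr)
          assume b: "b \<notin> S w"
          have "{a, b} \<in> w'" using step by (simp add: adj_rel_def)
          then have "{a, b} \<in> w' \<inter> \<tau> w" using b w by (auto simp: \<tau>_def)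
          then have "{a, b} \<in> w" using w(3) by blast
          moreover have "escapes B w b"
            using b by (cases "b \<in> B") (auto simp: S_def escapes_def)
          ultimately have "escapes B w a" by (rule escapes_step)
          then show False using step.IH by (simp add: S_def)
        qed
      qed (rule x)
      then show ?thesis using x by (auto simp: S_def escapes_def)
    qed
    ultimately show ?thesis by blast
  qed
  have stop: "\<tau> w' = \<tau> w" if "w \<subseteq> L" "w' \<subseteq> L" "w \<inter> \<tau> w = w' \<inter> \<tau> w" for w w'
    using stopS[OF that] by (simp add: \<tau>_def)
  define F where "F = (\<lambda>A C. of_bool (u \<in> S A) * (\<Sum>(x, y)\<in>out_pairs (S A). conn_wt 1 C u x) :: real)"
  have S\<tau>: "S (w \<inter> \<tau> w) = S w" if "w \<subseteq> L" for w
    by (rule stopS) (use that in auto)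
  have pt: "F (w \<inter> \<tau> w) (w - \<tau> w) \<le> (\<Sum>e\<in>L. f (insert e w) - f (w - {e}))" if w: "w \<subseteq> L" for w
  proof (cases "u \<in> S w")
    case False
    then show ?thesis using S\<tau>[OF w] fm by (auto simp: F_def intro!: sum_nonneg simp: subset_insertI2)
  next
    case True
    let ?h = "\<lambda>(x, y). {x, y}"
    have "F (w \<inter> \<tau> w) (w - \<tau> w) \<le> (\<Sum>(x, y)\<in>out_pairs (S w). conn_wt 1 w u x)"
      using True S\<tau>[OF w] by (auto simp: F_def intro!: sum_mono conn_wt_mono)
    \<comment> \<open>If \<open>u\<close> reaches \<open>x\<close>, the edge \<open>{x, y}\<close>
      is pivotal: \<open>y\<close> lies outside \<open>S w\<close> and escapes already, so opening
      the edge lets \<open>u\<close> escape, whereas \<open>u\<close> itself is in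
      \<open>S w\<close> and does not escape without it.\<close>
    also have "\<dots> \<le> (\<Sum>q\<in>out_pairs (S w). f (insert (?h q) w) - f (w - {?h q}))"
    proof (rule sum_mono, clarify)
      fix x y assume xy: "(x, y) \<in> out_pairs (S w)"
      show "conn_wt 1 w u x \<le> f (insert {x, y} w) - f (w - {{x, y}})"
      proof (cases "(u, x) \<in> (adj_rel w)\<^sup>*")
        case True
        let ?w = "insert {x, y} w"
        have "y \<notin> S w" using xy by (auto simp: out_pairs_def)
        then have "escapes B w y" by (cases "y \<in> B") (auto simp: S_def escapes_def)
        then have "escapes B ?w y" by (rule escapes_mono[rotated]) auto
        then have "escapes B ?w x" by (rule escapes_step[rotated]) simp
        moreover have "(u, x) \<in> (adj_rel ?w)\<^sup>*" using True by (rule adj_rtrancl_mono[rotated]) auto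
        ultimately have "escapes B ?w u" unfolding escapes_def by (meson rtrancl_trans)
        moreover have "\<not> escapes B (w - {{x, y}}) u"
          using \<open>u \<in> S w\<close> escapes_mono[of "w - {{x, y}}" w] by (auto simp: S_def)
        ultimately show ?thesis using True by (simp add: f_def conn_wt_1)
      next
        case False
        have "f (w - {{x, y}}) \<le> f (insert {x, y} w)" by (rule fm) auto
        then show ?thesis using False by (simp add: conn_wt_1)
      qed
    qed
    also have "\<dots> = (\<Sum>e\<in>?h ` out_pairs (S w). f (insert e w) - f (w - {e}))"
    proof (rule sum.reindex[symmetric, unfolded o_def])
      show "inj_on ?h (out_pairs (S w))"
        by (auto simp: inj_on_def out_pairs_def doubleton_eq_iff)
    qed
    also have "\<dots> \<le> (\<Sum>e\<in>L. f (insert e w) - f (w - {e}))"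
    proof (rule sum_mono2)
      show "?h ` out_pairs (S w) \<subseteq> L"
        using S_fin(2)[of w] by (auto simp: out_pairs_def L_def touching_def)
    qed (use L fm in \<open>auto simp: subset_insertI2\<close>)
    finally show ?thesis .
  qed
  have "m * (1 - escape_prob u B p) = bern_exp L p (\<lambda>w1. of_bool (u \<in> S w1) * m)"
  proof -
    have "1 - escape_prob u B p = bern_exp L p (\<lambda>w. 1) - bern_exp L p f"
      using L by (simp add: escape_prob_def f_def L_def bern_exp_const)
    also have "\<dots> = bern_exp L p (\<lambda>w. 1 - f w)" by (simp add: bern_exp_diff)
    also have "\<dots> = bern_exp L p (\<lambda>w. of_bool (u \<in> S w))"
      using assms by (intro bern_exp_cong) (auto simp: f_def S_def)
    finally show ?thesis by (simp add: bern_exp_cmult_right)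
  qed
  \<comment> \<open>The edges inside \<open>S w1\<close> are exactly those not in
    \<open>\<tau> w1\<close>. A fresh copy on them has conditional mean
    \<open>exit_sum p u (S w1)\<close>, which is at least \<open>m\<close>.\<close>
  also have "\<dots> \<le> bern_exp L p (\<lambda>w1. bern_exp L p (\<lambda>w2. F (w1 \<inter> \<tau> w1) (w2 - \<tau> w1)))"
  proof (intro bern_exp_mono assms)
    fix w1 assume w1: "w1 \<subseteq> L"
    show "of_bool (u \<in> S w1) * m \<le> bern_exp L p (\<lambda>w2. F (w1 \<inter> \<tau> w1) (w2 - \<tau> w1))"
    proof (cases "u \<in> S w1")
      case True
      have inn: "inner_edges (S w1) \<subseteq> L"
        using inner_subset_touching[of "S w1"] S_fin(2)[of w1] by (auto simp: L_def touching_def)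
      have "m \<le> exit_sum p u (S w1)" using S_fin True by (intro m) auto
      also have "\<dots> = (\<Sum>(x, y)\<in>out_pairs (S w1). bern_exp L p (\<lambda>w2. conn_wt 1 (w2 \<inter> inner_edges (S w1)) u x))"
        unfolding exit_sum_def conn_exp_def using bern_exp_restrict[OF L(1) inn, where f = "\<lambda>w. conn_wt 1 w u _"]
        by simp
      also have "\<dots> = bern_exp L p (\<lambda>w2. \<Sum>(x, y)\<in>out_pairs (S w1). conn_wt 1 (w2 \<inter> inner_edges (S w1)) u x)"
        by (simp add: bern_exp_sum case_prod_unfold)
      also have "\<dots> = bern_exp L p (\<lambda>w2. F (w1 \<inter> \<tau> w1) (w2 - \<tau> w1))"
      proof (rule bern_exp_cong)
        fix w2 assume "w2 \<subseteq> L"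
        then have "w2 \<inter> inner_edges (S w1) = w2 - \<tau> w1" using L by (auto simp: \<tau>_def inner_edges_def)
        then show "(\<Sum>(x, y)\<in>out_pairs (S w1). conn_wt 1 (w2 \<inter> inner_edges (S w1)) u x) = F (w1 \<inter> \<tau> w1) (w2 - \<tau> w1)"
          using True S\<tau>[OF w1] by (simp add: F_def)
      qed
      finally show ?thesis using True by simp
    next
      case False
      then show ?thesis using assms
        by (auto intro!: bern_exp_nonneg mult_nonneg_nonneg sum_nonneg conn_wt_nonneg simp: F_def)
    qed
  qed
  also have "\<dots> = bern_exp L p (\<lambda>w. F (w \<inter> \<tau> w) (w - \<tau> w))"
    by (rule bern_exp_explore[symmetric, OF L(1) _ stop]) (auto simp: \<tau>_def)
  also have "\<dots> \<le> bern_exp L p (\<lambda>w. \<Sum>e\<in>L. f (insert e w) - f (w - {e}))"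
    by (intro bern_exp_mono assms pt)
  also have "\<dots> = ?D" by (simp add: bern_exp_sum bern_exp_diff)
  finally show ?thesis using der by blast
qed

text \<open>The derivative is at least one minus the escape probability at every density above
  \<open>p0\<close>, because \<open>exit_sum\<close> increases with the density. One application of
  the mean value theorem integrates this; the bound is uniform in \<open>B\<close>.\<close>

lemma escape_prob_lower:
  assumes "u \<in> B" "finite B" "B \<subseteq> V" "0 < p0" "p0 < p" "p \<le> 1"
    and "\<And>S. finite S \<Longrightarrow> S \<subseteq> V \<Longrightarrow> u \<in> S \<Longrightarrow> 1 \<le> p0 * exit_sum p0 u S"
  shows "(p - p0) / (1 + (p - p0)) \<le> escape_prob u B p"
proof -
  have one: "1 \<le> exit_sum \<xi> u S" if "p0 \<le> \<xi>" "\<xi> \<le> 1" "finite S" "S \<subseteq> V" "u \<in> S" for \<xi> S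
  proof -
    have e0: "0 \<le> exit_sum p0 u S"
      unfolding exit_sum_def using assms by (intro sum_nonneg) (auto intro!: conn_exp_nonneg)
    have "1 \<le> p0 * exit_sum p0 u S" using that by (intro assms(7))
    also have "\<dots> \<le> 1 * exit_sum p0 u S" using assms e0 by (intro mult_right_mono) auto
    also have "\<dots> \<le> exit_sum \<xi> u S" using exit_sum_mono[of S p0 \<xi> u] that assms by simp
    finally show ?thesis .
  qed
  have ex: "\<exists>D. (escape_prob u B has_real_derivative D) (at \<xi>) \<and> 1 * (1 - escape_prob u B \<xi>) \<le> D"
    if "p0 \<le> \<xi>" "\<xi> \<le> p" for \<xi>
    using that assms one by (intro escape_prob_derivative) auto
  define D where "D = (\<lambda>\<xi>. SOME D. (escape_prob u B has_real_derivative D) (at \<xi>) \<and> 1 * (1 - escape_prob u B \<xi>) \<le> D)"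
  have D: "(escape_prob u B has_real_derivative D \<xi>) (at \<xi>)" "1 - escape_prob u B \<xi> \<le> D \<xi>"
    if "p0 \<le> \<xi>" "\<xi> \<le> p" for \<xi>
    using someI_ex[OF ex[OF that]] by (simp_all add: D_def)
  obtain \<xi> where \<xi>: "p0 < \<xi>" "\<xi> < p" "escape_prob u B p - escape_prob u B p0 = (p - p0) * D \<xi>"
    using MVT2[OF assms(5), of "escape_prob u B" D] D(1) by auto
  have L: "finite (touching B)" using finite_touching assms by blast
  have "escape_prob u B \<xi> \<le> escape_prob u B p"
    unfolding escape_prob_def using L \<xi> assms escapes_mono by (intro bern_exp_mono_p) auto
  then have "(p - p0) * (1 - escape_prob u B p) \<le> (p - p0) * D \<xi>"
    using D(2)[of \<xi>] \<xi> assms by (intro mult_left_mono) auto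
  moreover have "0 \<le> escape_prob u B p0"
    unfolding escape_prob_def using assms by (intro bern_exp_nonneg) auto
  ultimately have "(p - p0) * (1 - escape_prob u B p) \<le> escape_prob u B p" using \<xi> by linarith
  then show ?thesis using assms by (simp add: pos_divide_le_eq algebra_simps)
qed

end

section \<open>Infinite volume percolation\<close>

context qt_graph
begin

lemma prob_space_percolation: "prob_space (percolation E p)"
  unfolding percolation_def by (intro prob_space_PiM measure_pmf.prob_space_axioms)

lemma percolation_cylinder:
  assumes "finite J" "J \<subseteq> E"
  shows "measure (percolation E p) {\<omega> \<in> space (percolation E p). \<forall>e\<in>J. \<omega> e \<in> S e}
    = (\<Prod>e\<in>J. measure (measure_pmf (bernoulli_pmf p)) (S e))"
proof -
  interpret P: product_prob_space "\<lambda>_::'v set. measure_pmf (bernoulli_pmf p)" E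
    by unfold_locales
  have "emeasure (percolation E p) {\<omega> \<in> space (percolation E p). \<forall>e\<in>J. \<omega> e \<in> S e}
    = (\<Prod>e\<in>J. emeasure (measure_pmf (bernoulli_pmf p)) (S e))"
    unfolding percolation_def using assms by (intro P.emeasure_PiM_Collect) auto
  also have "\<dots> = ennreal (\<Prod>e\<in>J. measure (measure_pmf (bernoulli_pmf p)) (S e))"
    by (simp add: measure_pmf.emeasure_eq_measure prod_ennreal)
  finally show ?thesis by (simp add: measure_def prod_nonneg)
qed

lemma sets_edge_event:
  assumes "e \<in> E"
  shows "{\<omega> \<in> space (percolation E p). \<omega> e \<in> S} \<in> sets (percolation E p)"
proof -
  have "(\<lambda>\<omega>. \<omega> e) \<in> measurable (percolation E p) (measure_pmf (bernoulli_pmf p))"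
    unfolding percolation_def using assms by measurable
  from measurable_sets[OF this, of S] show ?thesis by (simp add: vimage_def Int_def conj_commute)
qed

lemma percolation_finite_event:
  assumes "finite L" "L \<subseteq> E" "0 \<le> p" "p \<le> 1"
  shows "{\<omega> \<in> space (percolation E p). P {e \<in> L. \<omega> e}} \<in> sets (percolation E p)"
    and "measure (percolation E p) {\<omega> \<in> space (percolation E p). P {e \<in> L. \<omega> e}}
      = bern_exp L p (\<lambda>w. of_bool (P w))"
proof -
  let ?M = "percolation E p"
  interpret prob_space ?M by (rule prob_space_percolation)
  define W where "W = {w \<in> Pow L. P w}"
  define B where "B = (\<lambda>w. {\<omega> \<in> space ?M. \<forall>e\<in>L. \<omega> e \<in> {e \<in> w}})"
  have finW: "finite W" using assms by (simp add: W_def)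
  have B_iff: "\<omega> \<in> B w \<longleftrightarrow> \<omega> \<in> space ?M \<and> {e \<in> L. \<omega> e} = w" if "w \<subseteq> L" for w \<omega>
    using that by (auto simp: B_def)
  have Bsets: "B w \<in> sets ?M" for w
  proof (cases "L = {}")
    case False
    then show ?thesis
      unfolding B_def using assms by (intro sets.sets_Collect_finite_All' sets_edge_event) auto
  qed (simp add: B_def)
  have eq: "{\<omega> \<in> space ?M. P {e \<in> L. \<omega> e}} = (\<Union>w\<in>W. B w)"
  proof (intro set_eqI iffI)
    fix \<omega> assume "\<omega> \<in> {\<omega> \<in> space ?M. P {e \<in> L. \<omega> e}}"
    then have "{e \<in> L. \<omega> e} \<in> W" "\<omega> \<in> B {e \<in> L. \<omega> e}" by (auto simp: W_def B_iff)
    then show "\<omega> \<in> (\<Union>w\<in>W. B w)" by blast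
  next
    fix \<omega> assume "\<omega> \<in> (\<Union>w\<in>W. B w)"
    then obtain w where "w \<subseteq> L" "P w" "\<omega> \<in> B w" by (auto simp: W_def)
    then show "\<omega> \<in> {\<omega> \<in> space ?M. P {e \<in> L. \<omega> e}}" using B_iff[of w \<omega>] by auto
  qed
  show "{\<omega> \<in> space ?M. P {e \<in> L. \<omega> e}} \<in> sets ?M"
    unfolding eq using finW Bsets by (intro sets.finite_UN) auto
  have "measure ?M (\<Union>w\<in>W. B w) = (\<Sum>w\<in>W. measure ?M (B w))"
  proof (rule finite_measure_finite_Union[OF finW])
    show "B ` W \<subseteq> sets ?M" using Bsets by auto
    show "disjoint_family_on B W"
      by (auto simp: disjoint_family_on_def W_def B_iff)
  qed
  also have "\<dots> = (\<Sum>w\<in>W. bern_wt L p w)"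
  proof (rule sum.cong[OF refl])
    fix w assume "w \<in> W"
    then have w: "w \<subseteq> L" by (simp add: W_def)
    have "measure ?M (B w) = (\<Prod>e\<in>L. measure (measure_pmf (bernoulli_pmf p)) {e \<in> w})"
      unfolding B_def by (rule percolation_cylinder[OF assms(1,2)])
    also have "\<dots> = (\<Prod>e\<in>L. if e \<in> w then p else 1 - p)"
      using assms by (intro prod.cong) (auto simp: measure_pmf_single)
    also have "\<dots> = p ^ card w * (1 - p) ^ card (L - w)"
    proof -
      have "L \<inter> {e. e \<in> w} = w" "L \<inter> - {e. e \<in> w} = L - w" using w by auto
      then show ?thesis using assms(1) by (simp add: prod.If_cases)
    qed
    finally show "measure ?M (B w) = bern_wt L p w" by (simp add: bern_wt_def)
  qed
  also have "\<dots> = (\<Sum>w\<in>Pow L. if P w then bern_wt L p w else 0)"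
    unfolding W_def using assms(1) by (intro sum.inter_filter) simp
  also have "\<dots> = bern_exp L p (\<lambda>w. of_bool (P w))"
    unfolding bern_exp_def by (intro sum.cong) auto
  finally show "measure ?M {\<omega> \<in> space ?M. P {e \<in> L. \<omega> e}} = bern_exp L p (\<lambda>w. of_bool (P w))"
    using eq by simp
qed

lemma rtrancl_finite_support:
  "(u, v) \<in> (adj_rel w)\<^sup>* \<longleftrightarrow> (\<exists>L. finite L \<and> L \<subseteq> w \<and> (u, v) \<in> (adj_rel L)\<^sup>*)"
proof
  assume "(u, v) \<in> (adj_rel w)\<^sup>*"
  from relpow_path_set[OF gdist_relpow[OF this]] obtain A where
    "A \<subseteq> w" "finite A" "(u, v) \<in> adj_rel A ^^ gdist w u v" by blast
  then show "\<exists>L. finite L \<and> L \<subseteq> w \<and> (u, v) \<in> (adj_rel L)\<^sup>*"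
    using relpow_imp_rtrancl by (intro exI[of _ A]) auto
next
  assume "\<exists>L. finite L \<and> L \<subseteq> w \<and> (u, v) \<in> (adj_rel L)\<^sup>*"
  then obtain L where "L \<subseteq> w" "(u, v) \<in> (adj_rel L)\<^sup>*" by auto
  then show "(u, v) \<in> (adj_rel w)\<^sup>*" by (rule adj_rtrancl_mono)
qed

text \<open>A connection is witnessed by one of countably many finite edge sets. Measure space and
  edge set are left general, because the zero-one law needs this for the events determined by all
  but finitely many edges.\<close>

lemma sets_connection:
  assumes "E' \<subseteq> E" and N: "\<And>e. e \<in> E' \<Longrightarrow> {\<omega> \<in> space N. \<omega> e} \<in> sets N"
  shows "{\<omega> \<in> space N. (u, v) \<in> (adj_rel {e \<in> E'. \<omega> e})\<^sup>*} \<in> sets N"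
proof -
  let ?I = "{L. finite L \<and> L \<subseteq> E' \<and> (u, v) \<in> (adj_rel L)\<^sup>*}"
  have "countable E'" using countable_subset[OF assms(1) countable_E] .
  then have "countable {L. finite L \<and> L \<subseteq> E'}" by (rule countable_Collect_finite_subset)
  then have I: "countable ?I" by (rule countable_subset[rotated]) auto
  have "{\<omega> \<in> space N. (u, v) \<in> (adj_rel {e \<in> E'. \<omega> e})\<^sup>*} = {\<omega> \<in> space N. \<exists>L\<in>?I. \<forall>e\<in>L. \<omega> e}"
    unfolding rtrancl_finite_support[of u v "{e \<in> E'. _ e}"] by blast
  moreover have "{\<omega> \<in> space N. \<exists>L\<in>?I. \<forall>e\<in>L. \<omega> e} \<in> sets N"
  proof (rule sets.sets_Collect_countable_Ex'[OF _ I])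
    fix L assume L: "L \<in> ?I"
    show "{\<omega> \<in> space N. \<forall>e\<in>L. \<omega> e} \<in> sets N"
      using L N by (cases "L = {}") (auto intro!: sets.sets_Collect_finite_All')
  qed
  ultimately show ?thesis by simp
qed

lemma sets_infinite_cluster:
  assumes "E' \<subseteq> E" and N: "\<And>e. e \<in> E' \<Longrightarrow> {\<omega> \<in> space N. \<omega> e} \<in> sets N"
  shows "{\<omega> \<in> space N. infinite {z \<in> V. (v, z) \<in> (adj_rel {e \<in> E'. \<omega> e})\<^sup>*}} \<in> sets N"
proof -
  have inf: "infinite {z \<in> V. P z} \<longleftrightarrow> (\<forall>G\<in>{G. finite G \<and> G \<subseteq> V}. \<exists>z\<in>V - G. P z)" for P
  proof
    assume "infinite {z \<in> V. P z}"
    then show "\<forall>G\<in>{G. finite G \<and> G \<subseteq> V}. \<exists>z\<in>V - G. P z"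
      by (metis (mono_tags, lifting) DiffI finite_subset mem_Collect_eq subsetI)
  next
    assume *: "\<forall>G\<in>{G. finite G \<and> G \<subseteq> V}. \<exists>z\<in>V - G. P z"
    show "infinite {z \<in> V. P z}"
    proof
      assume "finite {z \<in> V. P z}"
      then show False using *[rule_format, of "{z \<in> V. P z}"] by auto
    qed
  qed
  have c: "countable {G. finite G \<and> G \<subseteq> V}" by (rule countable_Collect_finite_subset[OF countable_V])
  show ?thesis
    unfolding inf
  proof (rule sets.sets_Collect_countable_All'[OF _ c])
    fix G assume "G \<in> {G. finite G \<and> G \<subseteq> V}"
    show "{\<omega> \<in> space N. \<exists>z\<in>V - G. (v, z) \<in> (adj_rel {e \<in> E'. \<omega> e})\<^sup>*} \<in> sets N"
      using countable_V by (intro sets.sets_Collect_countable_Ex' sets_connection assms) auto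
  qed
qed

lemma exhaustion_E:
  obtains Ln :: "nat \<Rightarrow> 'v set set" where "\<And>n. finite (Ln n)" "incseq Ln" "(\<Union>n. Ln n) = E"
proof -
  obtain f :: "'v set \<Rightarrow> nat" where f: "inj_on f E" using countable_E by (auto simp: countable_def)
  define Ln where "Ln = (\<lambda>n. {e \<in> E. f e < n})"
  have "finite (Ln n)" for n
  proof (rule finite_imageD)
    show "finite (f ` Ln n)" by (rule finite_subset[of _ "{..<n}"]) (auto simp: Ln_def)
    show "inj_on f (Ln n)" by (rule inj_on_subset[OF f]) (auto simp: Ln_def)
  qed
  moreover have "incseq Ln" by (auto simp: incseq_def Ln_def)
  moreover have "(\<Union>n. Ln n) = E" by (auto simp: Ln_def)
  ultimately show ?thesis by (rule that)
qed

lemma finite_subset_incseq: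
  assumes "incseq A" "finite L" "L \<subseteq> (\<Union>n. A n)"
  shows "\<exists>n :: nat. L \<subseteq> A n"
  using assms(2,3)
proof (induction L rule: finite_induct)
  case (insert x L)
  then obtain n m where "L \<subseteq> A n" "x \<in> A m" by auto
  then have "insert x L \<subseteq> A (max n m)"
    using incseqD[OF assms(1), of n "max n m"] incseqD[OF assms(1), of m "max n m"] by auto
  then show ?case by blast
qed simp

lemma two_point_eq:
  assumes "0 \<le> p" "p \<le> 1"
  shows "two_point E p u v = ennreal (conn_lim p 1 u v)"
    and "{\<omega> \<in> space (percolation E p). open_connected E \<omega> u v} \<in> sets (percolation E p)"
proof -
  let ?M = "percolation E p"
  interpret prob_space ?M by (rule prob_space_percolation)
  obtain Ln :: "nat \<Rightarrow> 'v set set" where Ln: "\<And>n. finite (Ln n)" "incseq Ln" "(\<Union>n. Ln n) = E"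
    using exhaustion_E by blast
  have LE: "Ln n \<subseteq> E" for n using Ln by blast
  define C where "C = (\<lambda>n. {\<omega> \<in> space ?M. (u, v) \<in> (adj_rel {e \<in> Ln n. \<omega> e})\<^sup>*})"
  have C: "C n \<in> sets ?M" "measure ?M (C n) = conn_exp (Ln n) p 1 u v" for n
    using percolation_finite_event[OF Ln(1) LE assms, where P = "\<lambda>w. (u, v) \<in> (adj_rel w)\<^sup>*"]
    by (auto simp: C_def conn_exp_def conn_wt_1)
  have inc: "incseq C"
    unfolding incseq_def C_def using incseqD[OF Ln(2)]
    by (auto intro: adj_rtrancl_mono[rotated])
  have eq: "{\<omega> \<in> space ?M. open_connected E \<omega> u v} = (\<Union>n. C n)"
  proof (intro set_eqI iffI)
    fix \<omega> assume "\<omega> \<in> {\<omega> \<in> space ?M. open_connected E \<omega> u v}"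
    then have w: "\<omega> \<in> space ?M" "(u, v) \<in> (adj_rel {e \<in> E. \<omega> e})\<^sup>*"
      by (auto simp: open_connected_def open_edges_def)
    then obtain L where L: "finite L" "L \<subseteq> {e \<in> E. \<omega> e}" "(u, v) \<in> (adj_rel L)\<^sup>*"
      using rtrancl_finite_support[of u v "{e \<in> E. \<omega> e}"] by blast
    then obtain n where "L \<subseteq> Ln n" using finite_subset_incseq[OF Ln(2), of L] Ln(3) by blast
    then have "(u, v) \<in> (adj_rel {e \<in> Ln n. \<omega> e})\<^sup>*" using L by (intro adj_rtrancl_mono[OF _ L(3)]) auto
    then show "\<omega> \<in> (\<Union>n. C n)" using w by (auto simp: C_def)
  next
    fix \<omega> assume "\<omega> \<in> (\<Union>n. C n)"
    then obtain n where n: "\<omega> \<in> space ?M" "(u, v) \<in> (adj_rel {e \<in> Ln n. \<omega> e})\<^sup>*" by (auto simp: C_def)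
    then have "(u, v) \<in> (adj_rel {e \<in> E. \<omega> e})\<^sup>*" using LE[of n] by (intro adj_rtrancl_mono[OF _ n(2)]) auto
    then show "\<omega> \<in> {\<omega> \<in> space ?M. open_connected E \<omega> u v}"
      using n by (simp add: open_connected_def open_edges_def)
  qed
  show "{\<omega> \<in> space ?M. open_connected E \<omega> u v} \<in> sets ?M" unfolding eq using C by blast
  have "two_point E p u v = (SUP n. emeasure ?M (C n))"
    unfolding two_point_def eq using C inc by (intro SUP_emeasure_incseq[symmetric]) auto
  also have "\<dots> = (SUP n. ennreal (conn_exp (Ln n) p 1 u v))"
    using C by (simp add: emeasure_eq_measure)
  also have "\<dots> = ennreal (conn_lim p 1 u v)"
  proof (rule antisym)
    show "(SUP n. ennreal (conn_exp (Ln n) p 1 u v)) \<le> ennreal (conn_lim p 1 u v)"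
      using Ln LE assms by (intro SUP_least ennreal_leI conn_lim_upper) auto
    have fin: "(SUP n. ennreal (conn_exp (Ln n) p 1 u v)) \<le> 1"
      using Ln assms by (intro SUP_least) (auto intro: conn_exp_le_1)
    have "conn_lim p 1 u v \<le> enn2real (SUP n. ennreal (conn_exp (Ln n) p 1 u v))"
    proof (rule conn_lim_least)
      fix L assume L: "finite L" "L \<subseteq> E"
      then obtain n where n: "L \<subseteq> Ln n" using finite_subset_incseq[OF Ln(2), of L] Ln(3) by blast
      have "ennreal (conn_exp L p 1 u v) \<le> ennreal (conn_exp (Ln n) p 1 u v)"
        using n Ln assms by (intro ennreal_leI conn_exp_mono) auto
      also have "\<dots> \<le> (SUP n. ennreal (conn_exp (Ln n) p 1 u v))" by (rule SUP_upper) simp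
      finally have "enn2real (ennreal (conn_exp L p 1 u v)) \<le> enn2real (SUP n. ennreal (conn_exp (Ln n) p 1 u v))"
        using fin by (intro enn2real_mono) (auto intro: le_less_trans)
      then show "conn_exp L p 1 u v \<le> enn2real (SUP n. ennreal (conn_exp (Ln n) p 1 u v))"
        using assms conn_exp_nonneg[of p 1 L u v] by simp
    qed
    then have "ennreal (conn_lim p 1 u v) \<le> ennreal (enn2real (SUP n. ennreal (conn_exp (Ln n) p 1 u v)))"
      by (rule ennreal_leI)
    also have "\<dots> = (SUP n. ennreal (conn_exp (Ln n) p 1 u v))"
      using fin by (intro ennreal_enn2real) (auto intro: le_less_trans)
    finally show "ennreal (conn_lim p 1 u v) \<le> (SUP n. ennreal (conn_exp (Ln n) p 1 u v))" .
  qed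
  finally show "two_point E p u v = ennreal (conn_lim p 1 u v)" .
qed

lemma cluster_eq: "cluster V E \<omega> v = {z \<in> V. (v, z) \<in> (adj_rel {e \<in> E. \<omega> e})\<^sup>*}"
  by (simp add: cluster_def open_connected_def open_edges_def)

lemma sets_cluster_infinite:
  "{\<omega> \<in> space (percolation E p). infinite (cluster V E \<omega> v)} \<in> sets (percolation E p)"
  unfolding cluster_eq using sets_edge_event[of _ p "{True}"] by (intro sets_infinite_cluster) auto

text \<open>Borel-Cantelli: the probabilities that \<open>v\<close> is connected to the successive
  vertices are summable.\<close>

lemma AE_finite_cluster:
  assumes "row_bdd p 1 K" "0 \<le> p" "p \<le> 1" "v \<in> V" "infinite V"
  shows "AE \<omega> in percolation E p. finite (cluster V E \<omega> v)"
proof -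
  let ?M = "percolation E p"
  interpret prob_space ?M by (rule prob_space_percolation)
  let ?g = "from_nat_into V"
  have bij: "bij_betw ?g UNIV V" using countable_V assms(5) by (rule bij_betw_from_nat_into)
  have gV: "?g n \<in> V" for n using bij by (auto simp: bij_betw_def)
  have inj: "inj ?g" using bij by (simp add: bij_betw_def)
  define A where "A = (\<lambda>n. {\<omega> \<in> space ?M. open_connected E \<omega> v (?g n)})"
  have A: "A n \<in> sets ?M" for n using two_point_eq(2)[OF assms(2,3)] by (simp add: A_def)
  have mA: "measure ?M (A n) = conn_lim p 1 v (?g n)" for n
    using two_point_eq(1)[OF assms(2,3), of v "?g n"] assms
    by (simp add: two_point_def A_def measure_def conn_lim_nonneg)
  have "summable (\<lambda>n. measure ?M (A n))"
  proof (rule bounded_imp_summable)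
    show "0 \<le> measure ?M (A n)" for n by simp
    show "(\<Sum>k\<le>n. measure ?M (A k)) \<le> K" for n
    proof -
      have "(\<Sum>k\<le>n. measure ?M (A k)) = (\<Sum>z\<in>?g ` {..n}. conn_lim p 1 v z)"
        unfolding mA by (subst sum.reindex) (auto intro: inj_on_subset[OF inj])
      also have "\<dots> \<le> K" using gV assms by (intro row_bddD[OF assms(1)]) auto
      finally show ?thesis .
    qed
  qed
  then have "AE \<omega> in ?M. eventually (\<lambda>n. \<omega> \<in> space ?M - A n) sequentially"
    using A by (intro borel_cantelli_AE1) (auto simp: less_top[symmetric])
  then show ?thesis
  proof eventually_elim
    case (elim \<omega>)
    then obtain N where N: "\<And>n. N \<le> n \<Longrightarrow> \<omega> \<in> space ?M - A n" by (auto simp: eventually_sequentially)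
    have "cluster V E \<omega> v \<subseteq> ?g ` {..<N}"
    proof
      fix z assume z: "z \<in> cluster V E \<omega> v"
      then obtain n where n: "z = ?g n" using bij by (auto simp: cluster_def bij_betw_def)
      have "n < N"
      proof (rule ccontr)
        assume "\<not> n < N"
        then have "\<omega> \<in> space ?M - A n" by (intro N) simp
        then show False using z n by (simp add: A_def cluster_def)
      qed
      then show "z \<in> ?g ` {..<N}" using n by blast
    qed
    then show ?case by (rule finite_subset) simp
  qed
qed

lemma row_bdd_no_infinite_cluster:
  assumes "row_bdd p 1 K" "0 \<le> p" "p \<le> 1" "infinite V"
  shows "\<not> (AE \<omega> in percolation E p. \<exists>v\<in>V. infinite (cluster V E \<omega> v))"
proof
  interpret prob_space "percolation E p" by (rule prob_space_percolation)
  assume "AE \<omega> in percolation E p. \<exists>v\<in>V. infinite (cluster V E \<omega> v)"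
  moreover have "AE \<omega> in percolation E p. \<forall>v\<in>V. finite (cluster V E \<omega> v)"
    using AE_finite_cluster[OF assms(1-3) _ assms(4)] countable_V by (simp add: AE_ball_countable)
  ultimately have "AE \<omega> in percolation E p. False" by eventually_elim auto
  then show False by (simp add: AE_False)
qed

lemma p_crit_ge:
  assumes "row_bdd p 1 K" "0 \<le> p" "p \<le> 1" "infinite V"
  shows "p \<le> p_crit V E"
  unfolding p_crit_def
proof (rule cInf_greatest)
  fix s assume s: "s \<in> insert 1 {p \<in> {0..1}. AE \<omega> in percolation E p. \<exists>v\<in>V. infinite (cluster V E \<omega> v)}"
  show "p \<le> s"
  proof (rule ccontr)
    assume "\<not> p \<le> s"
    then have s1: "0 \<le> s" "s < p" "AE \<omega> in percolation E s. \<exists>v\<in>V. infinite (cluster V E \<omega> v)"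
      using s assms by auto
    then have "row_bdd s 1 K" using assms by (intro row_bdd_mono[OF assms(1)]) auto
    then show False using row_bdd_no_infinite_cluster[of s K] s1 assms by auto
  qed
qed simp

text \<open>Without \<open>D\<close> every vertex of the old cluster is still connected to
  \<open>v\<close> or to an endpoint of \<open>D\<close>; there are finitely many of these, so one
  of them has an infinite cluster. This makes the existence of an infinite cluster a tail
  event.\<close>

lemma infinite_cluster_remove_finite:
  assumes "finite D" "D \<subseteq> E" "v \<in> V" "infinite {z \<in> V. (v, z) \<in> (adj_rel w)\<^sup>*}"
  shows "\<exists>a\<in>V. infinite {z \<in> V. (a, z) \<in> (adj_rel (w - D))\<^sup>*}"
proof -
  let ?A = "insert v (\<Union>D)"
  have A: "finite ?A" "?A \<subseteq> V" using finite_Union_edges Union_edges assms by auto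
  have sub: "{z \<in> V. (v, z) \<in> (adj_rel w)\<^sup>*} \<subseteq> (\<Union>a\<in>?A. {z \<in> V. (a, z) \<in> (adj_rel (w - D))\<^sup>*})"
  proof
    fix z assume z: "z \<in> {z \<in> V. (v, z) \<in> (adj_rel w)\<^sup>*}"
    then obtain a where a: "a \<in> ?A" "(z, a) \<in> (adj_rel {e \<in> w. \<not> e \<subseteq> ?A})\<^sup>*"
      using adj_rtrancl_hit[OF adj_rtrancl_sym, of v z w ?A] by auto
    have "(z, a) \<in> (adj_rel (w - D))\<^sup>*" by (rule adj_rtrancl_mono[OF _ a(2)]) auto
    then show "z \<in> (\<Union>a\<in>?A. {z \<in> V. (a, z) \<in> (adj_rel (w - D))\<^sup>*})"
      using a(1) z adj_rtrancl_sym[of z a "w - D"] by auto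
  qed
  show ?thesis
  proof (rule ccontr)
    assume "\<not> ?thesis"
    then have "finite {z \<in> V. (a, z) \<in> (adj_rel (w - D))\<^sup>*}" if "a \<in> ?A" for a using A(2) that by blast
    then have "finite (\<Union>a\<in>?A. {z \<in> V. (a, z) \<in> (adj_rel (w - D))\<^sup>*})" by (rule finite_UN_I[OF A(1)])
    then show False using assms(4) finite_subset[OF sub] by blast
  qed
qed

lemma percolation_zero_one:
  assumes "infinite E"
  shows "measure (percolation E p) {\<omega> \<in> space (percolation E p). \<exists>v\<in>V. infinite (cluster V E \<omega> v)} \<in> {0, 1}"
proof -
  let ?M = "percolation E p"
  interpret prob_space ?M by (rule prob_space_percolation)
  let ?e = "from_nat_into E"
  have bij: "bij_betw ?e UNIV E" using countable_E assms by (rule bij_betw_from_nat_into)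
  have eE: "?e i \<in> E" for i using bij by (auto simp: bij_betw_def)
  have inj: "inj ?e" using bij by (simp add: bij_betw_def)
  \<comment> \<open>The events that depend on the state of the \<open>i\<close>-th edge
    alone.\<close>
  define A where "A = (\<lambda>i. sets (vimage_algebra (space ?M) (\<lambda>\<omega>. \<omega> (?e i)) (count_space (UNIV :: bool set))))"
  have A_eq: "A i = {{\<omega> \<in> space ?M. \<omega> (?e i) \<in> S} | S. True}" for i
    unfolding A_def by (subst sets_vimage_algebra2) (auto simp: vimage_def Int_def conj_commute)
  have sig: "sigma_algebra (space ?M) (A i)" for i
    unfolding A_def
    using sets.sigma_algebra_axioms[of "vimage_algebra (space ?M) (\<lambda>\<omega>. \<omega> (?e i)) (count_space (UNIV :: bool set))"]
    by simp
  have ev: "A i \<subseteq> events" for i unfolding A_eq using sets_edge_event[OF eE] by auto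
  have indep: "indep_sets A UNIV"
  proof (rule indep_setsI)
    show "A i \<subseteq> events" for i by (rule ev)
    fix B J assume J: "J \<noteq> {}" "J \<subseteq> (UNIV :: nat set)" "finite J" "\<forall>j\<in>J. B j \<in> A j"
    then have "\<forall>j\<in>J. \<exists>S. B j = {\<omega> \<in> space ?M. \<omega> (?e j) \<in> S}" by (auto simp: A_eq)
    from bchoice[OF this] obtain S where S: "\<And>j. j \<in> J \<Longrightarrow> B j = {\<omega> \<in> space ?M. \<omega> (?e j) \<in> S j}" by auto
    define S' where "S' = (\<lambda>e. S (the_inv ?e e))"
    have S': "S' (?e j) = S j" for j by (simp add: S'_def the_inv_f_f[OF inj])
    have one: "prob (B j) = measure (measure_pmf (bernoulli_pmf p)) (S j)" if "j \<in> J" for j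
      using percolation_cylinder[of "{?e j}" p "\<lambda>_. S j"] eE S[OF that] by simp
    have "(\<Inter>j\<in>J. B j) = {\<omega> \<in> space ?M. \<forall>e\<in>?e ` J. \<omega> e \<in> S' e}"
      using J(1) S S' by auto
    then have "prob (\<Inter>j\<in>J. B j) = (\<Prod>e\<in>?e ` J. measure (measure_pmf (bernoulli_pmf p)) (S' e))"
      using percolation_cylinder[of "?e ` J" p S'] J(3) eE by auto
    also have "\<dots> = (\<Prod>j\<in>J. measure (measure_pmf (bernoulli_pmf p)) (S j))"
      by (subst prod.reindex[OF inj_on_subset[OF inj]]) (auto simp: S')
    also have "\<dots> = (\<Prod>j\<in>J. prob (B j))" using one by simp
    finally show "prob (\<Inter>j\<in>J. B j) = (\<Prod>j\<in>J. prob (B j))" .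
  qed
  let ?X = "{\<omega> \<in> space ?M. \<exists>v\<in>V. infinite (cluster V E \<omega> v)}"
  have "?X \<in> sigma_sets (space ?M) (\<Union> (A ` {n..}))" for n
  proof -
    let ?G = "\<Union> (A ` {n..})"
    define N where "N = sigma (space ?M) ?G"
    have sub: "?G \<subseteq> Pow (space ?M)" using ev sets.sets_into_space by blast
    have N: "sets N = sigma_sets (space ?M) ?G" "space N = space ?M"
      unfolding N_def using sub by (simp_all add: sets_measure_of space_measure_of)
    define D where "D = ?e ` {..<n}"
    have D: "finite D" "D \<subseteq> E" using eE by (auto simp: D_def)
    have eN: "{\<omega> \<in> space N. \<omega> e} \<in> sets N" if "e \<in> E - D" for e
    proof -
      have "e \<in> range ?e" using that bij_betw_imp_surj_on[OF bij] by blast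
      then obtain i where i: "e = ?e i" by blast
      then have "n \<le> i" using that by (auto simp: D_def not_less[symmetric])
      moreover have "{\<omega> \<in> space ?M. \<omega> e} \<in> A i" unfolding A_eq i by (auto intro!: exI[of _ "{True}"])
      ultimately show ?thesis unfolding N by (intro sigma_sets.Basic) auto
    qed
    have "?X = {\<omega> \<in> space N. \<exists>v\<in>V. infinite {z \<in> V. (v, z) \<in> (adj_rel {e \<in> E - D. \<omega> e})\<^sup>*}}"
    proof (intro set_eqI iffI)
      fix \<omega> assume "\<omega> \<in> ?X"
      then obtain v where v: "\<omega> \<in> space N" "v \<in> V" "infinite {z \<in> V. (v, z) \<in> (adj_rel {e \<in> E. \<omega> e})\<^sup>*}"
        by (auto simp: cluster_eq N)
      have "{e \<in> E. \<omega> e} - D = {e \<in> E - D. \<omega> e}" by auto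
      then show "\<omega> \<in> {\<omega> \<in> space N. \<exists>v\<in>V. infinite {z \<in> V. (v, z) \<in> (adj_rel {e \<in> E - D. \<omega> e})\<^sup>*}}"
        using infinite_cluster_remove_finite[OF D v(2,3)] v(1) by auto
    next
      fix \<omega> assume "\<omega> \<in> {\<omega> \<in> space N. \<exists>v\<in>V. infinite {z \<in> V. (v, z) \<in> (adj_rel {e \<in> E - D. \<omega> e})\<^sup>*}}"
      then obtain v where v: "\<omega> \<in> space ?M" "v \<in> V" "infinite {z \<in> V. (v, z) \<in> (adj_rel {e \<in> E - D. \<omega> e})\<^sup>*}"
        by (auto simp: N)
      have "{z \<in> V. (v, z) \<in> (adj_rel {e \<in> E - D. \<omega> e})\<^sup>*} \<subseteq> cluster V E \<omega> v"
        unfolding cluster_eq by (auto intro: adj_rtrancl_mono[rotated])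
      then have "infinite (cluster V E \<omega> v)" using v(3) finite_subset by auto
      then show "\<omega> \<in> ?X" using v by blast
    qed
    also have "\<dots> \<in> sets N"
      using countable_V eN by (intro sets.sets_Collect_countable_Ex' sets_infinite_cluster) auto
    finally show ?thesis using N by simp
  qed
  then have "?X \<in> tail_events A" by (simp add: tail_events_def)
  then show ?thesis using kolmogorov_0_1_law[OF sig indep] by auto
qed

text \<open>The events that \<open>u\<close> escapes from balls decrease to the event that its
  cluster is infinite, and their probabilities share a positive lower bound. The zero-one law turns
  positive probability of an infinite cluster into probability one.\<close>

lemma AE_infinite_cluster:
  assumes "u \<in> V" "infinite V" "0 < p0" "p0 < p" "p \<le> 1"
    and "\<And>S. finite S \<Longrightarrow> S \<subseteq> V \<Longrightarrow> u \<in> S \<Longrightarrow> 1 \<le> p0 * exit_sum p0 u S"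
  shows "AE \<omega> in percolation E p. \<exists>v\<in>V. infinite (cluster V E \<omega> v)"
proof -
  let ?M = "percolation E p"
  interpret prob_space ?M by (rule prob_space_percolation)
  define c where "c = (p - p0) / (1 + (p - p0))"
  have c: "0 < c" using assms by (simp add: c_def)
  have infE: "infinite E"
  proof
    assume "finite E"
    then have "finite (\<Union>E)" by (intro finite_Union_edges) auto
    moreover have "V \<subseteq> insert u (\<Union>E)" using adj_rtrancl_in_Union[OF reach[OF assms(1)]] by blast
    ultimately show False using assms(2) finite_subset by blast
  qed
  define B where "B = (\<lambda>n. gball E u n)"
  have B: "finite (B n)" "B n \<subseteq> V" "u \<in> B n" for n
    using assms(1) finite_gball gball_subset gball_self by (auto simp: B_def)
  define A where "A = (\<lambda>n. {\<omega> \<in> space ?M. escapes (B n) {e \<in> touching (B n). \<omega> e} u})"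
  have tf: "finite (touching (B n))" "touching (B n) \<subseteq> E" for n
    using finite_touching[OF B(1,2)] by (auto simp: touching_def)
  have A: "A n \<in> sets ?M" "measure ?M (A n) = escape_prob u (B n) p" for n
    using percolation_finite_event[OF tf, where P = "\<lambda>w. escapes (B n) w u"] assms
    by (simp_all add: A_def escape_prob_def)
  have Ac: "c \<le> measure ?M (A n)" for n
    unfolding A c_def using B assms by (intro escape_prob_lower) auto
  have cl: "\<omega> \<in> A n \<longleftrightarrow> \<omega> \<in> space ?M \<and> \<not> cluster V E \<omega> u \<subseteq> B n" for n \<omega>
  proof
    assume "\<omega> \<in> A n"
    then obtain y where y: "\<omega> \<in> space ?M" "y \<notin> B n" "(u, y) \<in> (adj_rel {e \<in> touching (B n). \<omega> e})\<^sup>*"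
      by (auto simp: A_def escapes_def)
    have r: "(u, y) \<in> (adj_rel {e \<in> E. \<omega> e})\<^sup>*"
      by (rule adj_rtrancl_mono[OF _ y(3)]) (auto simp: touching_def)
    have "y \<in> V"
    proof (cases "u = y")
      case False
      then have "y \<in> \<Union>{e \<in> E. \<omega> e}" using adj_rtrancl_in_Union[OF r] by simp
      then show ?thesis using edge_in_V by auto
    qed (use assms(1) in simp)
    then show "\<omega> \<in> space ?M \<and> \<not> cluster V E \<omega> u \<subseteq> B n" using y r by (auto simp: cluster_eq)
  next
    assume *: "\<omega> \<in> space ?M \<and> \<not> cluster V E \<omega> u \<subseteq> B n"
    then obtain y where y: "y \<notin> B n" "(u, y) \<in> (adj_rel {e \<in> E. \<omega> e})\<^sup>*" by (auto simp: cluster_eq)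
    have "escapes (B n) {e \<in> touching (B n). \<omega> e} u"
      using y(2) B(3)[of n]
    proof (induction rule: converse_rtrancl_induct)
      case base then show ?case using y(1) by (auto simp: escapes_def)
    next
      case (step a b)
      then have ab: "{a, b} \<in> E" "\<omega> {a, b}" by (auto simp: adj_rel_def)
      show ?case
      proof (cases "a \<in> B n")
        case True
        then have "{a, b} \<in> {e \<in> touching (B n). \<omega> e}" using ab by (auto simp: touching_def)
        moreover have "escapes (B n) {e \<in> touching (B n). \<omega> e} b"
          using step.IH by (cases "b \<in> B n") (auto simp: escapes_def)
        ultimately show ?thesis by (rule escapes_step)
      qed (auto simp: escapes_def)
    qed
    then show "\<omega> \<in> A n" using * by (simp add: A_def)
  qed
  have dec: "decseq A"
    unfolding decseq_def
  proof (intro allI impI subsetI)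
    fix m n \<omega> assume "m \<le> n" "\<omega> \<in> A n"
    moreover have "B m \<subseteq> B n" unfolding B_def by (rule gball_mono) (rule \<open>m \<le> n\<close>)
    ultimately show "\<omega> \<in> A m" unfolding cl by blast
  qed
  have inter: "(\<Inter>n. A n) \<subseteq> {\<omega> \<in> space ?M. \<exists>v\<in>V. infinite (cluster V E \<omega> v)}"
  proof
    fix \<omega> assume \<omega>: "\<omega> \<in> (\<Inter>n. A n)"
    have "infinite (cluster V E \<omega> u)"
    proof
      assume "finite (cluster V E \<omega> u)"
      moreover have "cluster V E \<omega> u \<subseteq> (\<Union>n. B n)"
        using in_gball[OF assms(1)] by (auto simp: B_def cluster_eq)
      moreover have "incseq B" by (simp add: incseq_def B_def gball_mono)
      ultimately obtain n where "cluster V E \<omega> u \<subseteq> B n" using finite_subset_incseq by blast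
      moreover have "\<omega> \<in> A n" using \<omega> by blast
      ultimately show False unfolding cl by blast
    qed
    moreover have "\<omega> \<in> space ?M" using \<omega> cl[of \<omega> 0] by blast
    ultimately show "\<omega> \<in> {\<omega> \<in> space ?M. \<exists>v\<in>V. infinite (cluster V E \<omega> v)}" using assms(1) by blast
  qed
  have X: "{\<omega> \<in> space ?M. \<exists>v\<in>V. infinite (cluster V E \<omega> v)} \<in> sets ?M"
    using countable_V sets_cluster_infinite by (intro sets.sets_Collect_countable_Ex') auto
  have "(\<lambda>n. measure ?M (A n)) \<longlonglongrightarrow> measure ?M (\<Inter>n. A n)"
    using A dec by (intro finite_Lim_measure_decseq) auto
  then have "c \<le> measure ?M (\<Inter>n. A n)" by (rule LIMSEQ_le_const) (use Ac in auto)
  also have "\<dots> \<le> measure ?M {\<omega> \<in> space ?M. \<exists>v\<in>V. infinite (cluster V E \<omega> v)}"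
    using inter X by (intro finite_measure_mono)
  finally have "measure ?M {\<omega> \<in> space ?M. \<exists>v\<in>V. infinite (cluster V E \<omega> v)} = 1"
    using percolation_zero_one[OF infE, of p] c by auto
  then show ?thesis using X by (subst (asm) prob_Collect_eq_1) auto
qed

text \<open>If no finite set around some \<open>u\<close> had \<open>p * exit_sum\<close> below 1,
  there would be an infinite cluster at every larger density, in particular at the midpoint
  \<open>q\<close>, which is still below \<open>p_crit\<close>.\<close>

lemma sharpness:
  assumes "infinite V" "0 \<le> p" "p < p_crit V E"
  obtains K where "row_bdd p 1 K"
proof -
  have bdd: "bdd_below (insert 1 {p \<in> {0..1}. AE \<omega> in percolation E p. \<exists>v\<in>V. infinite (cluster V E \<omega> v)})"
    by (intro bdd_belowI[of _ 0]) auto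
  have pc1: "p_crit V E \<le> 1" unfolding p_crit_def using bdd by (intro cInf_lower) auto
  have "\<exists>S. finite S \<and> S \<subseteq> V \<and> u \<in> S \<and> p * exit_sum p u S < 1" if u: "u \<in> V" for u
  proof (rule ccontr)
    assume "\<not> ?thesis"
    then have *: "\<And>S. finite S \<Longrightarrow> S \<subseteq> V \<Longrightarrow> u \<in> S \<Longrightarrow> 1 \<le> p * exit_sum p u S" by (auto simp: not_less)
    have p0: "0 < p" using *[of "{u}"] u assms(2) by (cases "p = 0") auto
    define q where "q = (p + p_crit V E) / 2"
    have q: "p < q" "q < p_crit V E" "q \<le> 1" using assms pc1 by (auto simp: q_def)
    have "AE \<omega> in percolation E q. \<exists>v\<in>V. infinite (cluster V E \<omega> v)"
      using u assms p0 q * by (intro AE_infinite_cluster) auto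
    then have "p_crit V E \<le> q" unfolding p_crit_def using bdd q p0 by (intro cInf_lower) auto
    then show False using q by simp
  qed
  then show ?thesis using row_bdd_if_exit_sum[of p thesis] assms pc1 that by auto
qed

text \<open>For \<open>S = {u}\<close> the exit sum is at most the number of neighbours, which is
  bounded over all vertices.\<close>

lemma p_crit_pos:
  assumes "infinite V" shows "0 < p_crit V E"
proof -
  obtain B where B: "\<And>v. v \<in> V \<Longrightarrow> card (gball E v 1) \<le> B" "0 < B" using card_gball_bounded by blast
  define p where "p = 1 / (2 * real B)"
  have p: "0 < p" "p \<le> 1" using B by (auto simp: p_def field_simps)
  have "\<exists>S. finite S \<and> S \<subseteq> V \<and> u \<in> S \<and> p * exit_sum p u S < 1" if u: "u \<in> V" for u
  proof -
    have sub: "out_pairs {u} \<subseteq> Pair u ` gball E u 1"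
    proof
      fix q assume "q \<in> out_pairs {u}"
      then obtain y where y: "q = (u, y)" "{u, y} \<in> E" by (auto simp: out_pairs_def)
      then have "y \<in> gball E u 1" unfolding One_nat_def gball_Suc gball_0 by auto
      then show "q \<in> Pair u ` gball E u 1" using y by blast
    qed
    have "card (out_pairs {u}) \<le> card (Pair u ` gball E u 1)"
      using sub finite_gball[OF u] by (intro card_mono) auto
    also have "\<dots> \<le> card (gball E u 1)" using finite_gball[OF u] by (intro card_image_le)
    also have "\<dots> \<le> B" by (rule B(1)[OF u])
    finally have card: "card (out_pairs {u}) \<le> B" .
    have "finite (inner_edges {u})" using u by (intro finite_inner) auto
    then have "conn_exp (inner_edges {u}) p 1 u z \<le> 1" for z using p by (intro conn_exp_le_1) auto
    then have "exit_sum p u {u} \<le> (\<Sum>q\<in>out_pairs {u}. 1)"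
      unfolding exit_sum_def by (intro sum_mono) (simp split: prod.split)
    also have "\<dots> \<le> B" using card by simp
    finally have "p * exit_sum p u {u} \<le> p * B" using p by (intro mult_left_mono) auto
    also have "\<dots> < 1" using B by (simp add: p_def)
    finally show ?thesis using u by (intro exI[of _ "{u}"]) auto
  qed
  then obtain K where "row_bdd p 1 K" using row_bdd_if_exit_sum[of p] p by auto
  then have "p \<le> p_crit V E" using p assms by (intro p_crit_ge) auto
  then show ?thesis using p by linarith
qed

end

section \<open>Operator bounds\<close>

lemma Holder_sum:
  fixes f g :: "'b \<Rightarrow> real"
  assumes "finite F" "\<And>i. i \<in> F \<Longrightarrow> 0 \<le> f i" "\<And>i. i \<in> F \<Longrightarrow> 0 \<le> g i" "0 < \<alpha>" "\<alpha> < 1"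
  shows "(\<Sum>i\<in>F. f i powr \<alpha> * g i powr (1 - \<alpha>)) \<le> (\<Sum>i\<in>F. f i) powr \<alpha> * (\<Sum>i\<in>F. g i) powr (1 - \<alpha>)"
proof -
  define A where "A = (\<Sum>i\<in>F. f i)"
  define B where "B = (\<Sum>i\<in>F. g i)"
  have AB0: "0 \<le> A" "0 \<le> B" using assms by (auto simp: A_def B_def intro: sum_nonneg)
  show ?thesis
  proof (cases "A = 0 \<or> B = 0")
    case True
    then have "(\<forall>i\<in>F. f i = 0) \<or> (\<forall>i\<in>F. g i = 0)"
      unfolding A_def B_def using assms by (simp add: sum_nonneg_eq_0_iff)
    then have "(\<Sum>i\<in>F. f i powr \<alpha> * g i powr (1 - \<alpha>)) = 0" using assms by (intro sum.neutral) auto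
    then show ?thesis by (simp add: mult_nonneg_nonneg)
  next
    case False
    then have AB: "0 < A" "0 < B" using AB0 by auto
    have "f i powr \<alpha> * g i powr (1 - \<alpha>) \<le> A powr \<alpha> * B powr (1 - \<alpha>) * (\<alpha> * (f i / A) + (1 - \<alpha>) * (g i / B))"
      if i: "i \<in> F" for i
    proof (cases "f i = 0 \<or> g i = 0")
      case True
      have "0 \<le> A powr \<alpha> * B powr (1 - \<alpha>) * (\<alpha> * (f i / A) + (1 - \<alpha>) * (g i / B))"
        using assms i AB by (intro mult_nonneg_nonneg add_nonneg_nonneg) auto
      then show ?thesis using True assms by auto
    next
      case False
      then have pos: "0 < f i" "0 < g i" using assms(2,3)[OF i] by auto
      have "(f i / A) powr \<alpha> * (g i / B) powr (1 - \<alpha>) \<le> \<alpha> * (f i / A) + (1 - \<alpha>) * (g i / B)"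
        using assms pos AB by (intro Youngs_inequality_0) auto
      then have "A powr \<alpha> * B powr (1 - \<alpha>) * ((f i / A) powr \<alpha> * (g i / B) powr (1 - \<alpha>))
          \<le> A powr \<alpha> * B powr (1 - \<alpha>) * (\<alpha> * (f i / A) + (1 - \<alpha>) * (g i / B))"
        by (intro mult_left_mono) auto
      moreover have "A powr \<alpha> * B powr (1 - \<alpha>) * ((f i / A) powr \<alpha> * (g i / B) powr (1 - \<alpha>))
          = f i powr \<alpha> * g i powr (1 - \<alpha>)"
        using pos AB by (simp add: powr_divide)
      ultimately show ?thesis by simp
    qed
    then have "(\<Sum>i\<in>F. f i powr \<alpha> * g i powr (1 - \<alpha>))
        \<le> (\<Sum>i\<in>F. A powr \<alpha> * B powr (1 - \<alpha>) * (\<alpha> * (f i / A) + (1 - \<alpha>) * (g i / B)))"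
      by (rule sum_mono)
    also have "\<dots> = A powr \<alpha> * B powr (1 - \<alpha>) * (\<alpha> * (A / A) + (1 - \<alpha>) * (B / B))"
      by (simp add: sum_distrib_left[symmetric] sum.distrib sum_divide_distrib[symmetric] A_def B_def)
    also have "\<dots> = A powr \<alpha> * B powr (1 - \<alpha>)" using AB by simp
    finally show ?thesis by (simp add: A_def B_def)
  qed
qed

lemma Holder_bern_exp:
  assumes "finite L" "0 \<le> p" "p \<le> 1" "\<And>w. 0 \<le> f w" "\<And>w. 0 \<le> g w" "0 < \<alpha>" "\<alpha> < 1"
  shows "bern_exp L p (\<lambda>w. f w powr \<alpha> * g w powr (1 - \<alpha>)) \<le> bern_exp L p f powr \<alpha> * bern_exp L p g powr (1 - \<alpha>)"
proof -
  have wt: "0 \<le> bern_wt L p w" for w using assms by (intro bern_wt_nonneg)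
  have "bern_exp L p (\<lambda>w. f w powr \<alpha> * g w powr (1 - \<alpha>))
      = (\<Sum>w\<in>Pow L. (bern_wt L p w * f w) powr \<alpha> * (bern_wt L p w * g w) powr (1 - \<alpha>))"
    unfolding bern_exp_def
  proof (rule sum.cong[OF refl])
    fix w
    have "bern_wt L p w = bern_wt L p w powr \<alpha> * bern_wt L p w powr (1 - \<alpha>)"
      using wt[of w] by (simp add: powr_add[symmetric])
    then show "bern_wt L p w * (f w powr \<alpha> * g w powr (1 - \<alpha>))
        = (bern_wt L p w * f w) powr \<alpha> * (bern_wt L p w * g w) powr (1 - \<alpha>)"
      using wt[of w] assms by (simp add: powr_mult)
  qed
  also have "\<dots> \<le> bern_exp L p f powr \<alpha> * bern_exp L p g powr (1 - \<alpha>)"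
    unfolding bern_exp_def using assms wt by (intro Holder_sum) auto
  finally show ?thesis .
qed

lemma power2_powr:
  fixes y :: real
  assumes "0 \<le> y"
  shows "(y\<^sup>2) powr a = y powr (2 * a)"
proof -
  have "y\<^sup>2 = y powr 2" using assms by simp
  then show ?thesis by (simp only: powr_powr)
qed

text \<open>The norm bound \<open>C\<close> on the truncations to a finite set, the same for rows
  and columns, raised to the power \<open>q\<close>. For matrices with nonnegative entries these
  truncations determine the norm.\<close>

definition lq_bdd :: "'v set \<Rightarrow> real \<Rightarrow> ('v \<Rightarrow> 'v \<Rightarrow> real) \<Rightarrow> real \<Rightarrow> bool" where
  "lq_bdd V q M C \<longleftrightarrow> (\<forall>F f. finite F \<and> F \<subseteq> V \<and> (\<forall>v. 0 \<le> f v) \<longrightarrow>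
     (\<Sum>u\<in>F. (\<Sum>v\<in>F. M u v * f v) powr q) \<le> C powr q * (\<Sum>v\<in>F. f v powr q))"

lemma lq_bddD:
  "lq_bdd V q M C \<Longrightarrow> finite F \<Longrightarrow> F \<subseteq> V \<Longrightarrow> (\<And>v. 0 \<le> f v) \<Longrightarrow>
    (\<Sum>u\<in>F. (\<Sum>v\<in>F. M u v * f v) powr q) \<le> C powr q * (\<Sum>v\<in>F. f v powr q)"
  by (simp add: lq_bdd_def)

lemma lq_bdd_mono:
  assumes "lq_bdd V q M C" "\<And>u v. 0 \<le> M' u v" "\<And>u v. M' u v \<le> M u v" "0 \<le> C" "C \<le> C'" "0 < q"
  shows "lq_bdd V q M' C'"
  unfolding lq_bdd_def
proof (intro allI impI, elim conjE)
  fix F and f :: "'a \<Rightarrow> real"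
  assume F: "finite F" "F \<subseteq> V" and f: "\<forall>v. 0 \<le> f v"
  have "(\<Sum>u\<in>F. (\<Sum>v\<in>F. M' u v * f v) powr q) \<le> (\<Sum>u\<in>F. (\<Sum>v\<in>F. M u v * f v) powr q)"
    using assms f by (intro sum_mono powr_mono2 mult_right_mono sum_nonneg mult_nonneg_nonneg) auto
  also have "\<dots> \<le> C powr q * (\<Sum>v\<in>F. f v powr q)" using assms F f by (intro lq_bddD) auto
  also have "\<dots> \<le> C' powr q * (\<Sum>v\<in>F. f v powr q)"
    using assms by (intro mult_right_mono powr_mono2 sum_nonneg) auto
  finally show "(\<Sum>u\<in>F. (\<Sum>v\<in>F. M' u v * f v) powr q) \<le> C' powr q * (\<Sum>v\<in>F. f v powr q)" .
qed

text \<open>The image \<open>h\<close> of \<open>f\<close> is paired with its norming function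
  \<open>k = h powr (q' - 1)\<close>, and symmetry moves the matrix onto \<open>k\<close>. The
  resulting inequality contains a power of \<open>S\<close> on both sides; as \<open>S\<close> is
  finite it can be divided out.\<close>

lemma lq_bdd_dual:
  assumes "lq_bdd V q M C" "\<And>u v. M u v = M v u" "\<And>u v. 0 \<le> M u v" "1 < q" "0 \<le> C"
  shows "lq_bdd V (q / (q - 1)) M C"
  unfolding lq_bdd_def
proof (intro allI impI, elim conjE)
  fix F and f :: "'a \<Rightarrow> real"
  assume F: "finite F" "F \<subseteq> V" and f: "\<forall>v. 0 \<le> f v"
  define q' where "q' = q / (q - 1)"
  have q': "1 < q'" "1 / q' = 1 - 1 / q" "(q' - 1) * q = q'" "1 + (q' - 1) = q'"
    using assms by (auto simp: q'_def field_simps)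
  define h where "h = (\<lambda>u. \<Sum>v\<in>F. M u v * f v)"
  have h0: "0 \<le> h u" for u unfolding h_def using assms f by (intro sum_nonneg mult_nonneg_nonneg) auto
  define k where "k = (\<lambda>u. h u powr (q' - 1))"
  define Mk where "Mk = (\<lambda>v. \<Sum>u\<in>F. M v u * k u)"
  have Mk0: "0 \<le> Mk v" for v unfolding Mk_def k_def using assms by (intro sum_nonneg mult_nonneg_nonneg) auto
  define S where "S = (\<Sum>u\<in>F. h u powr q')"
  define R where "R = (\<Sum>v\<in>F. f v powr q')"
  have S0: "0 \<le> S" and R0: "0 \<le> R" by (auto simp: S_def R_def intro: sum_nonneg)
  have hk: "h u powr q' = h u * k u" for u
    unfolding k_def using h0[of u] powr_mult_base[of "h u" "q' - 1"] by (simp add: q'(4))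
  have "S = (\<Sum>u\<in>F. \<Sum>v\<in>F. M u v * f v * k u)"
    unfolding S_def hk unfolding h_def by (simp add: sum_distrib_right)
  also have "\<dots> = (\<Sum>v\<in>F. Mk v * f v)"
  proof (subst sum.swap, rule sum.cong[OF refl])
    fix v
    have "(\<Sum>u\<in>F. M u v * f v * k u) = (\<Sum>u\<in>F. M v u * k u * f v)"
      by (intro sum.cong refl) (simp add: assms(2)[of _ v] mult_ac)
    then show "(\<Sum>u\<in>F. M u v * f v * k u) = Mk v * f v" by (simp add: Mk_def sum_distrib_right)
  qed
  also have "\<dots> = (\<Sum>v\<in>F. (Mk v powr q) powr (1 / q) * (f v powr q') powr (1 - 1 / q))"
  proof (rule sum.cong[OF refl])
    fix v
    have "(f v powr q') powr (1 - 1 / q) = f v"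
      unfolding q'(2)[symmetric] using q'(1) f by (simp add: powr_powr)
    then show "Mk v * f v = (Mk v powr q) powr (1 / q) * (f v powr q') powr (1 - 1 / q)"
      using Mk0[of v] assms by (simp add: powr_powr)
  qed
  also have "\<dots> \<le> (\<Sum>v\<in>F. Mk v powr q) powr (1 / q) * R powr (1 - 1 / q)"
    unfolding R_def using assms F by (intro Holder_sum) auto
  also have "\<dots> \<le> (C powr q * S) powr (1 / q) * R powr (1 - 1 / q)"
  proof (intro mult_right_mono powr_mono2)
    have "(\<Sum>v\<in>F. Mk v powr q) \<le> C powr q * (\<Sum>u\<in>F. k u powr q)"
      unfolding Mk_def using assms F by (intro lq_bddD) (auto simp: k_def)
    also have "(\<Sum>u\<in>F. k u powr q) = S" by (simp add: k_def S_def powr_powr q'(3))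
    finally show "(\<Sum>v\<in>F. Mk v powr q) \<le> C powr q * S" .
  qed (use assms in \<open>auto intro: sum_nonneg\<close>)
  also have "\<dots> = C * S powr (1 / q) * R powr (1 - 1 / q)"
    using assms S0 by (simp add: powr_mult powr_powr)
  finally have main: "S \<le> C * S powr (1 / q) * R powr (1 - 1 / q)" .
  show "(\<Sum>u\<in>F. (\<Sum>v\<in>F. M u v * f v) powr (q / (q - 1))) \<le> C powr (q / (q - 1)) * (\<Sum>v\<in>F. f v powr (q / (q - 1)))"
  proof (cases "S = 0")
    case True
    then show ?thesis using R0 by (simp add: S_def R_def h_def q'_def)
  next
    case False
    then have Spos: "0 < S" using S0 by simp
    have "S powr (1 / q) * S powr (1 / q') = S" unfolding q'(2) powr_add[symmetric] using Spos by simp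
    then have "S powr (1 / q) * S powr (1 / q') \<le> S powr (1 / q) * (C * R powr (1 / q'))"
      using main by (simp add: q'(2) mult_ac)
    then have "S powr (1 / q') \<le> C * R powr (1 / q')" using Spos by simp
    then have "(S powr (1 / q')) powr q' \<le> (C * R powr (1 / q')) powr q'" using q'(1) by (intro powr_mono2) auto
    then have "S \<le> C powr q' * R" using q'(1) Spos R0 assms by (simp add: powr_powr powr_mult)
    then show ?thesis by (simp add: S_def R_def h_def q'_def)
  qed
qed

text \<open>
  Interpolation between row sums and \<open>L\<^sup>2\<close>: write \<open>f = (f powr q) powr (1 - \<theta>) * (f powr (q/2)) powr \<theta>\<close> and apply
  Holder's inequality first in the column and then in the row index.
\<close>

lemma lq_bdd_interpolate:
  assumes \<theta>: "0 < \<theta>" "\<theta> < 1" and q: "q = 1 / (1 - \<theta> / 2)"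
    and A: "\<And>u v. 0 \<le> A u v" "\<And>v F. v \<in> V \<Longrightarrow> finite F \<Longrightarrow> F \<subseteq> V \<Longrightarrow> (\<Sum>u\<in>F. A u v) \<le> a" "0 \<le> a"
    and B: "\<And>u v. 0 \<le> B u v" "\<And>F f. finite F \<Longrightarrow> F \<subseteq> V \<Longrightarrow> (\<And>v. 0 \<le> f v) \<Longrightarrow>
       (\<Sum>u\<in>F. (\<Sum>v\<in>F. B u v * f v)\<^sup>2) \<le> b\<^sup>2 * (\<Sum>v\<in>F. (f v)\<^sup>2)" "0 \<le> b"
    and M: "\<And>u v. 0 \<le> M u v" "\<And>u v. M u v \<le> A u v powr (1 - \<theta>) * B u v powr \<theta>"
  shows "lq_bdd V q M (a powr (1 - \<theta>) * b powr \<theta>)"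
  unfolding lq_bdd_def
proof (intro allI impI, elim conjE)
  fix F and f :: "'a \<Rightarrow> real"
  assume F: "finite F" "F \<subseteq> V" and f: "\<forall>v. 0 \<le> f v"
  \<comment> \<open>From \<open>1 / q = (1 - \<theta>) + \<theta> / 2\<close> the share of the L1
    endpoint in the outer sum is \<open>\<alpha> = q * (1 - \<theta>)\<close>, and that of the L2
    endpoint is \<open>1 - \<alpha> = q * \<theta> / 2\<close>.\<close>
  define \<alpha> where "\<alpha> = q * (1 - \<theta>)"
  have q0: "0 < q" using \<theta> q by simp
  have \<alpha>: "0 < \<alpha>" "\<alpha> < 1" "q * \<theta> = 2 * (1 - \<alpha>)" using \<theta> by (auto simp: \<alpha>_def q field_simps)
  have "q / 2 * \<theta> = q * \<theta> / 2" by simp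
  then have \<alpha>q: "\<alpha> + q / 2 * \<theta> = 1" using \<alpha>(3) by (simp add: diff_divide_distrib)
  define f1 where "f1 = (\<lambda>v. f v powr q)"
  define f2 where "f2 = (\<lambda>v. f v powr (q / 2))"
  define A1 where "A1 = (\<lambda>u. \<Sum>v\<in>F. A u v * f1 v)"
  define B2 where "B2 = (\<lambda>u. \<Sum>v\<in>F. B u v * f2 v)"
  have A10: "0 \<le> A1 u" for u unfolding A1_def f1_def using A by (intro sum_nonneg mult_nonneg_nonneg) auto
  have B20: "0 \<le> B2 u" for u unfolding B2_def f2_def using B by (intro sum_nonneg mult_nonneg_nonneg) auto
  have fdec: "f v = f1 v powr (1 - \<theta>) * f2 v powr \<theta>" for v
  proof -
    have "f1 v powr (1 - \<theta>) * f2 v powr \<theta> = f v powr (\<alpha> + q / 2 * \<theta>)"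
      unfolding f1_def f2_def powr_powr powr_add \<alpha>_def by simp
    then show ?thesis using \<alpha>q f by simp
  qed
  have pt: "(\<Sum>v\<in>F. M u v * f v) \<le> A1 u powr (1 - \<theta>) * B2 u powr \<theta>" for u
  proof -
    have "(\<Sum>v\<in>F. M u v * f v) \<le> (\<Sum>v\<in>F. (A u v * f1 v) powr (1 - \<theta>) * (B u v * f2 v) powr (1 - (1 - \<theta>)))"
    proof (rule sum_mono)
      fix v
      have "M u v * f v \<le> (A u v powr (1 - \<theta>) * B u v powr \<theta>) * (f1 v powr (1 - \<theta>) * f2 v powr \<theta>)"
        unfolding fdec[symmetric] using M f by (intro mult_right_mono) auto
      also have "\<dots> = (A u v * f1 v) powr (1 - \<theta>) * (B u v * f2 v) powr (1 - (1 - \<theta>))"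
        using A B by (simp add: powr_mult f1_def f2_def)
      finally show "M u v * f v \<le> (A u v * f1 v) powr (1 - \<theta>) * (B u v * f2 v) powr (1 - (1 - \<theta>))" .
    qed
    also have "\<dots> \<le> A1 u powr (1 - \<theta>) * B2 u powr (1 - (1 - \<theta>))"
      unfolding A1_def B2_def using F A B \<theta> by (intro Holder_sum) (auto simp: f1_def f2_def)
    finally show ?thesis by simp
  qed
  have S0: "0 \<le> (\<Sum>v\<in>F. f1 v)" by (auto simp: f1_def intro: sum_nonneg)
  have "(\<Sum>u\<in>F. (\<Sum>v\<in>F. M u v * f v) powr q) \<le> (\<Sum>u\<in>F. (A1 u powr (1 - \<theta>) * B2 u powr \<theta>) powr q)"
    using pt q0 M f by (intro sum_mono powr_mono2 sum_nonneg mult_nonneg_nonneg) auto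
  also have "\<dots> = (\<Sum>u\<in>F. A1 u powr \<alpha> * ((B2 u)\<^sup>2) powr (1 - \<alpha>))"
  proof (rule sum.cong[OF refl])
    fix u
    have "((B2 u)\<^sup>2) powr (1 - \<alpha>) = B2 u powr (\<theta> * q)"
      unfolding power2_powr[OF B20] using \<alpha>(3) by (simp add: mult.commute)
    then show "(A1 u powr (1 - \<theta>) * B2 u powr \<theta>) powr q = A1 u powr \<alpha> * ((B2 u)\<^sup>2) powr (1 - \<alpha>)"
      by (simp add: powr_mult powr_powr \<alpha>_def mult.commute)
  qed
  also have "\<dots> \<le> (\<Sum>u\<in>F. A1 u) powr \<alpha> * (\<Sum>u\<in>F. (B2 u)\<^sup>2) powr (1 - \<alpha>)"
    using F A10 \<alpha> by (intro Holder_sum) auto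
  also have "\<dots> \<le> (a * (\<Sum>v\<in>F. f1 v)) powr \<alpha> * (b\<^sup>2 * (\<Sum>v\<in>F. f1 v)) powr (1 - \<alpha>)"
  proof (intro mult_mono powr_mono2)
    have "(\<Sum>u\<in>F. A1 u) = (\<Sum>v\<in>F. (\<Sum>u\<in>F. A u v) * f1 v)"
      unfolding A1_def by (subst sum.swap) (simp add: sum_distrib_right)
    also have "\<dots> \<le> (\<Sum>v\<in>F. a * f1 v)" using A(2)[OF _ F] F by (intro sum_mono mult_right_mono) (auto simp: f1_def)
    finally show "(\<Sum>u\<in>F. A1 u) \<le> a * (\<Sum>v\<in>F. f1 v)" by (simp add: sum_distrib_left)
    have "(\<Sum>u\<in>F. (B2 u)\<^sup>2) \<le> b\<^sup>2 * (\<Sum>v\<in>F. (f2 v)\<^sup>2)"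
      unfolding B2_def using F by (intro B) (auto simp: f2_def)
    also have "(\<Sum>v\<in>F. (f2 v)\<^sup>2) = (\<Sum>v\<in>F. f1 v)"
      unfolding f2_def f1_def by (simp add: power2_eq_square powr_add[symmetric])
    finally show "(\<Sum>u\<in>F. (B2 u)\<^sup>2) \<le> b\<^sup>2 * (\<Sum>v\<in>F. f1 v)" by simp
  qed (use \<alpha> A10 in \<open>auto intro: sum_nonneg\<close>)
  also have "\<dots> = a powr \<alpha> * (b\<^sup>2) powr (1 - \<alpha>) * ((\<Sum>v\<in>F. f1 v) powr \<alpha> * (\<Sum>v\<in>F. f1 v) powr (1 - \<alpha>))"
    using A(3) S0 by (simp add: powr_mult)
  also have "(\<Sum>v\<in>F. f1 v) powr \<alpha> * (\<Sum>v\<in>F. f1 v) powr (1 - \<alpha>) = (\<Sum>v\<in>F. f1 v)"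
    using S0 by (simp add: powr_add[symmetric])
  also have "a powr \<alpha> * (b\<^sup>2) powr (1 - \<alpha>) = (a powr (1 - \<theta>) * b powr \<theta>) powr q"
  proof -
    have "(b\<^sup>2) powr (1 - \<alpha>) = b powr (\<theta> * q)"
      unfolding power2_powr[OF B(3)] using \<alpha>(3) by (simp add: mult.commute)
    then show ?thesis by (simp add: powr_mult powr_powr \<alpha>_def mult.commute)
  qed
  finally show "(\<Sum>u\<in>F. (\<Sum>v\<in>F. M u v * f v) powr q) \<le> (a powr (1 - \<theta>) * b powr \<theta>) powr q * (\<Sum>v\<in>F. f v powr q)"
    by (simp add: f1_def)
qed

text \<open>A crude form of the triangle inequality for \<open>q\<close>-th powers. Its factor 2 is
  the reason for the constants \<open>1 / 4\<close> and \<open>4 * C\<close> in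
  \<open>lq_bdd_neumann\<close>.\<close>

lemma powr_add_le:
  fixes a b :: real
  assumes "0 \<le> a" "0 \<le> b" "0 < q"
  shows "(a + b) powr q \<le> 2 powr q * (a powr q + b powr q)"
proof -
  have "(a + b) powr q \<le> (2 * max a b) powr q" using assms by (intro powr_mono2) auto
  also have "\<dots> = 2 powr q * max a b powr q" using assms by (simp add: powr_mult)
  also have "max a b powr q \<le> a powr q + b powr q" by (auto simp: max_def)
  finally show ?thesis by simp
qed

context qt_graph
begin

section \<open>The two-point matrix on Lq\<close>

lemma lq_bdd_limit:
  assumes "\<And>L. finite L \<Longrightarrow> L \<subseteq> E \<Longrightarrow> lq_bdd V q (conn_exp L p 1) C" "0 \<le> p" "p \<le> 1" "0 < q"
  shows "lq_bdd V q (conn_lim p 1) C"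
  unfolding lq_bdd_def
proof (intro allI impI, elim conjE)
  fix F and f :: "'v \<Rightarrow> real"
  assume F: "finite F" "F \<subseteq> V" and f: "\<forall>v. 0 \<le> f v"
  have "((\<lambda>L. \<Sum>u\<in>F. (\<Sum>v\<in>F. conn_exp L p 1 u v * f v) powr q)
      \<longlongrightarrow> (\<Sum>u\<in>F. (\<Sum>v\<in>F. conn_lim p 1 u v * f v) powr q)) (finite_subsets_at_top E)"
    using assms f
    by (intro tendsto_sum tendsto_powr2 tendsto_mult tendsto_const conn_lim_tendsto always_eventually allI
        sum_nonneg mult_nonneg_nonneg conn_exp_nonneg) auto
  then show "(\<Sum>u\<in>F. (\<Sum>v\<in>F. conn_lim p 1 u v * f v) powr q) \<le> C powr q * (\<Sum>v\<in>F. f v powr q)"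
  proof (rule lim_upper_bound)
    fix L assume "finite L" "L \<subseteq> E"
    from lq_bddD[OF assms(1)[OF this] F]
    show "(\<Sum>u\<in>F. (\<Sum>v\<in>F. conn_exp L p 1 u v * f v) powr q) \<le> C powr q * (\<Sum>v\<in>F. f v powr q)"
      using f by blast
  qed
qed

text \<open>The resolvent and chain estimates in a volume \<open>L\<close> need a finite set
  containing all endpoints of its edges. Extending \<open>f\<close> by zero allows such a set to be
  assumed.\<close>

lemma lq_bdd_extend:
  assumes "finite U" "U \<subseteq> V" "0 < q" "\<And>u v. 0 \<le> M u v"
    and "\<And>F f. finite F \<Longrightarrow> F \<subseteq> V \<Longrightarrow> U \<subseteq> F \<Longrightarrow> (\<And>v. 0 \<le> f v) \<Longrightarrow>
      (\<Sum>u\<in>F. (\<Sum>v\<in>F. M u v * f v) powr q) \<le> C powr q * (\<Sum>v\<in>F. f v powr q)"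
  shows "lq_bdd V q M C"
  unfolding lq_bdd_def
proof (intro allI impI, elim conjE)
  fix F and f :: "'v \<Rightarrow> real"
  assume F: "finite F" "F \<subseteq> V" and f: "\<forall>v. 0 \<le> f v"
  define f' where "f' = (\<lambda>v. if v \<in> F then f v else 0)"
  let ?G = "F \<union> U"
  have G: "finite ?G" "?G \<subseteq> V" using F assms by auto
  have f': "0 \<le> f' v" for v using f by (simp add: f'_def)
  have eq: "(\<Sum>v\<in>?G. g v (f' v)) = (\<Sum>v\<in>F. g v (f v))" if "\<And>v. g v 0 = 0" for g :: "'v \<Rightarrow> real \<Rightarrow> real"
  proof -
    have "(\<Sum>v\<in>?G. g v (f' v)) = (\<Sum>v\<in>F. g v (f' v))"
      using G F that by (intro sum.mono_neutral_right) (auto simp: f'_def)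
    also have "\<dots> = (\<Sum>v\<in>F. g v (f v))" by (intro sum.cong) (auto simp: f'_def)
    finally show ?thesis .
  qed
  have "(\<Sum>u\<in>F. (\<Sum>v\<in>F. M u v * f v) powr q) \<le> (\<Sum>u\<in>?G. (\<Sum>v\<in>F. M u v * f v) powr q)"
    using G by (intro sum_mono2) auto
  also have "\<dots> = (\<Sum>u\<in>?G. (\<Sum>v\<in>?G. M u v * f' v) powr q)"
    by (subst eq[where g = "\<lambda>v y. M _ v * y"]) auto
  also have "\<dots> \<le> C powr q * (\<Sum>v\<in>?G. f' v powr q)" using G f' by (intro assms(5)) auto
  also have "(\<Sum>v\<in>?G. f' v powr q) = (\<Sum>v\<in>F. f v powr q)"
    by (rule eq[where g = "\<lambda>v y. y powr q"]) simp
  finally show "(\<Sum>u\<in>F. (\<Sum>v\<in>F. M u v * f v) powr q) \<le> C powr q * (\<Sum>v\<in>F. f v powr q)" .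
qed

text \<open>The resolvent inequality between the weights \<open>t = p1 / p2\<close> and 1 at density
  \<open>p2\<close>; by thinning, the weighted function at \<open>t\<close> is at most the two-point
  function at \<open>p1\<close>. The term containing the unknown \<open>S\<close> has coefficient at
  most 1/2 and is absorbed, \<open>S\<close> being finite.\<close>

lemma lq_bdd_neumann:
  assumes "lq_bdd V q (conn_lim p1 1) C" "1 \<le> q" "0 < p1" "p1 \<le> p2" "p2 \<le> 1" "0 \<le> C"
    and small: "(1 - p1 / p2) * C \<le> 1 / 4"
  shows "lq_bdd V q (conn_lim p2 1) (4 * C)"
proof (rule lq_bdd_limit)
  fix L assume L: "finite L" "L \<subseteq> E"
  define c where "c = 1 - p1 / p2"
  have c: "0 \<le> c" using assms by (simp add: c_def)
  define t where "t = p1 / p2"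
  have t: "0 < t" "t \<le> 1" "p2 * t = p1" "1 - t / 1 = c" using assms by (auto simp: t_def c_def)
  let ?W = "conn_exp L p2 1" and ?K = "conn_lim p1 1"
  have thin: "conn_exp L p2 t u v \<le> ?K u v" for u v
  proof -
    have "conn_exp L p2 (t * 1) u v \<le> conn_exp L (p2 * t) 1 u v" using L assms t by (intro conn_exp_thin) auto
    also have "\<dots> \<le> ?K u v" unfolding t(3) using L assms by (intro conn_lim_upper) auto
    finally show ?thesis by simp
  qed
  have W0: "0 \<le> ?W u v" for u v using assms by (intro conn_exp_nonneg) auto
  have K0: "0 \<le> ?K u v" for u v using assms by (intro conn_lim_nonneg) auto
  have U: "finite (\<Union>L)" "\<Union>L \<subseteq> V" using L finite_Union_edges Union_edges by auto
  show "lq_bdd V q ?W (4 * C)"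
  proof (rule lq_bdd_extend[OF U _ W0])
    fix F and f :: "'v \<Rightarrow> real"
    assume F: "finite F" "F \<subseteq> V" "\<Union>L \<subseteq> F" and f: "\<And>v. 0 \<le> f v"
    define h where "h = (\<lambda>u. \<Sum>v\<in>F. ?W u v * f v)"
    define k where "k = (\<lambda>u. \<Sum>v\<in>F. ?K u v * f v)"
    have h0: "0 \<le> h u" for u unfolding h_def using W0 f by (intro sum_nonneg mult_nonneg_nonneg)
    have k0: "0 \<le> k u" for u unfolding k_def using K0 f by (intro sum_nonneg mult_nonneg_nonneg)
    have Kh0: "0 \<le> (\<Sum>a\<in>F. ?K u a * h a)" for u using K0 h0 by (intro sum_nonneg mult_nonneg_nonneg)
    define S where "S = (\<Sum>u\<in>F. h u powr q)"
    define R where "R = (\<Sum>v\<in>F. f v powr q)"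
    have R0: "0 \<le> R" and S0: "0 \<le> S" by (auto simp: R_def S_def intro: sum_nonneg)
    have hk: "h u \<le> k u + c * (\<Sum>a\<in>F. ?K u a * h a)" for u
    proof -
      have "?W u v \<le> ?K u v + c * (\<Sum>a\<in>F. ?K u a * ?W a v)" for v
      proof -
        have "?W u v \<le> conn_exp L p2 t u v + (1 - t / 1) * (\<Sum>a\<in>F. conn_exp L p2 t u a * ?W a v)"
          using L assms t F by (intro conn_exp_resolvent) auto
        also have "\<dots> \<le> ?K u v + c * (\<Sum>a\<in>F. ?K u a * ?W a v)"
          unfolding t(4) using thin W0 c by (intro add_mono mult_left_mono sum_mono mult_right_mono) auto
        finally show ?thesis .
      qed
      then have "h u \<le> (\<Sum>v\<in>F. (?K u v + c * (\<Sum>a\<in>F. ?K u a * ?W a v)) * f v)"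
        unfolding h_def using f by (intro sum_mono mult_right_mono) auto
      also have "\<dots> = k u + (\<Sum>v\<in>F. \<Sum>a\<in>F. c * (?K u a * ?W a v) * f v)"
        by (simp add: k_def algebra_simps sum.distrib sum_distrib_left sum_distrib_right)
      also have "(\<Sum>v\<in>F. \<Sum>a\<in>F. c * (?K u a * ?W a v) * f v) = c * (\<Sum>a\<in>F. ?K u a * h a)"
        unfolding h_def by (subst sum.swap) (simp add: sum_distrib_left mult_ac)
      finally show ?thesis .
    qed
    have "S \<le> (\<Sum>u\<in>F. (k u + c * (\<Sum>a\<in>F. ?K u a * h a)) powr q)"
      unfolding S_def using hk h0 assms by (intro sum_mono powr_mono2) auto
    also have "\<dots> \<le> (\<Sum>u\<in>F. 2 powr q * (k u powr q + (c * (\<Sum>a\<in>F. ?K u a * h a)) powr q))"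
      using k0 Kh0 c assms by (intro sum_mono powr_add_le) auto
    also have "\<dots> = 2 powr q * ((\<Sum>u\<in>F. k u powr q) + c powr q * (\<Sum>u\<in>F. (\<Sum>a\<in>F. ?K u a * h a) powr q))"
    proof -
      have "(c * (\<Sum>a\<in>F. ?K u a * h a)) powr q = c powr q * (\<Sum>a\<in>F. ?K u a * h a) powr q" for u
        using c Kh0 by (simp add: powr_mult)
      then show ?thesis by (simp only: sum.distrib sum_distrib_left[symmetric])
    qed
    also have "\<dots> \<le> 2 powr q * (C powr q * R + c powr q * (C powr q * S))"
      unfolding k_def R_def S_def using assms F f h0 by (intro mult_left_mono add_mono lq_bddD) auto
    also have "\<dots> = 2 powr q * C powr q * R + (2 * (c * C)) powr q * S"
      using c assms by (simp add: powr_mult algebra_simps)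
    also have "\<dots> \<le> 2 powr q * C powr q * R + (1 / 2) * S"
    proof (intro add_left_mono mult_right_mono S0)
      have "(2 * (c * C)) powr q \<le> (1 / 2) powr q"
      proof (rule powr_mono2)
        show "2 * (c * C) \<le> 1 / 2" using small[folded c_def] by linarith
      qed (use c assms in auto)
      also have "\<dots> \<le> (1 / 2) powr 1" using assms by (intro powr_mono') auto
      finally show "(2 * (c * C)) powr q \<le> 1 / 2" by simp
    qed
    finally have "S \<le> 2 * (2 powr q * C powr q * R)" by simp
    also have "\<dots> = (2 * 2 powr q) * (C powr q * R)" by simp
    also have "\<dots> \<le> (2 powr q * 2 powr q) * (C powr q * R)"
    proof (rule mult_right_mono)
      have "(2::real) powr 1 \<le> 2 powr q" using assms by (intro powr_mono) auto
      then show "2 * 2 powr q \<le> (2::real) powr q * 2 powr q" by simp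
    qed (use R0 in auto)
    also have "\<dots> = (4 * C) powr q * R"
    proof -
      have "(2::real) powr q * 2 powr q = 4 powr q" by (simp add: powr_mult[symmetric])
      then show ?thesis using assms by (simp add: powr_mult)
    qed
    finally show "(\<Sum>u\<in>F. (\<Sum>v\<in>F. ?W u v * f v) powr q) \<le> (4 * C) powr q * (\<Sum>v\<in>F. f v powr q)"
      by (simp add: S_def R_def h_def)
  qed (use assms in auto)
qed (use assms in auto)

text \<open>As the base exceeds 1, this is not monotone in the volume and no limit of it is taken;
  only bounds uniform in \<open>L\<close> are used.\<close>

definition exp_moment :: "'v set set \<Rightarrow> real \<Rightarrow> real \<Rightarrow> 'v \<Rightarrow> 'v \<Rightarrow> real" where
  "exp_moment L p s u v = bern_exp L p (\<lambda>w. conn_wt (1 + s) w u v)"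

text \<open>The binomial theorem expands \<open>(1 + s)\<close> to the power of the distance into
  powers of \<open>s\<close> times binomial coefficients, which count chains on a geodesic. By BK
  the chains of \<open>k\<close> vertices contribute at most the power \<open>k + 1\<close> of the
  two-point matrix, and the geometric series has norm at most
  \<open>N / (1 - s * N) = 2 * N\<close>.\<close>

lemma exp_moment_l2:
  assumes "l2_bdd p N" "0 < N" "s = 1 / (2 * N)" "0 \<le> p" "p \<le> 1" "finite L" "L \<subseteq> E"
    and F: "finite F" "F \<subseteq> V" and f: "\<And>v. 0 \<le> f v"
  shows "(\<Sum>u\<in>F. (\<Sum>v\<in>F. exp_moment L p s u v * f v)\<^sup>2) \<le> (2 * N)\<^sup>2 * (\<Sum>v\<in>F. (f v)\<^sup>2)"
proof -
  have s0: "0 < s" using assms by simp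
  have U: "finite (\<Union>L)" "\<Union>L \<subseteq> V" using assms finite_Union_edges Union_edges by auto
  have em0: "0 \<le> exp_moment L p s u v" for u v
    unfolding exp_moment_def using assms s0 by (intro bern_exp_nonneg conn_wt_nonneg) auto
  have "lq_bdd V 2 (exp_moment L p s) (2 * N)"
  proof (rule lq_bdd_extend[OF U _ em0])
    fix F and f :: "'v \<Rightarrow> real"
    assume F: "finite F" "F \<subseteq> V" "\<Union>L \<subseteq> F" and f: "\<And>v. 0 \<le> f v"
    let ?T = "conn_exp L p 1"
    define c where "c = (\<lambda>k u v. bern_exp L p (\<lambda>w. chain_count F k w u v))"
    define G where "G = (\<lambda>m u v. \<Sum>k\<le>m. s ^ k * c k u v)"
    define h where "h = (\<lambda>m u. \<Sum>v\<in>F. G m u v * f v)"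
    have finw: "finite w" "\<Union>w \<subseteq> F" if "w \<subseteq> L" for w
      using finite_subset[OF that assms(6)] Union_mono[OF that] F(3) by auto
    have c0: "0 \<le> c k u v" for k u v
      unfolding c_def using assms finw by (intro bern_exp_nonneg chain_count_nonneg) auto
    have h0: "0 \<le> h m u" for m u
      unfolding h_def G_def using s0 c0 f by (intro sum_nonneg mult_nonneg_nonneg) auto
    have T0: "0 \<le> ?T u v" for u v using assms by (intro conn_exp_nonneg) auto
    have Tg: "L2_set (\<lambda>u. \<Sum>v\<in>F. ?T u v * g v) F \<le> N * L2_set g F" if g: "\<And>v. 0 \<le> g v" for g
    proof -
      have "(\<Sum>u\<in>F. (\<Sum>v\<in>F. ?T u v * g v)\<^sup>2) \<le> (\<Sum>u\<in>F. (\<Sum>v\<in>F. conn_lim p 1 u v * g v)\<^sup>2)"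
        using T0 g assms by (intro sum_mono power_mono mult_right_mono conn_lim_upper sum_nonneg mult_nonneg_nonneg) auto
      also have "\<dots> \<le> N\<^sup>2 * (\<Sum>v\<in>F. (g v)\<^sup>2)" using assms F g by (intro l2_bddD) auto
      finally have "sqrt (\<Sum>u\<in>F. (\<Sum>v\<in>F. ?T u v * g v)\<^sup>2) \<le> sqrt (N\<^sup>2 * (\<Sum>v\<in>F. (g v)\<^sup>2))" by simp
      then show ?thesis using assms by (simp add: L2_set_def real_sqrt_mult)
    qed
    have rec: "h (Suc m) u \<le> (\<Sum>v\<in>F. ?T u v * f v) + s * (\<Sum>a\<in>F. ?T u a * h m a)" for m u
    proof -
      have "G (Suc m) u v \<le> ?T u v + s * (\<Sum>a\<in>F. ?T u a * G m a v)" for v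
      proof -
        have "G (Suc m) u v = c 0 u v + (\<Sum>k\<le>m. s ^ Suc k * c (Suc k) u v)"
          unfolding G_def by (subst sum.atMost_Suc_shift) simp
        also have "\<dots> \<le> ?T u v + (\<Sum>k\<le>m. s ^ Suc k * (\<Sum>a\<in>F. ?T u a * c k a v))"
        proof (intro add_mono sum_mono mult_left_mono)
          show "c 0 u v \<le> ?T u v" by (simp add: c_def conn_exp_def)
          show "c (Suc k) u v \<le> (\<Sum>a\<in>F. ?T u a * c k a v)" for k
            unfolding c_def using assms by (intro chain_count_exp)
        qed (use s0 in auto)
        also have "(\<Sum>k\<le>m. s ^ Suc k * (\<Sum>a\<in>F. ?T u a * c k a v)) = s * (\<Sum>a\<in>F. ?T u a * G m a v)"
          by (simp add: G_def sum_distrib_left mult_ac) (rule sum.swap)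
        finally show ?thesis .
      qed
      then have "h (Suc m) u \<le> (\<Sum>v\<in>F. (?T u v + s * (\<Sum>a\<in>F. ?T u a * G m a v)) * f v)"
        unfolding h_def using f by (intro sum_mono mult_right_mono) auto
      also have "\<dots> = (\<Sum>v\<in>F. ?T u v * f v) + (\<Sum>v\<in>F. \<Sum>a\<in>F. s * (?T u a * G m a v) * f v)"
        by (simp add: distrib_right sum.distrib sum_distrib_left sum_distrib_right)
      also have "(\<Sum>v\<in>F. \<Sum>a\<in>F. s * (?T u a * G m a v) * f v) = s * (\<Sum>a\<in>F. ?T u a * h m a)"
        unfolding h_def by (subst sum.swap) (simp add: sum_distrib_left mult.assoc)
      finally show ?thesis .
    qed
    have hm: "L2_set (h m) F \<le> 2 * N * L2_set f F" for m
    proof (induction m)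
      case 0
      have "h 0 = (\<lambda>u. \<Sum>v\<in>F. ?T u v * f v)" by (simp add: h_def G_def c_def conn_exp_def)
      then have "L2_set (h 0) F \<le> N * L2_set f F" using Tg[OF f] by simp
      moreover have "0 \<le> N * L2_set f F" using assms by simp
      ultimately show ?case by linarith
    next
      case (Suc m)
      have "L2_set (h (Suc m)) F \<le> L2_set (\<lambda>u. (\<Sum>v\<in>F. ?T u v * f v) + s * (\<Sum>a\<in>F. ?T u a * h m a)) F"
        using rec h0 by (intro L2_set_mono)
      also have "\<dots> \<le> L2_set (\<lambda>u. \<Sum>v\<in>F. ?T u v * f v) F + L2_set (\<lambda>u. s * (\<Sum>a\<in>F. ?T u a * h m a)) F"
        by (rule L2_set_triangle_ineq)
      also have "L2_set (\<lambda>u. s * (\<Sum>a\<in>F. ?T u a * h m a)) F = s * L2_set (\<lambda>u. \<Sum>a\<in>F. ?T u a * h m a) F"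
        using s0 by (simp add: L2_set_right_distrib)
      also have "L2_set (\<lambda>u. \<Sum>v\<in>F. ?T u v * f v) F + s * L2_set (\<lambda>u. \<Sum>a\<in>F. ?T u a * h m a) F
          \<le> N * L2_set f F + s * (N * (2 * N * L2_set f F))"
      proof (intro add_mono mult_left_mono Tg f)
        have "L2_set (\<lambda>u. \<Sum>a\<in>F. ?T u a * h m a) F \<le> N * L2_set (h m) F" by (rule Tg[OF h0])
        also have "\<dots> \<le> N * (2 * N * L2_set f F)" using Suc assms by (intro mult_left_mono) auto
        finally show "L2_set (\<lambda>u. \<Sum>a\<in>F. ?T u a * h m a) F \<le> N * (2 * N * L2_set f F)" .
      qed (use s0 in auto)
      also have "\<dots> = 2 * N * L2_set f F" using assms by (simp add: field_simps)
      finally show ?case .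
    qed
    \<comment> \<open>In a finite volume the distances are bounded, so a partial sum already
      contains the whole binomial expansion.\<close>
    define m where "m = Max ((\<lambda>(w, u, v). gdist w u v) ` (Pow L \<times> F \<times> F))"
    have em: "exp_moment L p s u v \<le> G m u v" if uv: "u \<in> F" "v \<in> F" for u v
    proof -
      have "conn_wt (1 + s) w u v \<le> (\<Sum>k\<le>m. s ^ k * chain_count F k w u v)" if w: "w \<subseteq> L" for w
      proof (cases "(u, v) \<in> (adj_rel w)\<^sup>*")
        case True
        have "gdist w u v \<in> (\<lambda>(w, u, v). gdist w u v) ` (Pow L \<times> F \<times> F)"
          using w uv by (intro image_eqI[of _ _ "(w, u, v)"]) auto
        then have n: "gdist w u v \<le> m" unfolding m_def using assms F by (intro Max_ge) auto
        have "conn_wt (1 + s) w u v = (\<Sum>k\<le>gdist w u v. real (gdist w u v choose k) * s ^ k)"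
          using True binomial_ring[of s 1 "gdist w u v"] by (simp add: conn_wt_def add.commute)
        also have "\<dots> \<le> (\<Sum>k\<le>m. real (gdist w u v choose k) * s ^ k)"
          using n s0 by (intro sum_mono2) auto
        also have "\<dots> \<le> (\<Sum>k\<le>m. s ^ k * chain_count F k w u v)"
          using chain_count_gdist[OF F(1) finw[OF w] True] s0
          by (intro sum_mono) (simp add: mult.commute mult_left_mono)
        finally show ?thesis .
      next
        case False
        then show ?thesis using s0 chain_count_nonneg[OF finw(1)[OF w]]
          by (auto simp: conn_wt_def intro!: sum_nonneg mult_nonneg_nonneg)
      qed
      then have "exp_moment L p s u v \<le> bern_exp L p (\<lambda>w. \<Sum>k\<le>m. s ^ k * chain_count F k w u v)"
        unfolding exp_moment_def using assms by (intro bern_exp_mono) auto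
      then show ?thesis by (simp add: bern_exp_sum bern_exp_cmult c_def G_def)
    qed
    have "L2_set (\<lambda>u. \<Sum>v\<in>F. exp_moment L p s u v * f v) F \<le> L2_set (h m) F"
      unfolding h_def using em em0 f by (intro L2_set_mono sum_mono mult_right_mono sum_nonneg mult_nonneg_nonneg) auto
    also have "\<dots> \<le> 2 * N * L2_set f F" by (rule hm)
    finally have "(L2_set (\<lambda>u. \<Sum>v\<in>F. exp_moment L p s u v * f v) F)\<^sup>2 \<le> (2 * N * L2_set f F)\<^sup>2"
      by (intro power_mono) auto
    then have "(\<Sum>u\<in>F. (\<Sum>v\<in>F. exp_moment L p s u v * f v)\<^sup>2) \<le> (2 * N)\<^sup>2 * (\<Sum>v\<in>F. (f v)\<^sup>2)"
      by (simp add: L2_set_def power_mult_distrib sum_nonneg)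
    then show "(\<Sum>u\<in>F. (\<Sum>v\<in>F. exp_moment L p s u v * f v) powr 2) \<le> (2 * N) powr 2 * (\<Sum>v\<in>F. f v powr 2)"
      using em0 f assms by (simp add: powr_numeral sum_nonneg)
  qed simp
  from lq_bddD[OF this F f] show ?thesis
    using em0 f assms by (simp add: powr_numeral sum_nonneg)
qed

lemma lq_bdd_critical:
  assumes "l2_bdd p N" "0 < N" "0 < p" "p \<le> 1" "0 < \<theta>" "\<theta> < 1" "q = 1 / (1 - \<theta> / 2)"
    and x: "x = (1 + 1 / (2 * N)) powr (- \<theta> / (1 - \<theta>))" and K: "row_bdd p x K" "0 \<le> K"
  shows "lq_bdd V q (conn_lim p 1) (K powr (1 - \<theta>) * (2 * N) powr \<theta>)"
proof (rule lq_bdd_limit)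
  fix L assume L: "finite L" "L \<subseteq> E"
  define s where "s = 1 / (2 * N)"
  have s0: "0 < s" using assms by (simp add: s_def)
  have x': "x = (1 + s) powr (- \<theta> / (1 - \<theta>))" using x by (simp add: s_def)
  have x01: "0 < x" "x \<le> 1"
  proof -
    show "0 < x" unfolding x' using s0 by simp
    have "- \<theta> / (1 - \<theta>) \<le> 0" using assms by (simp add: divide_nonneg_pos)
    then have "(1 + s) powr (- \<theta> / (1 - \<theta>)) \<le> (1 + s) powr 0" using s0 by (intro powr_mono) auto
    then show "x \<le> 1" unfolding x' using s0 by simp
  qed
  \<comment> \<open>The exponent in \<open>x\<close> is chosen for this identity: the indicator of a
    connection then splits into the two weights, and Holder's inequality is applied to the
    expectation before the interpolation between rows and columns.\<close>
  have xs: "x powr (1 - \<theta>) * (1 + s) powr \<theta> = 1"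
    unfolding x' powr_powr using assms s0 by (simp add: powr_add[symmetric])
  show "lq_bdd V q (conn_exp L p 1) (K powr (1 - \<theta>) * (2 * N) powr \<theta>)"
  proof (rule lq_bdd_interpolate[where A = "conn_exp L p x" and B = "exp_moment L p s"])
    show "0 \<le> conn_exp L p x u v" for u v using assms x01 by (intro conn_exp_nonneg) auto
    show "0 \<le> conn_exp L p 1 u v" for u v using assms by (intro conn_exp_nonneg) auto
    show "0 \<le> exp_moment L p s u v" for u v
      unfolding exp_moment_def using assms s0 by (intro bern_exp_nonneg conn_wt_nonneg) auto
    show "(\<Sum>u\<in>F. conn_exp L p x u v) \<le> K" if "v \<in> V" "finite F" "F \<subseteq> V" for v F
    proof -
      have "(\<Sum>u\<in>F. conn_exp L p x u v) \<le> (\<Sum>u\<in>F. conn_lim p x v u)"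
        unfolding conn_exp_commute[of L p x _ v] using L assms x01 by (intro sum_mono conn_lim_upper) auto
      also have "\<dots> \<le> K" using K(1) that by (intro row_bddD)
      finally show ?thesis .
    qed
    show "(\<Sum>u\<in>F. (\<Sum>v\<in>F. exp_moment L p s u v * f v)\<^sup>2) \<le> (2 * N)\<^sup>2 * (\<Sum>v\<in>F. (f v)\<^sup>2)"
      if "finite F" "F \<subseteq> V" "\<And>v. 0 \<le> f v" for F f
      using assms(1-4) that L by (intro exp_moment_l2) (auto simp: s_def)
    show "conn_exp L p 1 u v \<le> conn_exp L p x u v powr (1 - \<theta>) * exp_moment L p s u v powr \<theta>" for u v
    proof -
      have "conn_wt 1 w u v = conn_wt x w u v powr (1 - \<theta>) * conn_wt (1 + s) w u v powr (1 - (1 - \<theta>))" for w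
      proof (cases "(u, v) \<in> (adj_rel w)\<^sup>*")
        case True
        define n where "n = gdist w u v"
        have "(x ^ n) powr (1 - \<theta>) * ((1 + s) ^ n) powr \<theta> = (x powr (1 - \<theta>) * (1 + s) powr \<theta>) ^ n"
          using x01 s0 by (simp add: powr_realpow[symmetric] powr_powr powr_mult mult.commute)
        then show ?thesis using True xs by (simp add: conn_wt_def n_def)
      next
        case False
        then show ?thesis using assms by (simp add: conn_wt_def)
      qed
      then have "conn_exp L p 1 u v
          = bern_exp L p (\<lambda>w. conn_wt x w u v powr (1 - \<theta>) * conn_wt (1 + s) w u v powr (1 - (1 - \<theta>)))"
        by (simp add: conn_exp_def)
      also have "\<dots> \<le> conn_exp L p x u v powr (1 - \<theta>) * exp_moment L p s u v powr (1 - (1 - \<theta>))"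
        unfolding conn_exp_def exp_moment_def using L assms x01 s0 by (intro Holder_bern_exp conn_wt_nonneg) auto
      finally show ?thesis by simp
    qed
  qed (use assms in auto)
qed (use assms in auto)

end

section \<open>The operator norm in terms of finite sums\<close>

lemma ennpowr_ennreal: "0 \<le> x \<Longrightarrow> ennpowr (ennreal x) a = ennreal (x powr a)"
  by (simp add: ennpowr_def)

lemma nn_integral_count_space_tendsto:
  fixes g :: "'b \<Rightarrow> ennreal" and A :: "nat \<Rightarrow> 'b set"
  assumes "\<And>n. finite (A n)" "incseq A" "(\<Union>n. A n) = V"
  shows "(\<lambda>n. \<Sum>v\<in>A n. g v) \<longlonglongrightarrow> (\<integral>\<^sup>+ v. g v \<partial>count_space V)"
proof -
  define h where "h = (\<lambda>n v. g v * indicator (A n) v)"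
  have inc: "incseq h"
    unfolding h_def incseq_def le_fun_def
    using incseqD[OF assms(2)] by (auto intro!: mult_left_mono simp: indicator_def)
  have sup: "(SUP n. h n v) = g v" if v: "v \<in> V" for v
  proof -
    obtain n where n: "v \<in> A n" using v assms(3) by blast
    show ?thesis
    proof (rule antisym)
      show "(SUP n. h n v) \<le> g v" by (rule SUP_least) (auto simp: h_def indicator_def)
      have "g v = h n v" using n by (simp add: h_def)
      also have "\<dots> \<le> (SUP n. h n v)" by (rule SUP_upper) simp
      finally show "g v \<le> (SUP n. h n v)" .
    qed
  qed
  have int: "(\<integral>\<^sup>+ v. h n v \<partial>count_space V) = (\<Sum>v\<in>A n. g v)" for n
  proof -
    have "(\<integral>\<^sup>+ v. h n v \<partial>count_space V) = (\<Sum>v\<in>A n. h n v)"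
      using assms by (intro nn_integral_count_space') (auto simp: h_def)
    then show ?thesis by (simp add: h_def)
  qed
  have "(\<integral>\<^sup>+ v. g v \<partial>count_space V) = (\<integral>\<^sup>+ v. (SUP n. h n v) \<partial>count_space V)"
    using sup by (intro nn_integral_cong) simp
  also have "\<dots> = (SUP n. \<integral>\<^sup>+ v. h n v \<partial>count_space V)"
    using inc by (intro nn_integral_monotone_convergence_SUP) auto
  also have "\<dots> = (SUP n. \<Sum>v\<in>A n. g v)" by (simp add: int)
  finally have eq: "(\<integral>\<^sup>+ v. g v \<partial>count_space V) = (SUP n. \<Sum>v\<in>A n. g v)" .
  have "incseq (\<lambda>n. \<Sum>v\<in>A n. g v)"
    using assms(1) incseqD[OF assms(2)] by (auto simp: incseq_def intro!: sum_mono2)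
  then show ?thesis unfolding eq by (rule LIMSEQ_SUP)
qed

lemma sum_le_nn_integral_count_space:
  fixes g :: "'b \<Rightarrow> ennreal"
  assumes "finite F" "F \<subseteq> V"
  shows "(\<Sum>v\<in>F. g v) \<le> (\<integral>\<^sup>+ v. g v \<partial>count_space V)"
proof -
  have "(\<integral>\<^sup>+ v. g v * indicator F v \<partial>count_space V) = (\<Sum>v\<in>F. g v * indicator F v)"
    using assms by (intro nn_integral_count_space') auto
  then have "(\<Sum>v\<in>F. g v) = (\<integral>\<^sup>+ v. g v * indicator F v \<partial>count_space V)" by simp
  also have "\<dots> \<le> (\<integral>\<^sup>+ v. g v \<partial>count_space V)"
    by (intro nn_integral_mono) (auto simp: indicator_def)
  finally show ?thesis .
qed

context qt_graph
begin

lemma exhaustion_V: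
  obtains Vn :: "nat \<Rightarrow> 'v set" where "\<And>n. finite (Vn n)" "incseq Vn" "(\<Union>n. Vn n) = V"
proof -
  obtain f :: "'v \<Rightarrow> nat" where f: "inj_on f V" using countable_V by (auto simp: countable_def)
  define Vn where "Vn = (\<lambda>n. {v \<in> V. f v < n})"
  have "finite (Vn n)" for n
  proof (rule finite_imageD)
    show "finite (f ` Vn n)" by (rule finite_subset[of _ "{..<n}"]) (auto simp: Vn_def)
    show "inj_on f (Vn n)" by (rule inj_on_subset[OF f]) (auto simp: Vn_def)
  qed
  moreover have "incseq Vn" by (auto simp: incseq_def Vn_def)
  moreover have "(\<Union>n. Vn n) = V" by (auto simp: Vn_def)
  ultimately show ?thesis by (rule that)
qed

lemma two_point_fun: "0 \<le> p \<Longrightarrow> p \<le> 1 \<Longrightarrow> two_point E p = (\<lambda>u v. ennreal (conn_lim p 1 u v))"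
  by (intro ext two_point_eq(1))

lemma op_norm_le:
  assumes lq: "lq_bdd V q (conn_lim p 1) C" and p: "0 \<le> p" "p \<le> 1" and q: "1 \<le> q" and C: "0 \<le> C"
  shows "op_norm V q (two_point E p) \<le> ennreal C"
  unfolding op_norm_def
proof (rule SUP_least)
  fix f :: "'v \<Rightarrow> real"
  assume "f \<in> {f. (\<forall>v\<in>V. 0 \<le> f v) \<and> (\<exists>v\<in>V. f v \<noteq> 0) \<and> lq_norm V q (\<lambda>v. ennreal (f v)) < \<infinity>}"
  then have f: "\<And>v. v \<in> V \<Longrightarrow> 0 \<le> f v" "\<exists>v\<in>V. f v \<noteq> 0" "lq_norm V q (\<lambda>v. ennreal (f v)) < \<infinity>" by auto
  let ?T = "conn_lim p 1"
  have T0: "0 \<le> ?T u v" for u v using p by (intro conn_lim_nonneg) auto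
  define I where "I = (\<integral>\<^sup>+ v. ennpowr (ennreal (f v)) q \<partial>count_space V)"
  have Ifin: "I \<noteq> \<infinity>" using f(3) by (auto simp: lq_norm_def I_def ennpowr_def)
  define s where "s = enn2real I"
  have Is: "I = ennreal s" and s0: "0 \<le> s" using Ifin by (auto simp: s_def less_top[symmetric])
  have fs: "(\<Sum>v\<in>F. f v powr q) \<le> s" if F: "finite F" "F \<subseteq> V" for F
  proof -
    have "ennreal (\<Sum>v\<in>F. f v powr q) = (\<Sum>v\<in>F. ennreal (f v powr q))"
      by (rule sum_ennreal[symmetric]) simp
    also have "\<dots> = (\<Sum>v\<in>F. ennpowr (ennreal (f v)) q)"
      using F f(1) by (intro sum.cong) (auto simp: ennpowr_ennreal)
    also have "\<dots> \<le> I" unfolding I_def using F by (rule sum_le_nn_integral_count_space)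
    finally show ?thesis using Is s0 by simp
  qed
  have spos: "0 < s"
  proof -
    obtain v where v: "v \<in> V" "f v \<noteq> 0" using f(2) by blast
    then have "0 < f v powr q" using f(1)[OF v(1)] by simp
    also have "\<dots> \<le> s" using fs[of "{v}"] v by simp
    finally show ?thesis .
  qed
  \<comment> \<open>Functions in \<open>op_norm\<close> are nonnegative on \<open>V\<close> only,
    whereas \<open>lq_bdd\<close> tests functions nonnegative everywhere.\<close>
  define f' where "f' = (\<lambda>v. if v \<in> V then f v else 0)"
  have f'0: "0 \<le> f' v" for v using f(1) by (simp add: f'_def)
  have lqF: "(\<Sum>u\<in>F. (\<Sum>v\<in>F. ?T u v * f v) powr q) \<le> C powr q * s" if F: "finite F" "F \<subseteq> V" for F
  proof -
    have "(\<Sum>u\<in>F. (\<Sum>v\<in>F. ?T u v * f' v) powr q) \<le> C powr q * (\<Sum>v\<in>F. f' v powr q)"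
      using lq F f'0 by (rule lq_bddD)
    moreover have "(\<Sum>v\<in>F. ?T u v * f' v) = (\<Sum>v\<in>F. ?T u v * f v)" for u
      using F by (intro sum.cong) (auto simp: f'_def)
    moreover have "(\<Sum>v\<in>F. f' v powr q) = (\<Sum>v\<in>F. f v powr q)"
      using F by (intro sum.cong) (auto simp: f'_def)
    ultimately have "(\<Sum>u\<in>F. (\<Sum>v\<in>F. ?T u v * f v) powr q) \<le> C powr q * (\<Sum>v\<in>F. f v powr q)" by simp
    also have "\<dots> \<le> C powr q * s" using fs[OF F] by (intro mult_left_mono) auto
    finally show ?thesis .
  qed
  define h where "h = mat_apply V (two_point E p) (\<lambda>v. ennreal (f v))"
  have h_eq: "h u = (\<integral>\<^sup>+ v. ennreal (?T u v * f v) \<partial>count_space V)" for u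
    unfolding h_def mat_apply_def two_point_fun[OF p]
    using f(1) T0 by (intro nn_integral_cong) (simp add: ennreal_mult)
  obtain Vn :: "nat \<Rightarrow> 'v set" where Vn: "\<And>n. finite (Vn n)" "incseq Vn" "(\<Union>n. Vn n) = V"
    using exhaustion_V by blast
  have VnV: "Vn n \<subseteq> V" for n using Vn(3) by blast
  \<comment> \<open>Columns are truncated first and the limit is taken for each row; the rows are
    summed afterwards.\<close>
  define S where "S = (\<lambda>n u. \<Sum>v\<in>Vn n. ?T u v * f v)"
  have S0: "0 \<le> S n u" for n u
    unfolding S_def using T0 f(1) subsetD[OF VnV] by (intro sum_nonneg mult_nonneg_nonneg) auto
  have Slim: "(\<lambda>n. ennreal (S n u)) \<longlonglongrightarrow> h u" for u
  proof -
    have "(\<Sum>v\<in>Vn n. ennreal (?T u v * f v)) = ennreal (S n u)" for n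
      unfolding S_def using T0 f(1) subsetD[OF VnV] by (intro sum_ennreal) (auto intro!: mult_nonneg_nonneg)
    then show ?thesis using nn_integral_count_space_tendsto[OF Vn, of "\<lambda>v. ennreal (?T u v * f v)"]
      unfolding h_eq by simp
  qed
  \<comment> \<open>A uniform bound at each single vertex. It shows that the image of
    \<open>f\<close> is finite there, so that \<open>enn2real\<close> loses nothing.\<close>
  define b where "b = (C powr q * s) powr (1 / q)"
  have Sb: "S n u \<le> b" if u: "u \<in> V" for n u
  proof -
    let ?F = "insert u (Vn n)"
    have F: "finite ?F" "?F \<subseteq> V" using u Vn(1) VnV by auto
    have le: "S n u \<le> (\<Sum>v\<in>?F. ?T u v * f v)"
      unfolding S_def using F T0 f(1) by (intro sum_mono2) (auto intro!: mult_nonneg_nonneg)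
    have nn: "0 \<le> (\<Sum>v\<in>?F. ?T u v * f v)" using S0[of n u] le by linarith
    have "(\<Sum>v\<in>?F. ?T u v * f v) powr q \<le> (\<Sum>u\<in>?F. (\<Sum>v\<in>?F. ?T u v * f v) powr q)"
      using F by (intro member_le_sum) auto
    also have "\<dots> \<le> C powr q * s" by (rule lqF[OF F])
    finally have "((\<Sum>v\<in>?F. ?T u v * f v) powr q) powr (1 / q) \<le> b"
      unfolding b_def using q by (intro powr_mono2) auto
    then have "(\<Sum>v\<in>?F. ?T u v * f v) \<le> b" using q nn by (simp add: powr_powr)
    then show ?thesis using le by linarith
  qed
  have hfin: "h u \<noteq> \<infinity>" if "u \<in> V" for u
  proof -
    have "h u \<le> ennreal b"
      by (rule LIMSEQ_le_const2[OF Slim]) (use Sb[OF that] in \<open>auto intro: ennreal_leI\<close>)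
    then show ?thesis by (auto simp: top_unique)
  qed
  define r where "r = (\<lambda>u. enn2real (h u))"
  have hr: "h u = ennreal (r u)" if "u \<in> V" for u
    using hfin[OF that] by (simp add: r_def less_top[symmetric])
  have r0: "0 \<le> r u" for u by (simp add: r_def)
  have rlim: "(\<lambda>n. S n u) \<longlonglongrightarrow> r u" if "u \<in> V" for u
    using Slim[of u] hr[OF that] S0 r0 by (intro tendsto_ennrealD) auto
  have rsum: "(\<Sum>u\<in>F. r u powr q) \<le> C powr q * s" if F: "finite F" "F \<subseteq> V" for F
  proof (rule LIMSEQ_le_const2)
    show "(\<lambda>n. \<Sum>u\<in>F. S n u powr q) \<longlonglongrightarrow> (\<Sum>u\<in>F. r u powr q)"
      using F q S0 by (intro tendsto_sum tendsto_powr2 rlim tendsto_const) (auto intro: always_eventually)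
    obtain m where m: "F \<subseteq> Vn m" using finite_subset_incseq[OF Vn(2) F(1)] F(2) Vn(3) by auto
    show "\<exists>N. \<forall>n\<ge>N. (\<Sum>u\<in>F. S n u powr q) \<le> C powr q * s"
    proof (intro exI allI impI)
      fix n assume "m \<le> n"
      then have "F \<subseteq> Vn n" using m incseqD[OF Vn(2)] by blast
      then have "(\<Sum>u\<in>F. S n u powr q) \<le> (\<Sum>u\<in>Vn n. S n u powr q)"
        using Vn(1) by (intro sum_mono2) auto
      also have "\<dots> \<le> C powr q * s" unfolding S_def by (rule lqF[OF Vn(1) VnV])
      finally show "(\<Sum>u\<in>F. S n u powr q) \<le> C powr q * s" .
    qed
  qed
  have "(\<integral>\<^sup>+ u. ennpowr (h u) q \<partial>count_space V) = (\<integral>\<^sup>+ u. ennreal (r u powr q) \<partial>count_space V)"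
    using hr r0 by (intro nn_integral_cong) (simp add: ennpowr_ennreal)
  also have "\<dots> \<le> ennreal (C powr q * s)"
  proof (rule LIMSEQ_le_const2[OF nn_integral_count_space_tendsto[OF Vn]])
    show "\<exists>N. \<forall>n\<ge>N. (\<Sum>v\<in>Vn n. ennreal (r v powr q)) \<le> ennreal (C powr q * s)"
      using rsum[OF Vn(1) VnV] by (auto intro!: ennreal_leI simp: sum_ennreal)
  qed
  finally have Ih: "(\<integral>\<^sup>+ u. ennpowr (h u) q \<partial>count_space V) \<le> ennreal (C powr q * s)" .
  define J where "J = (\<integral>\<^sup>+ u. ennpowr (h u) q \<partial>count_space V)"
  have J: "J = ennreal (enn2real J)" "enn2real J \<le> C powr q * s"
  proof -
    have "J < \<top>" using Ih le_less_trans[OF Ih] by (simp add: J_def)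
    then show *: "J = ennreal (enn2real J)" by simp
    have "0 \<le> C powr q * s" using s0 by simp
    then show "enn2real J \<le> C powr q * s" using Ih unfolding J_def[symmetric] by (subst (asm) *) simp
  qed
  have "lq_norm V q h = ennpowr J (1 / q)" by (simp add: lq_norm_def J_def)
  also have "\<dots> = ennreal (enn2real J powr (1 / q))" by (subst J(1)) (simp add: ennpowr_ennreal)
  also have "\<dots> \<le> ennreal ((C powr q * s) powr (1 / q))"
    using J(2) q by (intro ennreal_leI powr_mono2) auto
  also have "(C powr q * s) powr (1 / q) = C * s powr (1 / q)"
    using C s0 q by (simp add: powr_mult powr_powr)
  also have "ennreal (C * s powr (1 / q)) = ennreal C * ennreal (s powr (1 / q))"
    using C by (simp add: ennreal_mult)
  finally have num: "lq_norm V q h \<le> ennreal C * ennreal (s powr (1 / q))" .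
  have den: "lq_norm V q (\<lambda>v. ennreal (f v)) = ennreal (s powr (1 / q))"
    using s0 by (simp add: lq_norm_def I_def[symmetric] Is ennpowr_ennreal)
  show "lq_norm V q (mat_apply V (two_point E p) (\<lambda>v. ennreal (f v))) / lq_norm V q (\<lambda>v. ennreal (f v)) \<le> ennreal C"
    unfolding den h_def[symmetric] using spos num by (intro divide_le_posI_ennreal) (auto simp: mult.commute)
qed

lemma lq_bdd_of_op_norm:
  assumes op: "op_norm V q (two_point E p) \<le> ennreal C" and p: "0 \<le> p" "p \<le> 1" and q: "1 \<le> q" and C: "0 \<le> C"
  shows "lq_bdd V q (conn_lim p 1) C"
  unfolding lq_bdd_def
proof (intro allI impI, elim conjE)
  fix F and f :: "'v \<Rightarrow> real"
  assume F: "finite F" "F \<subseteq> V" and f: "\<forall>v. 0 \<le> f v"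
  let ?T = "conn_lim p 1"
  have T0: "0 \<le> ?T u v" for u v using p by (intro conn_lim_nonneg) auto
  show "(\<Sum>u\<in>F. (\<Sum>v\<in>F. ?T u v * f v) powr q) \<le> C powr q * (\<Sum>v\<in>F. f v powr q)"
  proof (cases "\<forall>v\<in>F. f v = 0")
    case True
    then have "(\<Sum>v\<in>F. ?T u v * f v) = 0" for u by (intro sum.neutral) auto
    then show ?thesis using q by (simp add: sum_nonneg)
  next
    case False
    then obtain v0 where v0: "v0 \<in> F" "f v0 \<noteq> 0" by blast
    define g where "g = (\<lambda>v. if v \<in> F then f v else 0)"
    define R where "R = (\<Sum>v\<in>F. f v powr q)"
    have R0: "0 < R" unfolding R_def using F v0 f by (intro sum_pos2[of F v0]) (auto simp: less_le)
    have "(\<integral>\<^sup>+ v. ennpowr (ennreal (g v)) q \<partial>count_space V) = (\<Sum>v\<in>F. ennpowr (ennreal (g v)) q)"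
      using F q by (intro nn_integral_count_space') (auto simp: g_def ennpowr_def)
    also have "\<dots> = (\<Sum>v\<in>F. ennreal (f v powr q))"
      using f by (intro sum.cong) (auto simp: g_def ennpowr_ennreal)
    also have "\<dots> = ennreal R" unfolding R_def by (rule sum_ennreal) simp
    finally have norm_g: "lq_norm V q (\<lambda>v. ennreal (g v)) = ennreal (R powr (1 / q))"
      using R0 by (simp add: lq_norm_def ennpowr_ennreal)
    define h where "h = mat_apply V (two_point E p) (\<lambda>v. ennreal (g v))"
    have h: "h u = ennreal (\<Sum>v\<in>F. ?T u v * f v)" for u
    proof -
      have "h u = (\<Sum>v\<in>F. ennreal (?T u v) * ennreal (g v))"
        unfolding h_def mat_apply_def two_point_fun[OF p]
        using F by (intro nn_integral_count_space') (auto simp: g_def)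
      also have "\<dots> = (\<Sum>v\<in>F. ennreal (?T u v * f v))"
        using T0 f by (intro sum.cong) (auto simp: g_def ennreal_mult)
      also have "\<dots> = ennreal (\<Sum>v\<in>F. ?T u v * f v)" using T0 f by (intro sum_ennreal) auto
      finally show ?thesis .
    qed
    have "g \<in> {f. (\<forall>v\<in>V. 0 \<le> f v) \<and> (\<exists>v\<in>V. f v \<noteq> 0) \<and> lq_norm V q (\<lambda>v. ennreal (f v)) < \<infinity>}"
      using f v0 F norm_g by (auto simp: g_def intro!: bexI[of _ v0])
    then have "lq_norm V q h / lq_norm V q (\<lambda>v. ennreal (g v)) \<le> op_norm V q (two_point E p)"
      unfolding op_norm_def h_def by (rule SUP_upper)
    then have "lq_norm V q h / ennreal (R powr (1 / q)) \<le> ennreal C" using op norm_g by simp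
    then have "lq_norm V q h / ennreal (R powr (1 / q)) * ennreal (R powr (1 / q)) \<le> ennreal C * ennreal (R powr (1 / q))"
      by (rule mult_right_mono) simp
    moreover have "lq_norm V q h / ennreal (R powr (1 / q)) * ennreal (R powr (1 / q)) = lq_norm V q h"
      unfolding ennreal_divide_times using R0 by (subst ennreal_divide_self) auto
    ultimately have norm_h: "lq_norm V q h \<le> ennreal (C * R powr (1 / q))"
      using C by (simp add: ennreal_mult)
    define J where "J = (\<integral>\<^sup>+ u. ennpowr (h u) q \<partial>count_space V)"
    have "J \<noteq> \<infinity>" using norm_h by (auto simp: lq_norm_def J_def ennpowr_def top_unique)
    then have J: "J = ennreal (enn2real J)" by (simp add: less_top[symmetric])
    have "ennreal (enn2real J powr (1 / q)) \<le> ennreal (C * R powr (1 / q))"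
      using norm_h unfolding lq_norm_def J_def[symmetric] by (subst (asm) J) (simp add: ennpowr_ennreal)
    then have "enn2real J powr (1 / q) \<le> C * R powr (1 / q)" using C by simp
    then have "(enn2real J powr (1 / q)) powr q \<le> (C * R powr (1 / q)) powr q"
      using q by (intro powr_mono2) auto
    then have JR: "enn2real J \<le> C powr q * R" using q C R0 by (simp add: powr_powr powr_mult)
    have "ennreal (\<Sum>u\<in>F. (\<Sum>v\<in>F. ?T u v * f v) powr q) = (\<Sum>u\<in>F. ennpowr (h u) q)"
    proof -
      have "ennpowr (h u) q = ennreal ((\<Sum>v\<in>F. ?T u v * f v) powr q)" for u
        unfolding h using T0 f by (intro ennpowr_ennreal sum_nonneg mult_nonneg_nonneg) auto
      then show ?thesis by (simp add: sum_ennreal)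
    qed
    also have "\<dots> \<le> J" unfolding J_def using F by (rule sum_le_nn_integral_count_space)
    also have "J \<le> ennreal (C powr q * R)" by (subst J) (rule ennreal_leI[OF JR])
    finally show ?thesis using R0 by (simp add: R_def)
  qed
qed

text \<open>The map from \<open>q\<close> to \<open>q / (q - 1)\<close> is an involution, so one
  inequality for all \<open>q\<close> gives equality.\<close>

lemma op_norm_dual:
  assumes p: "0 \<le> p" "p \<le> 1" and q: "1 < q"
  shows "op_norm V (q / (q - 1)) (two_point E p) = op_norm V q (two_point E p)"
proof -
  have le: "op_norm V (q / (q - 1)) (two_point E p) \<le> op_norm V q (two_point E p)" if q: "1 < q" for q
  proof (cases "op_norm V q (two_point E p)")
    case (real C)
    then have "lq_bdd V q (conn_lim p 1) C" using p q by (intro lq_bdd_of_op_norm) auto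
    then have "lq_bdd V (q / (q - 1)) (conn_lim p 1) C"
      using p q real by (intro lq_bdd_dual conn_lim_commute conn_lim_nonneg) auto
    then show ?thesis using p q real by (simp, intro op_norm_le) (auto simp: field_simps)
  qed simp
  have q': "1 < q / (q - 1)" using q by (simp add: field_simps)
  have "(q / (q - 1)) / (q / (q - 1) - 1) = q" using q by (simp add: field_simps)
  then show ?thesis using le[OF q] le[OF q'] by simp
qed

end

section \<open>Asymptotics of the operator norms\<close>

context qt_graph
begin

lemma bern_exp_zero: "finite L \<Longrightarrow> bern_exp L 0 f = f {}"
  by (induction L rule: finite_induct) (simp_all add: bern_exp_insert)

text \<open>At density 0 the two-point matrix is the identity. This keeps the set whose supremum
  defines \<open>p_op\<close> nonempty, without which that supremum would be unspecified.\<close>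

lemma op_norm_zero: "1 \<le> q \<Longrightarrow> op_norm V q (two_point E 0) < \<infinity>"
proof -
  assume q: "1 \<le> q"
  have "lq_bdd V q (conn_exp L 0 1) 1" if L: "finite L" for L
    unfolding lq_bdd_def
  proof (intro allI impI, elim conjE)
    fix F and f :: "'v \<Rightarrow> real"
    assume F: "finite F" "F \<subseteq> V" and f: "\<forall>v. 0 \<le> f v"
    have "conn_exp L 0 1 u v = (if u = v then 1 else 0)" for u v
      using conn_wt_eq_0[of u v "{}" 1] by (simp add: conn_exp_def bern_exp_zero[OF L])
    then have "(\<Sum>v\<in>F. conn_exp L 0 1 u v * f v) = (\<Sum>v\<in>F. if u = v then f v else 0)" for u
      by (intro sum.cong) auto
    then show "(\<Sum>u\<in>F. (\<Sum>v\<in>F. conn_exp L 0 1 u v * f v) powr q) \<le> 1 powr q * (\<Sum>v\<in>F. f v powr q)"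
      using F by (simp add: sum.delta)
  qed
  then have "lq_bdd V q (conn_lim 0 1) 1" using q by (intro lq_bdd_limit) auto
  then have "op_norm V q (two_point E 0) \<le> ennreal 1" using q by (intro op_norm_le) auto
  then show ?thesis by (rule le_less_trans) simp
qed

lemma p_op_upper:
  assumes "0 \<le> p" "p \<le> 1" "op_norm V q (two_point E p) < \<infinity>"
  shows "p \<le> p_op V E q"
  unfolding p_op_def using assms by (intro cSup_upper bdd_aboveI[of _ 1]) auto

lemma p_op_least:
  assumes "1 \<le> q" "\<And>p. 0 \<le> p \<Longrightarrow> p \<le> 1 \<Longrightarrow> op_norm V q (two_point E p) < \<infinity> \<Longrightarrow> p \<le> c"
  shows "p_op V E q \<le> c"
proof -
  have "0 \<in> {p \<in> {0..1}. op_norm V q (two_point E p) < \<infinity>}" using op_norm_zero[OF assms(1)] by simp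
  then have "{p \<in> {0..1}. op_norm V q (two_point E p) < \<infinity>} \<noteq> {}" by blast
  then show ?thesis unfolding p_op_def using assms(2) by (intro cSup_least) auto
qed

lemma p_op_dual:
  assumes "1 < q"
  shows "p_op V E (q / (q - 1)) = p_op V E q"
proof -
  have "{p \<in> {0..1}. op_norm V (q / (q - 1)) (two_point E p) < \<infinity>}
      = {p \<in> {0..1}. op_norm V q (two_point E p) < \<infinity>}"
    using op_norm_dual[OF _ _ assms] by auto
  then show ?thesis by (simp add: p_op_def)
qed

text \<open>On a finite graph \<open>p_crit\<close> is 1, through the inserted value, and
  \<open>p_op\<close> cannot exceed 1.\<close>

lemma infinite_V:
  assumes "p_crit V E < p_op V E q" "1 \<le> q"
  shows "infinite V"
proof
  assume fin: "finite V"
  have "\<not> (AE \<omega> in percolation E p. \<exists>v\<in>V. infinite (cluster V E \<omega> v))" for p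
  proof
    interpret prob_space "percolation E p" by (rule prob_space_percolation)
    have "finite (cluster V E \<omega> v)" for \<omega> v using fin by (simp add: cluster_def)
    moreover assume "AE \<omega> in percolation E p. \<exists>v\<in>V. infinite (cluster V E \<omega> v)"
    ultimately show False by (simp add: AE_False)
  qed
  then have "p_crit V E = 1" by (simp add: p_crit_def)
  moreover have "p_op V E q \<le> 1" using assms by (intro p_op_least) auto
  ultimately show False using assms by simp
qed

lemma lq_bdd_of_finite:
  assumes "op_norm V q (two_point E p) < \<infinity>" "0 \<le> p" "p \<le> 1" "1 \<le> q"
  obtains C where "0 \<le> C" "lq_bdd V q (conn_lim p 1) C"
proof (cases "op_norm V q (two_point E p)")
  case (real C)
  then have "lq_bdd V q (conn_lim p 1) C" using assms by (intro lq_bdd_of_op_norm) auto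
  then show ?thesis using real that by blast
qed (use assms in auto)

lemma l2_window:
  assumes "p_crit V E < p_op V E 2"
  obtains ps N where "p_crit V E < ps" "ps < 1" "1 \<le> N" "l2_bdd ps N"
proof -
  have pc: "0 < p_crit V E" using p_crit_pos infinite_V[OF assms] by simp
  have "0 \<in> {p \<in> {0..1}. op_norm V 2 (two_point E p) < \<infinity>}" using op_norm_zero[of 2] by simp
  then have "{p \<in> {0..1}. op_norm V 2 (two_point E p) < \<infinity>} \<noteq> {}" by blast
  then obtain p' where p': "p_crit V E < p'" "0 \<le> p'" "p' \<le> 1" "op_norm V 2 (two_point E p') < \<infinity>"
    using assms less_cSupD unfolding p_op_def by (metis (mono_tags, lifting) atLeastAtMost_iff mem_Collect_eq)
  obtain C where C: "0 \<le> C" "lq_bdd V 2 (conn_lim p' 1) C"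
    using lq_bdd_of_finite[OF p'(4,2,3)] by auto
  \<comment> \<open>The density \<open>p'\<close> may equal 1; the midpoint stays strictly below 1
    and strictly above \<open>p_crit\<close>.\<close>
  define ps where "ps = (p_crit V E + p') / 2"
  define N where "N = max 1 C"
  have ps: "p_crit V E < ps" "ps < p'" "0 \<le> ps" using p' pc by (auto simp: ps_def)
  have "lq_bdd V 2 (conn_lim ps 1) N"
    using C(2) by (rule lq_bdd_mono) (use ps p' C in \<open>auto simp: N_def intro: conn_lim_nonneg conn_lim_mono\<close>)
  then have "l2_bdd ps N"
    unfolding l2_bdd_def
  proof (intro conjI allI impI, goal_cases)
    case (2 F f)
    from lq_bddD[OF 2(1), of F f] 2(2)
    have "(\<Sum>u\<in>F. (\<Sum>v\<in>F. conn_lim ps 1 u v * f v) powr 2) \<le> N powr 2 * (\<Sum>v\<in>F. f v powr 2)" by auto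
    moreover have "0 \<le> (\<Sum>v\<in>F. conn_lim ps 1 u v * f v)" for u
      using 2 ps p' by (intro sum_nonneg mult_nonneg_nonneg conn_lim_nonneg) auto
    moreover have "0 \<le> N" by (simp add: N_def)
    ultimately show ?case using 2 by simp
  qed (simp add: N_def)
  moreover have "ps < 1" "1 \<le> N" using ps p' by (auto simp: N_def)
  ultimately show ?thesis using that ps(1) by blast
qed

text \<open>Otherwise the Neumann bound raises the weight from \<open>x\<close> to 1, so the
  unweighted row sums are finite at \<open>p_crit\<close>. By \<open>row_sup_double\<close> they
  remain finite at a slightly larger density, where there would be no infinite cluster.\<close>

lemma row_sup_critical_lower:
  assumes "infinite V" "p_crit V E < 1" "row_bdd (p_crit V E) x K" "0 < x" "x \<le> 1"
  shows "1 \<le> (1 - x) * row_sup (p_crit V E) x"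
proof (rule ccontr)
  let ?pc = "p_crit V E"
  have pc: "0 < ?pc" using p_crit_pos[OF assms(1)] .
  assume "\<not> ?thesis"
  then have "(1 - x / 1) * row_sup ?pc x < 1" by simp
  then have b: "row_bdd ?pc 1 (row_sup ?pc x / (1 - (1 - x / 1) * row_sup ?pc x))"
    using row_bdd_row_sup[OF assms(3)] assms pc by (intro row_bdd_neumann) auto
  let ?X = "row_sup ?pc 1"
  have X: "1 \<le> ?X" using row_sup_ge_1[OF b] assms pc by auto
  define p2 where "p2 = ?pc + min (1 - ?pc) (?pc / 2 / ?X)"
  have p2: "?pc < p2" "p2 \<le> 1" using assms pc X by (auto simp: p2_def)
  have "(p2 - ?pc) * ?X \<le> (?pc / 2 / ?X) * ?X" using X by (intro mult_right_mono) (auto simp: p2_def)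
  then have "(p2 - ?pc) * ?X \<le> ?pc / 2" using X by simp
  then have "row_bdd p2 1 (2 * ?X)" using pc p2 by (intro row_sup_double[OF b pc]) auto
  then have "p2 \<le> ?pc" using p2 pc assms by (intro p_crit_ge) auto
  then show False using p2 by simp
qed

lemma one_minus_exp_bounds:
  fixes y :: real
  assumes "0 \<le> y" "y \<le> 1"
  shows "y / 2 \<le> 1 - exp (- y)" "1 - exp (- y) \<le> y"
proof -
  show "1 - exp (- y) \<le> y" using exp_ge_add_one_self[of "- y"] by simp
  have "exp (- y) * (1 + y) \<le> exp (- y) * exp y"
    using exp_ge_add_one_self[of y] by (intro mult_left_mono) auto
  also have "\<dots> = 1" by (simp add: exp_minus)
  finally have "exp (- y) \<le> 1 / (1 + y)" using assms by (simp add: pos_le_divide_eq)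
  moreover have "1 / (1 + y) \<le> 1 - y / 2"
  proof -
    have "y * y \<le> y * 1" using assms by (intro mult_left_mono) auto
    then have "1 \<le> (1 - y / 2) * (1 + y)" by (simp add: algebra_simps)
    then show ?thesis using assms by (simp add: pos_divide_le_eq)
  qed
  ultimately show "y / 2 \<le> 1 - exp (- y)" by linarith
qed

text \<open>These are the two upper bounds; both lower bounds follow from them through
  \<open>p_op_lower\<close>.\<close>

lemma critical_bounds:
  assumes "p_crit V E < p_op V E 2"
  obtains C \<delta>0 where "0 < C" "0 < \<delta>0" "\<delta>0 \<le> 1"
    "\<And>\<delta>. 0 < \<delta> \<Longrightarrow> \<delta> < \<delta>0 \<Longrightarrow> lq_bdd V (1 + \<delta>) (conn_lim (p_crit V E) 1) (C / \<delta>)"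
    "\<And>\<delta>. 0 < \<delta> \<Longrightarrow> \<delta> < \<delta>0 \<Longrightarrow> p_op V E (1 + \<delta>) \<le> p_crit V E + C * \<delta>"
proof -
  let ?pc = "p_crit V E"
  have inf: "infinite V" using infinite_V[OF assms] by simp
  have pc: "0 < ?pc" using p_crit_pos[OF inf] .
  obtain ps N where ps: "?pc < ps" "ps < 1" and N: "1 \<le> N" "l2_bdd ps N"
    using l2_window[OF assms] by blast
  have pc1: "?pc < 1" using ps by simp
  obtain C1 where C1: "0 < C1" and win: "\<And>p1 p2 x K. ?pc \<le> p1 \<Longrightarrow> p1 < p2 \<Longrightarrow> p2 \<le> ps \<Longrightarrow> 1 / 2 \<le> x \<Longrightarrow> x \<le> 1 \<Longrightarrow>
     row_bdd p2 x K \<Longrightarrow> (p2 - p1) * row_sup p1 x \<le> C1"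
    using row_sup_window[OF inf pc _ _ N(2)] ps by auto
  have N': "l2_bdd ?pc N"
    unfolding l2_bdd_def
  proof (intro conjI allI impI, goal_cases)
    case (2 F f)
    have "(\<Sum>u\<in>F. (\<Sum>v\<in>F. conn_lim ?pc 1 u v * f v)\<^sup>2) \<le> (\<Sum>u\<in>F. (\<Sum>v\<in>F. conn_lim ps 1 u v * f v)\<^sup>2)"
      using 2 pc ps by (intro sum_mono power_mono mult_right_mono conn_lim_mono sum_nonneg mult_nonneg_nonneg conn_lim_nonneg) auto
    also have "\<dots> \<le> N\<^sup>2 * (\<Sum>v\<in>F. (f v)\<^sup>2)" using 2 N(2) by (intro l2_bddD) auto
    finally show ?case .
  qed (use N in simp)
  \<comment> \<open>For \<open>1 - x \<le> e0\<close> the weight is at least 1/2 and the density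
    \<open>p2\<close> below stays within \<open>ps\<close>, as \<open>row_sup_window\<close>
    demands.\<close>
  define e0 where "e0 = min (1 / 2) (2 * (ps - ?pc) / ?pc)"
  have e0: "0 < e0" "e0 \<le> 1 / 2" using ps pc by (auto simp: e0_def)
  have row_up: "row_bdd ?pc x (2 * C1 / (?pc * (1 - x)))" if x: "1 - e0 \<le> x" "x < 1" for x
  proof -
    \<comment> \<open>Half of the excess over \<open>p_crit\<close> that the weight could
      compensate: \<open>p2 * x\<close> is still below \<open>p_crit\<close>, since
      \<open>x * (3 - x) < 2\<close>. Sharpness and thinning then give finite row sums at
      \<open>p2\<close> and \<open>x\<close>, which opens the window from \<open>p_crit\<close> to
      \<open>p2\<close>.\<close>
    define p2 where "p2 = ?pc + ?pc * (1 - x) / 2"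
    have x2: "1 / 2 \<le> x" using x e0 by simp
    have d: "p2 - ?pc = ?pc * (1 - x) / 2" by (simp add: p2_def)
    have "?pc * (1 - x) / 2 \<le> ?pc * e0 / 2" using x pc by (intro divide_right_mono mult_left_mono) auto
    also have "\<dots> \<le> ?pc * (2 * (ps - ?pc) / ?pc) / 2" using pc by (intro divide_right_mono mult_left_mono) (auto simp: e0_def)
    also have "\<dots> = ps - ?pc" using pc by simp
    finally have p2s: "p2 \<le> ps" using d by linarith
    have "0 < ?pc * (1 - x) / 2" using x pc by simp
    then have p2c: "?pc < p2" using d by linarith
    have "(1 - x) * (2 - x) > 0" using x by simp
    then have "x * (3 - x) < 2" by (simp add: algebra_simps)
    then have "?pc * (x * (3 - x)) < ?pc * 2" using pc by (intro mult_strict_left_mono)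
    moreover have "p2 * x = ?pc * (x * (3 - x)) / 2" by (simp add: p2_def field_simps)
    ultimately have "p2 * x < ?pc" by linarith
    moreover have "0 \<le> p2 * x" using p2c pc x2 by simp
    ultimately obtain K where "row_bdd (p2 * x) 1 K" using sharpness[OF inf] by blast
    then have "row_bdd p2 (x * 1) K" using x x2 p2c pc p2s ps by (intro row_bdd_thin) auto
    then have K: "row_bdd p2 x K" by simp
    have "(p2 - ?pc) * row_sup ?pc x \<le> C1" using K p2c p2s x x2 by (intro win) auto
    then have "row_sup ?pc x \<le> 2 * C1 / (?pc * (1 - x))"
      unfolding d using pc x by (simp add: field_simps)
    moreover have "row_bdd ?pc x K" using p2c p2s ps pc x x2 by (intro row_bdd_mono[OF K]) auto
    ultimately show ?thesis using row_bdd_row_sup row_bdd_weaken by blast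
  qed
  \<comment> \<open>With this rate the weight of \<open>lq_bdd_critical\<close> is
    \<open>exp (- y)\<close> for \<open>y = l * \<theta> / (1 - \<theta>)\<close>.\<close>
  define l where "l = ln (1 + 1 / (2 * N))"
  have Npos: "0 < 1 / (2 * N)" using N(1) by simp
  then have l0: "0 < l" unfolding l_def by (intro ln_gt_zero) linarith
  have l1: "l \<le> 1"
  proof -
    have "l \<le> 1 / (2 * N)" unfolding l_def using N by (intro ln_add_one_self_le_self) auto
    also have "\<dots> \<le> 1" using N by (simp add: field_simps)
    finally show ?thesis .
  qed
  define A where "A = 8 * C1 * N / (?pc * l) + 2 * N"
  have A0: "0 < A" using C1 N pc l0 by (simp add: A_def add_nonneg_pos)
  \<comment> \<open>Below, \<open>y \<le> 2 * \<theta> \<le> 4 * \<delta> \<le> e0\<close>, so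
    \<open>row_up\<close> applies.\<close>
  define \<delta>1 where "\<delta>1 = e0 / 4"
  have \<delta>1: "0 < \<delta>1" "\<delta>1 \<le> 1 / 8" using e0 by (auto simp: \<delta>1_def)
  have crit: "lq_bdd V (1 + \<delta>) (conn_lim ?pc 1) (A / \<delta>)" if \<delta>: "0 < \<delta>" "\<delta> < \<delta>1" for \<delta>
  proof -
    \<comment> \<open>The solution of \<open>1 + \<delta> = 1 / (1 - \<theta> / 2)\<close>. Thus
      \<open>\<theta>\<close>, and with it \<open>1 - x\<close>, is of order
      \<open>\<delta>\<close>, and the row sums are of order at most
      \<open>1 / \<delta>\<close>.\<close>
    define \<theta> where "\<theta> = 2 * \<delta> / (1 + \<delta>)"
    have \<theta>: "0 < \<theta>" "\<theta> < 1 / 2" "1 + \<delta> = 1 / (1 - \<theta> / 2)" "\<delta> \<le> \<theta>" "\<theta> \<le> 2 * \<delta>"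
      using \<delta> \<delta>1 by (auto simp: \<theta>_def field_simps)
    define y where "y = l * \<theta> / (1 - \<theta>)"
    have y0: "0 < y" using l0 \<theta> by (simp add: y_def)
    have y_le: "y \<le> 2 * \<theta>"
    proof -
      have "l * \<theta> \<le> 1 * \<theta>" using l1 \<theta> by (intro mult_right_mono) auto
      then have "y \<le> \<theta> / (1 - \<theta>)" using \<theta> by (simp add: y_def divide_right_mono)
      also have "\<dots> \<le> \<theta> / (1 / 2)" using \<theta> by (intro divide_left_mono) auto
      finally show ?thesis by simp
    qed
    have y_ge: "l * \<theta> \<le> y"
    proof -
      have "l * \<theta> / 1 \<le> l * \<theta> / (1 - \<theta>)" using \<theta> l0 by (intro divide_left_mono) auto
      then show ?thesis by (simp add: y_def)
    qed
    have ye: "y \<le> e0" using y_le \<theta> \<delta> by (simp add: \<delta>1_def)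
    define x where "x = (1 + 1 / (2 * N)) powr (- \<theta> / (1 - \<theta>))"
    have "x = exp ((- \<theta> / (1 - \<theta>)) * l)"
      unfolding x_def powr_def l_def[symmetric] using Npos by (intro if_not_P) linarith
    then have "x = exp (- y)" by (simp add: y_def mult.commute)
    then have x: "y / 2 \<le> 1 - x" "1 - x \<le> y"
      using one_minus_exp_bounds[of y] y0 ye e0 by auto
    define K where "K = 2 * C1 / (?pc * (1 - x))"
    have x1: "0 < 1 - x" using x y0 by linarith
    have rb: "row_bdd ?pc x K" unfolding K_def using x ye x1 by (intro row_up) auto
    have K0: "0 \<le> K" using C1 pc x1 by (simp add: K_def)
    have xle: "1 / 2 \<le> x" using x ye e0 by linarith
    have K1: "1 \<le> K" using row_sup_ge_1[OF rb] row_sup_le[OF rb] pc pc1 xle x1 by auto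
    have "K \<le> 2 * C1 / (?pc * (l * \<theta> / 2))"
      unfolding K_def using C1 pc l0 \<theta> x y_ge x1
      by (intro divide_left_mono mult_left_mono mult_pos_pos) auto
    also have "\<dots> = 4 * C1 / (?pc * l) / \<theta>" by simp
    also have "\<dots> \<le> 4 * C1 / (?pc * l) / \<delta>"
      using C1 pc l0 \<theta> \<delta> by (intro divide_left_mono) auto
    finally have K_le: "K \<le> 4 * C1 / (?pc * l) / \<delta>" .
    have "K powr (1 - \<theta>) \<le> K powr 1" using K1 \<theta> by (intro powr_mono) auto
    then have b1: "K powr (1 - \<theta>) \<le> K" using K1 by simp
    have "(2 * N) powr \<theta> \<le> (2 * N) powr 1" using N \<theta> by (intro powr_mono) auto
    then have b2: "(2 * N) powr \<theta> \<le> 2 * N" using N by simp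
    have "K powr (1 - \<theta>) * (2 * N) powr \<theta> \<le> K * (2 * N)" using b1 b2 K1 N by (intro mult_mono) auto
    also have "\<dots> \<le> (4 * C1 / (?pc * l) / \<delta>) * (2 * N)" using K_le N by (intro mult_right_mono) auto
    also have "\<dots> = (8 * C1 * N / (?pc * l)) / \<delta>" by simp
    also have "\<dots> \<le> A / \<delta>" unfolding A_def using \<delta> N by (intro divide_right_mono) auto
    finally have le: "K powr (1 - \<theta>) * (2 * N) powr \<theta> \<le> A / \<delta>" .
    have "lq_bdd V (1 + \<delta>) (conn_lim ?pc 1) (K powr (1 - \<theta>) * (2 * N) powr \<theta>)"
      using N N' pc pc1 \<theta> rb K0 by (intro lq_bdd_critical[where x = x]) (auto simp: x_def)
    then show ?thesis
      by (rule lq_bdd_mono) (use le K0 N pc pc1 \<delta> in \<open>auto intro: conn_lim_nonneg\<close>)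
  qed
  \<comment> \<open>With this rate \<open>exp (- (c * \<delta>))\<close> equals
    \<open>p_crit\<close> to the power \<open>\<delta>\<close>, a lower bound for the weight
    \<open>x\<close> below.\<close>
  define c where "c = ln (1 / ?pc)"
  have c0: "0 < c" using pc pc1 by (simp add: c_def)
  \<comment> \<open>The first entry keeps the weight at least 1/2; the second forces
    \<open>p\<close> to lie within the L2 window, below \<open>ps\<close>.\<close>
  define \<delta>2 where "\<delta>2 = min (1 / (2 * c)) ((ps - ?pc) / (2 * C1 * c))"
  have \<delta>2: "0 < \<delta>2" using c0 C1 ps by (simp add: \<delta>2_def)
  have up: "p_op V E (1 + \<delta>) \<le> ?pc + C1 * c * \<delta>" if \<delta>: "0 < \<delta>" "\<delta> < \<delta>2" for \<delta>
  proof (rule p_op_least)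
    show "1 \<le> 1 + \<delta>" using \<delta> by simp
    fix p assume p: "0 \<le> p" "p \<le> 1" "op_norm V (1 + \<delta>) (two_point E p) < \<infinity>"
    have main: "p' - ?pc \<le> C1 * c * \<delta>" if p': "?pc < p'" "p' \<le> ps" "p' \<le> p" for p'
    proof -
      obtain C where C: "0 \<le> C" "lq_bdd V (1 + \<delta>) (conn_lim p 1) C"
        using lq_bdd_of_finite[OF p(3,1,2)] \<delta> by auto
      have p01: "0 < p'" "p' < 1" using p' pc ps by auto
      \<comment> \<open>For this weight \<open>x ^ d = (p' ^ d) powr \<delta>\<close> is at most the
        two-point function to the power \<open>\<delta>\<close>, where \<open>d\<close> is the graph
        distance. The weighted function is thus at most the two-point function to the power
        \<open>1 + \<delta>\<close>, which is summable over a column.\<close>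
      define x where "x = p' powr \<delta>"
      have cp: "c * \<delta> \<le> 1 / 2" using \<delta> c0 by (simp add: \<delta>2_def field_simps)
      have xlow: "exp (- (c * \<delta>)) \<le> x"
      proof -
        have "exp (- (c * \<delta>)) = ?pc powr \<delta>" using pc by (simp add: powr_def c_def ln_div mult.commute)
        also have "\<dots> \<le> x" unfolding x_def using p' pc \<delta> by (intro powr_mono2) auto
        finally show ?thesis .
      qed
      have x1: "1 - x \<le> c * \<delta>" using one_minus_exp_bounds(2)[of "c * \<delta>"] xlow c0 \<delta> cp by auto
      have x: "1 / 2 \<le> x" "x < 1" "0 < x"
      proof -
        show "1 / 2 \<le> x" using x1 cp by linarith
        then show "0 < x" by simp
        have "p' powr \<delta> < 1 powr \<delta>" using p01 \<delta> by (intro powr_less_mono2) auto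
        then show "x < 1" by (simp add: x_def)
      qed
      have rb: "row_bdd p' x (C powr (1 + \<delta>))"
        unfolding row_bdd_def
      proof (intro ballI allI impI)
        fix u F assume u: "u \<in> V" and F: "finite F \<and> F \<subseteq> V"
        let ?T = "conn_lim p 1"
        \<comment> \<open>Rows and columns are truncated by the same set, so \<open>u\<close> has to
          belong to it before the bound is tested on the indicator of \<open>u\<close>.\<close>
        let ?F = "insert u F"
        have T0: "0 \<le> ?T a b" for a b using p by (intro conn_lim_nonneg) auto
        have "(\<Sum>v\<in>F. conn_lim p' x u v) \<le> (\<Sum>v\<in>F. ?T v u powr (1 + \<delta>))"
        proof (rule sum_mono)
          fix v assume "v \<in> F"
          then have v: "v \<in> V" using F by auto
          have T'0: "0 \<le> conn_lim p' 1 u v" using p01 by (intro conn_lim_nonneg) auto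
          have "conn_lim p' x u v \<le> x ^ gdist E u v * conn_lim p' 1 u v"
            using p01 x by (intro conn_lim_decay) auto
          also have "x ^ gdist E u v = (p' ^ gdist E u v) powr \<delta>"
            using p01 by (simp add: x_def powr_realpow[symmetric] powr_powr mult.commute)
          also have "(p' ^ gdist E u v) powr \<delta> * conn_lim p' 1 u v
              \<le> conn_lim p' 1 u v powr \<delta> * conn_lim p' 1 u v"
            using conn_lim_power_gdist[OF u v, of p'] p01 \<delta> T'0 by (intro mult_right_mono powr_mono2) auto
          also have "\<dots> = conn_lim p' 1 u v powr (1 + \<delta>)"
            using T'0 powr_mult_base[of "conn_lim p' 1 u v" \<delta>] by (simp add: mult.commute)
          also have "\<dots> \<le> ?T u v powr (1 + \<delta>)"
            using p p' p01 \<delta> T'0 by (intro powr_mono2 conn_lim_mono) auto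
          finally show "conn_lim p' x u v \<le> ?T v u powr (1 + \<delta>)" by (simp add: conn_lim_commute[of p 1 v u])
        qed
        also have "\<dots> \<le> (\<Sum>v\<in>?F. ?T v u powr (1 + \<delta>))" using F by (intro sum_mono2) auto
        also have "\<dots> = (\<Sum>v\<in>?F. (\<Sum>w\<in>?F. ?T v w * (if w = u then 1 else 0)) powr (1 + \<delta>))"
        proof (rule sum.cong[OF refl])
          fix v
          have "(\<Sum>w\<in>?F. ?T v w * (if w = u then 1 else 0)) = (\<Sum>w\<in>?F. if w = u then ?T v u else 0)"
            by (intro sum.cong) auto
          also have "\<dots> = ?T v u" using F by (subst sum.delta) auto
          finally show "?T v u powr (1 + \<delta>) = (\<Sum>w\<in>?F. ?T v w * (if w = u then 1 else 0)) powr (1 + \<delta>)" by simp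
        qed
        also have "\<dots> \<le> C powr (1 + \<delta>) * (\<Sum>w\<in>?F. (if w = u then 1 else 0) powr (1 + \<delta>))"
          using C u F by (intro lq_bddD) auto
        also have "(\<Sum>w\<in>?F. (if w = u then 1 else 0) powr (1 + \<delta>)) = (\<Sum>w\<in>?F. if w = u then 1 else 0 :: real)"
          by (intro sum.cong) auto
        also have "\<dots> = 1" using F by (subst sum.delta) auto
        finally show "(\<Sum>v\<in>F. conn_lim p' x u v) \<le> C powr (1 + \<delta>)" by simp
      qed
      have "row_bdd ?pc x (C powr (1 + \<delta>))" using p' p01 pc x by (intro row_bdd_mono[OF rb]) auto
      then have one: "1 \<le> (1 - x) * row_sup ?pc x" using inf pc1 x by (intro row_sup_critical_lower) auto
      \<comment> \<open>The row sums at \<open>p_crit\<close> are at least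
        \<open>1 / (1 - x)\<close> by criticality and at most \<open>C1 / (p' - p_crit)\<close> by
        the window.\<close>
      have "p' - ?pc \<le> (p' - ?pc) * ((1 - x) * row_sup ?pc x)"
        using mult_left_mono[OF one, of "p' - ?pc"] p' by simp
      also have "\<dots> = (1 - x) * ((p' - ?pc) * row_sup ?pc x)" by simp
      also have "\<dots> \<le> (1 - x) * C1" using rb p' x by (intro mult_left_mono win) auto
      also have "\<dots> \<le> (c * \<delta>) * C1" using x1 C1 by (intro mult_right_mono) auto
      finally show ?thesis by (simp add: mult_ac)
    qed
    show "p \<le> ?pc + C1 * c * \<delta>"
    proof (cases "p \<le> ?pc")
      case True
      then show ?thesis using C1 c0 \<delta> by (simp add: add_increasing2)
    next
      case False
      \<comment> \<open>Otherwise the estimate at \<open>ps\<close> itself would contradict the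
        second entry of \<open>\<delta>2\<close>.\<close>
      have "p \<le> ps"
      proof (rule ccontr)
        assume "\<not> p \<le> ps"
        then have "ps - ?pc \<le> C1 * c * \<delta>" using main[of ps] ps by simp
        also have "\<dots> < C1 * c * ((ps - ?pc) / (2 * C1 * c))"
          using \<delta> C1 c0 by (intro mult_strict_left_mono) (auto simp: \<delta>2_def)
        also have "\<dots> = (ps - ?pc) / 2" using C1 c0 by simp
        finally show False using ps by simp
      qed
      then show ?thesis using main[of p] False by simp
    qed
  qed
  define C where "C = max A (C1 * c)"
  have CA: "A \<le> C" "C1 * c \<le> C" "0 < C" using A0 by (auto simp: C_def)
  show ?thesis
  proof (rule that[of C "min \<delta>1 \<delta>2"])
    show "0 < C" "0 < min \<delta>1 \<delta>2" "min \<delta>1 \<delta>2 \<le> 1" using CA \<delta>1 \<delta>2 by auto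
    fix \<delta> assume \<delta>: "0 < \<delta>" "\<delta> < min \<delta>1 \<delta>2"
    have "lq_bdd V (1 + \<delta>) (conn_lim ?pc 1) (A / \<delta>)" using \<delta> by (intro crit) auto
    then show "lq_bdd V (1 + \<delta>) (conn_lim ?pc 1) (C / \<delta>)"
      by (rule lq_bdd_mono) (use \<delta> CA A0 pc pc1 in \<open>auto intro: conn_lim_nonneg divide_right_mono\<close>)
    have "p_op V E (1 + \<delta>) \<le> ?pc + C1 * c * \<delta>" using \<delta> by (intro up) auto
    also have "\<dots> \<le> ?pc + C * \<delta>" using CA \<delta> by (intro add_left_mono mult_right_mono) auto
    finally show "p_op V E (1 + \<delta>) \<le> ?pc + C * \<delta>" .
  qed
qed

text \<open>The density \<open>p2\<close> is chosen so that
  \<open>(1 - p_crit / p2) * C \<le> 1 / 4\<close>, the smallness required by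
  \<open>lq_bdd_neumann\<close>; the last hypothesis keeps it a probability.\<close>

lemma p_op_lower:
  assumes "lq_bdd V q (conn_lim (p_crit V E) 1) C" "1 \<le> q" "0 < C" "0 < p_crit V E"
    "p_crit V E * (1 + 1 / (4 * C)) \<le> 1"
  shows "p_crit V E + p_crit V E / (4 * C) \<le> p_op V E q"
proof -
  let ?pc = "p_crit V E"
  define p2 where "p2 = ?pc * (1 + 1 / (4 * C))"
  have C': "0 < 1 / (4 * C)" using assms by simp
  have p2: "?pc \<le> p2" "p2 \<le> 1" "0 < p2"
  proof -
    have "?pc * 1 \<le> p2" unfolding p2_def using assms C' by (intro mult_left_mono) auto
    then show "?pc \<le> p2" "0 < p2" using assms by auto
    show "p2 \<le> 1" using assms by (simp add: p2_def)
  qed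
  have "1 - ?pc / p2 = 1 - 1 / (1 + 1 / (4 * C))" using assms by (simp add: p2_def)
  also have "\<dots> \<le> 1 / (4 * C)" using assms by (simp add: field_simps)
  finally have "(1 - ?pc / p2) * C \<le> 1 / (4 * C) * C" using assms by (intro mult_right_mono) auto
  then have "(1 - ?pc / p2) * C \<le> 1 / 4" using assms by simp
  then have "lq_bdd V q (conn_lim p2 1) (4 * C)" using assms p2 by (intro lq_bdd_neumann) auto
  then have "op_norm V q (two_point E p2) \<le> ennreal (4 * C)" using assms p2 by (intro op_norm_le) auto
  then have "op_norm V q (two_point E p2) < \<infinity>" by (rule le_less_trans) simp
  then have "p2 \<le> p_op V E q" using p2 by (intro p_op_upper) auto
  then show ?thesis by (simp add: p2_def algebra_simps)
qed

text \<open>The lower bound on the norm comes from the upper bound on \<open>p_op\<close>: too small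
  a norm at \<open>p_crit\<close> would keep the Neumann series convergent beyond the
  latter.\<close>

lemma norm_asymptotics:
  assumes "p_crit V E < p_op V E 2"
  obtains a b \<delta>0 where "0 < a" "a \<le> b" "0 < \<delta>0" "\<delta>0 \<le> 1"
    "\<And>\<delta>. 0 < \<delta> \<Longrightarrow> \<delta> < \<delta>0 \<Longrightarrow> ennreal (a / \<delta>) \<le> op_norm V (1 + \<delta>) (two_point E (p_crit V E))"
    "\<And>\<delta>. 0 < \<delta> \<Longrightarrow> \<delta> < \<delta>0 \<Longrightarrow> op_norm V (1 + \<delta>) (two_point E (p_crit V E)) \<le> ennreal (b / \<delta>)"
    "\<And>\<delta>. 0 < \<delta> \<Longrightarrow> \<delta> < \<delta>0 \<Longrightarrow> a * \<delta> \<le> p_op V E (1 + \<delta>) - p_crit V E"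
    "\<And>\<delta>. 0 < \<delta> \<Longrightarrow> \<delta> < \<delta>0 \<Longrightarrow> p_op V E (1 + \<delta>) - p_crit V E \<le> b * \<delta>"
proof -
  let ?pc = "p_crit V E"
  obtain C \<delta>1 where C: "0 < C" and \<delta>1: "0 < \<delta>1" "\<delta>1 \<le> 1"
    and crit: "\<And>\<delta>. 0 < \<delta> \<Longrightarrow> \<delta> < \<delta>1 \<Longrightarrow> lq_bdd V (1 + \<delta>) (conn_lim ?pc 1) (C / \<delta>)"
    and up: "\<And>\<delta>. 0 < \<delta> \<Longrightarrow> \<delta> < \<delta>1 \<Longrightarrow> p_op V E (1 + \<delta>) \<le> ?pc + C * \<delta>"
    by (rule critical_bounds[OF assms]) blast
  have pc: "0 < ?pc" using p_crit_pos infinite_V[OF assms] by simp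
  have pc1: "?pc < 1"
  proof -
    have "p_op V E 2 \<le> 1" by (rule p_op_least) auto
    then show ?thesis using assms by simp
  qed
  \<comment> \<open>A norm of at most \<open>a0 / \<delta>\<close> would give \<open>p_op\<close> at
    least \<open>p_crit + 2 * C * \<delta>\<close>, twice the excess that is possible.\<close>
  define a0 where "a0 = ?pc / (8 * C)"
  have a0: "0 < a0" using pc C by (simp add: a0_def)
  define a where "a = min a0 (?pc / (4 * C))"
  define b where "b = max C a"
  have ab: "0 < a" "a \<le> b" "C \<le> b" "a \<le> a0" "a \<le> ?pc / (4 * C)"
    using a0 pc C by (auto simp: a_def b_def)
  define D where "D = min C a0"
  have D: "0 < D" "D \<le> C" "D \<le> a0" using C a0 by (auto simp: D_def)
  \<comment> \<open>\<open>p_op_lower\<close> is used with the constants \<open>C / \<delta>\<close>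
    and \<open>a0 / \<delta>\<close>. The second entry keeps the enlarged density at most 1 in both
    cases.\<close>
  define \<delta>0 where "\<delta>0 = min \<delta>1 (4 * D * (1 - ?pc))"
  have \<delta>0: "0 < \<delta>0" "\<delta>0 \<le> 1" using \<delta>1 D pc1 by (auto simp: \<delta>0_def)
  have room: "?pc * (1 + 1 / (4 * (G / \<delta>))) \<le> 1" if "0 < \<delta>" "\<delta> < \<delta>0" "D \<le> G" for \<delta> G
  proof -
    have G: "0 < G" using that D by simp
    have "\<delta> \<le> 4 * D * (1 - ?pc)" using that by (simp add: \<delta>0_def)
    also have "\<dots> \<le> 4 * G * (1 - ?pc)" using that pc1 by (intro mult_right_mono) auto
    finally have "\<delta> / (4 * G) \<le> 1 - ?pc" using G by (simp add: pos_divide_le_eq mult_ac)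
    moreover have "?pc * (\<delta> / (4 * G)) \<le> 1 * (\<delta> / (4 * G))"
      using pc1 that G by (intro mult_right_mono) auto
    ultimately show ?thesis using G that by (simp add: algebra_simps)
  qed
  show ?thesis
  proof (rule that[of a b \<delta>0])
    show "0 < a" "a \<le> b" "0 < \<delta>0" "\<delta>0 \<le> 1" using ab \<delta>0 by auto
    fix \<delta> assume \<delta>: "0 < \<delta>" "\<delta> < \<delta>0"
    then have \<delta>': "\<delta> < \<delta>1" by (simp add: \<delta>0_def)
    have upp: "p_op V E (1 + \<delta>) - ?pc \<le> C * \<delta>" using up[OF \<delta>(1) \<delta>'] by simp
    also have "\<dots> \<le> b * \<delta>" using ab \<delta> by (intro mult_right_mono) auto
    finally show "p_op V E (1 + \<delta>) - ?pc \<le> b * \<delta>" .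
    have "op_norm V (1 + \<delta>) (two_point E ?pc) \<le> ennreal (C / \<delta>)"
      using crit[OF \<delta>(1) \<delta>'] pc pc1 \<delta> C by (intro op_norm_le) auto
    also have "\<dots> \<le> ennreal (b / \<delta>)" using ab \<delta> by (intro ennreal_leI divide_right_mono) auto
    finally show "op_norm V (1 + \<delta>) (two_point E ?pc) \<le> ennreal (b / \<delta>)" .
    have "?pc + ?pc / (4 * (C / \<delta>)) \<le> p_op V E (1 + \<delta>)"
      using crit[OF \<delta>(1) \<delta>'] \<delta> C pc room[OF \<delta> D(2)] by (intro p_op_lower) auto
    then have "?pc / (4 * C) * \<delta> \<le> p_op V E (1 + \<delta>) - ?pc" by simp
    moreover have "a * \<delta> \<le> ?pc / (4 * C) * \<delta>" using ab \<delta> by (intro mult_right_mono) auto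
    ultimately show "a * \<delta> \<le> p_op V E (1 + \<delta>) - ?pc" by linarith
    show "ennreal (a / \<delta>) \<le> op_norm V (1 + \<delta>) (two_point E ?pc)"
    proof (rule ccontr)
      assume "\<not> ?thesis"
      then have "op_norm V (1 + \<delta>) (two_point E ?pc) \<le> ennreal (a / \<delta>)" by simp
      also have "\<dots> \<le> ennreal (a0 / \<delta>)" using ab \<delta> by (intro ennreal_leI divide_right_mono) auto
      finally have "lq_bdd V (1 + \<delta>) (conn_lim ?pc 1) (a0 / \<delta>)"
        using pc pc1 \<delta> a0 by (intro lq_bdd_of_op_norm) auto
      then have "?pc + ?pc / (4 * (a0 / \<delta>)) \<le> p_op V E (1 + \<delta>)"
        using \<delta> a0 pc room[OF \<delta> D(3)] by (intro p_op_lower) auto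
      moreover have "?pc / (4 * (a0 / \<delta>)) = 2 * C * \<delta>" using pc C by (simp add: a0_def)
      ultimately have "2 * C * \<delta> \<le> C * \<delta>" using upp by linarith
      then show False using C \<delta> by simp
    qed
  qed
qed

end

theorem theorem4p1:
  fixes V :: "'v set" and E :: "'v set set"
  assumes "is_graph V E"
    and "connected_graph V E"
    and "locally_finite_graph V E"
    and "nonamenable V E"
    and "quasi_transitive V E"
    and "p_crit V E < p_op V E 2"
  shows "asymp_comparable at_top
           (\<lambda>q. enn2ereal (op_norm V q (two_point E (p_crit V E)))) (\<lambda>q. q)
       \<and> asymp_comparable (at_right 1)
           (\<lambda>q. enn2ereal (op_norm V q (two_point E (p_crit V E)))) (\<lambda>q. inverse (q - 1))
       \<and> asymp_comparable at_top
           (\<lambda>q. ereal (p_op V E q - p_crit V E)) (\<lambda>q. inverse q)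
       \<and> asymp_comparable (at_right 1)
           (\<lambda>q. ereal (p_op V E q - p_crit V E)) (\<lambda>q. q - 1)"
proof -
  interpret qt_graph V E by (rule qt_graph.intro) (fact assms)+
  let ?pc = "p_crit V E"
  let ?N = "\<lambda>q. op_norm V q (two_point E ?pc)"
  obtain a b \<delta>0 where ab: "0 < a" "a \<le> b" and \<delta>0: "0 < \<delta>0" "\<delta>0 \<le> 1"
    and N1: "\<And>\<delta>. 0 < \<delta> \<Longrightarrow> \<delta> < \<delta>0 \<Longrightarrow> ennreal (a / \<delta>) \<le> ?N (1 + \<delta>)"
    and N2: "\<And>\<delta>. 0 < \<delta> \<Longrightarrow> \<delta> < \<delta>0 \<Longrightarrow> ?N (1 + \<delta>) \<le> ennreal (b / \<delta>)"
    and P1: "\<And>\<delta>. 0 < \<delta> \<Longrightarrow> \<delta> < \<delta>0 \<Longrightarrow> a * \<delta> \<le> p_op V E (1 + \<delta>) - ?pc"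
    and P2: "\<And>\<delta>. 0 < \<delta> \<Longrightarrow> \<delta> < \<delta>0 \<Longrightarrow> p_op V E (1 + \<delta>) - ?pc \<le> b * \<delta>"
    by (rule norm_asymptotics[OF assms(6)]) blast
  have pc: "0 < ?pc" using p_crit_pos infinite_V[OF assms(6)] by simp
  have pc1: "?pc < 1"
  proof -
    have "p_op V E 2 \<le> 1" by (rule p_op_least) auto
    then show ?thesis using assms(6) by simp
  qed
  have lower: "ereal c \<le> enn2ereal y" if "ennreal c \<le> y" "0 \<le> c" for c y
    using that by (simp add: less_eq_ennreal.rep_eq)
  have upper: "enn2ereal y \<le> ereal c" if "y \<le> ennreal c" "0 \<le> c" for c y
    using that by (simp add: less_eq_ennreal.rep_eq)
  have right: "\<forall>\<^sub>F q in at_right (1::real). 1 < q \<and> q < 1 + \<delta>0"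
    unfolding eventually_at_right_field using \<delta>0 by (intro exI[of _ "1 + \<delta>0"]) auto
  have top: "\<forall>\<^sub>F q in at_top. 2 \<le> q \<and> 1 + 1 / \<delta>0 < (q::real)"
    using eventually_ge_at_top eventually_gt_at_top by (rule eventually_conj)
  \<comment> \<open>The exponent dual to a large \<open>q\<close> is \<open>1 + 1 / (q - 1)\<close>,
    so the estimates near 1 apply with \<open>\<delta> = 1 / (q - 1)\<close>.\<close>
  have dual: "?N q = ?N (1 + 1 / (q - 1))" "p_op V E q = p_op V E (1 + 1 / (q - 1))"
    "0 < 1 / (q - 1)" "1 / (q - 1) < \<delta>0" if "2 \<le> q \<and> 1 + 1 / \<delta>0 < q" for q
  proof -
    have q: "q / (q - 1) = 1 + 1 / (q - 1)" using that by (simp add: field_simps)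
    show "?N q = ?N (1 + 1 / (q - 1))" using op_norm_dual[of ?pc q] that pc pc1 q by simp
    show "p_op V E q = p_op V E (1 + 1 / (q - 1))" using p_op_dual[of q] that q by simp
    show "0 < 1 / (q - 1)" using that by simp
    have "1 / \<delta>0 < q - 1" using that by simp
    then show "1 / (q - 1) < \<delta>0" using \<delta>0 that by (simp add: field_simps)
  qed
  have 1: "asymp_comparable (at_right 1) (\<lambda>q. enn2ereal (?N q)) (\<lambda>q. inverse (q - 1))"
    unfolding asymp_comparable_def
  proof (rule exI[of _ a], rule exI[of _ b], intro conjI)
    show "\<forall>\<^sub>F q in at_right 1. ereal (a * inverse (q - 1)) \<le> enn2ereal (?N q)
        \<and> enn2ereal (?N q) \<le> ereal (b * inverse (q - 1))"
      using right
    proof eventually_elim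
      case (elim q)
      then have d: "0 < q - 1" "q - 1 < \<delta>0" by auto
      show ?case
        using lower[OF N1[OF d]] upper[OF N2[OF d]] ab d by (simp add: divide_inverse)
    qed
  qed (use ab in auto)
  have 2: "asymp_comparable (at_right 1) (\<lambda>q. ereal (p_op V E q - ?pc)) (\<lambda>q. q - 1)"
    unfolding asymp_comparable_def
  proof (rule exI[of _ a], rule exI[of _ b], intro conjI)
    show "\<forall>\<^sub>F q in at_right 1. ereal (a * (q - 1)) \<le> ereal (p_op V E q - ?pc)
        \<and> ereal (p_op V E q - ?pc) \<le> ereal (b * (q - 1))"
      using right
    proof eventually_elim
      case (elim q)
      then have d: "0 < q - 1" "q - 1 < \<delta>0" by auto
      show ?case using P1[OF d] P2[OF d] by simp
    qed
  qed (use ab in auto)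
  have 3: "asymp_comparable at_top (\<lambda>q. enn2ereal (?N q)) (\<lambda>q. q)"
    unfolding asymp_comparable_def
  \<comment> \<open>For \<open>q \<ge> 2\<close> the number \<open>q - 1\<close> lies between
    \<open>q / 2\<close> and \<open>q\<close>; replacing it by \<open>q\<close> costs a factor 2 on
    one side.\<close>
  proof (rule exI[of _ "a / 2"], rule exI[of _ b], intro conjI)
    show "\<forall>\<^sub>F q in at_top. ereal (a / 2 * q) \<le> enn2ereal (?N q) \<and> enn2ereal (?N q) \<le> ereal (b * q)"
      using top
    proof eventually_elim
      case (elim q)
      note d = dual[OF elim]
      have "ereal (a / 2 * q) \<le> ereal (a * (q - 1))"
      proof -
        have "a * (q / 2) \<le> a * (q - 1)" using elim ab by (intro mult_left_mono) auto
        then show ?thesis by simp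
      qed
      also have "\<dots> \<le> enn2ereal (?N q)" using lower[OF N1[OF d(3,4)]] ab elim d(1) by simp
      finally have l: "ereal (a / 2 * q) \<le> enn2ereal (?N q)" .
      have "enn2ereal (?N q) \<le> ereal (b * (q - 1))" using upper[OF N2[OF d(3,4)]] ab elim d(1) by simp
      also have "\<dots> \<le> ereal (b * q)"
      proof -
        have "b * (q - 1) \<le> b * q" using ab by (intro mult_left_mono) auto
        then show ?thesis by simp
      qed
      finally show ?case using l by simp
    qed
  qed (use ab in auto)
  have 4: "asymp_comparable at_top (\<lambda>q. ereal (p_op V E q - ?pc)) (\<lambda>q. inverse q)"
    unfolding asymp_comparable_def
  proof (rule exI[of _ a], rule exI[of _ "2 * b"], intro conjI)
    show "\<forall>\<^sub>F q in at_top. ereal (a * inverse q) \<le> ereal (p_op V E q - ?pc)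
        \<and> ereal (p_op V E q - ?pc) \<le> ereal (2 * b * inverse q)"
      using top
    proof eventually_elim
      case (elim q)
      note d = dual[OF elim]
      have "a * inverse q \<le> a * (1 / (q - 1))"
        using elim ab by (intro mult_left_mono) (auto simp: inverse_eq_divide intro!: divide_left_mono)
      then have l: "a * inverse q \<le> p_op V E q - ?pc" using P1[OF d(3,4)] d(2) by linarith
      have "b * (1 / (q - 1)) \<le> b * (2 * inverse q)"
        using elim ab by (intro mult_left_mono) (auto simp: field_simps)
      then have "p_op V E q - ?pc \<le> 2 * b * inverse q" using P2[OF d(3,4)] d(2) by simp
      then show ?case using l by simp
    qed
  qed (use ab in auto)
  show ?thesis using 1 2 3 4 by blast
qed

end
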